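(* Let $\Omega\subset\mathbb{R}^3$ be a bounded strong Lipschitz domain with trivial topology. Let $(E_n),(H_n)\subset L^2(\Omega)$ be two bounded sequences of vector fields such that either (a) $(\widehat{\operatorname{curl}}\,E_n)$ is relatively compact in $\mathring{H}^{-1}(\Omega)$ and $(\widetilde{\operatorname{div}}\,H_n)$ is relatively compact in $H^{-1}(\Omega)$, or (b) $(\widetilde{\operatorname{curl}}\,E_n)$ is relatively compact in $H^{-1}(\Omega)$ and $(\widehat{\operatorname{div}}\,H_n)$ is relatively compact in $\mathring{H}^{-1}(\Omega)$. Then there exist $E,H\in L^2(\Omega)$ as well as subsequences, again denoted by $(E_n)$ and $(H_n)$, such that $E_n\rightharpoonup E$ and $H_n\rightharpoonup H$ weakly in $L^2(\Omega)$, and $$\langle E_n,H_n\rangle_{L^2(\Omega)}\to\langle E,H\rangle_{L^2(\Omega)}.$$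
   Context: Strong Lipschitz: the boundary is locally the graph of a Lipschitz function, with $\Omega$ on one side. Trivial topology: $\Omega$ is simply connected with connected boundary (so that both the space of Dirichlet fields, i.e. $L^2$ fields with vanishing curl and divergence and vanishing tangential trace, and the space of Neumann fields, with vanishing normal trace instead, are $\{0\}$). $\mathring{H}^1(\Omega)$ is the closure of $C_c^\infty(\Omega)$ in $H^1(\Omega)$; $H^{-1}(\Omega):=\mathring{H}^1(\Omega)'$ and $\mathring{H}^{-1}(\Omega):=H^1(\Omega)'$ are the dual spaces (of scalar or vector valued functions as appropriate). The operators $\widetilde{\operatorname{curl}},\widetilde{\operatorname{div}}:L^2(\Omega)\to H^{-1}(\Omega)$ and $\widehat{\operatorname{curl}},\widehat{\operatorname{div}}:L^2(\Omega)\to\mathring{H}^{-1}(\Omega)$ are defined for $E\in L^2(\Omega;\mathbb{R}^3)$ by $\widetilde{\operatorname{curl}}\,E(\Phi):=\langle\operatorname{curl}\Phi,E\rangle_{L^2(\Omega)}$ for vector fields $\Phi\in\mathring{H}^1(\Omega)$, $\widetilde{\operatorname{div}}\,E(\varphi):=-\langle\nabla\varphi,E\rangle_{L^2(\Omega)}$ for $\varphi\in\mathring{H}^1(\Omega)$, and by the same formulas, $\widehat{\operatorname{curl}}\,E(\Phi):=\langle\operatorname{curl}\Phi,E\rangle_{L^2(\Omega)}$ for vector fields $\Phi\in H^1(\Omega)$ and $\widehat{\operatorname{div}}\,E(\varphi):=-\langle\nabla\varphi,E\rangle_{L^2(\Omega)}$ for $\varphi\in H^1(\Omega)$. A sequence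 is relatively compact if its set of members has compact closure. *)

theory Defs
  imports "HOL-Analysis.Analysis"
begin

text \<open>In suitable Cartesian coordinates \<open>y = Q x\<close> near any boundary point, the domain
  lies strictly above the graph of a Lipschitz function and the boundary is that graph.
  Taking the function to be defined on the whole plane is no restriction, since real-valued
  Lipschitz functions extend with the same constant.\<close>

definition strong_lipschitz_boundary :: "(real^3) set \<Rightarrow> bool" where
  "strong_lipschitz_boundary \<Omega> \<longleftrightarrow>
     (\<forall>p\<in>frontier \<Omega>. \<exists>(Q :: real^3 \<Rightarrow> real^3) U L (g :: real \<times> real \<Rightarrow> real).
        orthogonal_transformation Q \<and> open U \<and> p \<in> U \<and> lipschitz_on L UNIV g \<and>
        \<Omega> \<inter> U = {x\<in>U. g (Q x $ 1, Q x $ 2) < Q x $ 3} \<and>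
        frontier \<Omega> \<inter> U = {x\<in>U. g (Q x $ 1, Q x $ 2) = Q x $ 3})"

definition bounded_strong_lipschitz_domain :: "(real^3) set \<Rightarrow> bool" where
  "bounded_strong_lipschitz_domain \<Omega> \<longleftrightarrow>
     open \<Omega> \<and> connected \<Omega> \<and> \<Omega> \<noteq> {} \<and> bounded \<Omega> \<and> strong_lipschitz_boundary \<Omega>"

definition topologically_trivial :: "(real^3) set \<Rightarrow> bool" where
  "topologically_trivial \<Omega> \<longleftrightarrow> simply_connected \<Omega> \<and> connected (frontier \<Omega>)"

text \<open>Function spaces are sets of representatives, not of classes modulo null sets, so their
  norms are only seminorms. A bounded functional takes the same value on any two
  representatives at distance zero, hence the dual is that of the quotient. Functionals are
  \<open>extensional\<close>, so that equality of functionals is equality on \<open>V\<close>.\<close>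

definition dual_space :: "('a \<Rightarrow> 'b::real_vector) set \<Rightarrow> (('a \<Rightarrow> 'b) \<Rightarrow> real) \<Rightarrow> (('a \<Rightarrow> 'b) \<Rightarrow> real) set" where
  "dual_space V N = {f \<in> extensional V.
     (\<forall>u\<in>V. \<forall>v\<in>V. f (\<lambda>x. u x + v x) = f u + f v) \<and>
     (\<forall>c. \<forall>u\<in>V. f (\<lambda>x. c *\<^sub>R u x) = c * f u) \<and>
     (\<exists>C. \<forall>u\<in>V. \<bar>f u\<bar> \<le> C * N u)}"

definition dual_norm :: "('a \<Rightarrow> 'b) set \<Rightarrow> (('a \<Rightarrow> 'b) \<Rightarrow> real) \<Rightarrow> (('a \<Rightarrow> 'b) \<Rightarrow> real) \<Rightarrow> real" where
  "dual_norm V N f = (SUP u\<in>{u\<in>V. N u \<le> 1}. \<bar>f u\<bar>)"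

text \<open>The value 0 outside the dual is a dummy, needed because \<open>Metric_space\<close> asks for
  nonnegativity and symmetry of the distance on the whole type.\<close>

definition dual_dist ::
    "('a \<Rightarrow> 'b::real_vector) set \<Rightarrow> (('a \<Rightarrow> 'b) \<Rightarrow> real) \<Rightarrow>
     (('a \<Rightarrow> 'b) \<Rightarrow> real) \<Rightarrow> (('a \<Rightarrow> 'b) \<Rightarrow> real) \<Rightarrow> real" where
  "dual_dist V N f g =
     (if f \<in> dual_space V N \<and> g \<in> dual_space V N then dual_norm V N (\<lambda>u. f u - g u) else 0)"

definition dual_topology ::
    "('a \<Rightarrow> 'b::real_vector) set \<Rightarrow> (('a \<Rightarrow> 'b) \<Rightarrow> real) \<Rightarrow> (('a \<Rightarrow> 'b) \<Rightarrow> real) topology" where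
  "dual_topology V N = Metric_space.mtopology (dual_space V N) (dual_dist V N)"

lemma Metric_space_dual:
  assumes nonempty: "V \<noteq> {}"
    and scale: "\<And>c u. u \<in> V \<Longrightarrow> (\<lambda>x. c *\<^sub>R u x) \<in> V"
    and homogeneous: "\<And>c u. u \<in> V \<Longrightarrow> N (\<lambda>x. c *\<^sub>R u x) = \<bar>c\<bar> * N u"
    and nonneg: "\<And>u. u \<in> V \<Longrightarrow> 0 \<le> N u"
  shows "Metric_space (dual_space V N) (dual_dist V N)"
proof -
  let ?B = "{u\<in>V. N u \<le> 1}"
  have ne: "?B \<noteq> {}"
  proof -
    obtain u where u: "u \<in> V" using nonempty by blast
    have "(\<lambda>x. 0 *\<^sub>R u x) \<in> ?B"
      using scale[OF u, of 0] homogeneous[OF u, of 0] by simp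
    then show ?thesis by blast
  qed
  have bdd: "bdd_above ((\<lambda>u. \<bar>f u - g u\<bar>) ` ?B)"
    if f: "f \<in> dual_space V N" and g: "g \<in> dual_space V N" for f g
  proof -
    obtain C D where C: "\<forall>u\<in>V. \<bar>f u\<bar> \<le> C * N u" and D: "\<forall>u\<in>V. \<bar>g u\<bar> \<le> D * N u"
      using f g unfolding dual_space_def by blast
    have "\<bar>f u - g u\<bar> \<le> \<bar>C\<bar> + \<bar>D\<bar>" if u: "u \<in> ?B" for u
    proof -
      have N: "0 \<le> N u" "N u \<le> 1" "u \<in> V" using u nonneg by auto
      have "C * N u \<le> \<bar>C\<bar> * 1" "D * N u \<le> \<bar>D\<bar> * 1"
        using N by (intro mult_mono; simp)+
      then show ?thesis using bspec[OF C N(3)] bspec[OF D N(3)] by linarith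
    qed
    then show ?thesis by (intro bdd_aboveI2)
  qed
  have upper: "\<bar>f u - g u\<bar> \<le> dual_dist V N f g"
    if "f \<in> dual_space V N" "g \<in> dual_space V N" "u \<in> ?B" for f g u
    using that cSUP_upper[OF that(3) bdd[OF that(1,2)]]
    by (simp add: dual_dist_def dual_norm_def)
  show ?thesis
  proof
    fix f g
    show "0 \<le> dual_dist V N f g"
    proof (cases "f \<in> dual_space V N \<and> g \<in> dual_space V N")
      case True
      obtain u where "u \<in> ?B" using ne by blast
      then show ?thesis using upper True abs_ge_zero order_trans by blast
    qed (auto simp: dual_dist_def)
    show "dual_dist V N f g = dual_dist V N g f"
      by (auto simp: dual_dist_def dual_norm_def abs_minus_commute)
  next
    fix f g assume fg: "f \<in> dual_space V N" "g \<in> dual_space V N"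
    show "dual_dist V N f g = 0 \<longleftrightarrow> f = g"
    proof
      assume "f = g"
      then show "dual_dist V N f g = 0"
        using ne by (simp add: dual_dist_def dual_norm_def)
    next
      assume 0: "dual_dist V N f g = 0"
      have "f u = g u" if u: "u \<in> V" for u
      proof -
        define c where "c = inverse (1 + N u)"
        have c: "c > 0" "c * N u \<le> 1"
          using nonneg[OF u] by (auto simp: c_def field_simps)
        have "(\<lambda>x. c *\<^sub>R u x) \<in> ?B"
          using scale[OF u] homogeneous[OF u] c by simp
        then have "f (\<lambda>x. c *\<^sub>R u x) = g (\<lambda>x. c *\<^sub>R u x)"
          using upper[OF fg] 0 by fastforce
        then have "c * f u = c * g u"
          using fg u by (simp add: dual_space_def)
        then show ?thesis using c by simp
      qed
      moreover have "f \<in> extensional V" "g \<in> extensional V"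
        using fg by (auto simp: dual_space_def)
      ultimately show "f = g" by (intro extensionalityI)
    qed
  next
    fix f g h assume fgh: "f \<in> dual_space V N" "g \<in> dual_space V N" "h \<in> dual_space V N"
    have "dual_norm V N (\<lambda>u. f u - h u) \<le> dual_dist V N f g + dual_dist V N g h"
      unfolding dual_norm_def
    proof (rule cSUP_least[OF ne])
      fix u assume u: "u \<in> ?B"
      show "\<bar>f u - h u\<bar> \<le> dual_dist V N f g + dual_dist V N g h"
        using upper[OF fgh(1,2) u] upper[OF fgh(2,3) u] by linarith
    qed
    then show "dual_dist V N f h \<le> dual_dist V N f g + dual_dist V N g h"
      using fgh by (simp add: dual_dist_def)
  qed
qed

definition relatively_compact_in :: "'a topology \<Rightarrow> (nat \<Rightarrow> 'a) \<Rightarrow> bool" where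
  "relatively_compact_in T f \<longleftrightarrow> range f \<subseteq> topspace T \<and> compactin T (T closure_of range f)"

definition L2 :: "(real^'n) set \<Rightarrow> (real^'n \<Rightarrow> 'b::euclidean_space) set" where
  "L2 \<Omega> = {u \<in> borel_measurable (lebesgue_on \<Omega>). integrable (lebesgue_on \<Omega>) (\<lambda>x. (norm (u x))\<^sup>2)}"

definition L2_inner :: "(real^'n) set \<Rightarrow> (real^'n \<Rightarrow> 'b) \<Rightarrow> (real^'n \<Rightarrow> 'b::euclidean_space) \<Rightarrow> real" where
  "L2_inner \<Omega> u v = (LINT x|lebesgue_on \<Omega>. u x \<bullet> v x)"

definition L2_norm :: "(real^'n) set \<Rightarrow> (real^'n \<Rightarrow> 'b::euclidean_space) \<Rightarrow> real" where
  "L2_norm \<Omega> u = sqrt (L2_inner \<Omega> u u)"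

definition L2_weakly_converges ::
    "(real^'n) set \<Rightarrow> (nat \<Rightarrow> real^'n \<Rightarrow> 'b::euclidean_space) \<Rightarrow> (real^'n \<Rightarrow> 'b) \<Rightarrow> bool" where
  "L2_weakly_converges \<Omega> u v \<longleftrightarrow> (\<forall>f \<in> dual_space (L2 \<Omega>) (L2_norm \<Omega>). (\<lambda>n. f (u n)) \<longlonglongrightarrow> f v)"

definition partial_deriv :: "'n \<Rightarrow> (real^'n \<Rightarrow> 'b::euclidean_space) \<Rightarrow> real^'n \<Rightarrow> 'b" where
  "partial_deriv i f x = frechet_derivative f (at x) (axis i 1)"

primrec C_k :: "nat \<Rightarrow> (real^'n \<Rightarrow> 'b::euclidean_space) \<Rightarrow> bool" where
  "C_k 0 f \<longleftrightarrow> continuous_on UNIV f"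
| "C_k (Suc k) f \<longleftrightarrow> f differentiable_on UNIV \<and> (\<forall>i. C_k k (partial_deriv i f))"

text \<open>\<open>C\<^sub>c\<^sup>\<infinity>(\<Omega>)\<close>, each function being extended by zero to the whole space.\<close>

definition test_functions :: "(real^'n) set \<Rightarrow> (real^'n \<Rightarrow> 'b::euclidean_space) set" where
  "test_functions \<Omega> =
     {\<phi>. (\<forall>k. C_k k \<phi>) \<and> compact (closure {x. \<phi> x \<noteq> 0}) \<and> closure {x. \<phi> x \<noteq> 0} \<subseteq> \<Omega>}"

definition is_weak_partial_deriv ::
    "(real^'n) set \<Rightarrow> 'n \<Rightarrow> (real^'n \<Rightarrow> 'b::euclidean_space) \<Rightarrow> (real^'n \<Rightarrow> 'b) \<Rightarrow> bool" where
  "is_weak_partial_deriv \<Omega> i u g \<longleftrightarrow>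
     (\<forall>\<phi>\<in>test_functions \<Omega>.
        (LINT x|lebesgue_on \<Omega>. partial_deriv i \<phi> x *\<^sub>R u x) =
        - (LINT x|lebesgue_on \<Omega>. (\<phi> x :: real) *\<^sub>R g x))"

definition H1 :: "(real^'n) set \<Rightarrow> (real^'n \<Rightarrow> 'b::euclidean_space) set" where
  "H1 \<Omega> = {u \<in> L2 \<Omega>. \<forall>i. \<exists>g \<in> L2 \<Omega>. is_weak_partial_deriv \<Omega> i u g}"

text \<open>For \<open>u \<in> H1 \<Omega>\<close> the chosen representative is unique up to null subsets of \<open>\<Omega>\<close>.\<close>

definition weak_partial_deriv ::
    "(real^'n) set \<Rightarrow> 'n \<Rightarrow> (real^'n \<Rightarrow> 'b::euclidean_space) \<Rightarrow> real^'n \<Rightarrow> 'b" where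
  "weak_partial_deriv \<Omega> i u = (SOME g. g \<in> L2 \<Omega> \<and> is_weak_partial_deriv \<Omega> i u g)"

definition H1_norm :: "(real^'n) set \<Rightarrow> (real^'n \<Rightarrow> 'b::euclidean_space) \<Rightarrow> real" where
  "H1_norm \<Omega> u =
     sqrt ((L2_norm \<Omega> u)\<^sup>2 + (\<Sum>i\<in>UNIV. (L2_norm \<Omega> (weak_partial_deriv \<Omega> i u))\<^sup>2))"

definition H1_ring :: "(real^'n) set \<Rightarrow> (real^'n \<Rightarrow> 'b::euclidean_space) set" where
  "H1_ring \<Omega> =
     {u \<in> H1 \<Omega>. \<forall>\<epsilon>>0. \<exists>\<phi>\<in>test_functions \<Omega>. H1_norm \<Omega> (\<lambda>x. u x - \<phi> x) < \<epsilon>}"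

definition grad :: "(real^'n) set \<Rightarrow> (real^'n \<Rightarrow> real) \<Rightarrow> real^'n \<Rightarrow> real^'n" where
  "grad \<Omega> \<phi> x = (\<chi> i. weak_partial_deriv \<Omega> i \<phi> x)"

definition curl :: "(real^3) set \<Rightarrow> (real^3 \<Rightarrow> real^3) \<Rightarrow> real^3 \<Rightarrow> real^3" where
  "curl \<Omega> \<Phi> x = vector
     [weak_partial_deriv \<Omega> 2 \<Phi> x $ 3 - weak_partial_deriv \<Omega> 3 \<Phi> x $ 2,
      weak_partial_deriv \<Omega> 3 \<Phi> x $ 1 - weak_partial_deriv \<Omega> 1 \<Phi> x $ 3,
      weak_partial_deriv \<Omega> 1 \<Phi> x $ 2 - weak_partial_deriv \<Omega> 2 \<Phi> x $ 1]"

text \<open>Pitfall: the ring moves to the other side under duality. \<open>Hm1_ring\<close> is the dual of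
  all of \<open>H1\<close>, not a closure of test functions.\<close>

definition Hm1 :: "(real^'n) set \<Rightarrow> ((real^'n \<Rightarrow> 'b::euclidean_space) \<Rightarrow> real) topology" where
  "Hm1 \<Omega> = dual_topology (H1_ring \<Omega>) (H1_norm \<Omega>)"

definition Hm1_ring :: "(real^'n) set \<Rightarrow> ((real^'n \<Rightarrow> 'b::euclidean_space) \<Rightarrow> real) topology" where
  "Hm1_ring \<Omega> = dual_topology (H1 \<Omega>) (H1_norm \<Omega>)"

definition curl_tilde :: "(real^3) set \<Rightarrow> (real^3 \<Rightarrow> real^3) \<Rightarrow> (real^3 \<Rightarrow> real^3) \<Rightarrow> real" where
  "curl_tilde \<Omega> E = (\<lambda>\<Phi>\<in>H1_ring \<Omega>. L2_inner \<Omega> (curl \<Omega> \<Phi>) E)"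

definition curl_hat :: "(real^3) set \<Rightarrow> (real^3 \<Rightarrow> real^3) \<Rightarrow> (real^3 \<Rightarrow> real^3) \<Rightarrow> real" where
  "curl_hat \<Omega> E = (\<lambda>\<Phi>\<in>H1 \<Omega>. L2_inner \<Omega> (curl \<Omega> \<Phi>) E)"

definition div_tilde :: "(real^3) set \<Rightarrow> (real^3 \<Rightarrow> real^3) \<Rightarrow> (real^3 \<Rightarrow> real) \<Rightarrow> real" where
  "div_tilde \<Omega> E = (\<lambda>\<phi>\<in>H1_ring \<Omega>. - L2_inner \<Omega> (grad \<Omega> \<phi>) E)"

definition div_hat :: "(real^3) set \<Rightarrow> (real^3 \<Rightarrow> real^3) \<Rightarrow> (real^3 \<Rightarrow> real) \<Rightarrow> real" where
  "div_hat \<Omega> E = (\<lambda>\<phi>\<in>H1 \<Omega>. - L2_inner \<Omega> (grad \<Omega> \<phi>) E)"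

end

theory Submission
  imports Defs "HOL-Library.Diagonal_Subsequence"
begin

text \<open>Subtract the weak limits. In the dual norm the functionals given by \<open>curl\<close> and \<open>div\<close> converge
  along a subsequence, so \<open>E\<close> and \<open>H\<close> may be taken weakly null with curl and divergence small
  against test functions, and by density they may be taken in \<open>C\<^sub>c\<^sup>\<infinity>(\<Omega>)\<close>.
  Localise with a partition of unity subordinate to neighbourhoods in which \<open>\<Omega>\<close> contains a
  translated cone at each of its points. With \<open>\<psi>\<^sub>k(x) = 8^k \<psi>(2^k x)\<close> there are kernels
  \<open>\<beta>\<close>, \<open>b\<close>, \<open>B\<close> supported in that cone such that
  \<open>K\<^sub>N f = (\<Sum>k<N. 2^-k \<beta>\<^sub>k * B\<^sub>k * f)\<close> satisfies
  \<open>div K\<^sub>N f = b\<^sub>N * b\<^sub>N * f - b\<^sub>0 * b\<^sub>0 * f\<close>. The first term approximates \<open>f\<close>, and on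
  weakly null sequences the second one is negligible. A square function estimate bounds \<open>K\<^sub>N\<close>
  from \<open>L\<^sup>2\<close> to \<open>H\<^sup>1\<close> uniformly in \<open>N\<close>, and each term of the sum tends to 0 on weakly null sequences.

  When the curl of \<open>E\<close> is controlled only against test functions in \<open>\<Omega>\<close>, write the localised field
  \<open>G = \<theta> H\<close> up to small terms as \<open>(div K)G = K div G - curl (K \<times> G)\<close>; in the other case write
  \<open>G = \<theta> E\<close> up to small terms as \<open>grad (K \<cdot> G)\<close> plus \<open>K\<close> applied to components of \<open>curl G\<close>. The
  cone keeps \<open>K \<times> G\<close> and \<open>K \<cdot> G\<close> supported in \<open>\<Omega>\<close>, so testing these identities against
  \<open>E\<close>, respectively \<open>H\<close>, gives the claim without boundary terms.\<close>

section \<open>Smooth functions\<close>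

text \<open>The obstacle is the boundary: one of the two functionals is known only on fields
  vanishing there, so every potential tested against it must stay inside \<open>\<Omega>\<close>.
  Kernels supported in a cone achieve this, but their \<open>H\<^sup>1\<close> bound has to come
  from cancellation scale by scale. This explains the double convolution. The increment of
  \<open>b\<^sub>k * b\<^sub>k\<close> from scale \<open>k\<close> to \<open>k + 1\<close> is a
  difference of squares, hence the convolution of the difference of the two dilates of
  \<open>b\<close>, which is the divergence of \<open>2^-k \<beta>\<^sub>k\<close>, with their sum,
  which is \<open>B\<^sub>k\<close>. A derivative put on \<open>B\<^sub>k\<close> leaves two factors
  of mean zero, provided that each component of \<open>\<beta>\<close> is itself a divergence; to
  this end the first moments of \<open>b\<close> are made to vanish. Each factor then obeys a square
  function estimate, and Cauchy-Schwarz over the scales bounds the sum. The number \<open>N\<close>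
  of scales is chosen anew for each member of the sequence, because members that are merely bounded
  in \<open>L\<^sup>2\<close> admit no common rate of approximation by mollification. Hence all
  constants must be independent of \<open>N\<close>.\<close>

definition smooth :: "(real^'n \<Rightarrow> 'b::euclidean_space) \<Rightarrow> bool" where
  "smooth f \<longleftrightarrow> (\<forall>k. C_k k f)"

lemma C_k_Suc_imp: "C_k (Suc k) f \<Longrightarrow> C_k k f"
proof (induction k arbitrary: f)
  case 0
  then show ?case by (simp add: differentiable_imp_continuous_on)
next
  case (Suc k)
  have "f differentiable_on UNIV" using Suc.prems by simp
  moreover have "C_k k (partial_deriv i f)" for i
    using Suc.IH[of "partial_deriv i f"] Suc.prems by simp
  ultimately show ?case by simp
qed

lemma smooth_differentiable: "smooth f \<Longrightarrow> f differentiable (at x)"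
  unfolding smooth_def differentiable_on_def by (metis C_k.simps(2) UNIV_I differentiable_on_def)

lemma smooth_partial: "smooth f \<Longrightarrow> smooth (partial_deriv i f)"
  unfolding smooth_def by (metis C_k.simps(2))

lemma smooth_continuous: "smooth f \<Longrightarrow> continuous_on UNIV f"
  unfolding smooth_def by (metis C_k.simps(1))

text \<open>By induction on the order, carried out for all members of \<open>S\<close> at once. It
  suits families such as superpositions, in which a derivative only changes the parameters.\<close>

lemma smooth_coinduct:
  assumes "f \<in> S"
    and "\<And>f x. f \<in> S \<Longrightarrow> f differentiable (at x)"
    and "\<And>f i. f \<in> S \<Longrightarrow> partial_deriv i f \<in> S"
  shows "smooth f"
proof -
  have "f \<in> S \<Longrightarrow> C_k k f" for k f
  proof (induction k arbitrary: f)
    case 0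
    then show ?case
      using assms(2) by (simp add: differentiable_imp_continuous_on differentiable_on_def differentiable_at_withinI)
  next
    case (Suc k)
    then show ?case
      using assms(2,3) by (simp add: differentiable_on_def differentiable_at_withinI)
  qed
  then show ?thesis using assms(1) by (simp add: smooth_def)
qed

section \<open>Calculus rules for partial derivatives and stability of smoothness under them\<close>

lemma partial_deriv_eq:
  "(f has_derivative f') (at x) \<Longrightarrow> partial_deriv i f x = f' (axis i 1)"
  unfolding partial_deriv_def by (simp add: frechet_derivative_at[symmetric])

lemma has_derivative_partial:
  fixes f :: "real^'n \<Rightarrow> 'b::euclidean_space"
  assumes "f differentiable (at x)"
  shows "(f has_derivative (\<lambda>h. \<Sum>i\<in>UNIV. h $ i *\<^sub>R partial_deriv i f x)) (at x)"
proof -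
  let ?D = "frechet_derivative f (at x)"
  have D: "(f has_derivative ?D) (at x)" using assms frechet_derivative_works by blast
  then have lin: "linear ?D" using has_derivative_linear by blast
  have "?D h = (\<Sum>i\<in>UNIV. h $ i *\<^sub>R partial_deriv i f x)" for h
  proof -
    have "?D h = ?D (\<Sum>i\<in>UNIV. h $ i *\<^sub>R axis i 1)"
      using basis_expansion[of h] by (simp add: scalar_mult_eq_scaleR)
    also have "\<dots> = (\<Sum>i\<in>UNIV. h $ i *\<^sub>R ?D (axis i 1))"
      using lin by (simp add: linear_sum linear_scale)
    finally show ?thesis by (simp add: partial_deriv_def)
  qed
  then have "?D = (\<lambda>h. \<Sum>i\<in>UNIV. h $ i *\<^sub>R partial_deriv i f x)" by blast
  then show ?thesis using D by simp
qed

lemmas smooth_has_derivative = has_derivative_partial[OF smooth_differentiable]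

lemma partial_deriv_add:
  assumes "f differentiable (at x)" "g differentiable (at x)"
  shows "partial_deriv i (\<lambda>x. f x + g x) x = partial_deriv i f x + partial_deriv i g x"
  using partial_deriv_eq[OF has_derivative_add[OF assms[unfolded frechet_derivative_works]]]
  by (simp add: partial_deriv_def)

lemma partial_deriv_scaleR:
  fixes f :: "real^'n \<Rightarrow> real"
  assumes "f differentiable (at x)" "g differentiable (at x)"
  shows "partial_deriv i (\<lambda>x. f x *\<^sub>R g x) x = f x *\<^sub>R partial_deriv i g x + partial_deriv i f x *\<^sub>R g x"
  using partial_deriv_eq[OF has_derivative_scaleR[OF assms[unfolded frechet_derivative_works]]]
  by (simp add: partial_deriv_def)

lemma partial_deriv_bounded_linear:
  assumes "bounded_linear L" "f differentiable (at x)"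
  shows "partial_deriv i (\<lambda>x. L (f x)) x = L (partial_deriv i f x)"
  using partial_deriv_eq[OF bounded_linear.has_derivative[OF assms(1) assms(2)[unfolded frechet_derivative_works]]]
  by (simp add: partial_deriv_def)

lemma C_k_add: "C_k k f \<Longrightarrow> C_k k g \<Longrightarrow> C_k k (\<lambda>x. f x + g x)"
proof (induction k arbitrary: f g)
  case 0
  then show ?case by (simp add: continuous_on_add)
next
  case (Suc k)
  have "partial_deriv i (\<lambda>x. f x + g x) = (\<lambda>x. partial_deriv i f x + partial_deriv i g x)" for i
    using Suc.prems by (auto simp: differentiable_on_def partial_deriv_add)
  then show ?case using Suc by (simp add: differentiable_on_add)
qed

lemma C_k_scaleR:
  fixes f :: "real^'n \<Rightarrow> real"
  shows "C_k k f \<Longrightarrow> C_k k g \<Longrightarrow> C_k k (\<lambda>x. f x *\<^sub>R g x)"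
proof (induction k arbitrary: f g)
  case 0
  then show ?case by (simp add: continuous_on_scaleR)
next
  case (Suc k)
  have fg: "f differentiable (at x)" "g differentiable (at x)" for x
    using Suc.prems by (auto simp: differentiable_on_def)
  have 1: "partial_deriv i (\<lambda>x. f x *\<^sub>R g x)
      = (\<lambda>x. f x *\<^sub>R partial_deriv i g x + partial_deriv i f x *\<^sub>R g x)" for i
    using fg by (auto simp: partial_deriv_scaleR)
  \<comment> \<open>The product rule leaves one factor undifferentiated, so its order has to be
    lowered by one before the induction hypothesis applies.\<close>
  have "C_k k (partial_deriv i (\<lambda>x. f x *\<^sub>R g x))" for i
    unfolding 1 using Suc.prems
    by (intro C_k_add Suc.IH C_k_Suc_imp[of k f] C_k_Suc_imp[of k g]) auto
  moreover have "(\<lambda>x. f x *\<^sub>R g x) differentiable_on UNIV"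
    using fg by (auto simp: differentiable_on_def intro!: differentiable_scaleR)
  ultimately show ?case by simp
qed

lemma C_k_bounded_linear:
  "bounded_linear L \<Longrightarrow> C_k k f \<Longrightarrow> C_k k (\<lambda>x. L (f x))"
proof (induction k arbitrary: f)
  case 0
  then show ?case by (simp add: bounded_linear.continuous_on)
next
  case (Suc k)
  have f: "f differentiable (at x)" for x
    using Suc.prems by (auto simp: differentiable_on_def)
  have "partial_deriv i (\<lambda>x. L (f x)) = (\<lambda>x. L (partial_deriv i f x))" for i
    using f Suc.prems by (auto simp: partial_deriv_bounded_linear)
  moreover have "(\<lambda>x. L (f x)) differentiable_on UNIV"
    using bounded_linear.has_derivative[OF Suc.prems(1) f[unfolded frechet_derivative_works]]
    by (auto simp: differentiable_on_def differentiable_def intro: has_derivative_at_withinI)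
  ultimately show ?case using Suc by simp
qed

lemma smooth_add: "smooth f \<Longrightarrow> smooth g \<Longrightarrow> smooth (\<lambda>x. f x + g x)"
  by (simp add: smooth_def C_k_add)

lemma smooth_scaleR:
  fixes f :: "real^'n \<Rightarrow> real"
  shows "smooth f \<Longrightarrow> smooth g \<Longrightarrow> smooth (\<lambda>x. f x *\<^sub>R g x)"
  by (simp add: smooth_def C_k_scaleR)

lemma smooth_mult:
  fixes f :: "real^'n \<Rightarrow> real"
  shows "smooth f \<Longrightarrow> smooth g \<Longrightarrow> smooth (\<lambda>x. f x * g x)"
  using smooth_scaleR[of f g] by simp

lemma smooth_bounded_linear: "bounded_linear L \<Longrightarrow> smooth f \<Longrightarrow> smooth (\<lambda>x. L (f x))"
  by (simp add: smooth_def C_k_bounded_linear)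

lemma smooth_const: "smooth (\<lambda>x::real^'n. c :: 'b::euclidean_space)"
proof (rule smooth_coinduct[where S="range (\<lambda>c x. c)"])
  fix f :: "real^'n \<Rightarrow> 'b" and i
  assume "f \<in> range (\<lambda>c x. c)"
  then obtain c where "f = (\<lambda>x. c)" by blast
  then have "partial_deriv i f = (\<lambda>x. 0)"
    using partial_deriv_eq[OF has_derivative_const] by blast
  then show "partial_deriv i f \<in> range (\<lambda>c x. c)" by blast
qed auto

lemma partial_deriv_nth: "partial_deriv i (\<lambda>x::real^'n. x $ j) x = (if i = j then 1 else 0)"
proof -
  have "((\<lambda>x::real^'n. x $ j) has_derivative (\<lambda>h. h $ j)) (at x)"
    by (rule bounded_linear_imp_has_derivative) (rule bounded_linear_vec_nth)
  from partial_deriv_eq[OF this, of i] show ?thesis by (auto simp: axis_def)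
qed

lemma smooth_nth: "smooth (\<lambda>x::real^'n. x $ j)"
proof -
  have "C_k k (\<lambda>x::real^'n. x $ j)" for k
  proof (cases k)
    case 0
    then show ?thesis by (simp add: continuous_on_component)
  next
    case (Suc m)
    have "partial_deriv i (\<lambda>x::real^'n. x $ j) = (\<lambda>x. (if i = j then 1 else 0))" for i
      by (rule ext) (rule partial_deriv_nth)
    moreover have "(\<lambda>x::real^'n. x $ j) differentiable_on UNIV"
      by (rule linear_imp_differentiable_on) (simp add: bounded_linear.linear bounded_linear_vec_nth)
    ultimately show ?thesis
      using Suc by (simp add: smooth_const[unfolded smooth_def, rule_format])
  qed
  then show ?thesis by (simp add: smooth_def)
qed

lemma smooth_sum:
  "(\<And>i. i \<in> I \<Longrightarrow> smooth (f i)) \<Longrightarrow> smooth (\<lambda>x. \<Sum>i\<in>I. f i x)"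
  by (induction I rule: infinite_finite_induct) (simp_all add: smooth_add smooth_const)

lemma partial_deriv_component:
  fixes f :: "real^'n \<Rightarrow> real^'m"
  assumes "smooth f"
  shows "partial_deriv i (\<lambda>x. f x $ j) x = partial_deriv i f x $ j"
  using partial_deriv_bounded_linear[OF bounded_linear_vec_nth smooth_differentiable[OF assms]] .

lemma partial_deriv_sum:
  assumes "\<And>i. i \<in> I \<Longrightarrow> smooth (f i)"
  shows "partial_deriv j (\<lambda>x. \<Sum>i\<in>I. f i x) x = (\<Sum>i\<in>I. partial_deriv j (f i) x)"
  using assms
proof (induction I rule: infinite_finite_induct)
  case (insert a I)
  then show ?case
    by (simp add: partial_deriv_add smooth_differentiable smooth_sum)
qed (simp_all add: partial_deriv_eq[OF has_derivative_const])

lemma partial_deriv_mult: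
  fixes f g :: "real^'n \<Rightarrow> real"
  assumes "smooth f" "smooth g"
  shows "partial_deriv i (\<lambda>x. f x * g x) x = f x * partial_deriv i g x + partial_deriv i f x * g x"
  using partial_deriv_scaleR[OF smooth_differentiable[OF assms(1)] smooth_differentiable[OF assms(2)]]
  by simp

lemma partial_deriv_cmult:
  fixes g :: "real^'n \<Rightarrow> real"
  assumes "smooth g"
  shows "partial_deriv i (\<lambda>x. c * g x) x = c * partial_deriv i g x"
  using partial_deriv_bounded_linear[OF bounded_linear_mult_right smooth_differentiable[OF assms]] .

lemma partial_deriv_diff:
  fixes g :: "real^'n \<Rightarrow> 'b::euclidean_space"
  assumes "smooth f" "smooth g"
  shows "partial_deriv i (\<lambda>x. f x - g x) x = partial_deriv i f x - partial_deriv i g x"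
  using partial_deriv_eq[OF has_derivative_diff[OF assms[THEN smooth_differentiable, unfolded frechet_derivative_works]]]
  by (simp add: partial_deriv_def)

lemma smooth_diff:
  "smooth f \<Longrightarrow> smooth g \<Longrightarrow> smooth (\<lambda>x. f x - g x)"
  using smooth_add[OF _ smooth_bounded_linear[OF bounded_linear_minus[OF bounded_linear_ident]], of f g] by simp

text \<open>The family \<open>h\<close> lists a smooth function of one variable and its successive derivatives.\<close>

lemma C_k_compose:
  fixes q :: "real^'n \<Rightarrow> real"
  assumes d: "\<And>m t. (h m has_real_derivative h (Suc m) t) (at t)" and q: "smooth q"
  shows "C_k k (\<lambda>x. h m (q x))"
proof (induction k arbitrary: m)
  case 0
  have "continuous_on UNIV (h m)"
    using d by (meson DERIV_isCont continuous_at_imp_continuous_on)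
  then show ?case
    using continuous_on_compose2[of UNIV "h m" UNIV q] smooth_continuous[OF q] by simp
next
  case (Suc k)
  have D: "((\<lambda>x. h m (q x)) has_derivative (\<lambda>v. h (Suc m) (q x) * (\<Sum>i\<in>UNIV. v $ i *\<^sub>R partial_deriv i q x))) (at x)" for x
    using has_derivative_compose[OF smooth_has_derivative[OF q] d[unfolded has_field_derivative_def]] by simp
  have 1: "partial_deriv i (\<lambda>x. h m (q x)) = (\<lambda>x. h (Suc m) (q x) *\<^sub>R partial_deriv i q x)" for i
  proof
    fix x
    show "partial_deriv i (\<lambda>x. h m (q x)) x = h (Suc m) (q x) *\<^sub>R partial_deriv i q x"
      using partial_deriv_eq[OF D, of i x] by (simp add: axis_def if_distrib[of "\<lambda>c. c * _"] cong: if_cong)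
  qed
  have "C_k k (partial_deriv i (\<lambda>x. h m (q x)))" for i
    unfolding 1 using q by (intro C_k_scaleR Suc.IH) (metis C_k.simps(2) smooth_def)
  then show ?case using D by (auto simp: differentiable_on_def differentiable_def intro: has_derivative_at_withinI)
qed

section \<open>Test functions, described by any compact set that carries them instead of the closure
  of their support\<close>

lemma test_functions_iff:
  fixes \<phi> :: "real^'n \<Rightarrow> 'b::euclidean_space"
  shows "\<phi> \<in> test_functions \<Omega> \<longleftrightarrow> smooth \<phi> \<and> (\<exists>K. compact K \<and> K \<subseteq> \<Omega> \<and> (\<forall>x. x \<notin> K \<longrightarrow> \<phi> x = 0))"
proof -
  have "compact (closure {x. \<phi> x \<noteq> 0}) \<and> closure {x. \<phi> x \<noteq> 0} \<subseteq> \<Omega>"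
    if K: "compact K" "K \<subseteq> \<Omega>" "\<forall>x. x \<notin> K \<longrightarrow> \<phi> x = 0" for K
  proof -
    have "closure {x. \<phi> x \<noteq> 0} \<subseteq> K"
      using K by (intro closure_minimal compact_imp_closed) auto
    then show ?thesis
      using K compact_Int_closed[OF K(1) closed_closure, of "{x. \<phi> x \<noteq> 0}"] by (auto simp: Int_absorb1)
  qed
  moreover have "\<phi> x = 0" if "x \<notin> closure {x. \<phi> x \<noteq> 0}" for x
    using that closure_subset[of "{x. \<phi> x \<noteq> 0}"] by auto
  ultimately show ?thesis
    unfolding test_functions_def smooth_def by blast
qed

lemma test_functionsI:
  "smooth \<phi> \<Longrightarrow> compact K \<Longrightarrow> K \<subseteq> \<Omega> \<Longrightarrow> (\<And>x. x \<notin> K \<Longrightarrow> \<phi> x = 0) \<Longrightarrow> \<phi> \<in> test_functions \<Omega>"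
  unfolding test_functions_iff by blast

lemma test_functions_smooth: "\<phi> \<in> test_functions \<Omega> \<Longrightarrow> smooth \<phi>"
  by (simp add: test_functions_iff)

lemma test_functions_mono: "\<phi> \<in> test_functions \<Omega> \<Longrightarrow> \<Omega> \<subseteq> \<Omega>' \<Longrightarrow> \<phi> \<in> test_functions \<Omega>'"
  unfolding test_functions_iff by blast

lemma test_functions_UNIV: "\<phi> \<in> test_functions \<Omega> \<Longrightarrow> \<phi> \<in> test_functions UNIV"
  by (rule test_functions_mono) auto

lemma test_functions_outside: "\<phi> \<in> test_functions \<Omega> \<Longrightarrow> x \<notin> \<Omega> \<Longrightarrow> \<phi> x = 0"
  unfolding test_functions_iff by blast

lemma partial_deriv_outside:
  assumes "closed K" "\<And>x. x \<notin> K \<Longrightarrow> \<phi> x = 0" "x \<notin> K"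
  shows "partial_deriv i \<phi> x = 0"
proof -
  have "(\<phi> has_derivative (\<lambda>h. 0)) (at x)"
    by (rule has_derivative_transform_within_open[of "\<lambda>x. 0" _ _ _ "- K"])
      (use assms in auto)
  from partial_deriv_eq[OF this] show ?thesis .
qed

lemma test_functions_partial:
  assumes "\<phi> \<in> test_functions \<Omega>" shows "partial_deriv i \<phi> \<in> test_functions \<Omega>"
proof -
  obtain K where K: "compact K" "K \<subseteq> \<Omega>" "\<And>x. x \<notin> K \<Longrightarrow> \<phi> x = 0"
    using assms by (auto simp: test_functions_iff)
  show ?thesis
    by (rule test_functionsI[OF smooth_partial[OF test_functions_smooth[OF assms]] K(1,2)])
      (rule partial_deriv_outside[OF compact_imp_closed[OF K(1)] K(3)])
qed

lemma test_functions_add: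
  assumes "f \<in> test_functions \<Omega>" "g \<in> test_functions \<Omega>"
  shows "(\<lambda>x. f x + g x) \<in> test_functions \<Omega>"
proof -
  obtain K where K: "compact K" "K \<subseteq> \<Omega>" "\<And>x. x \<notin> K \<Longrightarrow> f x = 0"
    using assms by (auto simp: test_functions_iff)
  obtain L where L: "compact L" "L \<subseteq> \<Omega>" "\<And>x. x \<notin> L \<Longrightarrow> g x = 0"
    using assms by (auto simp: test_functions_iff)
  show ?thesis
    by (rule test_functionsI[of _ "K \<union> L"])
      (use assms K L in \<open>auto intro: smooth_add test_functions_smooth\<close>)
qed

lemma test_functions_bounded_linear:
  assumes "bounded_linear L" "f \<in> test_functions \<Omega>"
  shows "(\<lambda>x. L (f x)) \<in> test_functions \<Omega>"
proof -
  obtain K where K: "compact K" "K \<subseteq> \<Omega>" "\<And>x. x \<notin> K \<Longrightarrow> f x = 0"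
    using assms by (auto simp: test_functions_iff)
  show ?thesis
    by (rule test_functionsI[of _ K])
      (use assms K in \<open>auto intro: smooth_bounded_linear test_functions_smooth simp: linear_0 bounded_linear.linear\<close>)
qed

lemma test_functions_cmult:
  fixes f :: "real^'n \<Rightarrow> real"
  shows "f \<in> test_functions \<Omega> \<Longrightarrow> (\<lambda>x. c * f x) \<in> test_functions \<Omega>"
  by (rule test_functions_bounded_linear[OF bounded_linear_mult_right])

lemma test_functions_uminus:
  "f \<in> test_functions \<Omega> \<Longrightarrow> (\<lambda>x. - f x) \<in> test_functions \<Omega>"
  by (rule test_functions_bounded_linear[OF bounded_linear_minus[OF bounded_linear_ident]])

lemma test_functions_diff:
  "f \<in> test_functions \<Omega> \<Longrightarrow> g \<in> test_functions \<Omega> \<Longrightarrow> (\<lambda>x. f x - g x) \<in> test_functions \<Omega>"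
  using test_functions_add[OF _ test_functions_uminus, of f \<Omega> g] by simp

lemma test_functions_zero: "(\<lambda>x. 0) \<in> test_functions \<Omega>"
  by (rule test_functionsI[of _ "{}"]) (auto intro: smooth_const)

lemma test_functions_sum:
  "(\<And>i. i \<in> I \<Longrightarrow> f i \<in> test_functions \<Omega>) \<Longrightarrow> (\<lambda>x. \<Sum>i\<in>I. f i x) \<in> test_functions \<Omega>"
  by (induction I rule: infinite_finite_induct) (simp_all add: test_functions_add test_functions_zero)

lemma test_functions_scaleR_left:
  fixes f :: "real^'n \<Rightarrow> real"
  assumes "f \<in> test_functions \<Omega>" "smooth g"
  shows "(\<lambda>x. f x *\<^sub>R g x) \<in> test_functions \<Omega>"
proof -
  obtain K where K: "compact K" "K \<subseteq> \<Omega>" "\<And>x. x \<notin> K \<Longrightarrow> f x = 0"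
    using assms by (auto simp: test_functions_iff)
  show ?thesis
    by (rule test_functionsI[of _ K])
      (use assms K in \<open>auto intro: smooth_scaleR test_functions_smooth\<close>)
qed

lemma test_functions_scaleR_right:
  fixes f :: "real^'n \<Rightarrow> real"
  assumes "smooth f" "g \<in> test_functions \<Omega>"
  shows "(\<lambda>x. f x *\<^sub>R g x) \<in> test_functions \<Omega>"
proof -
  obtain K where K: "compact K" "K \<subseteq> \<Omega>" "\<And>x. x \<notin> K \<Longrightarrow> g x = 0"
    using assms by (auto simp: test_functions_iff)
  show ?thesis
    by (rule test_functionsI[of _ K])
      (use assms K in \<open>auto intro: smooth_scaleR test_functions_smooth\<close>)
qed

lemma test_functions_mult_left:
  fixes f :: "real^'n \<Rightarrow> real"
  shows "f \<in> test_functions \<Omega> \<Longrightarrow> smooth g \<Longrightarrow> (\<lambda>x. f x * g x) \<in> test_functions \<Omega>"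
  using test_functions_scaleR_left[of f \<Omega> g] by simp

lemma test_functions_mult_right:
  fixes f :: "real^'n \<Rightarrow> real"
  shows "smooth f \<Longrightarrow> g \<in> test_functions \<Omega> \<Longrightarrow> (\<lambda>x. f x * g x) \<in> test_functions \<Omega>"
  using test_functions_scaleR_right[of f g \<Omega>] by simp

lemma test_functions_component:
  fixes f :: "real^'n \<Rightarrow> real^'m"
  shows "f \<in> test_functions \<Omega> \<Longrightarrow> (\<lambda>x. f x $ j) \<in> test_functions \<Omega>"
  by (rule test_functions_bounded_linear[OF bounded_linear_vec_nth])

lemma test_functions_vec:
  fixes f :: "'m::finite \<Rightarrow> real^'n \<Rightarrow> real"
  assumes "\<And>j. f j \<in> test_functions \<Omega>"
  shows "(\<lambda>x. (\<chi> j. f j x) :: real^'m) \<in> test_functions \<Omega>"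
proof -
  have "(\<chi> j. f j x) = (\<Sum>j\<in>UNIV. f j x *\<^sub>R axis j (1::real))" for x
    using basis_expansion[of "\<chi> j. f j x"] by (simp add: scalar_mult_eq_scaleR)
  then show ?thesis
    using assms by (simp only:) (intro test_functions_sum test_functions_scaleR_left smooth_const)
qed

section \<open>Affine changes of variable\<close>

lemma has_derivative_affine:
  fixes f :: "real^'n \<Rightarrow> 'b::euclidean_space"
  assumes "smooth f"
  shows "((\<lambda>x. f (s *\<^sub>R x - y)) has_derivative
     (\<lambda>h. \<Sum>i\<in>UNIV. h $ i *\<^sub>R (s *\<^sub>R partial_deriv i f (s *\<^sub>R x - y)))) (at x)"
proof -
  have "((\<lambda>x. s *\<^sub>R x - y) has_derivative (\<lambda>h. s *\<^sub>R h)) (at x)"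
    by (auto intro!: derivative_eq_intros)
  from has_derivative_compose[OF this smooth_has_derivative[OF assms]]
  show ?thesis by (simp add: mult.commute)
qed

lemma partial_deriv_affine:
  assumes "smooth f"
  shows "partial_deriv i (\<lambda>x. f (s *\<^sub>R x - y)) x = s *\<^sub>R partial_deriv i f (s *\<^sub>R x - y)"
  using partial_deriv_eq[OF has_derivative_affine[OF assms], of i s y x]
  by (simp add: axis_def if_distrib[of "\<lambda>c. c *\<^sub>R _"] if_distrib[of "\<lambda>c. c * s"] cong: if_cong)

lemma smooth_affine:
  assumes "smooth f"
  shows "smooth (\<lambda>x. f (s *\<^sub>R x - y))"
\<comment> \<open>The scalar \<open>c\<close> collects the powers of \<open>s\<close> that repeated
  differentiation produces.\<close>
proof (rule smooth_coinduct[where S="{\<lambda>x. c *\<^sub>R g (s *\<^sub>R x - y) | c g. smooth g}"])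
  show "(\<lambda>x. f (s *\<^sub>R x - y)) \<in> {\<lambda>x. c *\<^sub>R g (s *\<^sub>R x - y) | c g. smooth g}"
    using assms scaleR_one[where 'a='b] by (intro CollectI exI[of _ 1] exI[of _ f]) auto
next
  fix u x i assume "u \<in> {\<lambda>x. c *\<^sub>R g (s *\<^sub>R x - y) | c g. smooth g}"
  then obtain c g where u: "u = (\<lambda>x. c *\<^sub>R g (s *\<^sub>R x - y))" and g: "smooth g" by blast
  have d: "(\<lambda>x. g (s *\<^sub>R x - y)) differentiable (at x)" for x
    using has_derivative_affine[OF g] by (auto simp: differentiable_def)
  show "u differentiable (at x)" unfolding u using d by (intro differentiable_scaleR) auto
  have "partial_deriv i u = (\<lambda>x. (c * s) *\<^sub>R partial_deriv i g (s *\<^sub>R x - y))"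
    unfolding u using partial_deriv_bounded_linear[OF bounded_linear_scaleR_right d]
    by (simp add: partial_deriv_affine[OF g] fun_eq_iff)
  then show "partial_deriv i u \<in> {\<lambda>x. c *\<^sub>R g (s *\<^sub>R x - y) | c g. smooth g}"
    using smooth_partial[OF g] by blast
qed

lemma test_functions_affine:
  assumes f: "f \<in> test_functions UNIV" and s: "s \<noteq> 0"
  shows "(\<lambda>x. f (s *\<^sub>R x - y)) \<in> test_functions UNIV"
proof -
  obtain K where K: "compact K" "\<And>x. x \<notin> K \<Longrightarrow> f x = 0"
    using f by (auto simp: test_functions_iff)
  let ?L = "(\<lambda>z. (1/s) *\<^sub>R (z + y)) ` K"
  have "compact ?L"
    using K(1) by (intro compact_continuous_image continuous_intros)
  moreover have "f (s *\<^sub>R x - y) = 0" if "x \<notin> ?L" for x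
  proof (rule K(2), rule)
    assume "s *\<^sub>R x - y \<in> K"
    then have "(1/s) *\<^sub>R ((s *\<^sub>R x - y) + y) \<in> ?L" by blast
    then show False using that s by simp
  qed
  ultimately show ?thesis
    using smooth_affine[OF test_functions_smooth[OF f]] by (intro test_functionsI[of _ ?L]) auto
qed

section \<open>Uniform estimates from compact support\<close>

lemma uniformly_continuous_compact_support:
  fixes f :: "'a::euclidean_space \<Rightarrow> 'b::metric_space"
  assumes cont: "continuous_on UNIV f" and K: "compact K" "\<And>x. x \<notin> K \<Longrightarrow> f x = c"
  shows "uniformly_continuous_on UNIV f"
proof -
  obtain R where "\<forall>x\<in>K. norm x \<le> R"
    using compact_imp_bounded[OF K(1)] unfolding bounded_iff by blast
  then have R: "K \<subseteq> cball 0 R" by auto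
  have uc: "uniformly_continuous_on (cball 0 (R+1)) f"
    using cont by (intro compact_uniformly_continuous) (auto intro: continuous_on_subset)
  show ?thesis
    unfolding uniformly_continuous_on_def
  proof (intro allI impI)
    fix e :: real assume e: "e > 0"
    obtain d where d: "d > 0" "\<And>x y. x \<in> cball 0 (R+1) \<Longrightarrow> y \<in> cball 0 (R+1) \<Longrightarrow> dist y x < d \<Longrightarrow> dist (f y) (f x) < e"
      using uc e unfolding uniformly_continuous_on_def by blast
    have "dist (f y) (f x) < e" if xy: "dist y x < min d 1" for x y
    proof (cases "x \<in> cball 0 (R+1) \<and> y \<in> cball 0 (R+1)")
      case True
      then show ?thesis using d xy by auto
    next
      case False
      have "norm x \<le> norm y + dist y x" "norm y \<le> norm x + dist y x"
        using norm_triangle_sub[of x y] norm_triangle_sub[of y x] by (auto simp: dist_norm norm_minus_commute)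
      then have "norm x > R \<and> norm y > R" using False xy by auto
      then have "x \<notin> K" "y \<notin> K" using R by auto
      then have "f x = c" "f y = c" using K(2) by blast+
      then show ?thesis using e by simp
    qed
    then show "\<exists>d>0. \<forall>x\<in>UNIV. \<forall>x'\<in>UNIV. dist x' x < d \<longrightarrow> dist (f x') (f x) < e"
      using d(1) by (intro exI[of _ "min d 1"]) auto
  qed
qed

lemma test_function_uniformly_continuous:
  fixes f :: "real^'n \<Rightarrow> 'b::euclidean_space"
  shows "f \<in> test_functions UNIV \<Longrightarrow> uniformly_continuous_on UNIV f"
  unfolding test_functions_iff using uniformly_continuous_compact_support[OF smooth_continuous] by blast

lemma bounded_compact_support:
  fixes f :: "'a::euclidean_space \<Rightarrow> 'b::real_normed_vector"
  assumes "continuous_on UNIV f" and K: "compact K" "\<And>x. x \<notin> K \<Longrightarrow> f x = 0"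
  shows "\<exists>B\<ge>0. \<forall>x. norm (f x) \<le> B"
proof -
  have "bounded (f ` K)"
    using assms by (intro compact_imp_bounded compact_continuous_image) (auto intro: continuous_on_subset)
  then obtain B where "\<And>x. x \<in> K \<Longrightarrow> norm (f x) \<le> B" by (auto simp: bounded_iff)
  then have "norm (f x) \<le> max B 0" for x using K(2)[of x] by (cases "x \<in> K") force+
  then show ?thesis by (intro exI[of _ "max B 0"]) auto
qed

lemma test_function_bounded:
  fixes f :: "real^'n \<Rightarrow> 'b::euclidean_space"
  shows "f \<in> test_functions UNIV \<Longrightarrow> \<exists>B\<ge>0. \<forall>x. norm (f x) \<le> B"
  unfolding test_functions_iff using bounded_compact_support[OF smooth_continuous] by blast

text \<open>The mean value theorem on a segment, combined with uniform continuity of the gradient.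
  That \<open>d\<close> does not depend on \<open>x\<close> is what allows differentiation under
  integral signs later.\<close>

lemma test_function_uniform_linearization:
  fixes \<phi> :: "real^'n \<Rightarrow> real"
  assumes \<phi>: "\<phi> \<in> test_functions UNIV" and e: "e > 0"
  shows "\<exists>d>0. \<forall>x h. norm h < d \<longrightarrow>
    \<bar>\<phi> (x + h) - \<phi> x - (\<Sum>i\<in>UNIV. h $ i * partial_deriv i \<phi> x)\<bar> \<le> e * norm h"
proof -
  define g where "g x = (\<chi> i. partial_deriv i \<phi> x)" for x
  have g: "g \<in> test_functions UNIV"
    unfolding g_def by (intro test_functions_vec test_functions_partial \<phi>)
  obtain d where d: "d > 0" "\<And>x y. dist y x < d \<Longrightarrow> dist (g y) (g x) < e"
    using test_function_uniformly_continuous[OF g, unfolded uniformly_continuous_on_def, rule_format, OF e] by auto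
  have "\<bar>\<phi> (x + h) - \<phi> x - (\<Sum>i\<in>UNIV. h $ i * partial_deriv i \<phi> x)\<bar> \<le> e * norm h" if h: "norm h < d" for x h
  proof -
    have D: "(\<phi> has_derivative (\<lambda>h. h \<bullet> g y)) (at y)" for y
      using smooth_has_derivative[OF test_functions_smooth[OF \<phi>], of y]
      by (simp add: g_def inner_vec_def)
    have line: "((\<lambda>t. x + t *\<^sub>R h) has_derivative (\<lambda>t. t *\<^sub>R h)) (at t)" for t
      by (auto intro!: derivative_eq_intros)
    have D1: "((\<lambda>t. \<phi> (x + t *\<^sub>R h)) has_real_derivative h \<bullet> g (x + t *\<^sub>R h)) (at t)" for t
      using has_derivative_compose[OF line D] unfolding has_field_derivative_def
      by (simp add: mult.commute[of _ "h \<bullet> _"])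
    obtain t where t: "0 < t" "t < 1" "\<phi> (x + 1 *\<^sub>R h) - \<phi> (x + 0 *\<^sub>R h) = (1 - 0) * (h \<bullet> g (x + t *\<^sub>R h))"
      using MVT2[of 0 1 "\<lambda>t. \<phi> (x + t *\<^sub>R h)" "\<lambda>t. h \<bullet> g (x + t *\<^sub>R h)"] D1 by (metis less_numeral_extra(1))
    have "\<phi> (x + h) - \<phi> x - h \<bullet> g x = h \<bullet> (g (x + t *\<^sub>R h) - g x)"
      using t(3) by (simp add: inner_diff_right)
    moreover have "\<bar>h \<bullet> (g (x + t *\<^sub>R h) - g x)\<bar> \<le> norm h * dist (g (x + t *\<^sub>R h)) (g x)"
      by (simp add: dist_norm Cauchy_Schwarz_ineq2)
    moreover have "t * norm h \<le> norm h" using t by (simp add: mult_left_le_one_le)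
    then have "dist (x + t *\<^sub>R h) x < d" using t h by (simp add: dist_norm)
    then have "norm h * dist (g (x + t *\<^sub>R h)) (g x) \<le> norm h * e"
      using d(2) by (intro mult_left_mono) (auto intro: less_imp_le)
    ultimately show ?thesis by (simp add: inner_vec_def g_def mult.commute)
  qed
  then show ?thesis using d(1) by blast
qed

text \<open>Convolutions and averages over dilations are both of this form.\<close>

definition superpose ::
  "'a measure \<Rightarrow> ('a \<Rightarrow> real) \<Rightarrow> ('a \<Rightarrow> real^'n) \<Rightarrow> ('a \<Rightarrow> real) \<Rightarrow> (real^'n \<Rightarrow> real) \<Rightarrow> real^'n \<Rightarrow> real" where
  "superpose M s y c \<phi> x = (LINT t|M. c t * \<phi> (s t *\<^sub>R x - y t))"

lemma continuous_borel_measurable_compose: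
  assumes "continuous_on UNIV (f :: 'a::topological_space \<Rightarrow> 'b::topological_space)" "g \<in> measurable M borel"
  shows "(\<lambda>t. f (g t)) \<in> measurable M borel"
  using measurable_compose[OF assms(2) borel_measurable_continuous_onI[OF assms(1)]] .

lemma superpose_integrable:
  fixes \<phi> :: "real^'n \<Rightarrow> real"
  assumes [measurable]: "s \<in> borel_measurable M" "y \<in> borel_measurable M"
    and c: "integrable M c" and \<phi>: "\<phi> \<in> test_functions UNIV"
  shows "integrable M (\<lambda>t. c t * \<phi> (s t *\<^sub>R x - y t))"
proof -
  obtain B where B: "\<And>x. norm (\<phi> x) \<le> B" using test_function_bounded[OF \<phi>] by blast
  have [measurable]: "c \<in> borel_measurable M" using c by simp
  have 1: "(\<lambda>t. \<phi> (s t *\<^sub>R x - y t)) \<in> borel_measurable M"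
    by (rule continuous_borel_measurable_compose[OF smooth_continuous[OF test_functions_smooth[OF \<phi>]]]) measurable
  show ?thesis
  proof (rule Bochner_Integration.integrable_bound[OF integrable_mult_left[OF integrable_norm[OF c], of B]])
    show "(\<lambda>t. c t * \<phi> (s t *\<^sub>R x - y t)) \<in> borel_measurable M"
      using borel_measurable_integrable[OF c] 1 by (rule borel_measurable_times)
    have "0 \<le> B" using B norm_ge_zero order_trans by blast
    then show "AE t in M. norm (c t * \<phi> (s t *\<^sub>R x - y t)) \<le> norm (norm (c t) * B)"
      using B by (auto simp: abs_mult intro!: mult_left_mono)
  qed
qed

text \<open>The linearisation error of \<open>\<phi>\<close> is uniform in the base point, so
  integrating it against the weight \<open>c\<close> keeps it small compared with
  \<open>norm h\<close>; the bound \<open>S\<close> on the scale controls the increment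
  \<open>s t *\<^sub>R h\<close>.\<close>

lemma superpose_has_derivative:
  fixes y :: "'a \<Rightarrow> real^'n"
  assumes s[measurable]: "s \<in> borel_measurable M" and y[measurable]: "y \<in> borel_measurable M"
    and S: "\<And>t. \<bar>s t\<bar> \<le> S" and c: "integrable M c" and \<phi>: "\<phi> \<in> test_functions UNIV"
  shows "(superpose M s y c \<phi> has_derivative
     (\<lambda>h. \<Sum>i\<in>UNIV. h $ i *\<^sub>R superpose M s y (\<lambda>t. c t * s t) (partial_deriv i \<phi>) x)) (at x)"
proof -
  have S0: "S \<ge> 0" using S abs_ge_zero order_trans by blast
  have [measurable]: "c \<in> borel_measurable M" using c by simp
  have cs: "integrable M (\<lambda>t. c t * s t)"
    by (rule Bochner_Integration.integrable_bound[OF integrable_mult_left[OF integrable_norm[OF c], of S]])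
      (use S S0 in \<open>auto simp: abs_mult intro!: mult_left_mono\<close>)
  have int1: "integrable M (\<lambda>t. c t * \<phi> (s t *\<^sub>R x - y t))" for x
    by (rule superpose_integrable[OF s y c \<phi>])
  have int2: "integrable M (\<lambda>t. c t * s t * partial_deriv i \<phi> (s t *\<^sub>R x - y t))" for x i
    by (rule superpose_integrable[OF s y cs test_functions_partial[OF \<phi>]])
  define A where "A = (LINT t|M. \<bar>c t\<bar>)"
  have A0: "A \<ge> 0" unfolding A_def by simp
  show ?thesis
    unfolding has_derivative_at_alt
  proof (intro conjI allI impI)
    show "bounded_linear (\<lambda>h. \<Sum>i\<in>UNIV. h $ i *\<^sub>R superpose M s y (\<lambda>t. c t * s t) (partial_deriv i \<phi>) x)"
      by (intro bounded_linear_sum bounded_linear_scaleR_const bounded_linear_vec_nth)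
  next
    fix e :: real assume e: "e > 0"
    \<comment> \<open>The integrated error is \<open>e' * (S * A) * norm h\<close>; the added 1
      avoids a division by zero.\<close>
    define e' where "e' = e / (S * A + 1)"
    have e': "e' > 0" using e S0 A0 unfolding e'_def by (simp add: add_nonneg_pos)
    obtain d where d: "d > 0" and lin: "\<And>x h. norm h < d \<Longrightarrow>
        \<bar>\<phi> (x + h) - \<phi> x - (\<Sum>i\<in>UNIV. h $ i * partial_deriv i \<phi> x)\<bar> \<le> e' * norm h"
      using test_function_uniform_linearization[OF \<phi> e'] by blast
    have "norm (superpose M s y c \<phi> z - superpose M s y c \<phi> x -
       (\<Sum>i\<in>UNIV. (z - x) $ i *\<^sub>R superpose M s y (\<lambda>t. c t * s t) (partial_deriv i \<phi>) x)) \<le> e * norm (z - x)"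
      \<comment> \<open>This radius makes every scaled increment \<open>s t *\<^sub>R h\<close>
        shorter than \<open>d\<close>.\<close>
      if z: "norm (z - x) < d / (S + 1)" for z
    proof -
      define h where "h = z - x"
      have zh: "z = x + h" by (simp add: h_def)
      let ?f = "\<lambda>t. c t * \<phi> (s t *\<^sub>R z - y t) - c t * \<phi> (s t *\<^sub>R x - y t)
         - (\<Sum>i\<in>UNIV. h $ i * (c t * s t * partial_deriv i \<phi> (s t *\<^sub>R x - y t)))"
      have intf: "integrable M ?f"
        by (intro Bochner_Integration.integrable_diff Bochner_Integration.integrable_sum integrable_mult_right int1 int2)
      have eq: "superpose M s y c \<phi> z - superpose M s y c \<phi> x -
         (\<Sum>i\<in>UNIV. h $ i *\<^sub>R superpose M s y (\<lambda>t. c t * s t) (partial_deriv i \<phi>) x) = (LINT t|M. ?f t)"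
        unfolding superpose_def
        by (subst Bochner_Integration.integral_diff, intro Bochner_Integration.integrable_diff int1,
            intro Bochner_Integration.integrable_sum integrable_mult_right int2,
            subst Bochner_Integration.integral_diff[OF int1 int1],
            subst Bochner_Integration.integral_sum, intro integrable_mult_right int2)
          (simp add: int2)
      have bound: "norm (?f t) \<le> \<bar>c t\<bar> * (e' * (S * norm h))" for t
      proof -
        let ?h = "s t *\<^sub>R h"
        have nh: "norm ?h \<le> S * norm h" using S by (simp add: mult_right_mono)
        also have "\<dots> < d"
        proof -
          have "S * norm h + norm h < d" using z S0 unfolding h_def by (simp add: field_simps)
          then show ?thesis using norm_ge_zero[of h] by linarith
        qed
        finally have nd: "norm ?h < d" .
        have "?f t = c t * (\<phi> ((s t *\<^sub>R x - y t) + ?h) - \<phi> (s t *\<^sub>R x - y t)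
            - (\<Sum>i\<in>UNIV. ?h $ i * partial_deriv i \<phi> (s t *\<^sub>R x - y t)))"
          unfolding zh by (simp add: algebra_simps sum_distrib_left)
        then have "norm (?f t) \<le> \<bar>c t\<bar> * (e' * norm ?h)"
          using lin[OF nd] by (simp add: abs_mult mult_left_mono)
        also have "\<dots> \<le> \<bar>c t\<bar> * (e' * (S * norm h))"
          using nh e' by (intro mult_left_mono) auto
        finally show ?thesis .
      qed
      have "norm (LINT t|M. ?f t) \<le> (LINT t|M. \<bar>c t\<bar> * (e' * (S * norm h)))"
      proof (rule order_trans[OF integral_norm_bound integral_mono])
        show "integrable M (\<lambda>t. norm (?f t))" by (rule integrable_norm[OF intf])
        show "integrable M (\<lambda>t. \<bar>c t\<bar> * (e' * (S * norm h)))"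
          using c by (intro integrable_mult_left integrable_abs)
      qed (rule bound)
      also have "\<dots> = e' * (S * A) * norm h" by (simp add: A_def)
      also have "\<dots> \<le> e * norm h"
      proof (rule mult_right_mono)
        have "e' * (S * A) \<le> e' * (S * A + 1)" using e' by simp
        also have "\<dots> = e" unfolding e'_def using S0 A0 by (simp add: add_nonneg_eq_0_iff field_simps)
        finally show "e' * (S * A) \<le> e" .
      qed simp
      finally show ?thesis using eq unfolding h_def by simp
    qed
    then show "\<exists>d>0. \<forall>z. norm (z - x) < d \<longrightarrow> norm (superpose M s y c \<phi> z - superpose M s y c \<phi> x -
       (\<Sum>i\<in>UNIV. (z - x) $ i *\<^sub>R superpose M s y (\<lambda>t. c t * s t) (partial_deriv i \<phi>) x)) \<le> e * norm (z - x)"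
      using d S0 by (intro exI[of _ "d / (S + 1)"]) auto
  qed
qed

lemma superpose_partial_deriv:
  fixes y :: "'a \<Rightarrow> real^'n"
  assumes "s \<in> borel_measurable M" "y \<in> borel_measurable M"
    "\<And>t. \<bar>s t\<bar> \<le> S" "integrable M c" "\<phi> \<in> test_functions UNIV"
  shows "partial_deriv i (superpose M s y c \<phi>) = superpose M s y (\<lambda>t. c t * s t) (partial_deriv i \<phi>)"
  using partial_deriv_eq[OF superpose_has_derivative[OF assms], of i]
  by (simp add: fun_eq_iff axis_def if_distrib[of "\<lambda>c. c *\<^sub>R _"] if_distrib[of "\<lambda>c. c * _"] cong: if_cong)

text \<open>Differentiating moves the derivative onto \<open>\<phi>\<close> and multiplies the
  weight by \<open>s\<close>, which preserves integrability because \<open>s\<close> is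
  bounded.\<close>

lemma superpose_smooth:
  fixes y :: "'a \<Rightarrow> real^'n"
  assumes s[measurable]: "s \<in> borel_measurable M" and y: "y \<in> borel_measurable M"
    and S: "\<And>t. \<bar>s t\<bar> \<le> S" and c: "integrable M c" and \<phi>: "\<phi> \<in> test_functions UNIV"
  shows "smooth (superpose M s y c \<phi>)"
proof (rule smooth_coinduct[where S="{superpose M s y c \<phi> | c \<phi>. integrable M c \<and> \<phi> \<in> test_functions UNIV}"])
  show "superpose M s y c \<phi> \<in> {superpose M s y c \<phi> | c \<phi>. integrable M c \<and> \<phi> \<in> test_functions UNIV}"
    using c \<phi> by blast
next
  fix f x i assume "f \<in> {superpose M s y c \<phi> | c \<phi>. integrable M c \<and> \<phi> \<in> test_functions UNIV}"
  then obtain c \<phi> where f: "f = superpose M s y c \<phi>" and c: "integrable M c" and \<phi>: "\<phi> \<in> test_functions UNIV"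
    by blast
  show "f differentiable (at x)"
    using superpose_has_derivative[OF s y S c \<phi>] f by (auto simp: differentiable_def)
  have [measurable]: "c \<in> borel_measurable M" using c by simp
  have "S \<ge> 0" using S abs_ge_zero order_trans by blast
  then have "integrable M (\<lambda>t. c t * s t)"
    by (intro Bochner_Integration.integrable_bound[OF integrable_mult_left[OF integrable_norm[OF c], of S]])
      (use S in \<open>auto simp: abs_mult intro!: mult_left_mono\<close>)
  then show "partial_deriv i f \<in> {superpose M s y c \<phi> | c \<phi>. integrable M c \<and> \<phi> \<in> test_functions UNIV}"
    using superpose_partial_deriv[OF s y S c \<phi>] f test_functions_partial[OF \<phi>] by blast
qed

subsection \<open>Bump functions\<close>

lemma poly_over_exp_tendsto_0: "((\<lambda>x. poly p x / exp x) \<longlongrightarrow> 0) (at_top :: real filter)"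
proof -
  have "((\<lambda>x. \<Sum>i\<le>degree p. coeff p i * (x ^ i / exp x)) \<longlongrightarrow> (\<Sum>i\<le>degree p. coeff p i * 0)) (at_top :: real filter)"
    by (intro tendsto_sum tendsto_mult tendsto_const tendsto_power_div_exp_0)
  then show ?thesis by (simp add: poly_altdef sum_divide_distrib)
qed

text \<open>This is \<open>exp (-1/t)\<close>, extended by zero to \<open>t \<le> 0\<close>. Listing
  all its derivatives explicitly supplies the family that \<open>C_k_compose\<close> asks
  for.\<close>

lemma flat_function_exists:
  "\<exists>h :: nat \<Rightarrow> real \<Rightarrow> real. (\<forall>m t. (h m has_real_derivative h (Suc m) t) (at t)) \<and>
     (\<forall>t\<le>0. h 0 t = 0) \<and> (\<forall>t>0. h 0 t > 0)"
proof -
  \<comment> \<open>The derivative of \<open>p(1/t) exp(-1/t)\<close> is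
    \<open>t^-2 (p - p')(1/t) exp(-1/t)\<close>; the polynomial \<open>[:0,0,1:]\<close> stands for
    the factor \<open>t^-2\<close> in the variable \<open>1/t\<close>.\<close>
  define P :: "nat \<Rightarrow> real poly" where "P = rec_nat 1 (\<lambda>_ p. [:0,0,1:] * (p - pderiv p))"
  have P0: "P 0 = 1" and PS: "P (Suc m) = [:0,0,1:] * (P m - pderiv (P m))" for m
    by (simp_all add: P_def)
  define h :: "nat \<Rightarrow> real \<Rightarrow> real" where
    "h m t = (if t \<le> 0 then 0 else poly (P m) (1/t) * exp (- (1/t)))" for m t
  have "(h m has_real_derivative h (Suc m) t) (at t)" for m t
  proof (cases t "0::real" rule: linorder_cases)
    case less
    have "((\<lambda>t. 0) has_real_derivative 0) (at t)" by simp
    then have "(h m has_real_derivative 0) (at t)"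
      by (rule has_field_derivative_transform_within_open[of _ _ _ "{..<0}"])
        (use less in \<open>auto simp: h_def\<close>)
    then show ?thesis using less by (simp add: h_def)
  next
    case greater
    have "((\<lambda>t. poly (P m) (1/t) * exp (- (1/t))) has_real_derivative
        (poly (pderiv (P m)) (1/t) * (- 1 / t^2)) * exp (- (1/t)) + poly (P m) (1/t) * (exp (- (1/t)) * (1/t^2))) (at t)"
      using greater
      by (auto intro!: derivative_eq_intros DERIV_chain2[OF poly_DERIV] simp: power2_eq_square)
    then have "(h m has_real_derivative
        (poly (pderiv (P m)) (1/t) * (- 1 / t^2)) * exp (- (1/t)) + poly (P m) (1/t) * (exp (- (1/t)) * (1/t^2))) (at t)"
      by (rule has_field_derivative_transform_within_open[of _ _ _ "{0<..}"])
        (use greater in \<open>auto simp: h_def\<close>)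
    moreover have "(poly (pderiv (P m)) (1/t) * (- 1 / t^2)) * exp (- (1/t)) + poly (P m) (1/t) * (exp (- (1/t)) * (1/t^2))
       = h (Suc m) t"
      using greater by (simp add: h_def PS power2_eq_square field_simps)
    ultimately show ?thesis by simp
  next
    case equal
    \<comment> \<open>The difference quotient at 0 divides by \<open>t\<close>, which is one more
      factor \<open>1/t\<close> in the polynomial; the exponential still wins.\<close>
    let ?p = "[:0,1:] * P m"
    have lim: "((\<lambda>t. poly ?p (inverse t) / exp (inverse t)) \<longlongrightarrow> 0) (at_right (0::real))"
      using filterlim_compose[OF poly_over_exp_tendsto_0 filterlim_inverse_at_top_right] .
    have "((\<lambda>t. h m t / t) \<longlongrightarrow> 0) (at_right 0)"
    proof (rule Lim_transform_eventually[OF lim])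
      show "\<forall>\<^sub>F t in at_right 0. poly ?p (inverse t) / exp (inverse t) = h m t / t"
        using eventually_at_right_less[of 0]
        by (rule eventually_mono) (simp add: h_def exp_minus divide_simps)
    qed
    moreover have "((\<lambda>t. h m t / t) \<longlongrightarrow> 0) (at_left 0)"
      by (rule tendsto_eventually) (simp add: h_def eventually_at_filter)
    ultimately have "((\<lambda>t. h m t / t) \<longlongrightarrow> 0) (at 0)" by (simp add: filterlim_split_at)
    then have "(h m has_real_derivative 0) (at 0)"
      unfolding has_field_derivative_iff by (simp add: h_def)
    then show ?thesis using equal by (simp add: h_def)
  qed
  moreover have "\<forall>t\<le>0. h 0 t = 0" "\<forall>t>0. h 0 t > 0" by (auto simp: h_def P0)
  ultimately show ?thesis by blast
qed

text \<open>The flat function is composed with the polynomial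
  \<open>r\<^sup>2 - (dist c x)\<^sup>2\<close>, which is positive exactly on the open ball.\<close>

lemma bump_exists:
  assumes r: "r > 0"
  shows "\<exists>\<phi>\<in>test_functions UNIV. (\<forall>x. (0::real) \<le> \<phi> x) \<and> (\<forall>x::real^'n. \<phi> x > 0 \<longleftrightarrow> x \<in> ball c r)"
proof -
  obtain h :: "nat \<Rightarrow> real \<Rightarrow> real" where h: "\<And>m t. (h m has_real_derivative h (Suc m) t) (at t)"
    and h0: "\<And>t. t \<le> 0 \<Longrightarrow> h 0 t = 0" and h1: "\<And>t. t > 0 \<Longrightarrow> h 0 t > 0"
    using flat_function_exists by blast
  define q :: "real^'n \<Rightarrow> real" where "q x = r\<^sup>2 - (\<Sum>i\<in>UNIV. (x $ i - c $ i) * (x $ i - c $ i))" for x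
  have q: "smooth q"
    unfolding q_def by (intro smooth_diff smooth_const smooth_sum smooth_mult smooth_nth)
  have q_eq: "q x = r\<^sup>2 - (dist c x)\<^sup>2" for x
  proof -
    have "(norm (x - c))\<^sup>2 = (\<Sum>i\<in>UNIV. (x $ i - c $ i) * (x $ i - c $ i))"
      by (simp add: power2_norm_eq_inner inner_vec_def)
    then show ?thesis by (simp add: q_def dist_norm norm_minus_commute)
  qed
  have pos: "q x > 0 \<longleftrightarrow> x \<in> ball c r" for x
    using r by (auto simp: q_eq power_strict_mono dest: power_less_imp_less_base)
  define \<phi> where "\<phi> x = h 0 (q x)" for x
  have iff: "\<phi> x > 0 \<longleftrightarrow> x \<in> ball c r" for x
    unfolding \<phi>_def using pos[of x] h0[of "q x"] h1[of "q x"] by (cases "q x > 0") auto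
  have "\<phi> x = 0" if "x \<notin> cball c r" for x
    unfolding \<phi>_def using pos[of x] that by (intro h0) auto
  moreover have "smooth \<phi>"
    unfolding smooth_def \<phi>_def using C_k_compose[where h=h, OF h q] by blast
  ultimately have tf: "\<phi> \<in> test_functions UNIV"
    by (intro test_functionsI[of _ "cball c r"]) auto
  have "\<phi> x \<ge> 0" for x
    unfolding \<phi>_def using h0[of "q x"] h1[of "q x"] by (cases "q x > 0") auto
  then show ?thesis
    using iff by (intro bexI[OF _ tf]) simp
qed

section \<open>Square integrable functions\<close>

text \<open>Stated over an arbitrary measure because two are needed: Lebesgue measure on
  \<open>\<Omega>\<close> for the theorem and \<open>lborel\<close> for convolutions. Members are
  representatives, so \<open>nrm\<close> is only a seminorm.\<close>

definition sqint :: "'a measure \<Rightarrow> ('a \<Rightarrow> 'b::euclidean_space) set" where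
  "sqint M = {u \<in> borel_measurable M. integrable M (\<lambda>x. (norm (u x))\<^sup>2)}"

definition ip :: "'a measure \<Rightarrow> ('a \<Rightarrow> 'b::euclidean_space) \<Rightarrow> ('a \<Rightarrow> 'b) \<Rightarrow> real" where
  "ip M u v = (LINT x|M. u x \<bullet> v x)"

definition nrm :: "'a measure \<Rightarrow> ('a \<Rightarrow> 'b::euclidean_space) \<Rightarrow> real" where
  "nrm M u = sqrt (ip M u u)"

lemma ip_integrable:
  assumes u: "u \<in> sqint M" and v: "v \<in> sqint M"
  shows "integrable M (\<lambda>x. u x \<bullet> v x)"
proof (rule Bochner_Integration.integrable_bound)
  show "integrable M (\<lambda>x. (norm (u x))\<^sup>2 + (norm (v x))\<^sup>2)"
    using u v by (auto simp: sqint_def)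
  show "(\<lambda>x. u x \<bullet> v x) \<in> borel_measurable M"
    using u v by (auto simp: sqint_def)
  have "norm (a \<bullet> b) \<le> norm ((norm a)\<^sup>2 + (norm b)\<^sup>2)" for a b :: 'b
  proof -
    have "\<bar>a \<bullet> b\<bar> \<le> norm a * norm b" by (rule Cauchy_Schwarz_ineq2)
    moreover have "2 * (norm a * norm b) \<le> (norm a)\<^sup>2 + (norm b)\<^sup>2"
      using sum_squares_bound[of "norm a" "norm b"] by simp
    moreover have "0 \<le> norm a * norm b" by simp
    ultimately show ?thesis unfolding real_norm_def by linarith
  qed
  then show "AE x in M. norm (u x \<bullet> v x) \<le> norm ((norm (u x))\<^sup>2 + (norm (v x))\<^sup>2)"
    by blast
qed

lemma sqint_add:
  assumes u: "u \<in> sqint M" and v: "v \<in> sqint M"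
  shows "(\<lambda>x. u x + v x) \<in> sqint M"
proof -
  have "integrable M (\<lambda>x. (norm (u x))\<^sup>2 + 2 * (u x \<bullet> v x) + (norm (v x))\<^sup>2)"
    using u v ip_integrable[OF u v] by (auto simp: sqint_def)
  moreover have "(\<lambda>x. (norm (u x + v x))\<^sup>2) = (\<lambda>x. (norm (u x))\<^sup>2 + 2 * (u x \<bullet> v x) + (norm (v x))\<^sup>2)"
    by (simp add: power2_norm_eq_inner inner_add_left inner_add_right inner_commute fun_eq_iff)
  ultimately show ?thesis using u v by (auto simp: sqint_def)
qed

lemma sqint_scaleR: "u \<in> sqint M \<Longrightarrow> (\<lambda>x. c *\<^sub>R u x) \<in> sqint M"
  by (auto simp: sqint_def power_mult_distrib)

lemma sqint_cmult: "u \<in> sqint M \<Longrightarrow> (\<lambda>x. c * u x :: real) \<in> sqint M"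
  using sqint_scaleR[of u M c] by simp

lemma sqint_uminus: "u \<in> sqint M \<Longrightarrow> (\<lambda>x. - u x) \<in> sqint M"
  using sqint_scaleR[of u M "-1"] by simp

lemma sqint_diff: "u \<in> sqint M \<Longrightarrow> v \<in> sqint M \<Longrightarrow> (\<lambda>x. u x - v x) \<in> sqint M"
  using sqint_add[OF _ sqint_uminus, of u M v] by simp

lemma sqint_zero: "(\<lambda>x. 0) \<in> sqint M"
  by (simp add: sqint_def)

lemma sqint_sum: "(\<And>i. i \<in> I \<Longrightarrow> u i \<in> sqint M) \<Longrightarrow> (\<lambda>x. \<Sum>i\<in>I. u i x) \<in> sqint M"
  by (induction I rule: infinite_finite_induct) (simp_all add: sqint_zero sqint_add)

lemma ip_commute: "ip M u v = ip M v u"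
  by (simp add: ip_def inner_commute)

lemma ip_add_left:
  "u \<in> sqint M \<Longrightarrow> v \<in> sqint M \<Longrightarrow> w \<in> sqint M \<Longrightarrow> ip M (\<lambda>x. u x + v x) w = ip M u w + ip M v w"
  by (simp add: ip_def inner_add_left ip_integrable)

lemma ip_scaleR_left: "ip M (\<lambda>x. c *\<^sub>R u x) w = c * ip M u w"
  by (simp add: ip_def)

lemma ip_diff_left:
  "u \<in> sqint M \<Longrightarrow> v \<in> sqint M \<Longrightarrow> w \<in> sqint M \<Longrightarrow> ip M (\<lambda>x. u x - v x) w = ip M u w - ip M v w"
  by (simp add: ip_def inner_diff_left ip_integrable)

lemma ip_sum_left:
  "(\<And>i. i \<in> I \<Longrightarrow> u i \<in> sqint M) \<Longrightarrow> w \<in> sqint M \<Longrightarrow>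
    ip M (\<lambda>x. \<Sum>i\<in>I. u i x) w = (\<Sum>i\<in>I. ip M (u i) w)"
  by (simp add: ip_def inner_sum_left ip_integrable)

lemma ip_add_right:
  "u \<in> sqint M \<Longrightarrow> v \<in> sqint M \<Longrightarrow> w \<in> sqint M \<Longrightarrow> ip M w (\<lambda>x. u x + v x) = ip M w u + ip M w v"
  by (simp add: ip_commute[of M w] ip_add_left)

lemma ip_diff_right:
  "u \<in> sqint M \<Longrightarrow> v \<in> sqint M \<Longrightarrow> w \<in> sqint M \<Longrightarrow> ip M w (\<lambda>x. u x - v x) = ip M w u - ip M w v"
  by (simp add: ip_commute[of M w] ip_diff_left)

lemma ip_scaleR_right: "ip M w (\<lambda>x. c *\<^sub>R u x) = c * ip M w u"
  by (simp add: ip_commute[of M w] ip_scaleR_left)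

lemma ip_sum_right:
  "(\<And>i. i \<in> I \<Longrightarrow> u i \<in> sqint M) \<Longrightarrow> w \<in> sqint M \<Longrightarrow>
    ip M w (\<lambda>x. \<Sum>i\<in>I. u i x) = (\<Sum>i\<in>I. ip M w (u i))"
  by (simp add: ip_commute[of M w] ip_sum_left)

lemma ip_self_nonneg: "0 \<le> ip M u u"
  by (simp add: ip_def)

lemma nrm_nonneg: "0 \<le> nrm M u"
  by (simp add: nrm_def ip_self_nonneg)

lemma nrm_power2: "(nrm M u)\<^sup>2 = ip M u u"
  by (simp add: nrm_def ip_self_nonneg)

lemma nrm_zero: "nrm M (\<lambda>x. 0) = 0"
  by (simp add: nrm_def ip_def)

lemma nrm_scaleR: "nrm M (\<lambda>x. c *\<^sub>R u x) = \<bar>c\<bar> * nrm M u"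
  by (simp add: nrm_def ip_scaleR_left ip_scaleR_right real_sqrt_mult flip: mult.assoc)

lemma nrm_cmult: "nrm M (\<lambda>x. c * u x :: real) = \<bar>c\<bar> * nrm M u"
  using nrm_scaleR[of M c u] by simp

lemma nrm_uminus: "nrm M (\<lambda>x. - u x) = nrm M u"
  using nrm_scaleR[of M "-1" u] by simp

lemma ip_Cauchy_Schwarz:
  assumes u: "u \<in> sqint M" and v: "v \<in> sqint M"
  shows "\<bar>ip M u v\<bar> \<le> nrm M u * nrm M v"
proof -
  let ?a = "ip M u u" and ?b = "ip M u v" and ?c = "ip M v v"
  have quad: "0 \<le> ?a + 2 * t * ?b + t * t * ?c" for t
  proof -
    have "0 \<le> ip M (\<lambda>x. u x + t *\<^sub>R v x) (\<lambda>x. u x + t *\<^sub>R v x)" by (rule ip_self_nonneg)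
    also have "\<dots> = ?a + 2 * t * ?b + t * t * ?c"
      using u v by (simp add: ip_add_left ip_add_right ip_scaleR_left ip_scaleR_right sqint_scaleR
          sqint_add ip_commute[of M v u] algebra_simps)
    finally show ?thesis .
  qed
  have "?b\<^sup>2 \<le> ?a * ?c"
  proof (cases "?c = 0")
    case True
    have "?b = 0"
    proof (rule ccontr)
      assume "?b \<noteq> 0"
      \<comment> \<open>With \<open>?c = 0\<close> the quadratic is affine in \<open>t\<close>, and
        this value of \<open>t\<close> makes it equal to -1.\<close>
      then show False using quad[of "- (?a + 1) / (2 * ?b)"] True ip_self_nonneg[of M u]
        by (simp add: field_simps)
    qed
    then show ?thesis using True by simp
  next
    case False
    then have c: "?c > 0" using ip_self_nonneg[of M v] by simp
    have "0 \<le> (?a + 2 * (- ?b / ?c) * ?b + (- ?b / ?c) * (- ?b / ?c) * ?c) * ?c"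
      using quad[of "- ?b / ?c"] c by (intro mult_nonneg_nonneg) auto
    also have "\<dots> = ?a * ?c - ?b\<^sup>2" using c by (simp add: field_simps power2_eq_square)
    finally show ?thesis by simp
  qed
  then have "\<bar>?b\<bar>\<^sup>2 \<le> (nrm M u * nrm M v)\<^sup>2"
    by (simp add: power_mult_distrib nrm_power2)
  then show ?thesis
    by (rule power2_le_imp_le) (simp add: nrm_nonneg)
qed

lemma nrm_triangle:
  assumes u: "u \<in> sqint M" and v: "v \<in> sqint M"
  shows "nrm M (\<lambda>x. u x + v x) \<le> nrm M u + nrm M v"
proof (rule power2_le_imp_le)
  have "(nrm M (\<lambda>x. u x + v x))\<^sup>2 = (nrm M u)\<^sup>2 + 2 * ip M u v + (nrm M v)\<^sup>2"
    using u v by (simp add: nrm_power2 ip_add_left ip_add_right sqint_add ip_commute[of M v u])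
  also have "\<dots> \<le> (nrm M u + nrm M v)\<^sup>2"
    using ip_Cauchy_Schwarz[OF u v] by (simp add: power2_eq_square algebra_simps)
  finally show "(nrm M (\<lambda>x. u x + v x))\<^sup>2 \<le> (nrm M u + nrm M v)\<^sup>2" .
qed (simp add: nrm_nonneg add_nonneg_nonneg)

lemma nrm_triangle_diff:
  "u \<in> sqint M \<Longrightarrow> v \<in> sqint M \<Longrightarrow> nrm M (\<lambda>x. u x - v x) \<le> nrm M u + nrm M v"
  using nrm_triangle[OF _ sqint_uminus, of u M v] by (simp add: nrm_uminus)

lemma nrm_sum:
  "(\<And>i. i \<in> I \<Longrightarrow> u i \<in> sqint M) \<Longrightarrow> nrm M (\<lambda>x. \<Sum>i\<in>I. u i x) \<le> (\<Sum>i\<in>I. nrm M (u i))"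
proof (induction I rule: infinite_finite_induct)
  case (insert i I)
  then show ?case
    using nrm_triangle[of "u i" M "\<lambda>x. \<Sum>i\<in>I. u i x"] by (force simp: sqint_sum)
qed (simp_all add: nrm_zero)

lemma nrm_eq_integral: "nrm M u = sqrt (LINT x|M. (norm (u x))\<^sup>2)"
  by (simp add: nrm_def ip_def power2_norm_eq_inner)

lemma nrm_mono:
  assumes "v \<in> sqint M" "\<And>x. x \<in> space M \<Longrightarrow> norm (u x) \<le> B * norm (v x)" "B \<ge> 0"
  shows "nrm M u \<le> B * nrm M v"
proof -
  have "(LINT x|M. (norm (u x))\<^sup>2) \<le> (LINT x|M. (B * norm (v x))\<^sup>2)"
  proof (intro integral_mono_AE')
    show "integrable M (\<lambda>x. (B * norm (v x))\<^sup>2)" using assms by (simp add: sqint_def power_mult_distrib)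
    show "AE x in M. (norm (u x))\<^sup>2 \<le> (B * norm (v x))\<^sup>2"
      using assms by (intro AE_I2 power_mono) auto
  qed simp
  also have "\<dots> = B\<^sup>2 * (LINT x|M. (norm (v x))\<^sup>2)" by (simp add: power_mult_distrib)
  finally show ?thesis
    using assms(3) unfolding nrm_eq_integral
    by (metis real_sqrt_le_mono real_sqrt_mult real_sqrt_abs abs_of_nonneg)
qed

section \<open>Integration of continuous functions with compact support\<close>

text \<open>A class wide enough for absolute values and square roots of test functions and for
  functions on product spaces, and narrow enough that integrability and Fubini are
  automatic.\<close>

definition cc :: "('a::euclidean_space \<Rightarrow> 'b::euclidean_space) \<Rightarrow> bool" where
  "cc f \<longleftrightarrow> continuous_on UNIV f \<and> (\<exists>K. compact K \<and> (\<forall>x. x \<notin> K \<longrightarrow> f x = 0))"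

lemma ccI: "continuous_on UNIV f \<Longrightarrow> compact K \<Longrightarrow> (\<And>x. x \<notin> K \<Longrightarrow> f x = 0) \<Longrightarrow> cc f"
  by (auto simp: cc_def)

lemma cc_continuous: "cc f \<Longrightarrow> continuous_on UNIV f"
  by (simp add: cc_def)

lemma cc_borel: "cc f \<Longrightarrow> f \<in> borel_measurable borel"
  by (simp add: cc_def borel_measurable_continuous_onI)

lemma test_function_cc: "f \<in> test_functions UNIV \<Longrightarrow> cc f"
  unfolding cc_def test_functions_iff using smooth_continuous by blast

lemma cc_integrable:
  assumes "cc f" shows "integrable lborel f"
proof -
  obtain K where K: "compact K" "\<And>x. x \<notin> K \<Longrightarrow> f x = 0" using assms by (auto simp: cc_def)
  have "integrable lborel (\<lambda>x. indicator K x *\<^sub>R f x)"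
    using assms K(1) by (intro borel_integrable_compact) (auto simp: cc_def intro: continuous_on_subset)
  moreover have "(\<lambda>x. indicator K x *\<^sub>R f x) = f" using K(2) by (auto simp: indicator_def fun_eq_iff)
  ultimately show ?thesis by simp
qed

lemma cc_compose:
  assumes "cc f" "continuous_on UNIV h" "h 0 = 0" shows "cc (\<lambda>x. h (f x))"
proof -
  obtain K where K: "compact K" "\<And>x. x \<notin> K \<Longrightarrow> f x = 0" using assms by (auto simp: cc_def)
  show ?thesis
    by (rule ccI[OF continuous_on_compose2[OF assms(2) cc_continuous[OF assms(1)]] K(1)])
      (use K assms in auto)
qed

lemma cc_mult_left:
  fixes f g :: "'a::euclidean_space \<Rightarrow> real"
  assumes "cc f" "continuous_on UNIV g" shows "cc (\<lambda>x. f x * g x)"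
proof -
  obtain K where K: "compact K" "\<And>x. x \<notin> K \<Longrightarrow> f x = 0" using assms by (auto simp: cc_def)
  show ?thesis
    by (rule ccI[OF continuous_on_mult[OF cc_continuous[OF assms(1)] assms(2)] K(1)]) (use K in auto)
qed

lemma cc_sqint: "cc f \<Longrightarrow> f \<in> sqint lborel"
  using cc_integrable[OF cc_compose[of f "\<lambda>y. (norm y)\<^sup>2"]]
  by (auto simp: sqint_def cc_borel intro!: continuous_intros)

lemmas test_function_integrable = cc_integrable[OF test_function_cc]
lemmas test_function_sqint = cc_sqint[OF test_function_cc]

lemma integral_affine:
  fixes f :: "'a::euclidean_space \<Rightarrow> real"
  assumes "f \<in> borel_measurable borel" "c \<noteq> 0"
  shows "(LINT x|lborel. f x) = \<bar>c\<bar> ^ DIM('a) * (LINT x|lborel. f (t + c *\<^sub>R x))"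
  using assms
  by (subst lborel_affine[of c t])
    (auto simp: integral_density integral_distr)

lemma integral_translate:
  fixes f :: "'a::euclidean_space \<Rightarrow> real"
  assumes "f \<in> borel_measurable borel"
  shows "(LINT x|lborel. f (t + x)) = (LINT x|lborel. f x)"
  using integral_affine[OF assms, of 1 t] by simp

lemma integral_reflect:
  fixes f :: "'a::euclidean_space \<Rightarrow> real"
  assumes "f \<in> borel_measurable borel"
  shows "(LINT x|lborel. f (t - x)) = (LINT x|lborel. f x)"
  using integral_affine[OF assms, of "-1" t] by simp

lemma integral_dilate:
  fixes f :: "'a::euclidean_space \<Rightarrow> real"
  assumes "f \<in> borel_measurable borel" "c > 0"
  shows "(LINT x|lborel. c ^ DIM('a) * f (c *\<^sub>R x)) = (LINT x|lborel. f x)"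
  using integral_affine[OF assms(1), of c 0] assms(2) by simp

lemma cc_Fubini:
  fixes f :: "'a::euclidean_space \<Rightarrow> 'b::euclidean_space \<Rightarrow> real"
  assumes "cc (\<lambda>(x, y). f x y)"
  shows "(LINT x|lborel. LINT y|lborel. f x y) = (LINT y|lborel. LINT x|lborel. f x y)"
  using lborel_pair.Fubini_integral[of f] cc_integrable[OF assms] by (simp add: lborel_prod)

lemma cc_pairI:
  fixes f :: "'a::euclidean_space \<Rightarrow> 'b::euclidean_space \<Rightarrow> real"
  assumes "continuous_on UNIV (\<lambda>(x, y). f x y)" "compact K" "compact L"
    "\<And>x y. x \<notin> K \<Longrightarrow> f x y = 0" "\<And>x y. y \<notin> L \<Longrightarrow> f x y = 0"
  shows "cc (\<lambda>(x, y). f x y)"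
  using assms by (intro ccI[of _ "K \<times> L"]) (auto intro: compact_Times)

text \<open>By translation invariance the integral of every difference quotient vanishes. The
  quotients approximate the derivative uniformly, and all of this happens in a fixed ball of finite
  measure.\<close>

lemma integral_partial_deriv:
  assumes \<phi>: "\<phi> \<in> test_functions (UNIV :: (real^'n) set)"
  shows "(LINT x|lborel. partial_deriv i \<phi> x :: real) = 0"
proof -
  obtain K where K: "compact K" "\<And>x. x \<notin> K \<Longrightarrow> \<phi> x = 0" using \<phi> by (auto simp: test_functions_iff)
  obtain R where R: "\<And>x. x \<in> K \<Longrightarrow> norm x \<le> R"
    using compact_imp_bounded[OF K(1)] unfolding bounded_iff by blast
  \<comment> \<open>The shift has length at most 1, so this ball carries both \<open>\<phi>\<close>
    and its translate.\<close>
  let ?B = "cball (0::real^'n) (R + 1)"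
  define V where "V = measure lborel ?B"
  have intB: "integrable lborel (\<lambda>x. c * indicator ?B x :: real)" for c
    by (intro integrable_mult_right integrable_real_indicator emeasure_compact_finite) auto
  have bd: "\<bar>LINT x|lborel. partial_deriv i \<phi> x\<bar> \<le> e * V" if e: "e > 0" for e
  proof -
    obtain d where d: "d > 0" and lin: "\<And>x h. norm h < d \<Longrightarrow>
        \<bar>\<phi> (x + h) - \<phi> x - (\<Sum>i\<in>UNIV. h $ i * partial_deriv i \<phi> x)\<bar> \<le> e * norm h"
      using test_function_uniform_linearization[OF \<phi> e] by blast
    define t where "t = min d 1 / 2"
    have t: "0 < t" "t < d" "t \<le> 1" using d by (auto simp: t_def)
    let ?h = "t *\<^sub>R axis i (1::real)"
    have nh: "norm ?h = t" using t by simp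
    have sumh: "(\<Sum>j\<in>UNIV. ?h $ j * partial_deriv j \<phi> x) = t * partial_deriv i \<phi> x" for x
    proof -
      have "(\<Sum>j\<in>UNIV. ?h $ j * partial_deriv j \<phi> x) = (\<Sum>j\<in>UNIV. if j = i then t * partial_deriv j \<phi> x else 0)"
        by (rule sum.cong) (auto simp: axis_def)
      then show ?thesis by simp
    qed
    let ?f = "\<lambda>x. \<phi> (?h + x) - \<phi> x - t * partial_deriv i \<phi> x"
    have f: "(\<lambda>x. \<phi> (?h + x)) \<in> test_functions UNIV"
      using test_functions_affine[OF \<phi>, of 1 "- ?h"] by (simp add: add.commute)
    have intf: "integrable lborel ?f"
      by (intro Bochner_Integration.integrable_diff integrable_mult_right test_function_integrable
          test_functions_partial \<phi> f)
    have "norm (?f x) \<le> e * t * indicator ?B x" for x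
    proof (cases "x \<in> ?B")
      case True
      then show ?thesis using lin[of ?h x] nh t sumh[of x] by (simp add: add.commute)
    next
      case False
      have "norm x \<le> norm (?h + x) + norm ?h" using norm_triangle_ineq4[of "?h + x" ?h] by simp
      then have "\<not> norm x \<le> R" "\<not> norm (?h + x) \<le> R" using False nh t by auto
      then have "x \<notin> K" "?h + x \<notin> K" using R by blast+
      then show ?thesis
        using K partial_deriv_outside[OF compact_imp_closed[OF K(1)], of \<phi> x i] False by simp
    qed
    then have "\<bar>LINT x|lborel. ?f x\<bar> \<le> (LINT x|lborel. e * t * indicator ?B x)"
      using order_trans[OF integral_norm_bound integral_mono[OF integrable_norm[OF intf] intB[of "e * t"]]] by simp
    also have "\<dots> = e * t * V" by (simp add: V_def)
    also have "(LINT x|lborel. ?f x) = - t * (LINT x|lborel. partial_deriv i \<phi> x)"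
      using integral_translate[OF cc_borel[OF test_function_cc[OF \<phi>]], of ?h] \<phi> f
      by (simp add: test_function_integrable test_functions_partial Bochner_Integration.integrable_diff)
    finally have "t * \<bar>LINT x|lborel. partial_deriv i \<phi> x\<bar> \<le> t * (e * V)"
      using t by (simp add: abs_mult mult.commute mult.left_commute)
    then show ?thesis using t by simp
  qed
  have "\<bar>LINT x|lborel. partial_deriv i \<phi> x\<bar> \<le> 0 + e" if e: "e > 0" for e
  proof -
    have V: "V \<ge> 0" by (simp add: V_def)
    have "e / (V + 1) * V \<le> e" using V e by (simp add: field_simps)
    then show ?thesis using bd[of "e / (V + 1)"] V e by (simp add: divide_pos_pos add_nonneg_pos)
  qed
  then have "\<bar>LINT x|lborel. partial_deriv i \<phi> x\<bar> \<le> 0" using field_le_epsilon by blast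
  then show ?thesis by simp
qed

lemma integral_by_parts:
  fixes f g :: "real^'n \<Rightarrow> real"
  assumes f: "f \<in> test_functions UNIV" and g: "smooth g"
  shows "(LINT x|lborel. partial_deriv i f x * g x) = - (LINT x|lborel. f x * partial_deriv i g x)"
proof -
  have "(LINT x|lborel. partial_deriv i (\<lambda>x. f x * g x) x) = 0"
    by (rule integral_partial_deriv[OF test_functions_mult_left[OF f g]])
  moreover have "partial_deriv i (\<lambda>x. f x * g x) x = f x * partial_deriv i g x + partial_deriv i f x * g x" for x
    by (rule partial_deriv_mult[OF test_functions_smooth[OF f] g])
  ultimately show ?thesis
    using test_function_integrable[OF test_functions_mult_left[OF f smooth_partial[OF g], of i]]
      test_function_integrable[OF test_functions_mult_left[OF test_functions_partial[OF f, of i] g]] by simp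
qed

section \<open>Convolution\<close>

text \<open>The smooth kernel is the first argument, and derivatives fall on it; the second may be
  as rough as an indicator function.\<close>

definition conv :: "(real^'n \<Rightarrow> real) \<Rightarrow> (real^'n \<Rightarrow> real) \<Rightarrow> real^'n \<Rightarrow> real" where
  "conv \<phi> f x = (LINT y|lborel. \<phi> (x - y) * f y)"

abbreviation tf :: "(real^'n \<Rightarrow> real) set" where
  "tf \<equiv> test_functions UNIV"

lemma conv_superpose: "conv \<phi> f = superpose lborel (\<lambda>_. 1) (\<lambda>y. y) f \<phi>"
  by (simp add: conv_def superpose_def fun_eq_iff mult.commute)

lemma conv_smooth: "\<phi> \<in> tf \<Longrightarrow> integrable lborel f \<Longrightarrow> smooth (conv \<phi> f)"
  unfolding conv_superpose by (rule superpose_smooth[of _ _ _ 1]) auto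

lemma partial_conv:
  "\<phi> \<in> tf \<Longrightarrow> integrable lborel f \<Longrightarrow> partial_deriv i (conv \<phi> f) = conv (partial_deriv i \<phi>) f"
  unfolding conv_superpose using superpose_partial_deriv[of "\<lambda>_. 1" lborel "\<lambda>y. y" 1 f \<phi> i] by simp

lemma conv_outside:
  assumes "\<And>x. x \<notin> K \<Longrightarrow> \<phi> x = 0" "\<And>x. x \<notin> L \<Longrightarrow> f x = 0" "x \<notin> {a + b |a b. a \<in> K \<and> b \<in> L}"
  shows "conv \<phi> f x = 0"
proof -
  have "\<phi> (x - y) * f y = 0" for y
  proof (rule ccontr)
    assume "\<phi> (x - y) * f y \<noteq> 0"
    then have "x - y \<in> K" "y \<in> L" using assms(1,2) by force+
    then have "(x - y) + y \<in> {a + b |a b. a \<in> K \<and> b \<in> L}" by blast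
    then show False using assms(3) by simp
  qed
  then have "(\<lambda>y. \<phi> (x - y) * f y) = (\<lambda>y. 0)" by (rule ext)
  then show ?thesis by (simp add: conv_def)
qed

lemma conv_test_function:
  assumes "\<phi> \<in> tf" "integrable lborel f" and K: "compact K" "\<And>x. x \<notin> K \<Longrightarrow> \<phi> x = 0"
    and L: "compact L" "\<And>x. x \<notin> L \<Longrightarrow> f x = 0"
    and \<Omega>: "\<And>a b. a \<in> K \<Longrightarrow> b \<in> L \<Longrightarrow> a + b \<in> \<Omega>"
  shows "conv \<phi> f \<in> test_functions \<Omega>"
proof (rule test_functionsI[OF conv_smooth[OF assms(1,2)]])
  show "compact {a + b |a b. a \<in> K \<and> b \<in> L}" using K L by (intro compact_sums)
  show "{a + b |a b. a \<in> K \<and> b \<in> L} \<subseteq> \<Omega>" using \<Omega> by blast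
  show "conv \<phi> f x = 0" if "x \<notin> {a + b |a b. a \<in> K \<and> b \<in> L}" for x
    using conv_outside[OF K(2) L(2) that] .
qed

lemma conv_tf: "\<phi> \<in> tf \<Longrightarrow> f \<in> tf \<Longrightarrow> conv \<phi> f \<in> tf"
proof -
  assume \<phi>: "\<phi> \<in> tf" and f: "f \<in> tf"
  obtain K where K: "compact K" "\<And>x. x \<notin> K \<Longrightarrow> \<phi> x = 0" using \<phi> by (auto simp: test_functions_iff)
  obtain L where L: "compact L" "\<And>x. x \<notin> L \<Longrightarrow> f x = 0" using f by (auto simp: test_functions_iff)
  show ?thesis
    by (rule conv_test_function[OF \<phi> test_function_integrable[OF f] K L]) auto
qed

lemma tf_continuous: "f \<in> tf \<Longrightarrow> continuous_on UNIV f"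
  by (rule cc_continuous[OF test_function_cc])

lemma tf_compose_continuous: "f \<in> tf \<Longrightarrow> continuous_on S h \<Longrightarrow> continuous_on S (\<lambda>x. f (h x))"
  using continuous_on_compose2[OF tf_continuous, of f S h] by simp

lemma tf_borel: "f \<in> tf \<Longrightarrow> f \<in> borel_measurable borel"
  by (rule cc_borel[OF test_function_cc])

lemma tf_reflect: "f \<in> tf \<Longrightarrow> (\<lambda>y. f (x - y)) \<in> tf"
  using test_functions_affine[of f "-1" "-x"] by simp

lemma tf_minus: "f \<in> tf \<Longrightarrow> (\<lambda>y. f (- y)) \<in> tf"
  using tf_reflect[of f 0] by simp

lemma tf_translate: "f \<in> tf \<Longrightarrow> (\<lambda>y. f (y - x)) \<in> tf"
  using test_functions_affine[of f 1 x] by simp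

lemma tf_mult: "f \<in> tf \<Longrightarrow> g \<in> tf \<Longrightarrow> (\<lambda>x. f x * g x) \<in> tf"
  by (rule test_functions_mult_left[OF _ test_functions_smooth])

section \<open>Algebra of convolution on test functions\<close>

lemma conv_commute:
  assumes "\<phi> \<in> tf" "f \<in> tf" shows "conv \<phi> f = conv f \<phi>"
proof
  fix x
  have "(\<lambda>y. \<phi> (x - y) * f y) \<in> borel_measurable borel"
    by (rule tf_borel[OF tf_mult[OF tf_reflect assms(2)]]) (rule assms)
  from integral_reflect[OF this, of x] show "conv \<phi> f x = conv f \<phi> x"
    by (simp add: conv_def mult.commute)
qed

lemma partial_conv_right:
  assumes "\<phi> \<in> tf" "f \<in> tf" shows "partial_deriv i (conv \<phi> f) = conv \<phi> (partial_deriv i f)"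
  using assms
  by (simp add: conv_commute[OF assms] partial_conv test_function_integrable
      conv_commute[of \<phi> "partial_deriv i f"] test_functions_partial)

lemma partial_conv_left:
  "\<phi> \<in> tf \<Longrightarrow> f \<in> tf \<Longrightarrow> partial_deriv i (conv \<phi> f) = conv (partial_deriv i \<phi>) f"
  by (simp add: partial_conv test_function_integrable)

lemma conv_integrable: "\<phi> \<in> tf \<Longrightarrow> f \<in> tf \<Longrightarrow> integrable lborel (\<lambda>y. \<phi> (x - y) * f y)"
  by (rule test_function_integrable[OF tf_mult[OF tf_reflect]])

lemma conv_add_right:
  "\<phi> \<in> tf \<Longrightarrow> f \<in> tf \<Longrightarrow> g \<in> tf \<Longrightarrow> conv \<phi> (\<lambda>x. f x + g x) = (\<lambda>x. conv \<phi> f x + conv \<phi> g x)"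
  by (simp add: conv_def fun_eq_iff distrib_left conv_integrable)

lemma conv_add_left:
  "\<phi> \<in> tf \<Longrightarrow> \<psi> \<in> tf \<Longrightarrow> f \<in> tf \<Longrightarrow> conv (\<lambda>x. \<phi> x + \<psi> x) f = (\<lambda>x. conv \<phi> f x + conv \<psi> f x)"
  by (simp add: conv_def fun_eq_iff distrib_right conv_integrable)

lemma conv_diff_right:
  "\<phi> \<in> tf \<Longrightarrow> f \<in> tf \<Longrightarrow> g \<in> tf \<Longrightarrow> conv \<phi> (\<lambda>x. f x - g x) = (\<lambda>x. conv \<phi> f x - conv \<phi> g x)"
  by (simp add: conv_def fun_eq_iff right_diff_distrib conv_integrable)

lemma conv_diff_left:
  "\<phi> \<in> tf \<Longrightarrow> \<psi> \<in> tf \<Longrightarrow> f \<in> tf \<Longrightarrow> conv (\<lambda>x. \<phi> x - \<psi> x) f = (\<lambda>x. conv \<phi> f x - conv \<psi> f x)"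
  by (simp add: conv_def fun_eq_iff left_diff_distrib conv_integrable)

lemma conv_cmult_left: "conv (\<lambda>x. c * \<phi> x) f = (\<lambda>x. c * conv \<phi> f x)"
  by (simp add: conv_def fun_eq_iff mult.assoc)

lemma conv_cmult_right: "conv \<phi> (\<lambda>x. c * f x) = (\<lambda>x. c * conv \<phi> f x)"
  by (simp add: conv_def fun_eq_iff mult.left_commute)

lemma conv_sum_left:
  "(\<And>i. i \<in> I \<Longrightarrow> \<phi> i \<in> tf) \<Longrightarrow> f \<in> tf \<Longrightarrow> conv (\<lambda>x. \<Sum>i\<in>I. \<phi> i x) f = (\<lambda>x. \<Sum>i\<in>I. conv (\<phi> i) f x)"
  by (simp add: conv_def fun_eq_iff sum_distrib_right conv_integrable)

lemma conv_sum_right: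
  "\<phi> \<in> tf \<Longrightarrow> (\<And>i. i \<in> I \<Longrightarrow> f i \<in> tf) \<Longrightarrow> conv \<phi> (\<lambda>x. \<Sum>i\<in>I. f i x) = (\<lambda>x. \<Sum>i\<in>I. conv \<phi> (f i) x)"
  by (simp add: conv_def fun_eq_iff sum_distrib_left conv_integrable)

lemma conv_assoc:
  assumes \<phi>: "\<phi> \<in> tf" and \<psi>: "\<psi> \<in> tf" and f: "f \<in> tf"
  shows "conv \<phi> (conv \<psi> f) = conv (conv \<phi> \<psi>) f"
proof
  fix x
  obtain L where L: "compact L" "\<And>x. x \<notin> L \<Longrightarrow> f x = 0" using f by (auto simp: test_functions_iff)
  obtain K where K: "compact K" "\<And>y. y \<notin> K \<Longrightarrow> \<phi> (x - y) = 0"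
    using tf_reflect[OF \<phi>, of x] by (auto simp: test_functions_iff)
  have F: "cc (\<lambda>(y, z). \<phi> (x - y) * (\<psi> (y - z) * f z))"
  proof (rule cc_pairI[OF _ K(1) L(1)])
    show "continuous_on UNIV (\<lambda>(y, z). \<phi> (x - y) * (\<psi> (y - z) * f z))"
      unfolding case_prod_beta
      by (intro continuous_intros tf_compose_continuous[OF \<phi>] tf_compose_continuous[OF \<psi>] tf_compose_continuous[OF f])
  qed (use K L in auto)
  have inner: "(LINT y|lborel. \<phi> (x - y) * (\<psi> (y - z) * f z)) = conv \<phi> \<psi> (x - z) * f z" for z
  proof -
    have m: "(\<lambda>y. \<phi> (x - y) * \<psi> (y - z)) \<in> borel_measurable borel"
      by (rule tf_borel[OF tf_mult[OF tf_reflect[OF \<phi>] tf_translate[OF \<psi>]]])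
    have "(LINT y|lborel. \<phi> (x - y) * \<psi> (y - z)) = conv \<phi> \<psi> (x - z)"
      using integral_translate[OF m, of z] by (simp add: conv_def algebra_simps)
    then show ?thesis by (simp flip: mult.assoc)
  qed
  have "conv \<phi> (conv \<psi> f) x = (LINT y|lborel. LINT z|lborel. \<phi> (x - y) * (\<psi> (y - z) * f z))"
    by (simp add: conv_def)
  also have "\<dots> = (LINT z|lborel. conv \<phi> \<psi> (x - z) * f z)"
    using cc_Fubini[OF F] inner by simp
  finally show "conv \<phi> (conv \<psi> f) x = conv (conv \<phi> \<psi>) f x" by (simp add: conv_def)
qed

lemma conv_left_commute:
  assumes "\<phi> \<in> tf" "\<psi> \<in> tf" "f \<in> tf"
  shows "conv \<phi> (conv \<psi> f) = conv \<psi> (conv \<phi> f)"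
  using assms by (simp add: conv_assoc conv_commute[OF assms(1,2)])

lemma conv_adjoint:
  assumes \<phi>: "\<phi> \<in> tf" and f: "f \<in> tf" and g: "g \<in> tf"
  shows "(LINT x|lborel. conv \<phi> f x * g x) = (LINT x|lborel. f x * conv (\<lambda>z. \<phi> (- z)) g x)"
proof -
  obtain L where L: "compact L" "\<And>x. x \<notin> L \<Longrightarrow> f x = 0" using f by (auto simp: test_functions_iff)
  obtain K where K: "compact K" "\<And>x. x \<notin> K \<Longrightarrow> g x = 0" using g by (auto simp: test_functions_iff)
  have F: "cc (\<lambda>(x, y). \<phi> (x - y) * f y * g x)"
  proof (rule cc_pairI[OF _ K(1) L(1)])
    show "continuous_on UNIV (\<lambda>(x, y). \<phi> (x - y) * f y * g x)"
      unfolding case_prod_beta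
      by (intro continuous_intros tf_compose_continuous[OF \<phi>] tf_compose_continuous[OF f] tf_compose_continuous[OF g])
  qed (use K L in auto)
  have "(LINT x|lborel. conv \<phi> f x * g x) = (LINT x|lborel. LINT y|lborel. \<phi> (x - y) * f y * g x)"
    by (simp add: conv_def)
  also have "\<dots> = (LINT y|lborel. LINT x|lborel. \<phi> (x - y) * f y * g x)" by (rule cc_Fubini[OF F])
  also have "\<dots> = (LINT y|lborel. f y * conv (\<lambda>z. \<phi> (- z)) g y)"
    by (simp add: conv_def mult.commute mult.left_commute)
  finally show ?thesis .
qed

definition nrm1 :: "(real^'n \<Rightarrow> real) \<Rightarrow> real" where
  "nrm1 \<phi> = (LINT x|lborel. \<bar>\<phi> x\<bar>)"

lemma nrm1_nonneg: "0 \<le> nrm1 \<phi>"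
  by (simp add: nrm1_def)

lemma tf_cc_abs: "\<phi> \<in> tf \<Longrightarrow> cc (\<lambda>x. \<bar>\<phi> x\<bar>)"
  by (rule cc_compose[OF test_function_cc]) (auto intro: continuous_intros)

lemma ip_real: "ip M f g = (LINT x|M. f x * g x)" for f g :: "_ \<Rightarrow> real"
  by (simp add: ip_def)

text \<open>Writing \<open>\<bar>\<phi>\<bar> \<bar>f\<bar>\<close> as the product of
  \<open>sqrt \<bar>\<phi>\<bar>\<close> and \<open>sqrt \<bar>\<phi>\<bar> \<bar>f\<bar>\<close>,
  Cauchy-Schwarz bounds the square of the convolution pointwise by \<open>A * P x\<close>, and
  Fubini integrates \<open>P\<close>.\<close>

lemma Young:
  assumes \<phi>: "\<phi> \<in> tf" and f: "f \<in> tf"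
  shows "nrm lborel (conv \<phi> f) \<le> nrm1 \<phi> * nrm lborel f"
proof -
  define A where "A = nrm1 \<phi>"
  have A0: "A \<ge> 0" by (simp add: A_def nrm1_nonneg)
  define P where "P x = (LINT y|lborel. \<bar>\<phi> (x - y)\<bar> * (f y)\<^sup>2)" for x
  obtain L where L: "compact L" "\<And>x. x \<notin> L \<Longrightarrow> f x = 0" using f by (auto simp: test_functions_iff)
  obtain K where K: "compact K" "\<And>x. x \<notin> K \<Longrightarrow> \<phi> x = 0" using \<phi> by (auto simp: test_functions_iff)
  let ?S = "{a + b |a b. a \<in> K \<and> b \<in> L}"
  have F: "cc (\<lambda>(x, y). \<bar>\<phi> (x - y)\<bar> * (f y)\<^sup>2)"
  proof (rule cc_pairI[OF _ compact_sums[OF K(1) L(1)] L(1)])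
    show "continuous_on UNIV (\<lambda>(x, y). \<bar>\<phi> (x - y)\<bar> * (f y)\<^sup>2)"
      unfolding case_prod_beta
      by (intro continuous_intros tf_compose_continuous[OF \<phi>] tf_compose_continuous[OF f])
    show "\<bar>\<phi> (x - y)\<bar> * (f y)\<^sup>2 = 0" if x: "x \<notin> ?S" for x y
    proof (rule ccontr)
      assume "\<bar>\<phi> (x - y)\<bar> * (f y)\<^sup>2 \<noteq> 0"
      then have "x - y \<in> K" "y \<in> L" using K(2) L(2) by force+
      then have "(x - y) + y \<in> ?S" by blast
      then show False using x by simp
    qed
  qed (use L in auto)
  have pw: "(conv \<phi> f x)\<^sup>2 \<le> A * P x" for x
  proof -
    let ?u = "\<lambda>y. sqrt \<bar>\<phi> (x - y)\<bar>" and ?v = "\<lambda>y. sqrt \<bar>\<phi> (x - y)\<bar> * \<bar>f y\<bar>"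
    have u: "cc ?u"
      by (rule cc_compose[OF test_function_cc[OF tf_reflect[OF \<phi>, of x]]]) (auto intro!: continuous_intros)
    have v: "cc ?v"
      by (rule cc_mult_left[OF u]) (intro continuous_intros tf_continuous[OF f])
    have "(LINT y|lborel. \<bar>\<phi> (x - y)\<bar>) = A"
      using integral_reflect[OF cc_borel[OF tf_cc_abs[OF \<phi>]], of x] by (simp add: A_def nrm1_def)
    then have uu: "nrm lborel ?u = sqrt A" by (simp add: nrm_def ip_def)
    have vv: "nrm lborel ?v = sqrt (P x)"
      by (simp add: nrm_def ip_def P_def power2_eq_square mult.commute mult.left_commute)
        (simp add: mult.assoc[symmetric])
    have "\<bar>conv \<phi> f x\<bar> \<le> (LINT y|lborel. \<bar>\<phi> (x - y) * f y\<bar>)"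
      unfolding conv_def by (rule integral_abs_bound)
    also have "\<dots> = ip lborel ?u ?v"
      by (simp add: ip_def abs_mult flip: mult.assoc)
    also have "\<dots> \<le> sqrt A * sqrt (P x)"
      using ip_Cauchy_Schwarz[OF cc_sqint[OF u] cc_sqint[OF v]] unfolding uu vv by linarith
    finally have "\<bar>conv \<phi> f x\<bar>\<^sup>2 \<le> (sqrt A * sqrt (P x))\<^sup>2" by (intro power_mono) auto
    moreover have "P x \<ge> 0" by (simp add: P_def)
    ultimately show ?thesis using A0 by (simp add: power_mult_distrib)
  qed
  have intP: "integrable lborel P"
    using lborel_pair.integrable_fst[of "\<lambda>x y. \<bar>\<phi> (x - y)\<bar> * (f y)\<^sup>2"] cc_integrable[OF F]
    by (simp add: lborel_prod P_def[abs_def])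
  have "(LINT x|lborel. P x) = (LINT y|lborel. LINT x|lborel. \<bar>\<phi> (x - y)\<bar> * (f y)\<^sup>2)"
    unfolding P_def by (rule cc_Fubini[OF F])
  also have "\<dots> = (LINT y|lborel. A * (f y)\<^sup>2)"
    using integral_translate[OF cc_borel[OF tf_cc_abs[OF \<phi>]], of "- _"] by (simp add: A_def nrm1_def)
  finally have intP_eq: "(LINT x|lborel. P x) = A * (nrm lborel f)\<^sup>2"
    by (simp add: nrm_power2 ip_def flip: power2_eq_square)
  have "(nrm lborel (conv \<phi> f))\<^sup>2 = (LINT x|lborel. (conv \<phi> f x)\<^sup>2)"
    by (simp add: nrm_power2 ip_def flip: power2_eq_square)
  also have "\<dots> \<le> (LINT x|lborel. A * P x)"
    using pw intP order_trans[OF zero_le_power2 pw] by (intro integral_mono_AE') auto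
  also have "\<dots> = (A * nrm lborel f)\<^sup>2" by (simp add: intP_eq power2_eq_square)
  finally have le: "(nrm lborel (conv \<phi> f))\<^sup>2 \<le> (A * nrm lborel f)\<^sup>2" .
  show ?thesis
    unfolding A_def[symmetric] by (rule power2_le_imp_le[OF le]) (simp add: A0 nrm_nonneg)
qed

section \<open>Dilations\<close>

text \<open>Normalised so that for \<open>c > 0\<close> the integral and \<open>nrm1\<close> do not
  depend on \<open>c\<close>, while each derivative costs a factor \<open>c\<close>.\<close>

definition dil :: "real \<Rightarrow> (real^'n \<Rightarrow> real) \<Rightarrow> real^'n \<Rightarrow> real" where
  "dil c \<phi> x = c ^ CARD('n) * \<phi> (c *\<^sub>R x)"

lemma tf_scale: "\<phi> \<in> tf \<Longrightarrow> c \<noteq> 0 \<Longrightarrow> (\<lambda>x. \<phi> (c *\<^sub>R x)) \<in> tf"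
  using test_functions_affine[of \<phi> c 0] by simp

lemma dil_tf: "\<phi> \<in> tf \<Longrightarrow> c > 0 \<Longrightarrow> dil c \<phi> \<in> tf"
  unfolding dil_def by (intro test_functions_cmult tf_scale) auto

lemma integral_dil:
  fixes \<phi> :: "real^'n \<Rightarrow> real"
  assumes "\<phi> \<in> borel_measurable borel" "c > 0" shows "(LINT x|lborel. dil c \<phi> x) = (LINT x|lborel. \<phi> x)"
  using integral_dilate[OF assms] by (simp add: dil_def)

lemma nrm1_dil: "\<phi> \<in> tf \<Longrightarrow> c > 0 \<Longrightarrow> nrm1 (dil c \<phi>) = nrm1 \<phi>"
  using integral_dil[OF cc_borel[OF tf_cc_abs], of \<phi> c] by (simp add: nrm1_def dil_def abs_mult)

lemma partial_dil:
  assumes "\<phi> \<in> tf" shows "partial_deriv i (dil c \<phi>) = (\<lambda>x. c * dil c (partial_deriv i \<phi>) x)"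
proof -
  have \<phi>: "smooth \<phi>" by (rule test_functions_smooth[OF assms])
  have "smooth (\<lambda>x. \<phi> (c *\<^sub>R x))" using smooth_affine[OF \<phi>, of c 0] by simp
  then show ?thesis
    using partial_deriv_affine[OF \<phi>, of i c 0]
    by (simp add: dil_def[abs_def] partial_deriv_cmult fun_eq_iff)
qed

lemma dil_minus: "(\<lambda>x. dil c \<phi> (- x)) = dil c (\<lambda>x. \<phi> (- x))"
  by (simp add: dil_def fun_eq_iff)

lemma dil_sum: "dil c (\<lambda>x. \<Sum>i\<in>I. \<phi> i x) = (\<lambda>x. \<Sum>i\<in>I. dil c (\<phi> i) x)"
  by (simp add: dil_def fun_eq_iff sum_distrib_left)

section \<open>A square function estimate\<close>

text \<open>A usable form of vanishing mean: it exhibits a derivative that can be integrated by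
  parts onto a coarser kernel.\<close>

definition divform :: "(real^'n \<Rightarrow> real) \<Rightarrow> bool" where
  "divform \<kappa> \<longleftrightarrow> (\<exists>\<omega>. (\<forall>i. \<omega> i \<in> tf) \<and> \<kappa> = (\<lambda>x. \<Sum>i\<in>UNIV. partial_deriv i (\<omega> i) x))"

lemma divform_tf: "divform \<kappa> \<Longrightarrow> \<kappa> \<in> tf"
  unfolding divform_def by (auto intro!: test_functions_sum test_functions_partial)

lemma divform_partial:
  assumes "\<phi> \<in> tf" shows "divform (partial_deriv i \<phi>)"
proof -
  have "partial_deriv i \<phi> x = (\<Sum>j\<in>UNIV. partial_deriv j (if j = i then \<phi> else (\<lambda>x. 0)) x)" for x
  proof -
    have "partial_deriv j (if j = i then \<phi> else (\<lambda>x. 0)) x = (if j = i then partial_deriv j \<phi> x else 0)" for j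
      by (simp add: partial_deriv_eq[OF has_derivative_const])
    then show ?thesis by simp
  qed
  then show ?thesis
    unfolding divform_def
    by (intro exI[of _ "\<lambda>j. if j = i then \<phi> else (\<lambda>x. 0)"]) (auto simp: assms test_functions_zero)
qed

lemma divform_minus:
  assumes "divform \<kappa>" shows "divform (\<lambda>x. \<kappa> (- x))"
proof -
  obtain \<omega> where \<omega>: "\<And>i. \<omega> i \<in> tf" "\<kappa> = (\<lambda>x. \<Sum>i\<in>UNIV. partial_deriv i (\<omega> i) x)"
    using assms unfolding divform_def by blast
  let ?w = "\<lambda>i x. - \<omega> i (- x)"
  have w: "?w i \<in> tf" for i by (rule test_functions_uminus[OF tf_minus[OF \<omega>(1)]])
  have "partial_deriv i (?w i) x = partial_deriv i (\<omega> i) (- x)" for i x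
  proof -
    have "smooth (\<lambda>x. \<omega> i (- x))" by (rule test_functions_smooth[OF tf_minus[OF \<omega>(1)]])
    from partial_deriv_cmult[OF this, of i "-1" x] show ?thesis
      using partial_deriv_affine[OF test_functions_smooth[OF \<omega>(1)], of i i "-1" 0 x] by simp
  qed
  then show ?thesis
    unfolding divform_def \<omega>(2) using w by (intro exI[of _ ?w]) auto
qed

abbreviation n2 :: "(real^'n \<Rightarrow> real) \<Rightarrow> real" where
  "n2 \<equiv> nrm lborel"

lemma n2_partial_conv_dil:
  assumes "\<theta> \<in> tf" "g \<in> tf" "c > 0"
  shows "n2 (partial_deriv i (conv (dil c \<theta>) g)) \<le> c * nrm1 (partial_deriv i \<theta>) * n2 g"
proof -
  have "partial_deriv i (conv (dil c \<theta>) g) = (\<lambda>x. c * conv (dil c (partial_deriv i \<theta>)) g x)"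
    using assms by (simp add: partial_conv_left dil_tf partial_dil conv_cmult_left)
  then have "n2 (partial_deriv i (conv (dil c \<theta>) g)) = c * n2 (conv (dil c (partial_deriv i \<theta>)) g)"
    using assms by (simp add: nrm_cmult)
  also have "\<dots> \<le> c * (nrm1 (partial_deriv i \<theta>) * n2 g)"
    using Young[OF dil_tf[OF test_functions_partial[OF assms(1)] assms(3)] assms(2), of i] assms
    by (intro mult_left_mono) (auto simp: nrm1_dil test_functions_partial)
  finally show ?thesis by simp
qed

text \<open>A derivative taken from the finer kernel \<open>\<kappa>\<close> and moved to the coarser one \<open>\<theta>\<close> gains the
  factor \<open>d / c\<close>.\<close>

lemma almost_orthogonal:
  assumes "divform \<kappa>" "\<theta> \<in> tf"
  shows "\<exists>C\<ge>0. \<forall>c>0. \<forall>d>0. \<forall>g\<in>tf. n2 (conv (dil c \<kappa>) (conv (dil d \<theta>) g)) \<le> C * (d / c) * n2 g"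
proof -
  obtain \<omega> where \<omega>: "\<And>i. \<omega> i \<in> tf" and \<kappa>: "\<kappa> = (\<lambda>x. \<Sum>i\<in>UNIV. partial_deriv i (\<omega> i) x)"
    using assms unfolding divform_def by blast
  define C where "C = (\<Sum>i\<in>UNIV. nrm1 (\<omega> i) * nrm1 (partial_deriv i \<theta>))"
  have "n2 (conv (dil c \<kappa>) (conv (dil d \<theta>) g)) \<le> C * (d / c) * n2 g"
    if c: "c > 0" and d: "d > 0" and g: "g \<in> tf" for c d g
  proof -
    let ?u = "conv (dil d \<theta>) g"
    have u: "?u \<in> tf" by (intro conv_tf dil_tf assms d g)
    \<comment> \<open>A derivative of a dilate produces the factor \<open>c\<close>, so expressing
      the dilated divergence through derivatives of dilates yields \<open>1 / c\<close>. The
      derivative is then carried by the kernel at scale \<open>d\<close>, at cost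
      \<open>d\<close>.\<close>
    have dil: "dil c \<kappa> = (\<lambda>x. \<Sum>i\<in>UNIV. (1 / c) * partial_deriv i (dil c (\<omega> i)) x)"
      using c by (simp add: \<kappa> dil_sum partial_dil[OF \<omega>])
    have "conv (dil c \<kappa>) ?u = (\<lambda>x. \<Sum>i\<in>UNIV. (1 / c) * conv (dil c (\<omega> i)) (partial_deriv i ?u) x)"
    proof -
      have "conv (dil c \<kappa>) ?u = (\<lambda>x. \<Sum>i\<in>UNIV. conv (\<lambda>x. (1 / c) * partial_deriv i (dil c (\<omega> i)) x) ?u x)"
        unfolding dil by (intro conv_sum_left test_functions_cmult test_functions_partial dil_tf \<omega> c u)
      also have "\<dots> = (\<lambda>x. \<Sum>i\<in>UNIV. (1 / c) * conv (dil c (\<omega> i)) (partial_deriv i ?u) x)"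
        using partial_conv_left[OF dil_tf[OF \<omega> c] u] partial_conv_right[OF dil_tf[OF \<omega> c] u]
        by (simp only: conv_cmult_left)
      finally show ?thesis .
    qed
    then have "n2 (conv (dil c \<kappa>) ?u) \<le> (\<Sum>i\<in>UNIV. n2 (\<lambda>x. (1 / c) * conv (dil c (\<omega> i)) (partial_deriv i ?u) x))"
      by (simp only:) (intro nrm_sum sqint_cmult test_function_sqint conv_tf dil_tf test_functions_partial \<omega> c u)
    also have "\<dots> \<le> (\<Sum>i\<in>UNIV. nrm1 (\<omega> i) * nrm1 (partial_deriv i \<theta>) * ((d / c) * n2 g))"
    proof (rule sum_mono)
      fix i
      have "n2 (\<lambda>x. (1 / c) * conv (dil c (\<omega> i)) (partial_deriv i ?u) x)
         = (1 / c) * n2 (conv (dil c (\<omega> i)) (partial_deriv i ?u))"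
        using c by (subst nrm_cmult) simp
      also have "\<dots> \<le> (1 / c) * (nrm1 (\<omega> i) * n2 (partial_deriv i ?u))"
        using Young[OF dil_tf[OF \<omega> c] test_functions_partial[OF u], of i i] c \<omega>
        by (intro mult_left_mono) (auto simp: nrm1_dil)
      also have "\<dots> \<le> (1 / c) * (nrm1 (\<omega> i) * (d * nrm1 (partial_deriv i \<theta>) * n2 g))"
        using c d g assms by (intro mult_left_mono n2_partial_conv_dil) (auto simp: nrm1_nonneg)
      finally show "n2 (\<lambda>x. (1 / c) * conv (dil c (\<omega> i)) (partial_deriv i ?u) x)
        \<le> nrm1 (\<omega> i) * nrm1 (partial_deriv i \<theta>) * ((d / c) * n2 g)" by (simp add: mult_ac)
    qed
    also have "\<dots> = C * (d / c) * n2 g" by (simp only: C_def sum_distrib_right mult.assoc)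
    finally show ?thesis .
  qed
  moreover have "C \<ge> 0" by (simp add: C_def sum_nonneg nrm1_nonneg)
  ultimately show ?thesis by blast
qed

text \<open>Subtraction on naturals truncates, so the exponent is the distance between
  \<open>k\<close> and \<open>m\<close>. The terms on either side of \<open>k\<close> form a
  geometric sum of at most 2; the diagonal is counted in both.\<close>

lemma sum_half_power_diff: "(\<Sum>m<N. (1/2::real) ^ ((k - m) + (m - k))) \<le> 4"
proof -
  have geo: "(\<Sum>j<n. (1/2::real) ^ j) \<le> 2" for n
    by (simp add: sum_gp_strict)
  have "(\<Sum>m<N. (1/2::real) ^ ((k - m) + (m - k))) \<le> (\<Sum>m\<in>{..k} \<union> {k..<k+N}. (1/2) ^ ((k - m) + (m - k)))"
    by (rule sum_mono2) auto
  also have "\<dots> \<le> (\<Sum>m\<in>{..k}. (1/2) ^ ((k - m) + (m - k))) + (\<Sum>m\<in>{k..<k+N}. (1/2) ^ ((k - m) + (m - k)))"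
    using sum.union_inter[of "{..k}" "{k..<k+N}" "\<lambda>m. (1/2::real) ^ ((k - m) + (m - k))"]
      sum_nonneg[of "{..k} \<inter> {k..<k+N}" "\<lambda>m. (1/2::real) ^ ((k - m) + (m - k))"] by simp
  also have "(\<Sum>m\<in>{..k}. (1/2::real) ^ ((k - m) + (m - k))) = (\<Sum>m<Suc k. (1/2) ^ (Suc k - Suc m))"
    by (rule sum.cong) auto
  also have "\<dots> = (\<Sum>j<Suc k. (1/2) ^ j)" by (rule sum.nat_diff_reindex)
  also have "(\<Sum>m\<in>{k..<k+N}. (1/2::real) ^ ((k - m) + (m - k))) = (\<Sum>j<N. (1/2) ^ j)"
    by (rule sum.reindex_bij_witness[of _ "\<lambda>j. k + j" "\<lambda>m. m - k"]) auto
  finally show ?thesis using geo[of "Suc k"] geo[of N] by linarith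
qed

text \<open>Schur's test for a symmetric kernel: bound \<open>a k * a m\<close> by half the sum of
  squares and use that all rows sum to at most 4.\<close>

lemma Schur_half_power:
  fixes a :: "nat \<Rightarrow> real"
  shows "(\<Sum>k<N. \<Sum>m<N. (1/2) ^ ((k - m) + (m - k)) * (a k * a m)) \<le> 4 * (\<Sum>k<N. (a k)\<^sup>2)"
proof -
  let ?w = "\<lambda>k m. (1/2::real) ^ ((k - m) + (m - k))"
  have "(\<Sum>k<N. \<Sum>m<N. ?w k m * (a k * a m)) \<le> (\<Sum>k<N. \<Sum>m<N. ?w k m * ((a k)\<^sup>2 / 2 + (a m)\<^sup>2 / 2))"
  proof (intro sum_mono mult_left_mono)
    fix k m
    show "a k * a m \<le> (a k)\<^sup>2 / 2 + (a m)\<^sup>2 / 2"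
      using sum_squares_bound[of "a k" "a m"] by simp
  qed simp
  also have "\<dots> = (\<Sum>k<N. \<Sum>m<N. ?w k m * (a k)\<^sup>2 / 2) + (\<Sum>k<N. \<Sum>m<N. ?w k m * (a m)\<^sup>2 / 2)"
    by (simp add: distrib_left sum.distrib)
  also have "(\<Sum>k<N. \<Sum>m<N. ?w k m * (a m)\<^sup>2 / 2) = (\<Sum>m<N. \<Sum>k<N. ?w k m * (a m)\<^sup>2 / 2)"
    by (rule sum.swap)
  also have "\<dots> = (\<Sum>k<N. \<Sum>m<N. ?w k m * (a k)\<^sup>2 / 2)" by (simp add: add.commute)
  also have "(\<Sum>k<N. \<Sum>m<N. ?w k m * (a k)\<^sup>2 / 2) + (\<Sum>k<N. \<Sum>m<N. ?w k m * (a k)\<^sup>2 / 2)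
     = (\<Sum>k<N. (\<Sum>m<N. ?w k m) * (a k)\<^sup>2)"
    by (simp add: sum_distrib_right flip: sum.distrib) (simp add: mult.commute)
  also have "\<dots> \<le> (\<Sum>k<N. 4 * (a k)\<^sup>2)"
    by (intro sum_mono mult_right_mono sum_half_power_diff) simp
  finally show ?thesis by (simp add: sum_distrib_left)
qed

text \<open>Duality turns the estimate into one for \<open>\<Sum>\<^sub>k \<kappa>\<^sub>k * g\<^sub>k\<close>, whose Gram matrix
  decays off the diagonal by almost orthogonality.\<close>

lemma square_function:
  assumes \<kappa>: "divform \<kappa>"
  shows "\<exists>C\<ge>0. \<forall>f\<in>tf. \<forall>N. (\<Sum>k<N. (n2 (conv (dil (2^k) \<kappa>) f))\<^sup>2) \<le> C * (n2 f)\<^sup>2"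
proof -
  let ?\<kappa>' = "\<lambda>x. \<kappa> (- x)"
  have \<kappa>tf: "\<kappa> \<in> tf" by (rule divform_tf[OF \<kappa>])
  have \<kappa>': "?\<kappa>' \<in> tf" by (rule tf_minus[OF \<kappa>tf])
  obtain C where C: "C \<ge> 0" and orth: "\<And>c d g. c > 0 \<Longrightarrow> d > 0 \<Longrightarrow> g \<in> tf \<Longrightarrow>
      n2 (conv (dil c \<kappa>) (conv (dil d ?\<kappa>') g)) \<le> C * (d / c) * n2 g"
    using almost_orthogonal[OF \<kappa> \<kappa>'] by blast
  have "(\<Sum>k<N. (n2 (conv (dil (2^k) \<kappa>) f))\<^sup>2) \<le> (4 * C) * (n2 f)\<^sup>2" if f: "f \<in> tf" for f N
  proof -
    define g where "g k = conv (dil (2^k) \<kappa>) f" for k :: nat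
    \<comment> \<open>\<open>h k\<close> is convolution at scale \<open>k\<close> followed by its
      adjoint, applied to \<open>f\<close>. Hence \<open>S\<close> is the pairing of
      \<open>f\<close> with the sum of the \<open>h k\<close>, and only the norm of that sum has to
      be estimated.\<close>
    define h where "h k = conv (dil (2^k) ?\<kappa>') (g k)" for k :: nat
    define S where "S = (\<Sum>k<N. (n2 (g k))\<^sup>2)"
    have S0: "S \<ge> 0" by (simp add: S_def sum_nonneg)
    have g: "g k \<in> tf" for k unfolding g_def by (intro conv_tf dil_tf \<kappa>tf f) auto
    have h: "h k \<in> tf" for k unfolding h_def by (intro conv_tf dil_tf \<kappa>' g) auto
    have adj: "ip lborel (conv (dil c \<kappa>) u) v = ip lborel u (conv (dil c ?\<kappa>') v)"
      if "c > 0" "u \<in> tf" "v \<in> tf" for c u v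
      using conv_adjoint[OF dil_tf[OF \<kappa>tf that(1)] that(2,3)] by (simp add: ip_real dil_minus)
    \<comment> \<open>The ratio \<open>2^k / 2^m\<close> is a gain only when the outer kernel has
      the finer scale; the opposite order follows by symmetry of the inner product.\<close>
    have gram1: "\<bar>ip lborel (h k) (h m)\<bar> \<le> C * (1/2) ^ ((k - m) + (m - k)) * (n2 (g k) * n2 (g m))"
      if km: "k \<le> m" for k m
    proof -
      have "ip lborel (h k) (h m) = ip lborel (conv (dil (2^m) \<kappa>) (h k)) (g m)"
        using adj[of "2^m" "h k" "g m"] by (simp add: h_def[of m] h g)
      then have "\<bar>ip lborel (h k) (h m)\<bar> \<le> n2 (conv (dil (2^m) \<kappa>) (h k)) * n2 (g m)"
        using ip_Cauchy_Schwarz[of "conv (dil (2^m) \<kappa>) (h k)" lborel "g m"]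
        by (simp add: test_function_sqint conv_tf dil_tf \<kappa>tf h g)
      also have "\<dots> \<le> C * (2^k / 2^m) * n2 (g k) * n2 (g m)"
        unfolding h_def by (intro mult_right_mono orth g) (auto simp: nrm_nonneg)
      also have "2^k / 2^m = (1/2::real) ^ ((k - m) + (m - k))"
        using km by (simp add: power_diff power_one_over)
      finally show ?thesis by (simp add: mult_ac)
    qed
    have gram: "ip lborel (h k) (h m) \<le> C * (1/2) ^ ((k - m) + (m - k)) * (n2 (g k) * n2 (g m))" for k m
    proof (cases "k \<le> m")
      case True
      then show ?thesis using gram1[OF True] by linarith
    next
      case False
      then have "\<bar>ip lborel (h m) (h k)\<bar> \<le> C * (1/2) ^ ((m - k) + (k - m)) * (n2 (g m) * n2 (g k))"
        by (intro gram1) simp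
      then show ?thesis by (simp add: ip_commute[of lborel "h k"] add.commute mult.commute[of "n2 (g k)"])
    qed
    define H where "H x = (\<Sum>k<N. h k x)" for x
    have H: "H \<in> tf" unfolding H_def[abs_def] by (intro test_functions_sum h)
    have sq: "f \<in> sqint lborel" "\<And>k. g k \<in> sqint lborel" "\<And>k. h k \<in> sqint lborel" "H \<in> sqint lborel"
      using f g h H by (simp_all add: test_function_sqint)
    have "(n2 H)\<^sup>2 = (\<Sum>k<N. \<Sum>m<N. ip lborel (h k) (h m))"
      using sq by (simp add: nrm_power2 H_def[abs_def] ip_sum_left ip_sum_right sqint_sum)
    also have "\<dots> \<le> (\<Sum>k<N. \<Sum>m<N. C * (1/2) ^ ((k - m) + (m - k)) * (n2 (g k) * n2 (g m)))"
      by (intro sum_mono gram)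
    also have "\<dots> = C * (\<Sum>k<N. \<Sum>m<N. (1/2) ^ ((k - m) + (m - k)) * (n2 (g k) * n2 (g m)))"
      by (simp add: sum_distrib_left mult_ac)
    also have "\<dots> \<le> C * (4 * S)"
      unfolding S_def by (intro mult_left_mono Schur_half_power C)
    finally have H2: "(n2 H)\<^sup>2 \<le> 4 * C * S" by simp
    have "S = (\<Sum>k<N. ip lborel f (h k))"
      unfolding S_def
    proof (rule sum.cong[OF refl])
      fix k
      show "(n2 (g k))\<^sup>2 = ip lborel f (h k)"
        using adj[of "2^k" f "g k"] f g by (simp add: nrm_power2 h_def g_def)
    qed
    also have "\<dots> = ip lborel f H" using sq by (simp add: H_def[abs_def] ip_sum_right)
    also have "\<dots> \<le> n2 f * n2 H" using ip_Cauchy_Schwarz[OF sq(1,4)] by linarith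
    \<comment> \<open>The bound on \<open>H\<close> again contains \<open>S\<close>, to the first
      power, so one factor \<open>S\<close> cancels.\<close>
    finally have "S\<^sup>2 \<le> (n2 f * n2 H)\<^sup>2" using S0 by (intro power_mono) auto
    also have "\<dots> \<le> (n2 f)\<^sup>2 * (4 * C * S)"
      unfolding power_mult_distrib by (intro mult_left_mono H2) simp
    finally have "S * S \<le> ((4 * C) * (n2 f)\<^sup>2) * S" by (simp add: power2_eq_square mult_ac)
    then have "S \<le> (4 * C) * (n2 f)\<^sup>2"
      using S0 C by (cases "S = 0") (auto simp: mult_le_cancel_right)
    then show ?thesis by (simp add: S_def g_def)
  qed
  moreover have "0 \<le> 4 * C" using C by simp
  ultimately show ?thesis by blast
qed

text \<open>Pairing the sum \<open>U\<close> with itself and moving each \<open>\<kappa>\<close> to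
  the other side gives a sum over the scales of products. Cauchy-Schwarz in the scale index and two
  square function estimates bound it by a multiple of \<open>n2 f * n2 U\<close>, and one factor
  \<open>n2 U\<close> cancels.\<close>

lemma multiscale_bound:
  assumes \<kappa>: "divform \<kappa>" and \<theta>: "divform \<theta>"
  shows "\<exists>C\<ge>0. \<forall>f\<in>tf. \<forall>N. n2 (\<lambda>x. \<Sum>k<N. conv (dil (2^k) \<kappa>) (conv (dil (2^k) \<theta>) f) x) \<le> C * n2 f"
proof -
  let ?\<kappa>' = "\<lambda>x. \<kappa> (- x)"
  have tf: "\<kappa> \<in> tf" "\<theta> \<in> tf" using \<kappa> \<theta> by (simp_all add: divform_tf)
  have \<kappa>': "?\<kappa>' \<in> tf" by (rule tf_minus[OF tf(1)])
  obtain A where A: "A \<ge> 0" "\<And>f N. f \<in> tf \<Longrightarrow> (\<Sum>k<N. (n2 (conv (dil (2^k) ?\<kappa>') f))\<^sup>2) \<le> A * (n2 f)\<^sup>2"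
    using square_function[OF divform_minus[OF \<kappa>]] by blast
  obtain B where B: "B \<ge> 0" "\<And>f N. f \<in> tf \<Longrightarrow> (\<Sum>k<N. (n2 (conv (dil (2^k) \<theta>) f))\<^sup>2) \<le> B * (n2 f)\<^sup>2"
    using square_function[OF \<theta>] by blast
  have "n2 (\<lambda>x. \<Sum>k<N. conv (dil (2^k) \<kappa>) (conv (dil (2^k) \<theta>) f) x) \<le> (sqrt A * sqrt B) * n2 f"
    if f: "f \<in> tf" for f N
  proof -
    define u where "u k = conv (dil (2^k) \<theta>) f" for k :: nat
    define U where "U x = (\<Sum>k<N. conv (dil (2^k) \<kappa>) (u k) x)" for x
    have u: "u k \<in> tf" for k unfolding u_def by (intro conv_tf dil_tf tf f) auto
    have cu: "conv (dil (2^k) \<kappa>) (u k) \<in> tf" for k by (intro conv_tf dil_tf tf u) auto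
    have U: "U \<in> tf" unfolding U_def[abs_def] by (intro test_functions_sum cu)
    define v where "v k = conv (dil (2^k) ?\<kappa>') U" for k :: nat
    have v: "v k \<in> tf" for k unfolding v_def by (intro conv_tf dil_tf \<kappa>' U) auto
    have "(n2 U)\<^sup>2 = ip lborel (\<lambda>x. \<Sum>k<N. conv (dil (2^k) \<kappa>) (u k) x) U"
      by (simp add: nrm_power2 U_def[abs_def])
    also have "\<dots> = (\<Sum>k<N. ip lborel (conv (dil (2^k) \<kappa>) (u k)) U)"
      by (intro ip_sum_left test_function_sqint cu U)
    also have "\<dots> = (\<Sum>k<N. ip lborel (u k) (v k))"
      using conv_adjoint[OF dil_tf[OF tf(1)] u U] by (simp add: ip_real dil_minus v_def)
    also have "\<dots> \<le> (\<Sum>k<N. n2 (u k) * n2 (v k))"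
      using ip_Cauchy_Schwarz[OF test_function_sqint[OF u] test_function_sqint[OF v]]
      by (intro sum_mono) (meson abs_le_D1)
    also have "\<dots> \<le> sqrt (\<Sum>k<N. (n2 (u k))\<^sup>2) * sqrt (\<Sum>k<N. (n2 (v k))\<^sup>2)"
    proof -
      have "(\<Sum>k<N. n2 (u k) * n2 (v k))\<^sup>2 \<le> (\<Sum>k<N. (n2 (u k))\<^sup>2) * (\<Sum>k<N. (n2 (v k))\<^sup>2)"
        by (rule Cauchy_Schwarz_ineq_sum)
      from real_sqrt_le_mono[OF this] show ?thesis
        by (simp add: real_sqrt_mult sum_nonneg nrm_nonneg)
    qed
    also have "\<dots> \<le> sqrt (B * (n2 f)\<^sup>2) * sqrt (A * (n2 U)\<^sup>2)"
      using B(2)[OF f, of N] A(2)[OF U, of N]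
      by (intro mult_mono real_sqrt_le_mono) (auto simp: u_def v_def sum_nonneg A B)
    also have "\<dots> = (sqrt A * sqrt B) * n2 f * n2 U"
      by (simp add: real_sqrt_mult nrm_nonneg)
    finally have "n2 U * n2 U \<le> ((sqrt A * sqrt B) * n2 f) * n2 U" by (simp add: power2_eq_square)
    moreover have "0 \<le> (sqrt A * sqrt B) * n2 f" using A B by (simp add: nrm_nonneg)
    ultimately have "n2 U \<le> (sqrt A * sqrt B) * n2 f"
      using nrm_nonneg[of lborel U] by (cases "n2 U = 0") (auto simp: mult_le_cancel_right)
    then show ?thesis by (simp add: U_def[abs_def] u_def)
  qed
  moreover have "0 \<le> sqrt A * sqrt B" using A B by simp
  ultimately show ?thesis by blast
qed

section \<open>Averages over dilations\<close>

definition avg :: "real \<Rightarrow> real \<Rightarrow> nat \<Rightarrow> (real^'n \<Rightarrow> real) \<Rightarrow> real^'n \<Rightarrow> real" where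
  "avg p q m \<psi> x = (LINT t|lborel. indicator {p..q} t * (t ^ m * \<psi> (t *\<^sub>R x)))"

text \<open>A superposition needs its scale to be bounded on the whole line; clamping
  \<open>t\<close> to the interval provides this and is invisible under the indicator.\<close>

lemma avg_superpose:
  "avg p q m \<psi> = superpose lborel (\<lambda>t. max p (min q t)) (\<lambda>_. 0) (\<lambda>t. indicator {p..q} t * t ^ m) \<psi>"
proof
  fix x
  have "(\<lambda>t. indicator {p..q} t * (t ^ m * \<psi> (t *\<^sub>R x)))
      = (\<lambda>t. indicator {p..q} t * t ^ m * \<psi> (max p (min q t) *\<^sub>R x - 0))"
    by (auto simp: indicator_def max_def min_def fun_eq_iff)
  then show "avg p q m \<psi> x = superpose lborel (\<lambda>t. max p (min q t)) (\<lambda>_. 0) (\<lambda>t. indicator {p..q} t * t ^ m) \<psi> x"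
    unfolding avg_def superpose_def by (rule arg_cong)
qed

lemma tf_smooth: "f \<in> tf \<Longrightarrow> smooth f"
  by (rule test_functions_smooth)

lemma partial_deriv_cdivide:
  fixes g :: "real^'n \<Rightarrow> real"
  assumes "smooth g"
  shows "partial_deriv i (\<lambda>x. g x / c) x = partial_deriv i g x / c"
  using partial_deriv_cmult[OF assms, of i "1 / c" x] by simp

lemma integrable_indicator_continuous:
  fixes f :: "real \<Rightarrow> real"
  assumes "continuous_on {p..q} f" shows "integrable lborel (\<lambda>t. indicator {p..q} t * f t)"
  using borel_integrable_compact[OF compact_Icc assms] by simp

lemma partial_avg:
  assumes "\<psi> \<in> tf"
  shows "partial_deriv i (avg p q m \<psi>) = avg p q (Suc m) (partial_deriv i \<psi>)"
proof -
  have "partial_deriv i (avg p q m \<psi>) = superpose lborel (\<lambda>t. max p (min q t)) (\<lambda>_. 0)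
      (\<lambda>t. indicator {p..q} t * t ^ m * max p (min q t)) (partial_deriv i \<psi>)"
    unfolding avg_superpose
    by (rule superpose_partial_deriv[where S="\<bar>p\<bar> + \<bar>q\<bar>"])
      (use assms in \<open>auto intro!: integrable_indicator_continuous continuous_intros simp: max_def min_def\<close>)
  also have "(\<lambda>t. indicator {p..q} t * t ^ m * max p (min q t)) = (\<lambda>t. indicator {p..q} t * t ^ Suc m)"
    by (auto simp: indicator_def max_def min_def fun_eq_iff)
  finally show ?thesis by (simp add: avg_superpose)
qed

lemma avg_outside:
  assumes "0 < p" "\<And>x. x \<notin> S \<Longrightarrow> \<psi> x = 0" "\<And>t. p \<le> t \<Longrightarrow> t \<le> q \<Longrightarrow> t *\<^sub>R x \<notin> S"
  shows "avg p q m \<psi> x = 0"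
proof -
  have "(\<lambda>t. indicator {p..q} t * (t ^ m * \<psi> (t *\<^sub>R x))) = (\<lambda>t. 0)"
    using assms by (auto simp: indicator_def fun_eq_iff)
  then show ?thesis by (simp add: avg_def)
qed

lemma compact_dilates:
  assumes "compact S" "0 < p"
  shows "compact ((\<lambda>(t, y). (1 / t) *\<^sub>R y) ` ({p..q} \<times> (S :: 'a::real_normed_vector set)))"
  using assms
  by (intro compact_continuous_image compact_Times compact_Icc)
    (auto simp: case_prod_beta intro!: continuous_intros)

lemma avg_outside_dilates:
  assumes "0 < p" "\<And>x. x \<notin> S \<Longrightarrow> \<psi> x = 0" "x \<notin> (\<lambda>(t, y). (1 / t) *\<^sub>R y) ` ({p..q} \<times> S)"
  shows "avg p q m \<psi> x = 0"
proof (rule avg_outside[OF assms(1,2)])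
  fix t assume t: "p \<le> t" "t \<le> q"
  show "t *\<^sub>R x \<notin> S"
  proof
    assume "t *\<^sub>R x \<in> S"
    then have "(\<lambda>(t, y). (1 / t) *\<^sub>R y) (t, t *\<^sub>R x) \<in> (\<lambda>(t, y). (1 / t) *\<^sub>R y) ` ({p..q} \<times> S)"
      using t by (intro imageI) auto
    then show False using assms(1,3) t by simp
  qed
qed

lemma avg_tf:
  assumes \<psi>: "\<psi> \<in> tf" and p: "0 < p" shows "avg p q m \<psi> \<in> tf"
proof -
  obtain S where S: "compact S" "\<And>x. x \<notin> S \<Longrightarrow> \<psi> x = 0" using \<psi> by (auto simp: test_functions_iff)
  have "smooth (avg p q m \<psi>)"
    unfolding avg_superpose
    by (rule superpose_smooth[where S="\<bar>p\<bar> + \<bar>q\<bar>"])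
      (use \<psi> in \<open>auto intro!: integrable_indicator_continuous continuous_intros simp: max_def min_def\<close>)
  then show ?thesis
    by (rule test_functionsI[OF _ compact_dilates[OF S(1) p, of q]]) (auto intro: avg_outside_dilates[OF p S(2)])
qed

lemma avg_sum:
  assumes "\<And>i. i \<in> I \<Longrightarrow> \<psi> i \<in> tf"
  shows "avg p q m (\<lambda>x. \<Sum>i\<in>I. \<psi> i x) x = (\<Sum>i\<in>I. avg p q m (\<psi> i) x)"
proof -
  have "integrable lborel (\<lambda>t. indicator {p..q} t * (t ^ m * \<psi> i (t *\<^sub>R x)))" if "i \<in> I" for i
    using assms[OF that]
    by (intro integrable_indicator_continuous continuous_intros tf_compose_continuous)
  then show ?thesis by (simp add: avg_def sum_distrib_left)
qed

text \<open>This integrates the infinitesimal generator \<open>x\<close> of the dilations, so its divergence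
  is a difference of two dilates.\<close>

definition dil_field :: "real \<Rightarrow> real \<Rightarrow> (real^'n \<Rightarrow> real) \<Rightarrow> 'n \<Rightarrow> real^'n \<Rightarrow> real" where
  "dil_field p q \<psi> i x = x $ i * avg p q (CARD('n) - 1) \<psi> x"

lemma dil_field_tf: "\<psi> \<in> tf \<Longrightarrow> 0 < p \<Longrightarrow> dil_field p q \<psi> i \<in> tf"
  unfolding dil_field_def[abs_def] by (intro test_functions_mult_right smooth_nth avg_tf)

text \<open>With \<open>n\<close> the dimension, the divergence under the integral is
  \<open>n t^(n-1) \<psi>(t x) + t^n x \<cdot> grad \<psi>(t x)\<close>, which is the derivative in
  \<open>t\<close> of \<open>t^n \<psi>(t x)\<close>. The fundamental theorem of calculus leaves the
  two end points.\<close>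

lemma div_dil_field:
  fixes \<psi> :: "real^'n \<Rightarrow> real"
  assumes \<psi>: "\<psi> \<in> tf" and p: "0 < p" "p \<le> q"
  shows "(\<Sum>i\<in>UNIV. partial_deriv i (dil_field p q \<psi> i) x) = dil q \<psi> x - dil p \<psi> x"
proof -
  let ?n = "CARD('n)"
  have n: "Suc (?n - 1) = ?n" by simp
  have a: "avg p q (?n - 1) \<psi> \<in> tf" by (rule avg_tf[OF \<psi> p(1)])
  have "partial_deriv i (dil_field p q \<psi> i) x
      = x $ i * avg p q ?n (partial_deriv i \<psi>) x + avg p q (?n - 1) \<psi> x" for i
    unfolding dil_field_def[abs_def]
    by (subst partial_deriv_mult[OF smooth_nth test_functions_smooth[OF a]])
      (simp add: partial_deriv_nth partial_avg[OF \<psi>] n)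
  then have "(\<Sum>i\<in>UNIV. partial_deriv i (dil_field p q \<psi> i) x)
      = (\<Sum>i\<in>UNIV. x $ i * avg p q ?n (partial_deriv i \<psi>) x) + ?n * avg p q (?n - 1) \<psi> x"
    by (simp add: sum.distrib)
  also have "\<dots> = (LINT t|lborel. indicator {p..q} t *\<^sub>R
     (?n * t ^ (?n - 1) * \<psi> (t *\<^sub>R x) + t ^ ?n * (\<Sum>i\<in>UNIV. x $ i * partial_deriv i \<psi> (t *\<^sub>R x))))"
  proof -
    have 1: "integrable lborel (\<lambda>t. indicator {p..q} t * (t ^ ?n * partial_deriv i \<psi> (t *\<^sub>R x)))" for i
      by (intro integrable_indicator_continuous continuous_intros tf_compose_continuous test_functions_partial \<psi>)
    have 2: "integrable lborel (\<lambda>t. indicator {p..q} t * (t ^ (?n - 1) * \<psi> (t *\<^sub>R x)))"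
      by (intro integrable_indicator_continuous continuous_intros tf_compose_continuous \<psi>)
    have "(\<Sum>i\<in>UNIV. x $ i * avg p q ?n (partial_deriv i \<psi>) x) + ?n * avg p q (?n - 1) \<psi> x
      = (LINT t|lborel. (\<Sum>i\<in>UNIV. x $ i * (indicator {p..q} t * (t ^ ?n * partial_deriv i \<psi> (t *\<^sub>R x))))
          + ?n * (indicator {p..q} t * (t ^ (?n - 1) * \<psi> (t *\<^sub>R x))))"
      unfolding avg_def using 1 2 by simp
    also have "\<dots> = (LINT t|lborel. indicator {p..q} t *\<^sub>R
     (?n * t ^ (?n - 1) * \<psi> (t *\<^sub>R x) + t ^ ?n * (\<Sum>i\<in>UNIV. x $ i * partial_deriv i \<psi> (t *\<^sub>R x))))"
      by (rule arg_cong[where f="integral\<^sup>L lborel"]) (simp add: fun_eq_iff sum_distrib_left algebra_simps)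
    finally show ?thesis .
  qed
  also have "\<dots> = q ^ ?n * \<psi> (q *\<^sub>R x) - p ^ ?n * \<psi> (p *\<^sub>R x)"
  proof (rule integral_FTC_atLeastAtMost[OF p(2)])
    fix t
    have "((\<lambda>t. t *\<^sub>R x) has_derivative (\<lambda>s. s *\<^sub>R x)) (at t)" by (auto intro!: derivative_eq_intros)
    from has_derivative_compose[OF this smooth_has_derivative[OF test_functions_smooth[OF \<psi>]]]
    moreover have "(\<lambda>s. \<Sum>i\<in>UNIV. (s *\<^sub>R x) $ i *\<^sub>R partial_deriv i \<psi> (t *\<^sub>R x))
        = (*) (\<Sum>i\<in>UNIV. x $ i * partial_deriv i \<psi> (t *\<^sub>R x))"
      by (simp add: fun_eq_iff sum_distrib_left sum_distrib_right mult_ac)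
    ultimately have 1: "((\<lambda>t. \<psi> (t *\<^sub>R x)) has_real_derivative (\<Sum>i\<in>UNIV. x $ i * partial_deriv i \<psi> (t *\<^sub>R x))) (at t)"
      unfolding has_field_derivative_def by simp
    have "((\<lambda>t. t ^ ?n * \<psi> (t *\<^sub>R x)) has_real_derivative
       ?n * t ^ (?n - 1) * \<psi> (t *\<^sub>R x) + t ^ ?n * (\<Sum>i\<in>UNIV. x $ i * partial_deriv i \<psi> (t *\<^sub>R x))) (at t)"
      by (rule derivative_eq_intros 1 refl)+ (simp add: algebra_simps)
    then show "((\<lambda>t. t ^ ?n * \<psi> (t *\<^sub>R x)) has_vector_derivative
       ?n * t ^ (?n - 1) * \<psi> (t *\<^sub>R x) + t ^ ?n * (\<Sum>i\<in>UNIV. x $ i * partial_deriv i \<psi> (t *\<^sub>R x))) (at t within {p..q})"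
      by (simp add: has_real_derivative_iff_has_vector_derivative has_vector_derivative_at_within)
  next
    show "continuous_on {p..q} (\<lambda>t. ?n * t ^ (?n - 1) * \<psi> (t *\<^sub>R x) + t ^ ?n * (\<Sum>i\<in>UNIV. x $ i * partial_deriv i \<psi> (t *\<^sub>R x)))"
      by (intro continuous_intros tf_compose_continuous test_functions_partial \<psi>)
  qed
  finally show ?thesis by (simp add: dil_def)
qed

lemma divform_dil_diff: "\<psi> \<in> tf \<Longrightarrow> 0 < p \<Longrightarrow> p \<le> q \<Longrightarrow> divform (\<lambda>x. dil q \<psi> x - dil p \<psi> x)"
  unfolding divform_def
  by (intro exI[of _ "dil_field p q \<psi>"]) (simp add: dil_field_tf div_dil_field)

text \<open>A derivative taken inside the average brings out one power of \<open>t\<close>; this is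
  why the exponent must be a successor.\<close>

lemma divform_avg:
  assumes "divform \<kappa>" "0 < p" shows "divform (avg p q (Suc m) \<kappa>)"
proof -
  obtain \<omega> where \<omega>: "\<And>i. \<omega> i \<in> tf" "\<kappa> = (\<lambda>x. \<Sum>i\<in>UNIV. partial_deriv i (\<omega> i) x)"
    using assms unfolding divform_def by blast
  have "avg p q (Suc m) \<kappa> = (\<lambda>x. \<Sum>i\<in>UNIV. partial_deriv i (avg p q m (\<omega> i)) x)"
    unfolding \<omega>(2) by (rule ext) (simp add: \<omega>(1) partial_avg avg_sum test_functions_partial)
  then show ?thesis
    unfolding divform_def using \<omega>(1) assms(2) by (intro exI[of _ "\<lambda>i. avg p q m (\<omega> i)"]) (simp add: avg_tf)
qed

lemma divform_cmult:
  assumes "divform \<kappa>" shows "divform (\<lambda>x. c * \<kappa> x)"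
proof -
  obtain \<omega> where \<omega>: "\<And>i. \<omega> i \<in> tf" "\<kappa> = (\<lambda>x. \<Sum>i\<in>UNIV. partial_deriv i (\<omega> i) x)"
    using assms unfolding divform_def by blast
  have "(\<lambda>x. c * \<kappa> x) = (\<lambda>x. \<Sum>i\<in>UNIV. partial_deriv i (\<lambda>x. c * \<omega> i x) x)"
    unfolding \<omega>(2) by (rule ext) (simp add: \<omega>(1) partial_deriv_cmult tf_smooth sum_distrib_left)
  then show ?thesis
    unfolding divform_def using \<omega>(1) by (intro exI[of _ "\<lambda>i x. c * \<omega> i x"]) (simp add: test_functions_cmult)
qed

section \<open>Multiscale homotopy operators\<close>

text \<open>The operator \<open>K\<^sub>N\<close> of the overview for a single component of the
  vector kernel. The scales run from 0 to \<open>N - 1\<close>.\<close>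

definition hop :: "(real^'n \<Rightarrow> real) \<Rightarrow> (real^'n \<Rightarrow> real) \<Rightarrow> nat \<Rightarrow> (real^'n \<Rightarrow> real) \<Rightarrow> real^'n \<Rightarrow> real" where
  "hop \<beta> B N f x = (\<Sum>k<N. (1/2) ^ k * conv (dil (2^k) \<beta>) (conv (dil (2^k) B) f) x)"

lemma hop_tf: "\<beta> \<in> tf \<Longrightarrow> B \<in> tf \<Longrightarrow> f \<in> tf \<Longrightarrow> hop \<beta> B N f \<in> tf"
  unfolding hop_def[abs_def] by (intro test_functions_sum test_functions_cmult conv_tf dil_tf) auto

lemma partial_hop:
  assumes "\<beta> \<in> tf" "B \<in> tf" "f \<in> tf"
  shows "partial_deriv i (hop \<beta> B N f) = hop \<beta> B N (partial_deriv i f)"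
proof
  fix x
  have "smooth (\<lambda>x. (1/2) ^ k * conv (dil (2^k) \<beta>) (conv (dil (2^k) B) f) x)"
    "smooth (conv (dil (2^k) \<beta>) (conv (dil (2^k) B) f))" for k :: nat
    using assms by (auto intro!: test_functions_smooth[of _ UNIV] test_functions_cmult conv_tf dil_tf)
  then show "partial_deriv i (hop \<beta> B N f) x = hop \<beta> B N (partial_deriv i f) x"
    using assms
    by (simp add: hop_def[abs_def] partial_deriv_sum partial_deriv_cmult partial_deriv_cdivide partial_conv_right conv_tf dil_tf)
qed

text \<open>Differentiating the dilated \<open>\<beta>\<close> produces \<open>2^k\<close>, which
  cancels the weight. This form telescopes when summed over the components.\<close>

lemma partial_hop_left:
  assumes "\<beta> \<in> tf" "B \<in> tf" "f \<in> tf"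
  shows "partial_deriv i (hop \<beta> B N f) x
    = (\<Sum>k<N. conv (dil (2^k) (partial_deriv i \<beta>)) (conv (dil (2^k) B) f) x)"
proof -
  have "smooth (\<lambda>x. (1/2) ^ k * conv (dil (2^k) \<beta>) (conv (dil (2^k) B) f) x)"
    "smooth (conv (dil (2^k) \<beta>) (conv (dil (2^k) B) f))" for k :: nat
    using assms by (auto intro!: test_functions_smooth[of _ UNIV] test_functions_cmult conv_tf dil_tf)
  then show ?thesis
    using assms
    by (simp add: hop_def[abs_def] partial_deriv_sum partial_deriv_cmult partial_deriv_cdivide partial_conv_left conv_tf dil_tf
        partial_dil conv_cmult_left power_one_over)
qed

text \<open>The same cancellation of weights with the derivative on \<open>B\<close> instead, which
  leaves two kernels of divergence form whenever \<open>\<beta>\<close> is one; this is the form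
  that admits the \<open>L\<^sup>2\<close> bound.\<close>

lemma partial_hop_middle:
  assumes "\<beta> \<in> tf" "B \<in> tf" "f \<in> tf"
  shows "partial_deriv i (hop \<beta> B N f) x
    = (\<Sum>k<N. conv (dil (2^k) \<beta>) (conv (dil (2^k) (partial_deriv i B)) f) x)"
proof -
  have "smooth (\<lambda>x. (1/2) ^ k * conv (dil (2^k) \<beta>) (conv (dil (2^k) B) f) x)"
    "smooth (conv (dil (2^k) \<beta>) (conv (dil (2^k) B) f))" for k :: nat
    using assms by (auto intro!: test_functions_smooth[of _ UNIV] test_functions_cmult conv_tf dil_tf)
  moreover have "partial_deriv i (conv (dil (2^k) \<beta>) (conv (dil (2^k) B) f))
      = (\<lambda>x. 2^k * conv (dil (2^k) \<beta>) (conv (dil (2^k) (partial_deriv i B)) f) x)" for k :: nat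
    using assms
    by (subst partial_conv_right)
      (simp_all add: partial_conv_left conv_tf dil_tf partial_dil conv_cmult_left conv_cmult_right)
  ultimately show ?thesis
    by (simp add: hop_def[abs_def] partial_deriv_sum partial_deriv_cmult partial_deriv_cdivide power_one_over)
qed

lemma hop_add:
  assumes "\<beta> \<in> tf" "B \<in> tf" "f \<in> tf" "g \<in> tf"
  shows "hop \<beta> B N (\<lambda>x. f x + g x) = (\<lambda>x. hop \<beta> B N f x + hop \<beta> B N g x)"
  using assms by (simp add: hop_def fun_eq_iff conv_add_right conv_tf dil_tf distrib_left sum.distrib)

lemma hop_sum:
  assumes "\<beta> \<in> tf" "B \<in> tf" "\<And>i. i \<in> I \<Longrightarrow> f i \<in> tf"
  shows "hop \<beta> B N (\<lambda>x. \<Sum>i\<in>I. f i x) = (\<lambda>x. \<Sum>i\<in>I. hop \<beta> B N (f i) x)"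
  using assms
  by (simp add: hop_def fun_eq_iff conv_sum_right conv_tf dil_tf sum_distrib_left sum.swap[of _ I])

lemma hop_adjoint:
  assumes \<beta>: "\<beta> \<in> tf" and B: "B \<in> tf" and f: "f \<in> tf" and g: "g \<in> tf"
  shows "(LINT x|lborel. hop \<beta> B N f x * g x)
    = (LINT x|lborel. f x * hop (\<lambda>x. \<beta> (- x)) (\<lambda>x. B (- x)) N g x)"
proof -
  let ?\<beta>' = "\<lambda>x. \<beta> (- x)" and ?B' = "\<lambda>x. B (- x)"
  have \<beta>': "?\<beta>' \<in> tf" and B': "?B' \<in> tf" using \<beta> B by (simp_all add: tf_minus)
  have pos: "(2::real) ^ k > 0" for k by simp
  have "(LINT x|lborel. conv (dil (2^k) \<beta>) (conv (dil (2^k) B) f) x * g x)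
     = (LINT x|lborel. f x * conv (dil (2^k) ?\<beta>') (conv (dil (2^k) ?B') g) x)" for k :: nat
  proof -
    have "(LINT x|lborel. conv (dil (2^k) \<beta>) (conv (dil (2^k) B) f) x * g x)
      = (LINT x|lborel. conv (dil (2^k) B) f x * conv (dil (2^k) ?\<beta>') g x)"
      using conv_adjoint[OF dil_tf[OF \<beta> pos] conv_tf[OF dil_tf[OF B pos] f] g] by (simp add: dil_minus)
    also have "\<dots> = (LINT x|lborel. f x * conv (dil (2^k) ?B') (conv (dil (2^k) ?\<beta>') g) x)"
      using conv_adjoint[OF dil_tf[OF B pos] f conv_tf[OF dil_tf[OF \<beta>' pos] g]] by (simp add: dil_minus)
    \<comment> \<open>Taking adjoints reverses the order of the two convolutions; as they commute,
      the adjoint is again of the form \<open>hop\<close>, with reflected kernels.\<close>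
    finally show ?thesis
      by (simp add: conv_left_commute[OF dil_tf[OF B' pos] dil_tf[OF \<beta>' pos] g])
  qed
  note term_eq = this
  have i1: "integrable lborel (\<lambda>x. conv (dil (2^k) \<beta>) (conv (dil (2^k) B) f) x * g x)" for k :: nat
    by (intro test_function_integrable tf_mult conv_tf dil_tf \<beta> B f g pos)
  have i2: "integrable lborel (\<lambda>x. f x * conv (dil (2^k) ?\<beta>') (conv (dil (2^k) ?B') g) x)" for k :: nat
    by (intro test_function_integrable tf_mult conv_tf dil_tf \<beta>' B' f g pos)
  have "(LINT x|lborel. hop \<beta> B N f x * g x)
    = (LINT x|lborel. (\<Sum>k<N. (1/2) ^ k * (conv (dil (2^k) \<beta>) (conv (dil (2^k) B) f) x * g x)))"
    by (simp add: hop_def sum_distrib_right mult.assoc)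
  also have "\<dots> = (\<Sum>k<N. (1/2) ^ k * (LINT x|lborel. conv (dil (2^k) \<beta>) (conv (dil (2^k) B) f) x * g x))"
    using i1 by simp
  also have "\<dots> = (\<Sum>k<N. (1/2) ^ k * (LINT x|lborel. f x * conv (dil (2^k) ?\<beta>') (conv (dil (2^k) ?B') g) x))"
    by (simp only: term_eq)
  also have "\<dots> = (LINT x|lborel. (\<Sum>k<N. (1/2) ^ k * (f x * conv (dil (2^k) ?\<beta>') (conv (dil (2^k) ?B') g) x)))"
    using i2 by simp
  also have "\<dots> = (LINT x|lborel. f x * hop ?\<beta>' ?B' N g x)"
    by (simp add: hop_def sum_distrib_left mult.left_commute)
  finally show ?thesis .
qed

lemma sum_half_power: "(\<Sum>k<N. (1/2::real) ^ k) \<le> 2"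
  by (simp add: sum_gp_strict)

lemma hop_scale_bound:
  assumes "\<beta> \<in> tf" "B \<in> tf" "f \<in> tf"
  shows "n2 (conv (dil (2^k) \<beta>) (conv (dil (2^k) B) f)) \<le> nrm1 \<beta> * nrm1 B * n2 f"
proof -
  have "n2 (conv (dil (2^k) \<beta>) (conv (dil (2^k) B) f)) \<le> nrm1 \<beta> * n2 (conv (dil (2^k) B) f)"
    using Young[OF dil_tf conv_tf[OF dil_tf], of \<beta> "2^k" B "2^k" f] assms by (simp add: nrm1_dil)
  also have "\<dots> \<le> nrm1 \<beta> * (nrm1 B * n2 f)"
    using Young[OF dil_tf, of B "2^k" f] assms by (intro mult_left_mono) (auto simp: nrm1_dil nrm1_nonneg)
  finally show ?thesis by simp
qed

lemma n2_hop_le_sum: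
  assumes "\<beta> \<in> tf" "B \<in> tf" "f \<in> tf"
  shows "n2 (hop \<beta> B N f) \<le> (\<Sum>k<N. (1/2)^k * n2 (conv (dil (2^k) \<beta>) (conv (dil (2^k) B) f)))"
proof -
  have "n2 (hop \<beta> B N f) \<le> (\<Sum>k<N. n2 (\<lambda>x. (1/2)^k * conv (dil (2^k) \<beta>) (conv (dil (2^k) B) f) x))"
    unfolding hop_def[abs_def]
    by (intro nrm_sum sqint_cmult test_function_sqint conv_tf dil_tf assms) auto
  then show ?thesis by (simp add: nrm_cmult)
qed

text \<open>For the function itself the weights \<open>2^-k\<close> are summable. For its
  derivatives no weight is left, and the cancellation in both kernels has to bound the sum.\<close>

lemma hop_H1_bound:
  assumes \<beta>: "divform \<beta>" and B: "B \<in> tf"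
  shows "\<exists>C\<ge>0. \<forall>f\<in>tf. \<forall>N. n2 (hop \<beta> B N f) \<le> C * n2 f \<and>
     (\<forall>i. n2 (partial_deriv i (hop \<beta> B N f)) \<le> C * n2 f)"
proof -
  have \<beta>tf: "\<beta> \<in> tf" by (rule divform_tf[OF \<beta>])
  have "\<exists>C\<ge>0. \<forall>f\<in>tf. \<forall>N. n2 (\<lambda>x. \<Sum>k<N. conv (dil (2^k) \<beta>) (conv (dil (2^k) (partial_deriv i B)) f) x) \<le> C * n2 f" for i
    by (rule multiscale_bound[OF \<beta> divform_partial[OF B]])
  then have "\<forall>i. \<exists>C. C \<ge> 0 \<and> (\<forall>f\<in>tf. \<forall>N.
      n2 (\<lambda>x. \<Sum>k<N. conv (dil (2^k) \<beta>) (conv (dil (2^k) (partial_deriv i B)) f) x) \<le> C * n2 f)"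
    by (rule allI)
  from choice[OF this] obtain D where D: "\<And>i. D i \<ge> 0" "\<And>i f N. f \<in> tf \<Longrightarrow>
      n2 (\<lambda>x. \<Sum>k<N. conv (dil (2^k) \<beta>) (conv (dil (2^k) (partial_deriv i B)) f) x) \<le> D i * n2 f"
    by auto
  define C where "C = 2 * (nrm1 \<beta> * nrm1 B) + (\<Sum>i\<in>UNIV. D i)"
  have C0: "C \<ge> 0" unfolding C_def by (intro add_nonneg_nonneg mult_nonneg_nonneg nrm1_nonneg sum_nonneg D) auto
  have "n2 (hop \<beta> B N f) \<le> C * n2 f" if f: "f \<in> tf" for f N
  proof -
    have "n2 (hop \<beta> B N f) \<le> (\<Sum>k<N. (1/2)^k * n2 (conv (dil (2^k) \<beta>) (conv (dil (2^k) B) f)))"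
      by (rule n2_hop_le_sum[OF \<beta>tf B f])
    also have "\<dots> \<le> (\<Sum>k<N. (1/2)^k * (nrm1 \<beta> * nrm1 B * n2 f))"
      by (intro sum_mono mult_left_mono hop_scale_bound \<beta>tf B f) auto
    also have "\<dots> = (\<Sum>k<N. (1/2)^k) * (nrm1 \<beta> * nrm1 B * n2 f)" by (simp add: sum_distrib_right)
    also have "\<dots> \<le> 2 * (nrm1 \<beta> * nrm1 B * n2 f)"
      by (intro mult_right_mono sum_half_power) (simp add: nrm1_nonneg nrm_nonneg)
    also have "\<dots> \<le> C * n2 f"
    proof -
      have "2 * (nrm1 \<beta> * nrm1 B) \<le> C" using D(1) by (simp add: C_def sum_nonneg)
      from mult_right_mono[OF this nrm_nonneg[of lborel f]] show ?thesis by (simp add: mult.assoc)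
    qed
    finally show ?thesis .
  qed
  moreover have "n2 (partial_deriv i (hop \<beta> B N f)) \<le> C * n2 f" if f: "f \<in> tf" for f N i
  proof -
    have "partial_deriv i (hop \<beta> B N f) = (\<lambda>x. \<Sum>k<N. conv (dil (2^k) \<beta>) (conv (dil (2^k) (partial_deriv i B)) f) x)"
      by (simp add: fun_eq_iff partial_hop_middle[OF \<beta>tf B f])
    then have "n2 (partial_deriv i (hop \<beta> B N f)) \<le> D i * n2 f" using D(2)[OF f] by simp
    also have "\<dots> \<le> C * n2 f"
    proof (rule mult_right_mono)
      have "D i \<le> (\<Sum>i\<in>UNIV. D i)" by (rule member_le_sum) (auto simp: D)
      moreover have "0 \<le> 2 * (nrm1 \<beta> * nrm1 B)" by (simp add: nrm1_nonneg)
      ultimately show "D i \<le> C" unfolding C_def by linarith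
    qed (simp add: nrm_nonneg)
    finally show ?thesis .
  qed
  ultimately show ?thesis using C0 by blast
qed

text \<open>A truncated convex cone with apex at the origin, open in its directions. For
  \<open>v = 0\<close> it is a ball around the origin, which covers the neighbourhoods of interior
  points of the domain.\<close>

definition cone_seg :: "'a::real_normed_vector \<Rightarrow> real \<Rightarrow> real \<Rightarrow> 'a set" where
  "cone_seg v \<rho> \<tau> = {s *\<^sub>R e | s e. 0 < s \<and> s \<le> \<tau> \<and> e \<in> ball v \<rho>}"

text \<open>The sum of \<open>s e\<close> and \<open>t f\<close> is \<open>s + t\<close> times a
  convex combination of \<open>e\<close> and \<open>f\<close>, and the ball of directions is
  convex.\<close>

lemma cone_seg_add:
  assumes "a \<in> cone_seg v \<rho> \<sigma>" "b \<in> cone_seg v \<rho> \<tau>"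
  shows "a + b \<in> cone_seg v \<rho> (\<sigma> + \<tau>)"
proof -
  obtain s e where a: "a = s *\<^sub>R e" "0 < s" "s \<le> \<sigma>" "e \<in> ball v \<rho>"
    using assms(1) unfolding cone_seg_def by blast
  obtain t f where b: "b = t *\<^sub>R f" "0 < t" "t \<le> \<tau>" "f \<in> ball v \<rho>"
    using assms(2) unfolding cone_seg_def by blast
  let ?g = "(s / (s + t)) *\<^sub>R e + (t / (s + t)) *\<^sub>R f"
  have "s / (s + t) + t / (s + t) = 1" using a b by (simp flip: add_divide_distrib)
  then have "?g \<in> ball v \<rho>"
    using a b by (intro convexD[OF convex_ball]) auto
  moreover have "a + b = (s + t) *\<^sub>R ?g"
    using a b by (simp add: scaleR_add_right)
  ultimately show ?thesis
    unfolding cone_seg_def using a b by (intro CollectI exI[of _ "s + t"] exI[of _ ?g]) auto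
qed

lemma cone_seg_scale:
  assumes "a \<in> cone_seg v \<rho> \<tau>" "0 < c" "c \<le> 1"
  shows "c *\<^sub>R a \<in> cone_seg v \<rho> \<tau>"
proof -
  obtain s e where a: "a = s *\<^sub>R e" "0 < s" "s \<le> \<tau>" "e \<in> ball v \<rho>"
    using assms(1) unfolding cone_seg_def by blast
  have "c * s \<le> 1 * s" using assms a by (intro mult_right_mono) auto
  then have "c * s \<le> \<tau>" using a by linarith
  then show ?thesis
    unfolding cone_seg_def using a assms by (intro CollectI exI[of _ "c * s"] exI[of _ e]) auto
qed

lemma normalized_bump_exists:
  assumes r: "r > 0"
  shows "\<exists>\<phi>\<in>test_functions UNIV. (\<forall>x. (0::real) \<le> \<phi> x) \<and> (\<forall>x::real^'n. x \<notin> cball c r \<longrightarrow> \<phi> x = 0)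
    \<and> (LINT x|lborel. \<phi> x) = 1"
proof -
  obtain \<phi> :: "real^'n \<Rightarrow> real" where \<phi>: "\<phi> \<in> tf" "\<And>x. 0 \<le> \<phi> x" "\<And>x. 0 < \<phi> x \<longleftrightarrow> x \<in> ball c r"
    using bump_exists[OF r, of c] by auto
  define I where "I = (LINT x|lborel. \<phi> x)"
  have "I \<noteq> 0"
  proof
    assume "I = 0"
    then have "AE x in lborel. \<phi> x = 0"
      using integral_nonneg_eq_0_iff_AE[OF test_function_integrable[OF \<phi>(1)]] \<phi>(2) by (simp add: I_def)
    moreover have "x \<notin> ball c r" if "\<phi> x = 0" for x
      using \<phi>(3)[of x] that by simp
    ultimately have "AE x in lborel. x \<notin> ball c r" by (rule eventually_mono)
    then have "ball c r \<in> null_sets lborel"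
      by (subst (asm) AE_iff_null) (auto simp: ball_def)
    then have "negligible (ball c r)"
      unfolding negligible_iff_null_sets by (rule null_sets_completionI)
    then show False using open_not_negligible[of "ball c r"] r by simp
  qed
  moreover have "I \<ge> 0" using \<phi>(2) by (simp add: I_def)
  ultimately have I: "I > 0" by simp
  have out: "\<phi> x = 0" if "x \<notin> cball c r" for x
    using \<phi>(2)[of x] \<phi>(3)[of x] that by auto
  show ?thesis
  proof (intro bexI conjI allI impI)
    show "(\<lambda>x. (1 / I) * \<phi> x) \<in> tf" by (rule test_functions_cmult[OF \<phi>(1)])
    show "(LINT x|lborel. (1 / I) * \<phi> x) = 1" using I by (simp add: I_def)
  qed (use \<phi>(2) I out in auto)
qed

text \<open>With \<open>b\<^sub>k\<close> the dilate of \<open>b\<close> by \<open>2^k\<close>, the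
  sum telescopes as \<open>\<beta>\<close> has divergence \<open>b\<^sub>1 - b\<^sub>0\<close> and
  \<open>B\<close> is \<open>b\<^sub>1 + b\<^sub>0\<close>. Supports are kept in the half-length
  cone because an application of \<open>hop\<close> convolves twice.\<close>

lemma homotopy_kernels:
  fixes v :: "real^3"
  assumes \<rho>: "\<rho> > 0"
  obtains b \<beta> B S where "b \<in> tf" "(LINT x|lborel. b x) = 1" "\<And>j. divform (\<beta> j)" "B \<in> tf"
    "\<And>f N x. f \<in> tf \<Longrightarrow> (\<Sum>j\<in>UNIV. partial_deriv j (hop (\<beta> j) B N f) x)
          = conv (dil (2^N) b) (conv (dil (2^N) b) f) x - conv b (conv b f) x"
    "compact S" "S \<subseteq> cone_seg v \<rho> (1/2)" "\<And>j x. x \<notin> S \<Longrightarrow> \<beta> j x = 0" "\<And>x. x \<notin> S \<Longrightarrow> B x = 0"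
proof -
  \<comment> \<open>Blown up by 4 this ball lies in \<open>ball v \<rho>\<close>. So it sits at
    height 1/4 of the cone, and its double at height 1/2 is still admissible.\<close>
  define S0 where "S0 = cball ((1/4) *\<^sub>R v) (\<rho> / 16)"
  obtain \<eta> :: "real^3 \<Rightarrow> real" where \<eta>: "\<eta> \<in> tf" "\<And>x. x \<notin> S0 \<Longrightarrow> \<eta> x = 0" "(LINT x|lborel. \<eta> x) = 1"
    using normalized_bump_exists[of "\<rho> / 16" "(1/4) *\<^sub>R v"] \<rho> unfolding S0_def by auto
  text \<open>The first moments of \<open>b\<close> vanish, which makes \<open>z\<^sub>j b(z)\<close> a divergence.\<close>
  define b where "b x = 2 * \<eta> x - dil (1/2) \<eta> x" for x
  have b: "b \<in> tf"
    unfolding b_def[abs_def] by (intro test_functions_diff test_functions_cmult dil_tf \<eta>) auto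
  have b1: "(LINT x|lborel. b x) = 1"
    unfolding b_def using \<eta> by (simp add: test_function_integrable dil_tf integral_dil tf_borel)
  define \<beta> where "\<beta> = dil_field 1 2 b"
  define B where "B x = dil 2 b x + b x" for x
  have B: "B \<in> tf" unfolding B_def[abs_def] by (intro test_functions_add dil_tf b) auto
  have \<beta>: "\<beta> j \<in> tf" for j unfolding \<beta>_def by (intro dil_field_tf b) auto
  have div: "divform (\<beta> j)" for j
  proof -
    \<comment> \<open>In \<open>dil (1/2) \<zeta>\<close> the coordinate contributes an extra 1/2,
      which matches the coefficients 2 and 1 in \<open>b\<close>: thus \<open>x $ j * b x\<close> is
      twice a difference of dilates of \<open>\<zeta>\<close>, hence a divergence.\<close>
    define \<zeta> where "\<zeta> x = x $ j * \<eta> x" for x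
    have \<zeta>: "\<zeta> \<in> tf" unfolding \<zeta>_def[abs_def] by (intro test_functions_mult_right smooth_nth \<eta>)
    have "divform (\<lambda>x. 2 * (dil 1 \<zeta> x - dil (1/2) \<zeta> x))"
      by (intro divform_cmult divform_dil_diff \<zeta>) auto
    also have "(\<lambda>x. 2 * (dil 1 \<zeta> x - dil (1/2) \<zeta> x)) = (\<lambda>x. x $ j * b x)"
      by (simp add: fun_eq_iff dil_def \<zeta>_def b_def algebra_simps)
    finally have "divform (avg 1 2 (Suc 0) (\<lambda>x. x $ j * b x))"
      by (rule divform_avg) simp
    \<comment> \<open>The coordinate inside the average brings a second power of \<open>t\<close>,
      giving the exponent 2, the dimension minus one, of \<open>dil_field\<close>.\<close>
    moreover have "avg 1 2 (Suc 0) (\<lambda>x. x $ j * b x) = \<beta> j"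
    proof
      fix x
      have "avg 1 2 (Suc 0) (\<lambda>x. x $ j * b x) x = (LINT t|lborel. x $ j * (indicator {1..2} t * (t ^ 2 * b (t *\<^sub>R x))))"
        unfolding avg_def by (rule arg_cong[where f="integral\<^sup>L lborel"]) (simp add: fun_eq_iff power2_eq_square mult_ac)
      then show "avg 1 2 (Suc 0) (\<lambda>x. x $ j * b x) x = \<beta> j x"
        by (simp add: \<beta>_def dil_field_def avg_def)
    qed
    ultimately show ?thesis by simp
  qed
  define Sb where "Sb = S0 \<union> (\<lambda>y. 2 *\<^sub>R y) ` S0"
  \<comment> \<open>\<open>S\<close> contains the supports of all dilates of \<open>b\<close> by
    factors between 1 and 2: those averaged in \<open>\<beta>\<close> and the two that make up
    \<open>B\<close>.\<close>
  define S where "S = (\<lambda>(t, y). (1 / t) *\<^sub>R y) ` ({1..2} \<times> Sb)"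
  have bS: "b x = 0" if "x \<notin> Sb" for x
  proof -
    have "(1/2) *\<^sub>R x \<notin> S0"
    proof
      assume "(1/2) *\<^sub>R x \<in> S0"
      then have "2 *\<^sub>R ((1/2) *\<^sub>R x) \<in> Sb" unfolding Sb_def by blast
      then show False using that by simp
    qed
    then show ?thesis using that \<eta>(2) by (simp add: b_def dil_def Sb_def)
  qed
  have S: "compact S"
    unfolding S_def Sb_def S0_def
    by (intro compact_dilates compact_Un compact_scaling compact_cball) auto
  have "Sb \<subseteq> cone_seg v \<rho> (1/2)"
  proof
    fix x assume "x \<in> Sb"
    then obtain s y where s: "s = 1/4 \<or> s = 1/2" and y: "y \<in> S0" and x: "x = s *\<^sub>R (4 *\<^sub>R y)"
      unfolding Sb_def by fastforce
    have "dist v (4 *\<^sub>R y) = 4 * dist ((1/4) *\<^sub>R v) y"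
      using norm_scaleR[of 4 "(1/4) *\<^sub>R v - y"] by (simp add: dist_norm scaleR_diff_right)
    also have "\<dots> \<le> 4 * (\<rho> / 16)" using y by (simp add: S0_def)
    also have "\<dots> < \<rho>" using \<rho> by simp
    finally have "4 *\<^sub>R y \<in> ball v \<rho>" by simp
    then show "x \<in> cone_seg v \<rho> (1/2)"
      unfolding cone_seg_def x using s by (intro CollectI exI[of _ s] exI[of _ "4 *\<^sub>R y"]) auto
  qed
  then have "S \<subseteq> cone_seg v \<rho> (1/2)"
    unfolding S_def by (auto intro!: cone_seg_scale simp del: scaleR_scaleR)
  moreover have "\<beta> j x = 0" if "x \<notin> S" for j x
    using avg_outside_dilates[of 1 Sb b x 2] bS that unfolding \<beta>_def dil_field_def S_def by simp
  moreover have "B x = 0" if "x \<notin> S" for x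
  proof -
    have "t *\<^sub>R x \<notin> Sb" if "1 \<le> t" "t \<le> 2" for t
    proof
      assume "t *\<^sub>R x \<in> Sb"
      then have "(\<lambda>(t, y). (1 / t) *\<^sub>R y) (t, t *\<^sub>R x) \<in> S" unfolding S_def using that by (intro imageI) auto
      then show False using that \<open>x \<notin> S\<close> by simp
    qed
    from this[of 1] this[of 2] show ?thesis using bS by (simp add: B_def dil_def)
  qed
  moreover have "(\<Sum>j\<in>UNIV. partial_deriv j (hop (\<beta> j) B N f) x)
      = conv (dil (2^N) b) (conv (dil (2^N) b) f) x - conv b (conv b f) x" if f: "f \<in> tf" for f N x
  proof -
    define bk where "bk k = dil (2^k) b" for k :: nat
    have bk: "bk k \<in> tf" for k unfolding bk_def by (rule dil_tf[OF b]) simp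
    have Bk: "dil (2^k) B = (\<lambda>x. bk (Suc k) x + bk k x)" for k
      by (simp add: bk_def B_def[abs_def] dil_def fun_eq_iff power_mult_distrib algebra_simps)
    \<comment> \<open>The difference of squares \<open>(p - q) * (p + q) = p * p - q * q\<close> for
      convolution, whose mixed terms cancel by commutativity.\<close>
    have step: "(\<Sum>j\<in>UNIV. conv (dil (2^k) (partial_deriv j (\<beta> j))) (conv (dil (2^k) B) f) x)
        = conv (bk (Suc k)) (conv (bk (Suc k)) f) x - conv (bk k) (conv (bk k) f) x" for k
    proof -
      have u: "conv (dil (2^k) B) f \<in> tf" by (intro conv_tf dil_tf B f) simp
      have "(\<lambda>x. \<Sum>j\<in>UNIV. dil (2^k) (partial_deriv j (\<beta> j)) x) = (\<lambda>x. bk (Suc k) x - bk k x)"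
        unfolding dil_sum[symmetric] \<beta>_def
        by (simp add: div_dil_field[OF b])
          (simp add: bk_def dil_def fun_eq_iff power_mult_distrib algebra_simps)
      then have "(\<Sum>j\<in>UNIV. conv (dil (2^k) (partial_deriv j (\<beta> j))) (conv (dil (2^k) B) f) x)
          = conv (\<lambda>x. bk (Suc k) x - bk k x) (conv (dil (2^k) B) f) x"
        using conv_sum_left[of UNIV "\<lambda>j. dil (2^k) (partial_deriv j (\<beta> j))", OF dil_tf[OF test_functions_partial[OF \<beta>]] u]
        by (simp add: fun_eq_iff)
      also have "\<dots> = conv (bk (Suc k)) (conv (bk (Suc k)) f) x - conv (bk k) (conv (bk k) f) x"
        unfolding Bk
        using bk f by (simp add: conv_add_left conv_diff_left conv_add_right conv_tf test_functions_add
            conv_left_commute[of "bk k" "bk (Suc k)" f])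
      finally show ?thesis .
    qed
    have "(\<Sum>j\<in>UNIV. partial_deriv j (hop (\<beta> j) B N f) x)
        = (\<Sum>k<N. \<Sum>j\<in>UNIV. conv (dil (2^k) (partial_deriv j (\<beta> j))) (conv (dil (2^k) B) f) x)"
      by (simp add: partial_hop_left[OF \<beta> B f] sum.swap[of _ UNIV])
    also have "\<dots> = conv (bk N) (conv (bk N) f) x - conv (bk 0) (conv (bk 0) f) x"
      unfolding step by (rule sum_lessThan_telescope)
    also have "bk 0 = b" by (simp add: bk_def dil_def fun_eq_iff)
    finally show ?thesis by (simp add: bk_def)
  qed
  ultimately show ?thesis
    using b b1 div B S by (intro that[of b \<beta> B S])
qed

text \<open>The kernels at finer scales shrink towards the apex and stay in the cone. Two
  convolutions displace the support of \<open>f\<close> by a sum of two elements of the half-length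
  cone, that is by an element of the cone of length 1.\<close>

lemma hop_test_function:
  assumes \<beta>: "\<beta> \<in> tf" and B: "B \<in> tf" and f: "f \<in> tf"
    and S: "compact S" "S \<subseteq> cone_seg v \<rho> (1/2)" "\<And>x. x \<notin> S \<Longrightarrow> \<beta> x = 0" "\<And>x. x \<notin> S \<Longrightarrow> B x = 0"
    and L: "compact L" "\<And>x. x \<notin> L \<Longrightarrow> f x = 0"
    and \<Omega>: "\<And>x z. x \<in> L \<Longrightarrow> z \<in> cone_seg v \<rho> 1 \<Longrightarrow> x + z \<in> \<Omega>"
  shows "hop \<beta> B N f \<in> test_functions \<Omega>"
proof -
  have "conv (dil (2^k) \<beta>) (conv (dil (2^k) B) f) \<in> test_functions \<Omega>" for k :: nat
  proof -
    define Sk where "Sk = (\<lambda>y. (1 / 2^k) *\<^sub>R y) ` S"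
    have pos: "(2::real)^k > 0" by simp
    have Sk: "compact Sk" unfolding Sk_def by (intro compact_scaling S)
    have "Sk \<subseteq> cone_seg v \<rho> (1/2)"
    proof
      fix x assume "x \<in> Sk"
      then obtain y where "y \<in> S" "x = (1 / 2^k) *\<^sub>R y" unfolding Sk_def by blast
      then show "x \<in> cone_seg v \<rho> (1/2)" using S(2) by (auto intro!: cone_seg_scale)
    qed
    then have sum: "a + b \<in> cone_seg v \<rho> 1" if "a \<in> Sk" "b \<in> Sk" for a b
      using cone_seg_add[of a v \<rho> "1/2" b "1/2"] that by auto
    have out: "dil (2^k) \<psi> x = 0" if "x \<notin> Sk" "\<And>x. x \<notin> S \<Longrightarrow> \<psi> x = 0" for \<psi> x
    proof -
      have "2^k *\<^sub>R x \<notin> S"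
      proof
        assume "2^k *\<^sub>R x \<in> S"
        then have "(1 / 2^k) *\<^sub>R (2^k *\<^sub>R x) \<in> Sk" unfolding Sk_def by blast
        then show False using that by simp
      qed
      then show ?thesis using that by (simp add: dil_def)
    qed
    have u: "conv (dil (2^k) B) f \<in> tf" by (intro conv_tf dil_tf B f pos)
    show ?thesis
    proof (rule conv_test_function[OF dil_tf[OF \<beta> pos] test_function_integrable[OF u] Sk _ compact_sums[OF Sk L(1)]])
      show "dil (2^k) \<beta> x = 0" if "x \<notin> Sk" for x using out[OF that S(3)] .
      show "conv (dil (2^k) B) f x = 0" if "x \<notin> {a + b |a b. a \<in> Sk \<and> b \<in> L}" for x
        by (rule conv_outside[OF out[OF _ S(4)] L(2) that])
      show "a + c \<in> \<Omega>" if ac: "a \<in> Sk" "c \<in> {a + b |a b. a \<in> Sk \<and> b \<in> L}" for a c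
      proof -
        obtain a' l where "c = a' + l" "a' \<in> Sk" "l \<in> L" using ac(2) by blast
        then show ?thesis using \<Omega>[of l "a + a'"] sum[OF ac(1)] by (simp add: algebra_simps)
      qed
    qed
  qed
  then show ?thesis
    unfolding hop_def[abs_def] by (intro test_functions_sum test_functions_cmult)
qed

text \<open>Uniform continuity makes the error uniformly small, and it lives on one compact set for
  all \<open>N\<close>. As \<open>b\<close> may change sign, its mass enters as
  \<open>nrm1 b\<close>.\<close>

lemma approximate_identity:
  fixes f :: "real^'n \<Rightarrow> real"
  assumes b: "b \<in> tf" "(LINT x|lborel. b x) = 1" and f: "f \<in> tf"
  shows "(\<lambda>N. n2 (\<lambda>x. conv (dil (2^N) b) f x - f x)) \<longlonglongrightarrow> 0"
proof -
  obtain R where R: "R > 0" "\<And>x. norm x > R \<Longrightarrow> b x = 0"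
  proof -
    obtain K where K: "compact K" "\<And>x. x \<notin> K \<Longrightarrow> b x = 0" using b by (auto simp: test_functions_iff)
    obtain R where "\<And>x. x \<in> K \<Longrightarrow> norm x \<le> R" using compact_imp_bounded[OF K(1)] unfolding bounded_iff by blast
    then have "\<And>x. norm x > max R 1 \<Longrightarrow> b x = 0" using K(2) by force
    then show ?thesis using that[of "max R 1"] by simp
  qed
  obtain L where L: "compact L" "\<And>x. x \<notin> L \<Longrightarrow> f x = 0" using f by (auto simp: test_functions_iff)
  \<comment> \<open>The dilated kernels all vanish outside the ball of radius \<open>R\<close>, so
    this set contains the supports of \<open>f\<close> and of all its mollifications.\<close>
  define S where "S = {a + c |a c. a \<in> cball 0 R \<and> c \<in> L}"
  have S: "compact S" unfolding S_def by (intro compact_sums compact_cball L)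
  have inS: "(indicator S :: real^'n \<Rightarrow> real) \<in> sqint lborel"
  proof -
    have "(\<lambda>x. (norm (indicator S x :: real))\<^sup>2) = indicator S" by (auto simp: indicator_def fun_eq_iff)
    then show ?thesis
      using emeasure_compact_finite[OF S] borel_compact[OF S] borel_measurable_indicator[of S borel]
      by (simp add: sqint_def)
  qed
  have pos: "(2::real)^N > 0" for N :: nat by simp
  have bound: "\<exists>d>0. \<forall>N. R / 2^N < d \<longrightarrow> n2 (\<lambda>x. conv (dil (2^N) b) f x - f x) \<le> (e * nrm1 b) * n2 (indicator S)"
    if e: "e > 0" for e
  proof -
    obtain d where d: "d > 0" "\<And>x y. dist y x < d \<Longrightarrow> dist (f y) (f x) < e"
      using test_function_uniformly_continuous[OF f, unfolded uniformly_continuous_on_def, rule_format, OF e] by auto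
    have "n2 (\<lambda>x. conv (dil (2^N) b) f x - f x) \<le> (e * nrm1 b) * n2 (indicator S)" if N: "R / 2^N < d" for N :: nat
    proof (rule nrm_mono[OF inS])
      fix x
      let ?bN = "dil (2^N) b"
      have bN: "?bN \<in> tf" by (rule dil_tf[OF b(1) pos])
      have bNout: "?bN z = 0" if "norm z > R / 2^N" for z
        using R(2)[of "2^N *\<^sub>R z"] that by (simp add: dil_def field_simps)
      show "norm (conv ?bN f x - f x) \<le> e * nrm1 b * norm (indicator S x :: real)"
      proof (cases "x \<in> S")
        case True
        have "f x = (LINT y|lborel. ?bN (x - y) * f x)"
          using integral_reflect[OF tf_borel[OF bN], of x] integral_dil[OF tf_borel[OF b(1)] pos, of N] b(2) by simp
        then have "conv ?bN f x - f x = (LINT y|lborel. ?bN (x - y) * f y) - (LINT y|lborel. ?bN (x - y) * f x)"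
          by (simp add: conv_def)
        also have "\<dots> = (LINT y|lborel. ?bN (x - y) * f y - ?bN (x - y) * f x)"
          using bN f by (simp add: conv_integrable test_function_integrable tf_reflect)
        finally have eq: "conv ?bN f x - f x = (LINT y|lborel. ?bN (x - y) * f y - ?bN (x - y) * f x)" .
        have i1: "integrable lborel (\<lambda>y. ?bN (x - y) * f y - ?bN (x - y) * f x)"
          using bN f by (simp add: conv_integrable test_function_integrable tf_reflect)
        have i2: "integrable lborel (\<lambda>y. \<bar>?bN (x - y)\<bar> * e)"
          using bN by (simp add: test_function_integrable tf_reflect)
        have "norm (conv ?bN f x - f x) \<le> (LINT y|lborel. \<bar>?bN (x - y)\<bar> * e)"
          unfolding eq
        proof (rule order_trans[OF integral_norm_bound integral_mono[OF integrable_norm[OF i1] i2]])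
          fix y
          show "norm (?bN (x - y) * f y - ?bN (x - y) * f x) \<le> \<bar>?bN (x - y)\<bar> * e"
          proof (cases "norm (x - y) > R / 2^N")
            case True
            then show ?thesis by (simp add: bNout)
          next
            case False
            then have "dist y x < d" using N by (simp add: dist_norm norm_minus_commute)
            then have "\<bar>f y - f x\<bar> \<le> e" using d(2)[of y x] by (simp add: dist_real_def)
            then have "\<bar>?bN (x - y)\<bar> * \<bar>f y - f x\<bar> \<le> \<bar>?bN (x - y)\<bar> * e" by (intro mult_left_mono) auto
            then show ?thesis by (simp add: abs_mult flip: right_diff_distrib)
          qed
        qed
        also have "\<dots> = nrm1 ?bN * e"
          using integral_reflect[OF cc_borel[OF tf_cc_abs[OF bN]], of x] by (simp add: nrm1_def)
        also have "\<dots> = e * nrm1 b" by (simp add: nrm1_dil[OF b(1) pos])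
        finally show ?thesis using True by simp
      next
        case False
        have "R / 2^N \<le> R" using R(1) by (simp add: field_simps)
        then have "conv ?bN f x = 0"
          by (intro conv_outside[OF _ L(2) False[unfolded S_def]]) (auto intro!: bNout)
        moreover have "f x = 0"
        proof (rule L(2), rule)
          assume "x \<in> L"
          then have "0 + x \<in> S" unfolding S_def using R(1) by (intro CollectI exI[of _ 0] exI[of _ x]) auto
          then show False using False by simp
        qed
        ultimately show ?thesis using False by simp
      qed
    qed (use e in \<open>simp add: nrm1_nonneg\<close>)
    then show ?thesis using d(1) by blast
  qed
  have lim: "(\<lambda>N. R / 2^N) \<longlonglongrightarrow> 0"
    using LIMSEQ_divide_realpow_zero[of 2 R] by simp
  show ?thesis
  proof (rule LIMSEQ_I)
    fix e :: real assume e: "e > 0"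
    define e' where "e' = e / 2 / (nrm1 b * n2 (indicator S) + 1)"
    have A: "nrm1 b * n2 (indicator S) \<ge> 0" by (simp add: nrm1_nonneg nrm_nonneg)
    have e': "e' > 0" using e A unfolding e'_def by (intro divide_pos_pos) auto
    obtain d where d: "d > 0" "\<And>N. R / 2^N < d \<Longrightarrow>
        n2 (\<lambda>x. conv (dil (2^N) b) f x - f x) \<le> (e' * nrm1 b) * n2 (indicator S)"
      using bound[OF e'] by blast
    have "e' * (nrm1 b * n2 (indicator S)) \<le> e / 2"
      using A e unfolding e'_def by (simp add: field_simps)
    then have small: "n2 (\<lambda>x. conv (dil (2^N) b) f x - f x) < e" if "R / 2^N < d" for N :: nat
      using d(2)[OF that] e by (simp add: mult.assoc)
    have "\<forall>\<^sub>F N in sequentially. R / 2^N < d"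
      using order_tendstoD(2)[OF lim d(1)] .
    then show "\<exists>no. \<forall>N\<ge>no. norm (n2 (\<lambda>x. conv (dil (2^N) b) f x - f x) - 0) < e"
      unfolding eventually_sequentially using small by (auto simp: nrm_nonneg)
  qed
qed

section \<open>Weakly null sequences of test functions\<close>

text \<open>Weak convergence is demanded only against test functions. This suffices below, because
  the value of a convolution at a point is a pairing with a test function.\<close>

definition wnull :: "(nat \<Rightarrow> real^'n \<Rightarrow> real) \<Rightarrow> bool" where
  "wnull F \<longleftrightarrow> (\<forall>n. F n \<in> tf) \<and> (\<exists>L. compact L \<and> (\<forall>n x. x \<notin> L \<longrightarrow> F n x = 0))
     \<and> (\<exists>M. \<forall>n. n2 (F n) \<le> M) \<and> (\<forall>\<psi>\<in>tf. (\<lambda>n. ip lborel (F n) \<psi>) \<longlonglongrightarrow> 0)"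

lemma wnull_tf: "wnull F \<Longrightarrow> F n \<in> tf"
  by (simp add: wnull_def)

lemma n2_mult_bounded:
  assumes "\<theta> \<in> tf"
  shows "\<exists>B\<ge>0. \<forall>f\<in>tf. n2 (\<lambda>x. \<theta> x * f x) \<le> B * n2 f"
proof -
  obtain B where B: "B \<ge> 0" "\<And>x. norm (\<theta> x) \<le> B" using test_function_bounded[OF assms] by blast
  have "n2 (\<lambda>x. \<theta> x * f x) \<le> B * n2 f" if "f \<in> tf" for f
    by (rule nrm_mono[OF test_function_sqint[OF that]]) (use B in \<open>auto simp: abs_mult intro!: mult_right_mono\<close>)
  then show ?thesis using B(1) by blast
qed

lemma wnull_mult:
  assumes F: "wnull F" and \<theta>: "\<theta> \<in> tf"
  shows "wnull (\<lambda>n x. \<theta> x * F n x)"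
  unfolding wnull_def
proof (intro conjI allI ballI)
  show "(\<lambda>x. \<theta> x * F n x) \<in> tf" for n by (intro tf_mult \<theta> wnull_tf[OF F])
  show "\<exists>L. compact L \<and> (\<forall>n x. x \<notin> L \<longrightarrow> \<theta> x * F n x = 0)"
    using F unfolding wnull_def by auto
  obtain M where M: "\<And>n. n2 (F n) \<le> M" using F unfolding wnull_def by blast
  obtain B where B: "B \<ge> 0" "\<And>f. f \<in> tf \<Longrightarrow> n2 (\<lambda>x. \<theta> x * f x) \<le> B * n2 f"
    using n2_mult_bounded[OF \<theta>] by blast
  have "n2 (\<lambda>x. \<theta> x * F n x) \<le> B * M" for n
    using order_trans[OF B(2)[OF wnull_tf[OF F]] mult_left_mono[OF M B(1)]] .
  then show "\<exists>M. \<forall>n. n2 (\<lambda>x. \<theta> x * F n x) \<le> M" by blast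
  show "(\<lambda>n. ip lborel (\<lambda>x. \<theta> x * F n x) \<psi>) \<longlonglongrightarrow> 0" if "\<psi> \<in> tf" for \<psi>
  proof -
    have "(\<lambda>n. ip lborel (F n) (\<lambda>x. \<theta> x * \<psi> x)) \<longlonglongrightarrow> 0"
      using F tf_mult[OF \<theta> that] unfolding wnull_def by blast
    then show ?thesis by (simp add: ip_real mult_ac)
  qed
qed

lemma wnull_add:
  assumes F: "wnull F" and G: "wnull G"
  shows "wnull (\<lambda>n x. F n x + G n x)"
  unfolding wnull_def
proof (intro conjI allI ballI)
  show "(\<lambda>x. F n x + G n x) \<in> tf" for n by (intro test_functions_add wnull_tf F G)
  obtain K where K: "compact K" "\<And>n x. x \<notin> K \<Longrightarrow> F n x = 0" using F unfolding wnull_def by blast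
  obtain L where L: "compact L" "\<And>n x. x \<notin> L \<Longrightarrow> G n x = 0" using G unfolding wnull_def by blast
  show "\<exists>L. compact L \<and> (\<forall>n x. x \<notin> L \<longrightarrow> F n x + G n x = 0)"
    using K L by (intro exI[of _ "K \<union> L"]) auto
  obtain M where M: "\<And>n. n2 (F n) \<le> M" using F unfolding wnull_def by blast
  obtain M' where M': "\<And>n. n2 (G n) \<le> M'" using G unfolding wnull_def by blast
  have "n2 (\<lambda>x. F n x + G n x) \<le> M + M'" for n
    using nrm_triangle[OF test_function_sqint[OF wnull_tf[OF F]] test_function_sqint[OF wnull_tf[OF G]], of n n]
      M[of n] M'[of n] by linarith
  then show "\<exists>M. \<forall>n. n2 (\<lambda>x. F n x + G n x) \<le> M" by blast
  show "(\<lambda>n. ip lborel (\<lambda>x. F n x + G n x) \<psi>) \<longlonglongrightarrow> 0" if \<psi>: "\<psi> \<in> tf" for \<psi>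
  proof -
    have "(\<lambda>n. ip lborel (F n) \<psi> + ip lborel (G n) \<psi>) \<longlonglongrightarrow> 0 + 0"
      using F G \<psi> unfolding wnull_def by (intro tendsto_add) auto
    then show ?thesis
      by (simp add: ip_add_left test_function_sqint wnull_tf[OF F] wnull_tf[OF G] \<psi>)
  qed
qed

lemma wnull_cmult:
  assumes F: "wnull F" shows "wnull (\<lambda>n x. c * F n x)"
  unfolding wnull_def
proof (intro conjI allI ballI)
  show "(\<lambda>x. c * F n x) \<in> tf" for n by (intro test_functions_cmult wnull_tf F)
  show "\<exists>L. compact L \<and> (\<forall>n x. x \<notin> L \<longrightarrow> c * F n x = 0)"
    using F unfolding wnull_def by auto
  obtain M where M: "\<And>n. n2 (F n) \<le> M" using F unfolding wnull_def by blast
  have "n2 (\<lambda>x. c * F n x) \<le> \<bar>c\<bar> * M" for n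
    by (simp add: nrm_cmult mult_left_mono M)
  then show "\<exists>M. \<forall>n. n2 (\<lambda>x. c * F n x) \<le> M" by blast
  show "(\<lambda>n. ip lborel (\<lambda>x. c * F n x) \<psi>) \<longlonglongrightarrow> 0" if "\<psi> \<in> tf" for \<psi>
    using tendsto_mult_right_zero[of "\<lambda>n. ip lborel (F n) \<psi>" sequentially c] F that ip_scaleR_left[of lborel c _ \<psi>]
    unfolding wnull_def by simp
qed

lemma wnull_diff: "wnull F \<Longrightarrow> wnull G \<Longrightarrow> wnull (\<lambda>n x. F n x - G n x)"
  using wnull_add[OF _ wnull_cmult[of G "-1"], of F] by simp

lemma wnull_bounded: "wnull F \<Longrightarrow> \<exists>M\<ge>0. \<forall>n. n2 (F n) \<le> M"
  unfolding wnull_def by (meson nrm_nonneg order_trans)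

text \<open>Convolution with a fixed test function is compact: the values converge to 0 pointwise,
  are bounded by \<open>M * n2 \<phi>\<close>, and vanish outside one compact set, so dominated
  convergence applies.\<close>

lemma conv_wnull:
  fixes F :: "nat \<Rightarrow> real^'n \<Rightarrow> real"
  assumes F: "wnull F" and \<phi>: "\<phi> \<in> tf"
  shows "(\<lambda>n. n2 (conv \<phi> (F n))) \<longlonglongrightarrow> 0"
proof -
  obtain L where L: "compact L" "\<And>n x. x \<notin> L \<Longrightarrow> F n x = 0" using F unfolding wnull_def by blast
  obtain M where M: "M \<ge> 0" "\<And>n. n2 (F n) \<le> M" using wnull_bounded[OF F] by blast
  obtain K where K: "compact K" "\<And>x. x \<notin> K \<Longrightarrow> \<phi> x = 0" using \<phi> by (auto simp: test_functions_iff)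
  define S where "S = {a + b |a b. a \<in> K \<and> b \<in> L}"
  have S: "compact S" unfolding S_def by (intro compact_sums K L)
  have Ftf: "F n \<in> tf" for n by (rule wnull_tf[OF F])
  have cF: "conv \<phi> (F n) \<in> tf" for n by (intro conv_tf \<phi> Ftf)
  have eq: "conv \<phi> (F n) x = ip lborel (F n) (\<lambda>y. \<phi> (x - y))" for n x
    by (simp add: conv_def ip_real mult.commute)
  have nr: "n2 (\<lambda>y. \<phi> (x - y)) = n2 \<phi>" for x
    using integral_reflect[OF tf_borel[OF tf_mult[OF \<phi> \<phi>]], of x] by (simp add: nrm_def ip_real)
  have bd: "\<bar>conv \<phi> (F n) x\<bar> \<le> M * n2 \<phi>" for n x
  proof -
    have "\<bar>conv \<phi> (F n) x\<bar> \<le> n2 (F n) * n2 \<phi>"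
      unfolding eq using ip_Cauchy_Schwarz[OF test_function_sqint[OF Ftf] test_function_sqint[OF tf_reflect[OF \<phi>]], of n x]
      by (simp add: nr)
    also have "\<dots> \<le> M * n2 \<phi>" by (intro mult_right_mono M nrm_nonneg)
    finally show ?thesis .
  qed
  have "(\<lambda>n. LINT x|lborel. (conv \<phi> (F n) x)\<^sup>2) \<longlonglongrightarrow> (LINT x|(lborel :: (real^'n) measure). 0)"
  proof (rule integral_dominated_convergence[where w="\<lambda>x. (M * n2 \<phi>)\<^sup>2 * indicator S x"])
    show "(\<lambda>x. (conv \<phi> (F n) x)\<^sup>2) \<in> borel_measurable lborel" for n
      using tf_borel[OF cF] by simp
    show "integrable lborel (\<lambda>x. (M * n2 \<phi>)\<^sup>2 * indicator S x :: real)"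
      using emeasure_compact_finite[OF S] borel_compact[OF S] by (intro integrable_mult_right integrable_real_indicator) auto
    show "AE x in lborel. norm ((conv \<phi> (F n) x)\<^sup>2) \<le> (M * n2 \<phi>)\<^sup>2 * indicator S x" for n
    proof (rule AE_I2)
      fix x
      show "norm ((conv \<phi> (F n) x)\<^sup>2) \<le> (M * n2 \<phi>)\<^sup>2 * indicator S x"
      proof (cases "x \<in> S")
        case True
        have "\<bar>conv \<phi> (F n) x\<bar>\<^sup>2 \<le> (M * n2 \<phi>)\<^sup>2" by (intro power_mono bd) simp
        then show ?thesis using True by simp
      next
        case False
        then show ?thesis using conv_outside[OF K(2) L(2), where x=x] by (simp add: S_def)
      qed
    qed
    show "AE x in lborel. (\<lambda>n. (conv \<phi> (F n) x)\<^sup>2) \<longlonglongrightarrow> 0"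
    proof (rule AE_I2)
      fix x
      have "(\<lambda>n. conv \<phi> (F n) x) \<longlonglongrightarrow> 0"
        unfolding eq using F tf_reflect[OF \<phi>] unfolding wnull_def by blast
      from tendsto_power[OF this, of 2] show "(\<lambda>n. (conv \<phi> (F n) x)\<^sup>2) \<longlonglongrightarrow> 0" by simp
    qed
  qed simp
  then have "(\<lambda>n. sqrt (LINT x|lborel. (conv \<phi> (F n) x)\<^sup>2)) \<longlonglongrightarrow> sqrt 0"
    by (intro tendsto_real_sqrt) simp
  then show ?thesis by (simp add: nrm_eq_integral)
qed

text \<open>The number of scales may depend on \<open>n\<close> in any way: the tail of the sum is
  small uniformly because of the weights \<open>2^-k\<close>, and each of the finitely many
  remaining scales tends to 0.\<close>

lemma hop_wnull:
  assumes F: "wnull F" and \<beta>: "\<beta> \<in> tf" and B: "B \<in> tf"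
  shows "(\<lambda>n. n2 (hop \<beta> B (N n) (F n))) \<longlonglongrightarrow> 0"
proof (rule LIMSEQ_I)
  fix e :: real assume e: "e > 0"
  obtain M where M: "M \<ge> 0" "\<And>n. n2 (F n) \<le> M" using wnull_bounded[OF F] by blast
  define A where "A = nrm1 \<beta> * nrm1 B * M"
  have A0: "A \<ge> 0" unfolding A_def by (simp add: nrm1_nonneg M)
  define a where "a k n = n2 (conv (dil (2^k) \<beta>) (conv (dil (2^k) B) (F n)))" for k n :: nat
  have Ftf: "F n \<in> tf" for n by (rule wnull_tf[OF F])
  have aA: "a k n \<le> A" for k n
    unfolding a_def A_def
    by (rule order_trans[OF hop_scale_bound[OF \<beta> B Ftf]]) (intro mult_left_mono M, simp add: nrm1_nonneg)
  have a0: "a k n \<ge> 0" for k n by (simp add: a_def nrm_nonneg)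
  have alim: "(\<lambda>n. a k n) \<longlonglongrightarrow> 0" for k
  proof (rule tendsto_sandwich[of "\<lambda>n. 0"])
    have pos: "(2::real)^k > 0" by simp
    show "\<forall>\<^sub>F n in sequentially. a k n \<le> nrm1 \<beta> * n2 (conv (dil (2^k) B) (F n))"
      unfolding a_def using Young[OF dil_tf[OF \<beta> pos] conv_tf[OF dil_tf[OF B pos] Ftf]]
      by (simp add: nrm1_dil[OF \<beta> pos])
    show "(\<lambda>n. nrm1 \<beta> * n2 (conv (dil (2^k) B) (F n))) \<longlonglongrightarrow> 0"
      by (intro tendsto_mult_right_zero conv_wnull[OF F] dil_tf B pos)
  qed (auto simp: a0)
  \<comment> \<open>The scales from \<open>m\<close> on contribute at most
    \<open>2 * (1/2)^m * A\<close>, which this choice puts below \<open>e / 2\<close>.\<close>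
  obtain m where m: "(1/2::real) ^ m < e / 4 / (A + 1)"
    using real_arch_pow_inv[of "e / 4 / (A + 1)" "1/2"] e A0 by auto
  have "(\<lambda>n. \<Sum>k<m. a k n) \<longlonglongrightarrow> (\<Sum>k<m. 0)" by (intro tendsto_sum alim)
  then have "\<forall>\<^sub>F n in sequentially. (\<Sum>k<m. a k n) < e / 2"
    using e by (intro order_tendstoD(2)) auto
  then obtain n0 where n0: "\<And>n. n \<ge> n0 \<Longrightarrow> (\<Sum>k<m. a k n) < e / 2"
    unfolding eventually_sequentially by blast
  have "n2 (hop \<beta> B (N n) (F n)) < e" if n: "n \<ge> n0" for n
  proof -
    have "n2 (hop \<beta> B (N n) (F n)) \<le> (\<Sum>k<N n. (1/2)^k * a k n)"
      unfolding a_def by (rule n2_hop_le_sum[OF \<beta> B Ftf])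
    also have "\<dots> \<le> (\<Sum>k<m + N n. (1/2)^k * a k n)"
      by (rule sum_mono2) (auto simp: a0)
    also have "\<dots> = (\<Sum>k<m. (1/2)^k * a k n) + (\<Sum>j<N n. (1/2)^(m + j) * a (m + j) n)"
    proof -
      have "{..<m + N n} = {..<m} \<union> {m..<m + N n}" by auto
      moreover have "(\<Sum>k\<in>{m..<m + N n}. (1/2)^k * a k n) = (\<Sum>j<N n. (1/2)^(m + j) * a (m + j) n)"
        by (rule sum.reindex_bij_witness[of _ "\<lambda>j. m + j" "\<lambda>k. k - m"]) auto
      moreover have "(\<Sum>k\<in>{..<m} \<union> {m..<m + N n}. (1/2)^k * a k n)
          = (\<Sum>k<m. (1/2)^k * a k n) + (\<Sum>k\<in>{m..<m + N n}. (1/2)^k * a k n)"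
        by (rule sum.union_disjoint) auto
      ultimately show ?thesis by simp
    qed
    also have "(\<Sum>k<m. (1/2)^k * a k n) \<le> (\<Sum>k<m. 1 * a k n)"
      by (intro sum_mono mult_right_mono a0 power_le_one) auto
    also have "(\<Sum>j<N n. (1/2)^(m + j) * a (m + j) n) \<le> (\<Sum>j<N n. (1/2)^(m + j) * A)"
      by (intro sum_mono mult_left_mono aA) auto
    also have "\<dots> = (1/2)^m * A * (\<Sum>j<N n. (1/2)^j)"
      by (simp add: power_add sum_distrib_left sum_distrib_right mult_ac)
    also have "\<dots> \<le> (1/2)^m * A * 2"
      by (intro mult_left_mono sum_half_power) (simp add: A0)
    also have "\<dots> \<le> (1/2)^m * (A + 1) * 2"
      by (intro mult_right_mono mult_left_mono) auto
    also have "\<dots> < e / 2"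
      using m A0 by (simp add: field_simps)
    finally show ?thesis using n0[OF n] by simp
  qed
  then show "\<exists>no. \<forall>n\<ge>no. norm (n2 (hop \<beta> B (N n) (F n)) - 0) < e"
    by (auto simp: nrm_nonneg)
qed

text \<open>Equivalent to the \<open>H\<^sup>1\<close> norm over the whole space, but a plain sum,
  so that it splits over terms and components; on \<open>\<Omega>\<close> it dominates
  \<open>H1_norm\<close>.\<close>

definition N1 :: "(real^'n \<Rightarrow> real) \<Rightarrow> real" where
  "N1 f = n2 f + (\<Sum>i\<in>UNIV. n2 (partial_deriv i f))"

lemma N1_nonneg: "0 \<le> N1 f"
  by (simp add: N1_def nrm_nonneg sum_nonneg)

lemma N1_add:
  assumes "f \<in> tf" "g \<in> tf" shows "N1 (\<lambda>x. f x + g x) \<le> N1 f + N1 g"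
proof -
  have "n2 (partial_deriv i (\<lambda>x. f x + g x)) \<le> n2 (partial_deriv i f) + n2 (partial_deriv i g)" for i
  proof -
    have "partial_deriv i (\<lambda>x. f x + g x) = (\<lambda>x. partial_deriv i f x + partial_deriv i g x)"
      using assms by (simp add: fun_eq_iff partial_deriv_add smooth_differentiable tf_smooth)
    then show ?thesis using assms by (simp add: nrm_triangle test_function_sqint test_functions_partial)
  qed
  then have "(\<Sum>i\<in>UNIV. n2 (partial_deriv i (\<lambda>x. f x + g x))) \<le> (\<Sum>i\<in>UNIV. n2 (partial_deriv i f) + n2 (partial_deriv i g))"
    by (rule sum_mono)
  moreover have "n2 (\<lambda>x. f x + g x) \<le> n2 f + n2 g"
    using assms by (simp add: nrm_triangle test_function_sqint)
  ultimately show ?thesis by (simp add: N1_def sum.distrib)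
qed

lemma N1_uminus: "f \<in> tf \<Longrightarrow> N1 (\<lambda>x. - f x) = N1 f"
proof -
  assume f: "f \<in> tf"
  have "partial_deriv i (\<lambda>x. - f x) = (\<lambda>x. - partial_deriv i f x)" for i
    using partial_deriv_cmult[OF tf_smooth[OF f], of i "-1"] by (simp add: fun_eq_iff)
  then show ?thesis by (simp add: N1_def nrm_uminus)
qed

lemma N1_diff: "f \<in> tf \<Longrightarrow> g \<in> tf \<Longrightarrow> N1 (\<lambda>x. f x - g x) \<le> N1 f + N1 g"
  using N1_add[OF _ test_functions_uminus, of f g] by (simp add: N1_uminus)

lemma partial_deriv_zero: "partial_deriv i (\<lambda>x. 0) = (\<lambda>x. 0)"
  using partial_deriv_eq[OF has_derivative_const] by blast

lemma N1_sum:
  "(\<And>i. i \<in> I \<Longrightarrow> f i \<in> tf) \<Longrightarrow> N1 (\<lambda>x. \<Sum>i\<in>I. f i x) \<le> (\<Sum>i\<in>I. N1 (f i))"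
proof (induction I rule: infinite_finite_induct)
  case (insert i I)
  then show ?case
    using N1_add[of "f i" "\<lambda>x. \<Sum>i\<in>I. f i x"] by (force simp: test_functions_sum)
qed (simp_all add: N1_def nrm_zero partial_deriv_zero)

lemma N1_mult:
  assumes \<theta>: "\<theta> \<in> tf"
  shows "\<exists>C\<ge>0. \<forall>f\<in>tf. N1 (\<lambda>x. \<theta> x * f x) \<le> C * N1 f"
proof -
  obtain B where B: "B \<ge> 0" "\<And>f. f \<in> tf \<Longrightarrow> n2 (\<lambda>x. \<theta> x * f x) \<le> B * n2 f"
    using n2_mult_bounded[OF \<theta>] by blast
  have "\<forall>i. \<exists>D. D \<ge> 0 \<and> (\<forall>f\<in>tf. n2 (\<lambda>x. partial_deriv i \<theta> x * f x) \<le> D * n2 f)"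
    using n2_mult_bounded[OF test_functions_partial[OF \<theta>]] by blast
  from choice[OF this] obtain D where D: "\<And>i. D i \<ge> 0"
    "\<And>i f. f \<in> tf \<Longrightarrow> n2 (\<lambda>x. partial_deriv i \<theta> x * f x) \<le> D i * n2 f" by auto
  define C where "C = B + (\<Sum>i\<in>UNIV. D i)"
  have C0: "C \<ge> 0" unfolding C_def using B D by (simp add: sum_nonneg)
  have "N1 (\<lambda>x. \<theta> x * f x) \<le> C * N1 f" if f: "f \<in> tf" for f
  proof -
    have "n2 (partial_deriv i (\<lambda>x. \<theta> x * f x)) \<le> B * n2 (partial_deriv i f) + D i * n2 f" for i
    proof -
      have "partial_deriv i (\<lambda>x. \<theta> x * f x) = (\<lambda>x. \<theta> x * partial_deriv i f x + partial_deriv i \<theta> x * f x)"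
        using \<theta> f by (simp add: fun_eq_iff partial_deriv_mult tf_smooth)
      then have "n2 (partial_deriv i (\<lambda>x. \<theta> x * f x))
          \<le> n2 (\<lambda>x. \<theta> x * partial_deriv i f x) + n2 (\<lambda>x. partial_deriv i \<theta> x * f x)"
        using nrm_triangle[of "\<lambda>x. \<theta> x * partial_deriv i f x" lborel "\<lambda>x. partial_deriv i \<theta> x * f x"] \<theta> f
        by (simp add: test_function_sqint tf_mult test_functions_partial)
      then show ?thesis
        using B(2)[OF test_functions_partial[OF f], of i] D(2)[OF f, of i] by linarith
    qed
    then have "(\<Sum>i\<in>UNIV. n2 (partial_deriv i (\<lambda>x. \<theta> x * f x))) \<le> (\<Sum>i\<in>UNIV. B * n2 (partial_deriv i f) + D i * n2 f)"
      by (rule sum_mono)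
    also have "\<dots> = B * (\<Sum>i\<in>UNIV. n2 (partial_deriv i f)) + (\<Sum>i\<in>UNIV. D i) * n2 f"
      by (simp add: sum.distrib sum_distrib_left sum_distrib_right)
    finally have "N1 (\<lambda>x. \<theta> x * f x) \<le> B * N1 f + (\<Sum>i\<in>UNIV. D i) * n2 f"
      using B(2)[OF f] by (simp add: N1_def distrib_left)
    also have "(\<Sum>i\<in>UNIV. D i) * n2 f \<le> (\<Sum>i\<in>UNIV. D i) * N1 f"
      by (intro mult_left_mono sum_nonneg D) (simp add: N1_def nrm_nonneg sum_nonneg)
    finally show ?thesis by (simp add: C_def distrib_right)
  qed
  then show ?thesis using C0 by blast
qed

lemma hop_N1_bound:
  fixes \<beta> B :: "real^'n \<Rightarrow> real"
  assumes \<beta>: "divform \<beta>" and B: "B \<in> tf"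
  shows "\<exists>C\<ge>0. \<forall>f\<in>tf. \<forall>N. N1 (hop \<beta> B N f) \<le> C * n2 f"
proof -
  obtain C where C: "C \<ge> 0" "\<And>f N. f \<in> tf \<Longrightarrow> n2 (hop \<beta> B N f) \<le> C * n2 f"
     "\<And>f N i. f \<in> tf \<Longrightarrow> n2 (partial_deriv i (hop \<beta> B N f)) \<le> C * n2 f"
    using hop_H1_bound[OF \<beta> B] by blast
  have "N1 (hop \<beta> B N f) \<le> (C + CARD('n) * C) * n2 f" if f: "f \<in> tf" for f N
  proof -
    have "(\<Sum>i\<in>UNIV. n2 (partial_deriv i (hop \<beta> B N f))) \<le> (\<Sum>i\<in>(UNIV::'n set). C * n2 f)"
      by (intro sum_mono C f)
    then show ?thesis using C(2)[OF f, of N] by (simp add: N1_def distrib_right mult.assoc)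
  qed
  moreover have "0 \<le> C + CARD('n) * C" using C(1) by simp
  ultimately show ?thesis by blast
qed

section \<open>The localised div-curl lemma\<close>

definition ccurl :: "(3 \<Rightarrow> real^3 \<Rightarrow> real) \<Rightarrow> 3 \<Rightarrow> real^3 \<Rightarrow> real" where
  "ccurl \<Phi> j x =
     (if j = 1 then partial_deriv 2 (\<Phi> 3) x - partial_deriv 3 (\<Phi> 2) x
      else if j = 2 then partial_deriv 3 (\<Phi> 1) x - partial_deriv 1 (\<Phi> 3) x
      else partial_deriv 1 (\<Phi> 2) x - partial_deriv 2 (\<Phi> 1) x)"

text \<open>Shares the index pattern of the curl: it reads off the axial vector of the antisymmetric
  part of \<open>w\<close>, which is a cross product when \<open>w i j\<close> is a product of
  components.\<close>

definition cyc :: "(3 \<Rightarrow> 3 \<Rightarrow> real^3 \<Rightarrow> real) \<Rightarrow> 3 \<Rightarrow> real^3 \<Rightarrow> real" where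
  "cyc w j x = (if j = 1 then w 2 3 x - w 3 2 x else if j = 2 then w 3 1 x - w 1 3 x else w 1 2 x - w 2 1 x)"

lemma cyc_in:
  assumes "\<And>i j. w i j \<in> test_functions \<Omega>" shows "cyc w j \<in> test_functions \<Omega>"
  using exhaust_3[of j]
  by (auto simp: cyc_def[abs_def] intro!: test_functions_diff assms)

lemma ccurl_tf: "(\<And>j. \<Phi> j \<in> tf) \<Longrightarrow> ccurl \<Phi> j \<in> tf"
  using exhaust_3[of j]
  by (auto simp: ccurl_def[abs_def] intro!: test_functions_diff test_functions_partial)

lemma N1_cyc:
  assumes w: "\<And>i j. w i j \<in> tf"
  shows "(\<Sum>j\<in>UNIV. N1 (cyc w j)) \<le> (\<Sum>i\<in>UNIV. \<Sum>j\<in>UNIV. N1 (w i j))"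
proof -
  have "N1 (cyc w 1) \<le> N1 (w 2 3) + N1 (w 3 2)" "N1 (cyc w 2) \<le> N1 (w 3 1) + N1 (w 1 3)"
    "N1 (cyc w 3) \<le> N1 (w 1 2) + N1 (w 2 1)"
    by (simp_all add: cyc_def[abs_def] N1_diff w)
  then show ?thesis
    using N1_nonneg[of "w 1 1"] N1_nonneg[of "w 2 2"] N1_nonneg[of "w 3 3"] by (simp add: sum_3)
qed

text \<open>In vector notation, with \<open>w i j\<close> playing the role of the product \<open>K\<^sub>i G\<^sub>j\<close>:
  \<open>div K G = K div G - curl (K \<times> G)\<close>.\<close>

lemma ccurl_cyc:
  assumes w: "\<And>i j. w i j \<in> tf"
  shows "ccurl (cyc w) j x = (\<Sum>i\<in>UNIV. partial_deriv i (w j i) x) - (\<Sum>i\<in>UNIV. partial_deriv i (w i j) x)"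
  using exhaust_3[of j]
  by (auto simp: ccurl_def cyc_def[abs_def] sum_3 partial_deriv_diff tf_smooth w)

text \<open>For each \<open>n\<close> separately a fine enough scale exists because
  \<open>G n j\<close> is a test function. Nothing makes the scale uniform in \<open>n\<close>, so
  it is selected anew for every \<open>n\<close>.\<close>

lemma mollification_scales:
  fixes G :: "nat \<Rightarrow> 3 \<Rightarrow> real^3 \<Rightarrow> real"
  assumes G: "\<And>j. wnull (\<lambda>n. G n j)" and b: "b \<in> tf" "(LINT x|lborel. b x) = 1"
  shows "\<exists>N. (\<lambda>n. \<Sum>j\<in>UNIV. n2 (\<lambda>x. G n j x - conv (dil (2^N n) b) (conv (dil (2^N n) b) (G n j)) x)) \<longlonglongrightarrow> 0"
proof -
  have Gtf: "G n j \<in> tf" for n j by (rule wnull_tf[OF G])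
  have "\<exists>N. (\<Sum>j\<in>UNIV. n2 (\<lambda>x. G n j x - conv (dil (2^N) b) (conv (dil (2^N) b) (G n j)) x)) < inverse (real (Suc n))" for n
  proof -
    have "(\<lambda>N. n2 (\<lambda>x. G n j x - conv (dil (2^N) b) (conv (dil (2^N) b) (G n j)) x)) \<longlonglongrightarrow> 0" for j
    proof (rule tendsto_sandwich[of "\<lambda>n. 0"])
      let ?d = "\<lambda>N x. conv (dil (2^N) b) (G n j) x - G n j x"
      show "\<forall>\<^sub>F N in sequentially. n2 (\<lambda>x. G n j x - conv (dil (2^N) b) (conv (dil (2^N) b) (G n j)) x)
          \<le> (nrm1 b + 1) * n2 (?d N)"
      proof (rule always_eventually, rule allI)
        fix N :: nat
        have pos: "(2::real)^N > 0" by simp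
        have bN: "dil (2^N) b \<in> tf" by (rule dil_tf[OF b(1) pos])
        have d: "?d N \<in> tf" by (intro test_functions_diff conv_tf bN Gtf)
        have "(\<lambda>x. G n j x - conv (dil (2^N) b) (conv (dil (2^N) b) (G n j)) x)
          = (\<lambda>x. - (conv (dil (2^N) b) (?d N) x + ?d N x))"
          using bN Gtf by (simp add: conv_diff_right conv_tf fun_eq_iff)
        then have "n2 (\<lambda>x. G n j x - conv (dil (2^N) b) (conv (dil (2^N) b) (G n j)) x)
           = n2 (\<lambda>x. conv (dil (2^N) b) (?d N) x + ?d N x)" by (simp only: nrm_uminus)
        also have "\<dots> \<le> n2 (conv (dil (2^N) b) (?d N)) + n2 (?d N)"
          by (intro nrm_triangle test_function_sqint conv_tf bN d)
        also have "\<dots> \<le> (nrm1 b + 1) * n2 (?d N)"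
          using Young[OF bN d] by (simp add: nrm1_dil[OF b(1) pos] distrib_right)
        finally show "n2 (\<lambda>x. G n j x - conv (dil (2^N) b) (conv (dil (2^N) b) (G n j)) x)
          \<le> (nrm1 b + 1) * n2 (?d N)" .
      qed
      show "(\<lambda>N. (nrm1 b + 1) * n2 (?d N)) \<longlonglongrightarrow> 0"
        by (intro tendsto_mult_right_zero approximate_identity b Gtf)
    qed (auto simp: nrm_nonneg)
    then have "(\<lambda>N. \<Sum>j\<in>(UNIV :: 3 set). n2 (\<lambda>x. G n j x - conv (dil (2^N) b) (conv (dil (2^N) b) (G n j)) x)) \<longlonglongrightarrow> (\<Sum>j\<in>(UNIV :: 3 set). 0)"
      by (intro tendsto_sum)
    then have "\<forall>\<^sub>F N in sequentially. (\<Sum>j\<in>UNIV. n2 (\<lambda>x. G n j x - conv (dil (2^N) b) (conv (dil (2^N) b) (G n j)) x)) < inverse (real (Suc n))"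
      by (intro order_tendstoD(2)) auto
    then show ?thesis unfolding eventually_sequentially by blast
  qed
  then have "\<forall>n. \<exists>N. (\<Sum>j\<in>UNIV. n2 (\<lambda>x. G n j x - conv (dil (2^N) b) (conv (dil (2^N) b) (G n j)) x)) < inverse (real (Suc n))"
    by (rule allI)
  from choice[OF this] obtain N where N: "\<And>n. (\<Sum>j\<in>UNIV. n2 (\<lambda>x. G n j x - conv (dil (2^N n) b) (conv (dil (2^N n) b) (G n j)) x)) < inverse (real (Suc n))"
    by blast
  show ?thesis
  proof (rule exI[of _ N], rule tendsto_sandwich[of "\<lambda>n. 0"])
    show "(\<lambda>n. inverse (real (Suc n))) \<longlonglongrightarrow> 0" by (rule LIMSEQ_inverse_real_of_nat)
    show "\<forall>\<^sub>F n in sequentially. (\<Sum>j\<in>UNIV. n2 (\<lambda>x. G n j x - conv (dil (2^N n) b) (conv (dil (2^N n) b) (G n j)) x)) \<le> inverse (real (Suc n))"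
      using N by (intro always_eventually allI less_imp_le)
  qed (auto simp: sum_nonneg nrm_nonneg)
qed

lemma abs_sum_ip_le:
  assumes "\<And>j. F j \<in> tf" "\<And>j. G j \<in> tf" "\<And>j. n2 (F j) \<le> M"
  shows "\<bar>\<Sum>j\<in>(UNIV::3 set). ip lborel (F j) (G j)\<bar> \<le> M * (\<Sum>j\<in>UNIV. n2 (G j))"
proof -
  have "\<bar>\<Sum>j\<in>(UNIV::3 set). ip lborel (F j) (G j)\<bar> \<le> (\<Sum>j\<in>UNIV. \<bar>ip lborel (F j) (G j)\<bar>)" by (rule sum_abs)
  also have "\<dots> \<le> (\<Sum>j\<in>UNIV. M * n2 (G j))"
  proof (rule sum_mono)
    fix j
    have "\<bar>ip lborel (F j) (G j)\<bar> \<le> n2 (F j) * n2 (G j)"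
      by (intro ip_Cauchy_Schwarz test_function_sqint assms)
    also have "\<dots> \<le> M * n2 (G j)" by (intro mult_right_mono assms nrm_nonneg)
    finally show "\<bar>ip lborel (F j) (G j)\<bar> \<le> M * n2 (G j)" .
  qed
  finally show ?thesis by (simp add: sum_distrib_left)
qed

text \<open>The sum of the individual constants serves for all indices, since they and
  \<open>g\<close> are nonnegative.\<close>

lemma finite_uniform_bound:
  fixes f :: "'i::finite \<Rightarrow> 'x \<Rightarrow> real"
  assumes bd: "\<And>i. \<exists>C\<ge>0. \<forall>x\<in>X. f i x \<le> C * g x" and g: "\<And>x. x \<in> X \<Longrightarrow> g x \<ge> 0"
  shows "\<exists>C\<ge>0. \<forall>i. \<forall>x\<in>X. f i x \<le> C * g x"
proof -
  have "\<forall>i. \<exists>C. C \<ge> 0 \<and> (\<forall>x\<in>X. f i x \<le> C * g x)" using bd by blast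
  from choice[OF this] obtain C where C: "\<forall>i. C i \<ge> 0 \<and> (\<forall>x\<in>X. f i x \<le> C i * g x)" by (rule exE)
  have le: "C i \<le> (\<Sum>i\<in>UNIV. C i)" for i
    using C by (intro member_le_sum) auto
  have "f i x \<le> (\<Sum>i\<in>UNIV. C i) * g x" if "x \<in> X" for i x
    using C that mult_right_mono[OF le[of i] g[OF that]] by (meson order_trans)
  then show ?thesis using C by (intro exI[of _ "\<Sum>i\<in>UNIV. C i"]) (simp add: sum_nonneg)
qed

lemma wnull_uniform_bound:
  fixes F :: "nat \<Rightarrow> 'i::finite \<Rightarrow> real^'n \<Rightarrow> real"
  assumes "\<And>j. wnull (\<lambda>n. F n j)"
  obtains M where "M \<ge> 0" "\<And>n j. n2 (F n j) \<le> M"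
proof -
  have "\<exists>C\<ge>0. \<forall>n\<in>UNIV. n2 (F n j) \<le> C * 1" for j
    using wnull_bounded[OF assms[of j]] by simp
  from finite_uniform_bound[of UNIV "\<lambda>j n. n2 (F n j)" "\<lambda>n. 1", OF this] show thesis
    using that by auto
qed

lemma hop_N1_uniform_bound:
  fixes \<beta> :: "'i::finite \<Rightarrow> real^'n \<Rightarrow> real"
  assumes "\<And>i. divform (\<beta> i)" "B \<in> tf"
  obtains C where "C \<ge> 0" "\<And>i f N. f \<in> tf \<Longrightarrow> N1 (hop (\<beta> i) B N f) \<le> C * n2 f"
proof -
  have "\<exists>C\<ge>0. \<forall>p\<in>tf \<times> UNIV. N1 (hop (\<beta> i) B (snd p) (fst p)) \<le> C * n2 (fst p)" for i
    using hop_N1_bound[OF assms(1)[of i] assms(2)] by auto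
  from finite_uniform_bound[of "tf \<times> UNIV" "\<lambda>i p. N1 (hop (\<beta> i) B (snd p) (fst p))" "\<lambda>p. n2 (fst p)", OF this]
  show thesis
    using that by (auto simp: nrm_nonneg)
qed

text \<open>The pairing splits into five parts: mollification error, coarse mollification,
  \<open>K\<close> applied to \<open>\<theta> div H\<close>, \<open>K\<close> applied to the
  commutator of divergence and \<open>\<theta>\<close>, and a curl. The hypothesis on the curl of
  \<open>E\<close> meets a field supported in \<open>\<Omega>\<close> only because of the
  cone.\<close>

lemma div_curl_core_curl:
  fixes E H :: "nat \<Rightarrow> 3 \<Rightarrow> real^3 \<Rightarrow> real"
  assumes \<theta>: "\<theta> \<in> tf" and \<rho>: "\<rho> > 0" and L: "compact L" "\<And>n j x. x \<notin> L \<Longrightarrow> \<theta> x * H n j x = 0"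
    and cone: "\<And>x z. x \<in> L \<Longrightarrow> z \<in> cone_seg v \<rho> 1 \<Longrightarrow> x + z \<in> \<Omega>"
    and E: "\<And>j. wnull (\<lambda>n. E n j)" and H: "\<And>j. wnull (\<lambda>n. H n j)"
    and \<delta>: "\<delta> \<longlonglongrightarrow> 0"
    and curlE: "\<And>n \<Phi>. (\<And>j. \<Phi> j \<in> test_functions \<Omega>) \<Longrightarrow>
        \<bar>\<Sum>j\<in>UNIV. ip lborel (E n j) (ccurl \<Phi> j)\<bar> \<le> \<delta> n * (\<Sum>j\<in>UNIV. N1 (\<Phi> j))"
    and divH: "\<And>n \<phi>. \<phi> \<in> tf \<Longrightarrow> \<bar>\<Sum>j\<in>UNIV. ip lborel (H n j) (partial_deriv j \<phi>)\<bar> \<le> \<delta> n * N1 \<phi>"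
  shows "(\<lambda>n. \<Sum>j\<in>UNIV. ip lborel (E n j) (\<lambda>x. \<theta> x * H n j x)) \<longlonglongrightarrow> 0"
proof -
  obtain b and \<beta> :: "3 \<Rightarrow> real^3 \<Rightarrow> real" and B S where b: "b \<in> tf" "(LINT x|lborel. b x) = 1"
    and \<beta>: "\<And>j. divform (\<beta> j)" and B: "B \<in> tf"
    and htpy: "\<And>f N x. f \<in> tf \<Longrightarrow> (\<Sum>j\<in>UNIV. partial_deriv j (hop (\<beta> j) B N f) x)
          = conv (dil (2^N) b) (conv (dil (2^N) b) f) x - conv b (conv b f) x"
    and S: "compact S" "S \<subseteq> cone_seg v \<rho> (1/2)" "\<And>j x. x \<notin> S \<Longrightarrow> \<beta> j x = 0" "\<And>x. x \<notin> S \<Longrightarrow> B x = 0"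
    by (rule homotopy_kernels[OF \<rho>, of v], rule that) (assumption | simp)+
  have \<beta>tf: "\<beta> j \<in> tf" for j by (rule divform_tf[OF \<beta>])
  let ?\<beta>' = "\<lambda>j x. \<beta> j (- x)" and ?B' = "\<lambda>x. B (- x)"
  have \<beta>'tf: "?\<beta>' j \<in> tf" for j by (rule tf_minus[OF \<beta>tf])
  have B'tf: "?B' \<in> tf" by (rule tf_minus[OF B])
  define G where "G n j x = \<theta> x * H n j x" for n j x
  have G: "wnull (\<lambda>n. G n j)" for j unfolding G_def[abs_def] by (rule wnull_mult[OF H \<theta>])
  have tf: "E n j \<in> tf" "H n j \<in> tf" "G n j \<in> tf" for n j
    using wnull_tf[OF E] wnull_tf[OF H] wnull_tf[OF G] by auto
  \<comment> \<open>The commutator term in the divergence of \<open>\<theta> H\<close>. It has no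
    derivative on \<open>H\<close>, hence is weakly null and becomes small under
    \<open>K\<close>.\<close>
  define W where "W n x = (\<Sum>i\<in>UNIV. partial_deriv i \<theta> x * H n i x)" for n x
  have W: "wnull W"
    unfolding W_def[abs_def] sum_3
    by (intro wnull_add wnull_mult H test_functions_partial \<theta>)
  define divH' where "divH' n x = (\<Sum>i\<in>UNIV. partial_deriv i (H n i) x)" for n x
  have divHtf: "divH' n \<in> tf" for n
    unfolding divH'_def[abs_def] by (intro test_functions_sum test_functions_partial tf)
  obtain N where N: "(\<lambda>n. \<Sum>j\<in>UNIV. n2 (\<lambda>x. G n j x - conv (dil (2^N n) b) (conv (dil (2^N n) b) (G n j)) x)) \<longlonglongrightarrow> 0"
    using mollification_scales[of G b, OF G b] by blast
  obtain ME where ME: "ME \<ge> 0" "\<And>n j. n2 (E n j) \<le> ME"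
    using wnull_uniform_bound[of E, OF E] by blast
  obtain MG where MG: "MG \<ge> 0" "\<And>n j. n2 (G n j) \<le> MG"
    using wnull_uniform_bound[of G, OF G] by blast
  define M where "M = ME + MG"
  have M0: "M \<ge> 0" unfolding M_def using ME MG by simp
  have M: "n2 (E n j) \<le> M" "n2 (G n j) \<le> M" for n j
    using ME(1) MG(1) ME(2)[of n j] MG(2)[of n j] unfolding M_def by linarith+
  obtain C where C: "C \<ge> 0" "\<And>i f N. f \<in> tf \<Longrightarrow> N1 (hop (\<beta> i) B N f) \<le> C * n2 f"
    using hop_N1_uniform_bound[of \<beta> B, OF \<beta> B] by blast
  obtain D where D: "D \<ge> 0" "\<And>i f N. f \<in> tf \<Longrightarrow> N1 (hop (?\<beta>' i) ?B' N f) \<le> D * n2 f"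
    using hop_N1_uniform_bound[of ?\<beta>' ?B', OF divform_minus[OF \<beta>] B'tf] by blast
  obtain Q where Q: "Q \<ge> 0" "\<And>f. f \<in> tf \<Longrightarrow> N1 (\<lambda>x. \<theta> x * f x) \<le> Q * N1 f"
    using N1_mult[OF \<theta>] by blast
  define c1 where "c1 = (\<Sum>i\<in>(UNIV::3 set). \<Sum>j\<in>(UNIV::3 set). C * M)"
  define c2 where "c2 = Q * (\<Sum>j\<in>(UNIV::3 set). D * M)"
  define R where "R n = M * (\<Sum>j\<in>UNIV. n2 (\<lambda>x. G n j x - conv (dil (2^N n) b) (conv (dil (2^N n) b) (G n j)) x))
      + M * (\<Sum>j\<in>UNIV. n2 (conv b (conv b (G n j)))) + \<bar>\<delta> n\<bar> * c1 + \<bar>\<delta> n\<bar> * c2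
      + M * (\<Sum>j\<in>UNIV. n2 (hop (\<beta> j) B (N n) (W n)))" for n
  have "\<bar>\<Sum>j\<in>UNIV. ip lborel (E n j) (G n j)\<bar> \<le> R n" for n
  proof -
    define K where "K i f = hop (\<beta> i) B (N n) f" for i f
    have Ktf: "K i f \<in> tf" if "f \<in> tf" for i f unfolding K_def by (rule hop_tf[OF \<beta>tf B that])
    define w where "w i j = K i (G n j)" for i j
    have wtf: "w i j \<in> tf" for i j unfolding w_def by (rule Ktf[OF tf(3)])
    \<comment> \<open>Here the cone condition enters: the potential stays in \<open>\<Omega>\<close>
      for every number of scales.\<close>
    have w\<Omega>: "w i j \<in> test_functions \<Omega>" for i j
      unfolding w_def K_def
      by (rule hop_test_function[OF \<beta>tf B tf(3) S L(1) _ cone]) (use L(2) in \<open>auto simp: G_def\<close>)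
    define \<Phi> where "\<Phi> = cyc w"
    have \<Phi>\<Omega>: "\<Phi> j \<in> test_functions \<Omega>" for j unfolding \<Phi>_def by (rule cyc_in[OF w\<Omega>])
    have \<Phi>tf: "\<Phi> j \<in> tf" for j using test_functions_UNIV[OF \<Phi>\<Omega>] .
    define u1 where "u1 j x = G n j x - conv (dil (2^N n) b) (conv (dil (2^N n) b) (G n j)) x" for j x
    define u2 where "u2 j = conv b (conv b (G n j))" for j
    have u1: "u1 j \<in> tf" for j
      unfolding u1_def[abs_def] by (intro test_functions_diff conv_tf dil_tf tf b) auto
    have u2: "u2 j \<in> tf" for j unfolding u2_def by (intro conv_tf tf b)
    define U where "U x = \<theta> x * divH' n x" for x
    have U: "U \<in> tf" unfolding U_def[abs_def] by (intro tf_mult \<theta> divHtf)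
    have divG: "(\<Sum>i\<in>UNIV. partial_deriv i (G n i) x) = U x + W n x" for x
      unfolding G_def[abs_def] U_def W_def divH'_def
      by (simp add: partial_deriv_mult tf_smooth \<theta> tf sum.distrib sum_distrib_left)
    have KdivG: "(\<Sum>i\<in>UNIV. partial_deriv i (w j i) x) = K j U x + K j (W n) x" for j x
    proof -
      have "(\<Sum>i\<in>UNIV. partial_deriv i (w j i) x) = (\<Sum>i\<in>UNIV. K j (partial_deriv i (G n i)) x)"
        unfolding w_def K_def by (simp add: partial_hop[OF \<beta>tf B tf(3)])
      also have "\<dots> = K j (\<lambda>x. \<Sum>i\<in>UNIV. partial_deriv i (G n i) x) x"
        unfolding K_def by (subst hop_sum[OF \<beta>tf B]) (auto intro: test_functions_partial tf)
      also have "\<dots> = K j U x + K j (W n) x"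
        unfolding divG K_def by (subst hop_add[OF \<beta>tf B U wnull_tf[OF W]]) simp
      finally show ?thesis .
    qed
    \<comment> \<open>\<open>u1\<close> and \<open>u2\<close> are the two ends of the telescoping
      sum; the remaining terms rewrite the sum of the \<open>partial_deriv i (w i j)\<close> by
      means of \<open>ccurl_cyc\<close>.\<close>
    have decomp: "G n j = (\<lambda>x. u1 j x + u2 j x + K j U x + K j (W n) x - ccurl \<Phi> j x)" for j
    proof
      fix x
      have "(\<Sum>i\<in>UNIV. partial_deriv i (w i j) x)
          = conv (dil (2^N n) b) (conv (dil (2^N n) b) (G n j)) x - conv b (conv b (G n j)) x"
        unfolding w_def K_def by (rule htpy[OF tf(3)])
      then show "G n j x = u1 j x + u2 j x + K j U x + K j (W n) x - ccurl \<Phi> j x"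
        unfolding \<Phi>_def ccurl_cyc[OF wtf] KdivG u1_def u2_def by simp
    qed
    have "ip lborel (E n j) (G n j) = ip lborel (E n j) (u1 j) + ip lborel (E n j) (u2 j) + ip lborel (E n j) (K j U)
        + ip lborel (E n j) (K j (W n)) - ip lborel (E n j) (ccurl \<Phi> j)" for j
      by (subst decomp)
        (simp add: ip_add_right ip_diff_right test_function_sqint sqint_add tf u1 u2 Ktf U wnull_tf[OF W] ccurl_tf \<Phi>tf)
    then have split: "(\<Sum>j\<in>UNIV. ip lborel (E n j) (G n j)) = (\<Sum>j\<in>UNIV. ip lborel (E n j) (u1 j))
       + (\<Sum>j\<in>UNIV. ip lborel (E n j) (u2 j)) + (\<Sum>j\<in>UNIV. ip lborel (E n j) (K j U))
       + (\<Sum>j\<in>UNIV. ip lborel (E n j) (K j (W n))) - (\<Sum>j\<in>UNIV. ip lborel (E n j) (ccurl \<Phi> j))"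
      by (simp add: sum.distrib sum_subtractf)
    have e1: "\<bar>\<Sum>j\<in>UNIV. ip lborel (E n j) (u1 j)\<bar> \<le> M * (\<Sum>j\<in>UNIV. n2 (u1 j))"
      by (rule abs_sum_ip_le[OF tf(1) u1 M(1)])
    have e2: "\<bar>\<Sum>j\<in>UNIV. ip lborel (E n j) (u2 j)\<bar> \<le> M * (\<Sum>j\<in>UNIV. n2 (u2 j))"
      by (rule abs_sum_ip_le[OF tf(1) u2 M(1)])
    have e5: "\<bar>\<Sum>j\<in>UNIV. ip lborel (E n j) (K j (W n))\<bar> \<le> M * (\<Sum>j\<in>UNIV. n2 (K j (W n)))"
      by (rule abs_sum_ip_le[OF tf(1) Ktf[OF wnull_tf[OF W]] M(1)])
    have e3: "\<bar>\<Sum>j\<in>UNIV. ip lborel (E n j) (ccurl \<Phi> j)\<bar> \<le> \<bar>\<delta> n\<bar> * c1"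
    proof -
      have "(\<Sum>j\<in>UNIV. N1 (\<Phi> j)) \<le> (\<Sum>i\<in>UNIV. \<Sum>j\<in>UNIV. N1 (w i j))"
        unfolding \<Phi>_def by (rule N1_cyc[OF wtf])
      also have "\<dots> \<le> c1"
        unfolding c1_def
      proof (intro sum_mono)
        fix i j
        have "N1 (w i j) \<le> C * n2 (G n j)" unfolding w_def K_def by (rule C(2)[OF tf(3)])
        also have "\<dots> \<le> C * M" by (intro mult_left_mono M C)
        finally show "N1 (w i j) \<le> C * M" .
      qed
      finally have 1: "(\<Sum>j\<in>UNIV. N1 (\<Phi> j)) \<le> c1" .
      have "\<bar>\<Sum>j\<in>UNIV. ip lborel (E n j) (ccurl \<Phi> j)\<bar> \<le> \<delta> n * (\<Sum>j\<in>UNIV. N1 (\<Phi> j))"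
        by (rule curlE[OF \<Phi>\<Omega>])
      also have "\<dots> \<le> \<bar>\<delta> n\<bar> * (\<Sum>j\<in>UNIV. N1 (\<Phi> j))"
        by (intro mult_right_mono sum_nonneg N1_nonneg) auto
      also have "\<dots> \<le> \<bar>\<delta> n\<bar> * c1" by (intro mult_left_mono 1) auto
      finally show ?thesis .
    qed
    have e4: "\<bar>\<Sum>j\<in>UNIV. ip lborel (E n j) (K j U)\<bar> \<le> \<bar>\<delta> n\<bar> * c2"
    proof -
      \<comment> \<open>\<open>K\<close> is moved onto \<open>E\<close>. The adjoint kernels point
        along the opposite cone, and the resulting test function may leave \<open>\<Omega>\<close>;
        \<open>divH\<close> admits such functions. The factor \<open>\<theta>\<close> moves onto it
        as well, so that the bare divergence of \<open>H\<close> is tested.\<close>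
      define p where "p j = hop (?\<beta>' j) ?B' (N n) (E n j)" for j
      have p: "p j \<in> tf" for j unfolding p_def by (rule hop_tf[OF \<beta>'tf B'tf tf(1)])
      define q where "q x = (\<Sum>j\<in>UNIV. p j x)" for x
      have q: "q \<in> tf" unfolding q_def[abs_def] by (intro test_functions_sum p)
      define \<phi> where "\<phi> x = \<theta> x * q x" for x
      have \<phi>: "\<phi> \<in> tf" unfolding \<phi>_def[abs_def] by (intro tf_mult \<theta> q)
      have "(\<Sum>j\<in>UNIV. ip lborel (E n j) (K j U)) = (\<Sum>j\<in>UNIV. ip lborel U (p j))"
        using hop_adjoint[OF \<beta>tf B U tf(1)] by (simp add: ip_real K_def p_def mult.commute)
      also have "\<dots> = ip lborel U q"
        unfolding q_def[abs_def] by (rule ip_sum_right[symmetric]) (intro test_function_sqint p U)+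
      also have "\<dots> = ip lborel (divH' n) \<phi>"
        by (simp add: ip_real U_def \<phi>_def mult_ac)
      also have "\<dots> = (\<Sum>i\<in>UNIV. ip lborel (partial_deriv i (H n i)) \<phi>)"
        unfolding divH'_def[abs_def]
        by (rule ip_sum_left) (intro test_function_sqint test_functions_partial tf \<phi>)+
      also have "\<dots> = (\<Sum>i\<in>UNIV. - ip lborel (H n i) (partial_deriv i \<phi>))"
        by (simp add: ip_real integral_by_parts[OF tf(2) tf_smooth[OF \<phi>]])
      finally have "\<bar>\<Sum>j\<in>UNIV. ip lborel (E n j) (K j U)\<bar> = \<bar>\<Sum>i\<in>UNIV. ip lborel (H n i) (partial_deriv i \<phi>)\<bar>"
        by (simp add: sum_negf)
      also have "\<dots> \<le> \<delta> n * N1 \<phi>" by (rule divH[OF \<phi>])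
      also have "\<dots> \<le> \<bar>\<delta> n\<bar> * N1 \<phi>" by (intro mult_right_mono N1_nonneg) auto
      also have "\<dots> \<le> \<bar>\<delta> n\<bar> * c2"
      proof (rule mult_left_mono)
        have "N1 \<phi> \<le> Q * N1 q" unfolding \<phi>_def[abs_def] by (rule Q(2)[OF q])
        also have "N1 q \<le> (\<Sum>j\<in>UNIV. N1 (p j))" unfolding q_def[abs_def] by (rule N1_sum[OF p])
        also have "\<dots> \<le> (\<Sum>j\<in>(UNIV::3 set). D * M)"
        proof (rule sum_mono)
          fix j
          have "N1 (p j) \<le> D * n2 (E n j)" unfolding p_def by (rule D(2)[OF tf(1)])
          also have "\<dots> \<le> D * M" by (intro mult_left_mono M D)
          finally show "N1 (p j) \<le> D * M" .
        qed
        finally show "N1 \<phi> \<le> c2" unfolding c2_def using Q(1) by (simp add: mult_left_mono)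
      qed simp
      finally show ?thesis .
    qed
    show ?thesis
      unfolding split R_def using e1 e2 e3 e4 e5 unfolding u1_def u2_def K_def by linarith
  qed
  moreover have "R \<longlonglongrightarrow> 0"
  proof -
    have 2: "(\<lambda>n. \<Sum>j\<in>UNIV. n2 (conv b (conv b (G n j)))) \<longlonglongrightarrow> (\<Sum>j\<in>(UNIV::3 set). 0)"
    proof (rule tendsto_sum)
      fix j
      show "(\<lambda>n. n2 (conv b (conv b (G n j)))) \<longlonglongrightarrow> 0"
        using conv_wnull[OF G conv_tf[OF b(1) b(1)], of j] by (simp add: conv_assoc b tf)
    qed
    have 5: "(\<lambda>n. \<Sum>j\<in>UNIV. n2 (hop (\<beta> j) B (N n) (W n))) \<longlonglongrightarrow> (\<Sum>j\<in>(UNIV::3 set). 0)"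
      by (intro tendsto_sum hop_wnull W \<beta>tf B)
    have "R \<longlonglongrightarrow> M * 0 + M * (\<Sum>j\<in>(UNIV::3 set). 0) + \<bar>0\<bar> * c1 + \<bar>0\<bar> * c2 + M * (\<Sum>j\<in>(UNIV::3 set). 0)"
      unfolding R_def[abs_def] by (intro tendsto_add tendsto_mult tendsto_const tendsto_rabs N 2 5 \<delta>)
    then show ?thesis by simp
  qed
  ultimately have "(\<lambda>n. \<Sum>j\<in>UNIV. ip lborel (E n j) (G n j)) \<longlonglongrightarrow> 0"
    unfolding real_norm_def[symmetric] by (rule Lim_null_comparison[OF always_eventually[OF allI]])
  then show ?thesis by (simp add: G_def[abs_def])
qed

text \<open>The dual of the preceding case: the cone now keeps the scalar potential in
  \<open>\<Omega>\<close>, where the divergence of \<open>H\<close> may be tested with it, while the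
  curl of \<open>E\<close> is tested with adjoint potentials that may leave
  \<open>\<Omega>\<close>.\<close>

lemma div_curl_core_div:
  fixes E H :: "nat \<Rightarrow> 3 \<Rightarrow> real^3 \<Rightarrow> real"
  assumes \<theta>: "\<theta> \<in> tf" and \<rho>: "\<rho> > 0" and L: "compact L" "\<And>n j x. x \<notin> L \<Longrightarrow> \<theta> x * E n j x = 0"
    and cone: "\<And>x z. x \<in> L \<Longrightarrow> z \<in> cone_seg v \<rho> 1 \<Longrightarrow> x + z \<in> \<Omega>"
    and E: "\<And>j. wnull (\<lambda>n. E n j)" and H: "\<And>j. wnull (\<lambda>n. H n j)"
    and \<delta>: "\<delta> \<longlonglongrightarrow> 0"
    and curlE: "\<And>n \<Phi>. (\<And>j. \<Phi> j \<in> tf) \<Longrightarrow>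
        \<bar>\<Sum>j\<in>UNIV. ip lborel (E n j) (ccurl \<Phi> j)\<bar> \<le> \<delta> n * (\<Sum>j\<in>UNIV. N1 (\<Phi> j))"
    and divH: "\<And>n \<phi>. \<phi> \<in> test_functions \<Omega> \<Longrightarrow>
        \<bar>\<Sum>j\<in>UNIV. ip lborel (H n j) (partial_deriv j \<phi>)\<bar> \<le> \<delta> n * N1 \<phi>"
  shows "(\<lambda>n. \<Sum>j\<in>UNIV. ip lborel (H n j) (\<lambda>x. \<theta> x * E n j x)) \<longlonglongrightarrow> 0"
proof -
  obtain b and \<beta> :: "3 \<Rightarrow> real^3 \<Rightarrow> real" and B S where b: "b \<in> tf" "(LINT x|lborel. b x) = 1"
    and \<beta>: "\<And>j. divform (\<beta> j)" and B: "B \<in> tf"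
    and htpy: "\<And>f N x. f \<in> tf \<Longrightarrow> (\<Sum>j\<in>UNIV. partial_deriv j (hop (\<beta> j) B N f) x)
          = conv (dil (2^N) b) (conv (dil (2^N) b) f) x - conv b (conv b f) x"
    and S: "compact S" "S \<subseteq> cone_seg v \<rho> (1/2)" "\<And>j x. x \<notin> S \<Longrightarrow> \<beta> j x = 0" "\<And>x. x \<notin> S \<Longrightarrow> B x = 0"
    by (rule homotopy_kernels[OF \<rho>, of v], rule that) (assumption | simp)+
  have \<beta>tf: "\<beta> j \<in> tf" for j by (rule divform_tf[OF \<beta>])
  let ?\<beta>' = "\<lambda>j x. \<beta> j (- x)" and ?B' = "\<lambda>x. B (- x)"
  have \<beta>'tf: "?\<beta>' j \<in> tf" for j by (rule tf_minus[OF \<beta>tf])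
  have B'tf: "?B' \<in> tf" by (rule tf_minus[OF B])
  define G where "G n j x = \<theta> x * E n j x" for n j x
  have G: "wnull (\<lambda>n. G n j)" for j unfolding G_def[abs_def] by (rule wnull_mult[OF E \<theta>])
  have tf: "E n j \<in> tf" "H n j \<in> tf" "G n j \<in> tf" for n j
    using wnull_tf[OF E] wnull_tf[OF H] wnull_tf[OF G] by auto
  \<comment> \<open>The commutators of the curl with \<open>\<theta>\<close>, free of derivatives of
    \<open>E\<close>. Together with \<open>Z\<close> all index pairs are kept instead of the three
    components of the curl, which lets the sums over \<open>i\<close> and \<open>j\<close> be
    treated uniformly.\<close>
  define W where "W i j n x = partial_deriv i \<theta> x * E n j x - partial_deriv j \<theta> x * E n i x" for i j n x
  have W: "wnull (W i j)" for i j
    unfolding W_def[abs_def] by (intro wnull_diff wnull_mult E test_functions_partial \<theta>)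
  define Z where "Z i j n x = partial_deriv i (E n j) x - partial_deriv j (E n i) x" for i j n x
  have Ztf: "Z i j n \<in> tf" for i j n
    unfolding Z_def[abs_def] by (intro test_functions_diff test_functions_partial tf)
  obtain N where N: "(\<lambda>n. \<Sum>j\<in>UNIV. n2 (\<lambda>x. G n j x - conv (dil (2^N n) b) (conv (dil (2^N n) b) (G n j)) x)) \<longlonglongrightarrow> 0"
    using mollification_scales[of G b, OF G b] by blast
  obtain MH where MH: "MH \<ge> 0" "\<And>n j. n2 (H n j) \<le> MH"
    using wnull_uniform_bound[of H, OF H] by blast
  obtain MG where MG: "MG \<ge> 0" "\<And>n j. n2 (G n j) \<le> MG"
    using wnull_uniform_bound[of G, OF G] by blast
  define M where "M = MH + MG"
  have M0: "M \<ge> 0" unfolding M_def using MH MG by simp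
  have M: "n2 (H n j) \<le> M" "n2 (G n j) \<le> M" for n j
    using MH(1) MG(1) MH(2)[of n j] MG(2)[of n j] unfolding M_def by linarith+
  obtain C where C: "C \<ge> 0" "\<And>i f N. f \<in> tf \<Longrightarrow> N1 (hop (\<beta> i) B N f) \<le> C * n2 f"
    using hop_N1_uniform_bound[of \<beta> B, OF \<beta> B] by blast
  obtain D where D: "D \<ge> 0" "\<And>i f N. f \<in> tf \<Longrightarrow> N1 (hop (?\<beta>' i) ?B' N f) \<le> D * n2 f"
    using hop_N1_uniform_bound[of ?\<beta>' ?B', OF divform_minus[OF \<beta>] B'tf] by blast
  obtain Q where Q: "Q \<ge> 0" "\<And>f. f \<in> tf \<Longrightarrow> N1 (\<lambda>x. \<theta> x * f x) \<le> Q * N1 f"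
    using N1_mult[OF \<theta>] by blast
  define c1 where "c1 = (\<Sum>i\<in>(UNIV::3 set). C * M)"
  define c2 where "c2 = (\<Sum>i\<in>(UNIV::3 set). \<Sum>j\<in>(UNIV::3 set). Q * (D * M))"
  define R where "R n = M * (\<Sum>j\<in>UNIV. n2 (\<lambda>x. G n j x - conv (dil (2^N n) b) (conv (dil (2^N n) b) (G n j)) x))
      + M * (\<Sum>j\<in>UNIV. n2 (conv b (conv b (G n j)))) + \<bar>\<delta> n\<bar> * c1 + \<bar>\<delta> n\<bar> * c2
      + (\<Sum>i\<in>UNIV. M * (\<Sum>j\<in>UNIV. n2 (hop (\<beta> i) B (N n) (W i j n))))" for n
  have "\<bar>\<Sum>j\<in>UNIV. ip lborel (H n j) (G n j)\<bar> \<le> R n" for n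
  proof -
    define K where "K i f = hop (\<beta> i) B (N n) f" for i f
    have Ktf: "K i f \<in> tf" if "f \<in> tf" for i f unfolding K_def by (rule hop_tf[OF \<beta>tf B that])
    \<comment> \<open>The scalar potential \<open>K \<cdot> G\<close>; its gradient is the main part
      of \<open>G\<close>.\<close>
    define a where "a x = (\<Sum>i\<in>UNIV. K i (G n i) x)" for x
    have a\<Omega>: "a \<in> test_functions \<Omega>"
    proof -
      have "K i (G n i) \<in> test_functions \<Omega>" for i
        unfolding K_def
        by (rule hop_test_function[OF \<beta>tf B tf(3) S L(1) _ cone]) (use L(2) in \<open>auto simp: G_def\<close>)
      then show ?thesis unfolding a_def[abs_def] by (intro test_functions_sum)
    qed
    have atf: "a \<in> tf" by (rule test_functions_UNIV[OF a\<Omega>])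
    define u1 where "u1 j x = G n j x - conv (dil (2^N n) b) (conv (dil (2^N n) b) (G n j)) x" for j x
    define u2 where "u2 j = conv b (conv b (G n j))" for j
    have u1: "u1 j \<in> tf" for j
      unfolding u1_def[abs_def] by (intro test_functions_diff conv_tf dil_tf tf b) auto
    have u2: "u2 j \<in> tf" for j unfolding u2_def by (intro conv_tf tf b)
    define U where "U i j x = \<theta> x * Z i j n x" for i j x
    have U: "U i j \<in> tf" for i j unfolding U_def[abs_def] by (intro tf_mult \<theta> Ztf)
    \<comment> \<open>Exchanging the two indices turns the divergence of the kernel acting on
      \<open>G n j\<close> into the derivative in direction \<open>j\<close> of \<open>a\<close>, at
      the price of curl terms.\<close>
    have curlG: "partial_deriv i (G n j) = (\<lambda>x. partial_deriv j (G n i) x + (U i j x + W i j n x))" for i j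
      unfolding G_def[abs_def] U_def W_def Z_def
      by (simp add: fun_eq_iff partial_deriv_mult tf_smooth \<theta> tf right_diff_distrib)
    have decomp: "G n j = (\<lambda>x. u1 j x + u2 j x + partial_deriv j a x + (\<Sum>i\<in>UNIV. K i (U i j) x) + (\<Sum>i\<in>UNIV. K i (W i j n) x))" for j
    proof
      fix x
      have pa: "partial_deriv j a x = (\<Sum>i\<in>UNIV. K i (partial_deriv j (G n i)) x)"
        unfolding a_def[abs_def]
        by (subst partial_deriv_sum) (auto simp: tf_smooth Ktf tf K_def partial_hop \<beta>tf B hop_tf)
      have "(\<Sum>i\<in>UNIV. partial_deriv i (K i (G n j)) x)
          = conv (dil (2^N n) b) (conv (dil (2^N n) b) (G n j)) x - conv b (conv b (G n j)) x"
        unfolding K_def by (rule htpy[OF tf(3)])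
      moreover have "(\<Sum>i\<in>UNIV. partial_deriv i (K i (G n j)) x) = (\<Sum>i\<in>UNIV. K i (partial_deriv i (G n j)) x)"
        unfolding K_def by (simp add: partial_hop[OF \<beta>tf B tf(3)])
      moreover have "K i (partial_deriv i (G n j)) x = K i (partial_deriv j (G n i)) x + (K i (U i j) x + K i (W i j n) x)" for i
        unfolding curlG[of i j] K_def
        by (simp add: hop_add \<beta>tf B U wnull_tf[OF W] test_functions_add test_functions_partial tf)
      ultimately show "G n j x = u1 j x + u2 j x + partial_deriv j a x + (\<Sum>i\<in>UNIV. K i (U i j) x) + (\<Sum>i\<in>UNIV. K i (W i j n) x)"
        unfolding pa u1_def u2_def by (simp add: sum.distrib)
    qed
    have KU: "(\<lambda>x. \<Sum>i\<in>UNIV. K i (U i j) x) \<in> tf" for j by (intro test_functions_sum Ktf U)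
    have KW: "(\<lambda>x. \<Sum>i\<in>UNIV. K i (W i j n) x) \<in> tf" for j by (intro test_functions_sum Ktf wnull_tf[OF W])
    have "ip lborel (H n j) (G n j) = ip lborel (H n j) (u1 j) + ip lborel (H n j) (u2 j) + ip lborel (H n j) (partial_deriv j a)
        + (\<Sum>i\<in>UNIV. ip lborel (H n j) (K i (U i j))) + (\<Sum>i\<in>UNIV. ip lborel (H n j) (K i (W i j n)))" for j
      by (subst decomp)
        (simp add: ip_add_right ip_sum_right test_function_sqint sqint_add tf u1 u2 KU KW Ktf U wnull_tf[OF W] test_functions_partial atf)
    then have split: "(\<Sum>j\<in>UNIV. ip lborel (H n j) (G n j)) = (\<Sum>j\<in>UNIV. ip lborel (H n j) (u1 j))
       + (\<Sum>j\<in>UNIV. ip lborel (H n j) (u2 j)) + (\<Sum>j\<in>UNIV. ip lborel (H n j) (partial_deriv j a))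
       + (\<Sum>j\<in>UNIV. \<Sum>i\<in>UNIV. ip lborel (H n j) (K i (U i j))) + (\<Sum>i\<in>UNIV. \<Sum>j\<in>UNIV. ip lborel (H n j) (K i (W i j n)))"
      using sum.swap[of "\<lambda>i j. ip lborel (H n j) (K i (W i j n))" UNIV UNIV] by (simp add: sum.distrib)
    have e1: "\<bar>\<Sum>j\<in>UNIV. ip lborel (H n j) (u1 j)\<bar> \<le> M * (\<Sum>j\<in>UNIV. n2 (u1 j))"
      by (rule abs_sum_ip_le[OF tf(2) u1 M(1)])
    have e2: "\<bar>\<Sum>j\<in>UNIV. ip lborel (H n j) (u2 j)\<bar> \<le> M * (\<Sum>j\<in>UNIV. n2 (u2 j))"
      by (rule abs_sum_ip_le[OF tf(2) u2 M(1)])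
    have e5: "\<bar>\<Sum>i\<in>UNIV. \<Sum>j\<in>UNIV. ip lborel (H n j) (K i (W i j n))\<bar> \<le> (\<Sum>i\<in>UNIV. M * (\<Sum>j\<in>UNIV. n2 (K i (W i j n))))"
      by (rule order_trans[OF sum_abs sum_mono[OF abs_sum_ip_le[OF tf(2) Ktf[OF wnull_tf[OF W]] M(1)]]])
    have e3: "\<bar>\<Sum>j\<in>UNIV. ip lborel (H n j) (partial_deriv j a)\<bar> \<le> \<bar>\<delta> n\<bar> * c1"
    proof -
      have "N1 a \<le> (\<Sum>i\<in>UNIV. N1 (K i (G n i)))"
        unfolding a_def[abs_def] by (rule N1_sum[OF Ktf[OF tf(3)]])
      also have "\<dots> \<le> c1"
        unfolding c1_def
      proof (rule sum_mono)
        fix i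
        have "N1 (K i (G n i)) \<le> C * n2 (G n i)" unfolding K_def by (rule C(2)[OF tf(3)])
        also have "\<dots> \<le> C * M" by (intro mult_left_mono M C)
        finally show "N1 (K i (G n i)) \<le> C * M" .
      qed
      finally have 1: "N1 a \<le> c1" .
      have "\<bar>\<Sum>j\<in>UNIV. ip lborel (H n j) (partial_deriv j a)\<bar> \<le> \<delta> n * N1 a" by (rule divH[OF a\<Omega>])
      also have "\<dots> \<le> \<bar>\<delta> n\<bar> * N1 a" by (intro mult_right_mono N1_nonneg) auto
      also have "\<dots> \<le> \<bar>\<delta> n\<bar> * c1" by (intro mult_left_mono 1) auto
      finally show ?thesis .
    qed
    have e4: "\<bar>\<Sum>j\<in>UNIV. \<Sum>i\<in>UNIV. ip lborel (H n j) (K i (U i j))\<bar> \<le> \<bar>\<delta> n\<bar> * c2"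
    proof -
      define p where "p i j = hop (?\<beta>' i) ?B' (N n) (H n j)" for i j
      have p: "p i j \<in> tf" for i j unfolding p_def by (rule hop_tf[OF \<beta>'tf B'tf tf(2)])
      define w where "w i j x = \<theta> x * p i j x" for i j x
      have w: "w i j \<in> tf" for i j unfolding w_def[abs_def] by (intro tf_mult \<theta> p)
      \<comment> \<open>After summation over \<open>i\<close> and \<open>j\<close>, pairing the
        antisymmetric array \<open>Z\<close> with \<open>w\<close> becomes pairing \<open>E\<close>
        with the curl of \<open>cyc w\<close>, which \<open>curlE\<close> controls.\<close>
      have term_eq: "ip lborel (H n j) (K i (U i j))
          = ip lborel (E n i) (partial_deriv j (w i j)) - ip lborel (E n j) (partial_deriv i (w i j))" for i j
      proof -
        have "ip lborel (H n j) (K i (U i j)) = ip lborel (U i j) (p i j)"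
          using hop_adjoint[OF \<beta>tf B U tf(2)] by (simp add: ip_real K_def p_def mult.commute)
        also have "\<dots> = ip lborel (Z i j n) (w i j)" by (simp add: ip_real U_def w_def mult_ac)
        also have "\<dots> = ip lborel (partial_deriv i (E n j)) (w i j) - ip lborel (partial_deriv j (E n i)) (w i j)"
          unfolding Z_def[abs_def] by (rule ip_diff_left) (intro test_function_sqint test_functions_partial tf w)+
        finally show ?thesis by (simp add: ip_real integral_by_parts[OF tf(1) tf_smooth[OF w]])
      qed
      have "ip lborel (E n j) (ccurl (cyc w) j)
          = (\<Sum>i\<in>UNIV. ip lborel (E n j) (partial_deriv i (w j i))) - (\<Sum>i\<in>UNIV. ip lborel (E n j) (partial_deriv i (w i j)))" for j
      proof -
        have "ccurl (cyc w) j = (\<lambda>x. (\<Sum>i\<in>UNIV. partial_deriv i (w j i) x) - (\<Sum>i\<in>UNIV. partial_deriv i (w i j) x))"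
          by (rule ext) (rule ccurl_cyc[OF w])
        then show ?thesis
          by (simp add: ip_diff_right ip_sum_right test_function_sqint test_functions_sum test_functions_partial tf w)
      qed
      then have "(\<Sum>j\<in>UNIV. ip lborel (E n j) (ccurl (cyc w) j))
          = (\<Sum>j\<in>UNIV. \<Sum>i\<in>UNIV. ip lborel (E n j) (partial_deriv i (w j i)))
            - (\<Sum>j\<in>UNIV. \<Sum>i\<in>UNIV. ip lborel (E n j) (partial_deriv i (w i j)))"
        by (simp add: sum_subtractf)
      also have "\<dots> = (\<Sum>j\<in>UNIV. \<Sum>i\<in>UNIV. ip lborel (H n j) (K i (U i j)))"
        unfolding term_eq sum_subtractf
        using sum.swap[of "\<lambda>j i. ip lborel (E n j) (partial_deriv i (w j i))" UNIV UNIV] by simp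
      finally have "\<bar>\<Sum>j\<in>UNIV. \<Sum>i\<in>UNIV. ip lborel (H n j) (K i (U i j))\<bar>
          = \<bar>\<Sum>j\<in>UNIV. ip lborel (E n j) (ccurl (cyc w) j)\<bar>" by simp
      also have "\<dots> \<le> \<delta> n * (\<Sum>j\<in>UNIV. N1 (cyc w j))" by (rule curlE[OF cyc_in[OF w]])
      also have "\<dots> \<le> \<bar>\<delta> n\<bar> * (\<Sum>j\<in>UNIV. N1 (cyc w j))"
        by (intro mult_right_mono sum_nonneg N1_nonneg) auto
      also have "\<dots> \<le> \<bar>\<delta> n\<bar> * c2"
      proof (rule mult_left_mono)
        have "(\<Sum>j\<in>UNIV. N1 (cyc w j)) \<le> (\<Sum>i\<in>UNIV. \<Sum>j\<in>UNIV. N1 (w i j))" by (rule N1_cyc[OF w])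
        also have "\<dots> \<le> c2"
          unfolding c2_def
        proof (intro sum_mono)
          fix i j
          have "N1 (w i j) \<le> Q * N1 (p i j)" unfolding w_def[abs_def] by (rule Q(2)[OF p])
          also have "N1 (p i j) \<le> D * n2 (H n j)" unfolding p_def by (rule D(2)[OF tf(2)])
          also have "D * n2 (H n j) \<le> D * M" by (intro mult_left_mono M D)
          finally show "N1 (w i j) \<le> Q * (D * M)" using Q(1) by (simp add: mult_left_mono)
        qed
        finally show "(\<Sum>j\<in>UNIV. N1 (cyc w j)) \<le> c2" .
      qed simp
      finally show ?thesis .
    qed
    show ?thesis
      unfolding split R_def using e1 e2 e3 e4 e5 unfolding u1_def u2_def K_def by linarith
  qed
  moreover have "R \<longlonglongrightarrow> 0"
  proof -
    have 2: "(\<lambda>n. \<Sum>j\<in>UNIV. n2 (conv b (conv b (G n j)))) \<longlonglongrightarrow> (\<Sum>j\<in>(UNIV::3 set). 0)"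
    proof (rule tendsto_sum)
      fix j
      show "(\<lambda>n. n2 (conv b (conv b (G n j)))) \<longlonglongrightarrow> 0"
        using conv_wnull[OF G conv_tf[OF b(1) b(1)], of j] by (simp add: conv_assoc b tf)
    qed
    have 5: "(\<lambda>n. \<Sum>i\<in>UNIV. M * (\<Sum>j\<in>UNIV. n2 (hop (\<beta> i) B (N n) (W i j n)))) \<longlonglongrightarrow> (\<Sum>i\<in>(UNIV::3 set). M * (\<Sum>j\<in>(UNIV::3 set). 0))"
      by (intro tendsto_sum tendsto_mult tendsto_const hop_wnull W \<beta>tf B)
    have "R \<longlonglongrightarrow> M * 0 + M * (\<Sum>j\<in>(UNIV::3 set). 0) + \<bar>0\<bar> * c1 + \<bar>0\<bar> * c2 + (\<Sum>i\<in>(UNIV::3 set). M * (\<Sum>j\<in>(UNIV::3 set). 0))"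
      unfolding R_def[abs_def] by (intro tendsto_add tendsto_mult tendsto_const tendsto_rabs N 2 5 \<delta>)
    then show ?thesis by simp
  qed
  ultimately have "(\<lambda>n. \<Sum>j\<in>UNIV. ip lborel (H n j) (G n j)) \<longlonglongrightarrow> 0"
    unfolding real_norm_def[symmetric] by (rule Lim_null_comparison[OF always_eventually[OF allI]])
  then show ?thesis by (simp add: G_def[abs_def])
qed

section \<open>Completeness and weak compactness of \<open>L\<^sup>2\<close>\<close>

lemma sqint_norm: "u \<in> sqint M \<Longrightarrow> (\<lambda>x. norm (u x)) \<in> sqint M"
  by (auto simp: sqint_def)

lemma nrm_norm: "nrm M (\<lambda>x. norm (u x)) = nrm M u"
  by (simp add: nrm_eq_integral)

lemma sqint_integrable_norm:
  assumes "finite_measure M" "u \<in> sqint M"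
  shows "integrable M (\<lambda>x. norm (u x))" "(LINT x|M. norm (u x)) \<le> sqrt (measure M (space M)) * nrm M u"
proof -
  interpret finite_measure M by fact
  have 1: "(\<lambda>x. 1::real) \<in> sqint M" by (simp add: sqint_def)
  show "integrable M (\<lambda>x. norm (u x))"
    using ip_integrable[OF sqint_norm[OF assms(2)] 1] by simp
  have "nrm M (\<lambda>x. 1::real) = sqrt (measure M (space M))" by (simp add: nrm_def ip_def)
  then show "(LINT x|M. norm (u x)) \<le> sqrt (measure M (space M)) * nrm M u"
    using ip_Cauchy_Schwarz[OF 1 sqint_norm[OF assms(2)]] by (simp add: ip_def nrm_norm)
qed

text \<open>On a finite measure the \<open>L\<^sup>2\<close> bounds on the increments are
  \<open>L\<^sup>1\<close> bounds up to a constant, so the series of their norms has a finite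
  integral and converges almost everywhere.\<close>

lemma AE_convergent_of_summable_nrm:
  assumes fin: "finite_measure M" and V: "\<And>k. V k \<in> sqint M"
    and s: "\<And>k. nrm M (\<lambda>x. V (Suc k) x - V k x) \<le> (1/2)^k"
  shows "AE x in M. convergent (\<lambda>k. V k x)"
proof -
  define d where "d k x = V (Suc k) x - V k x" for k x
  have d: "d k \<in> sqint M" for k unfolding d_def[abs_def] by (intro sqint_diff V)
  have [measurable]: "d k \<in> borel_measurable M" for k using d[of k] by (simp add: sqint_def)
  let ?c = "sqrt (measure M (space M))"
  have "(\<integral>\<^sup>+ x. (\<Sum>k. ennreal (norm (d k x))) \<partial>M) = (\<Sum>k. \<integral>\<^sup>+ x. ennreal (norm (d k x)) \<partial>M)"
    by (rule nn_integral_suminf) simp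
  also have "\<dots> \<le> (\<Sum>k. ennreal (?c * (1/2)^k))"
  proof (rule suminf_le)
    fix k
    have "(\<integral>\<^sup>+ x. ennreal (norm (d k x)) \<partial>M) = ennreal (LINT x|M. norm (d k x))"
      by (rule nn_integral_eq_integral[OF sqint_integrable_norm(1)[OF fin d]]) simp
    also have "\<dots> \<le> ennreal (?c * nrm M (d k))"
      by (intro ennreal_leI sqint_integrable_norm(2)[OF fin d])
    also have "\<dots> \<le> ennreal (?c * (1/2)^k)"
      using s[of k] by (intro ennreal_leI mult_left_mono) (auto simp: d_def[abs_def])
    finally show "(\<integral>\<^sup>+ x. ennreal (norm (d k x)) \<partial>M) \<le> ennreal (?c * (1/2)^k)" .
  qed auto
  also have "\<dots> = ennreal (\<Sum>k. ?c * (1/2)^k)"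
    by (rule suminf_ennreal2) (auto intro!: summable_mult summable_geometric)
  also have "\<dots> < \<infinity>" by simp
  finally have "AE x in M. (\<Sum>k. ennreal (norm (d k x))) \<noteq> \<infinity>"
    by (intro nn_integral_PInf_AE) auto
  then show ?thesis
  proof (rule eventually_mono)
    fix x assume "(\<Sum>k. ennreal (norm (d k x))) \<noteq> \<infinity>"
    then have "summable (\<lambda>k. norm (d k x))" by (intro summable_suminf_not_top) auto
    then have "summable (\<lambda>k. d k x)" by (rule summable_norm_cancel)
    then have "convergent (\<lambda>n. \<Sum>k<n. d k x)" by (simp add: summable_iff_convergent)
    moreover have "(\<Sum>k<n. d k x) = V n x - V 0 x" for n
      unfolding d_def by (rule sum_lessThan_telescope)
    ultimately have "convergent (\<lambda>n. V n x - V 0 x)" by simp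
    from convergent_add[OF this convergent_const[of "V 0 x"]] show "convergent (\<lambda>k. V k x)" by simp
  qed
qed

lemma nrm_ennreal: "u \<in> sqint M \<Longrightarrow> (\<integral>\<^sup>+ x. ennreal ((norm (u x))\<^sup>2) \<partial>M) = ennreal ((nrm M u)\<^sup>2)"
  by (subst nn_integral_eq_integral) (auto simp: sqint_def nrm_power2 ip_def power2_norm_eq_inner)

text \<open>Riesz-Fischer: a rapidly Cauchy subsequence converges almost everywhere, and Fatou's
  lemma upgrades this to convergence in \<open>nrm\<close> of the whole sequence.\<close>

lemma sqint_complete:
  assumes fin: "finite_measure M" and W: "\<And>n. W n \<in> sqint M"
    and Cauchy: "\<And>e. e > 0 \<Longrightarrow> \<exists>N. \<forall>m\<ge>N. \<forall>n\<ge>N. nrm M (\<lambda>x. W m x - W n x) < e"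
  shows "\<exists>w\<in>sqint M. (\<lambda>n. nrm M (\<lambda>x. W n x - w x)) \<longlonglongrightarrow> 0"
proof -
  have "\<forall>k. \<exists>N. \<forall>m\<ge>N. \<forall>n\<ge>N. nrm M (\<lambda>x. W m x - W n x) < (1/2)^k"
    using Cauchy by simp
  from choice[OF this] obtain N where N: "\<And>k m n. m \<ge> N k \<Longrightarrow> n \<ge> N k \<Longrightarrow> nrm M (\<lambda>x. W m x - W n x) < (1/2)^k"
    by blast
  \<comment> \<open>A cumulative sum plus \<open>k\<close> lies above \<open>N k\<close>, is
    nondecreasing and tends to infinity.\<close>
  define r where "r k = (\<Sum>i\<le>k. N i) + k" for k
  have rN: "N k \<le> r k" "r k \<le> r (Suc k)" "k \<le> r k" for k
    using member_le_sum[of k "{..k}" N] by (auto simp: r_def)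
  define V where "V k = W (r k)" for k
  have V: "V k \<in> sqint M" for k by (simp add: V_def W)
  have step: "nrm M (\<lambda>x. V (Suc k) x - V k x) \<le> (1/2)^k" for k
    using N[of k "r (Suc k)" "r k"] rN[of k] unfolding V_def by (simp add: less_imp_le)
  have conv: "AE x in M. convergent (\<lambda>k. V k x)"
    by (rule AE_convergent_of_summable_nrm[OF fin V step])
  define w where "w x = lim (\<lambda>k. V k x)" for x
  have [measurable]: "V k \<in> borel_measurable M" "W k \<in> borel_measurable M" for k
    using V[of k] W[of k] by (simp_all add: sqint_def)
  have wm[measurable]: "w \<in> borel_measurable M" unfolding w_def[abs_def] by measurable
  have lim: "AE x in M. (\<lambda>k. V k x) \<longlonglongrightarrow> w x"
    using conv by (rule eventually_mono) (simp add: w_def convergent_LIMSEQ_iff)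
  have fatou: "(\<integral>\<^sup>+ x. ennreal ((norm (W n x - w x))\<^sup>2) \<partial>M) \<le> ennreal (e\<^sup>2)"
    if e: "\<And>k. k \<ge> K \<Longrightarrow> nrm M (\<lambda>x. W n x - V k x) \<le> e" for n K e
  proof -
    have "(\<integral>\<^sup>+ x. ennreal ((norm (W n x - w x))\<^sup>2) \<partial>M) = (\<integral>\<^sup>+ x. liminf (\<lambda>k. ennreal ((norm (W n x - V k x))\<^sup>2)) \<partial>M)"
    proof (rule nn_integral_cong_AE, rule eventually_mono[OF lim])
      fix x assume "(\<lambda>k. V k x) \<longlonglongrightarrow> w x"
      then have "(\<lambda>k. ennreal ((norm (W n x - V k x))\<^sup>2)) \<longlonglongrightarrow> ennreal ((norm (W n x - w x))\<^sup>2)"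
        by (intro tendsto_intros)
      then show "ennreal ((norm (W n x - w x))\<^sup>2) = liminf (\<lambda>k. ennreal ((norm (W n x - V k x))\<^sup>2))"
        by (rule lim_imp_Liminf[OF trivial_limit_sequentially, symmetric])
    qed
    also have "\<dots> \<le> liminf (\<lambda>k. \<integral>\<^sup>+ x. ennreal ((norm (W n x - V k x))\<^sup>2) \<partial>M)"
      by (rule nn_integral_liminf) simp
    also have "\<dots> \<le> ennreal (e\<^sup>2)"
    proof (rule Liminf_le)
      show "\<forall>\<^sub>F k in sequentially. (\<integral>\<^sup>+ x. ennreal ((norm (W n x - V k x))\<^sup>2) \<partial>M) \<le> ennreal (e\<^sup>2)"
        unfolding eventually_sequentially
      proof (intro exI[of _ K] allI impI)
        fix k assume "K \<le> k"
        then show "(\<integral>\<^sup>+ x. ennreal ((norm (W n x - V k x))\<^sup>2) \<partial>M) \<le> ennreal (e\<^sup>2)"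
          using e[of k] nrm_ennreal[OF sqint_diff[OF W V], of n k]
          by (simp add: nrm_nonneg power_mono)
      qed
    qed simp
    finally show ?thesis .
  qed
  have small: "\<exists>n0. \<forall>n\<ge>n0. (\<lambda>x. W n x - w x) \<in> sqint M \<and> nrm M (\<lambda>x. W n x - w x) \<le> e" if e: "e > 0" for e
  proof -
    obtain n0 where n0: "\<And>m n. m \<ge> n0 \<Longrightarrow> n \<ge> n0 \<Longrightarrow> nrm M (\<lambda>x. W m x - W n x) < e"
      using Cauchy[OF e] by blast
    have "(\<lambda>x. W n x - w x) \<in> sqint M \<and> nrm M (\<lambda>x. W n x - w x) \<le> e" if n: "n \<ge> n0" for n
    proof -
      have b: "(\<integral>\<^sup>+ x. ennreal ((norm (W n x - w x))\<^sup>2) \<partial>M) \<le> ennreal (e\<^sup>2)"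
      proof (rule fatou)
        fix k assume "k \<ge> n0"
        then have "r k \<ge> n0" using rN(3)[of k] by simp
        then show "nrm M (\<lambda>x. W n x - V k x) \<le> e" using n0[OF n, of "r k"] by (simp add: V_def)
      qed
      have sq: "(\<lambda>x. W n x - w x) \<in> sqint M"
        unfolding sqint_def
      proof (intro CollectI conjI integrableI_nonneg)
        show "(\<integral>\<^sup>+ x. ennreal ((norm (W n x - w x))\<^sup>2) \<partial>M) < \<infinity>"
          using b ennreal_less_top le_less_trans by (metis infinity_ennreal_def)
      qed auto
      have "(nrm M (\<lambda>x. W n x - w x))\<^sup>2 \<le> e\<^sup>2" using b nrm_ennreal[OF sq] by simp
      then show ?thesis using sq e power2_le_imp_le[of _ e] by simp
    qed
    then show ?thesis by blast
  qed
  obtain n1 where "(\<lambda>x. W n1 x - w x) \<in> sqint M" using small[of 1] by auto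
  then have "(\<lambda>x. W n1 x - (W n1 x - w x)) \<in> sqint M" by (rule sqint_diff[OF W])
  then have w: "w \<in> sqint M" by simp
  have "(\<lambda>n. nrm M (\<lambda>x. W n x - w x)) \<longlonglongrightarrow> 0"
  proof (rule LIMSEQ_I)
    fix e :: real assume e: "e > 0"
    obtain n0 where "\<And>n. n \<ge> n0 \<Longrightarrow> nrm M (\<lambda>x. W n x - w x) \<le> e / 2" using small[of "e/2"] e by auto
    then show "\<exists>no. \<forall>n\<ge>no. norm (nrm M (\<lambda>x. W n x - w x) - 0) < e"
      using e by (intro exI[of _ n0]) (force simp: nrm_nonneg)
  qed
  then show ?thesis using w by blast
qed

text \<open>The argument of Banach and Saks: sums of \<open>J\<close> nearly orthogonal members have norm \<open>O(\<surd>J)\<close>,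
  while a functional not tending to zero would grow like \<open>J\<close> on them.\<close>

lemma functional_tendsto_0:
  fixes y :: "nat \<Rightarrow> 'a \<Rightarrow> 'b::euclidean_space"
  assumes y: "\<And>n. y n \<in> sqint M" and C: "\<And>n. nrm M (y n) \<le> C"
    and orth: "\<And>m. (\<lambda>n. ip M (y n) (y m)) \<longlonglongrightarrow> 0"
    and add: "\<And>u v. u \<in> sqint M \<Longrightarrow> v \<in> sqint M \<Longrightarrow> f (\<lambda>x. u x + v x) = f u + f v"
    and bd: "\<And>u. u \<in> sqint M \<Longrightarrow> \<bar>f u\<bar> \<le> B * nrm M u" and B: "B \<ge> 0"
  shows "(\<lambda>n. f (y n)) \<longlonglongrightarrow> (0::real)"
proof -
  have f0: "f (\<lambda>x. 0) = 0" using bd[OF sqint_zero] by (simp add: nrm_zero)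
  have C0: "C \<ge> 0" using C nrm_nonneg order_trans by blast
  \<comment> \<open>The sign \<open>\<sigma>\<close> treats infinitely many large positive values
    and infinitely many large negative values of the functional alike.\<close>
  have main: "False" if inf: "\<And>n0. \<exists>n\<ge>n0. \<sigma> * f (y n) \<ge> e" and e: "e > 0" and \<sigma>: "\<bar>\<sigma>\<bar> = 1" for \<sigma> e
  proof -
    \<comment> \<open>The next member is taken so late that its inner product with the previous sum
      is below 1; the squared norm then grows by at most 2 from the cross term and
      \<open>C\<^sup>2\<close> from the new member.\<close>
    have "\<exists>z\<in>sqint M. (nrm M z)\<^sup>2 \<le> J * (C\<^sup>2 + 2) \<and> \<sigma> * f z \<ge> J * e \<and> (\<lambda>n. ip M (y n) z) \<longlonglongrightarrow> 0" for J :: nat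
    proof (induction J)
      case 0
      show ?case
        by (rule bexI[of _ "\<lambda>x. 0"]) (auto simp: sqint_zero nrm_zero f0 ip_def)
    next
      case (Suc J)
      then obtain z where z: "z \<in> sqint M" "(nrm M z)\<^sup>2 \<le> J * (C\<^sup>2 + 2)" "\<sigma> * f z \<ge> J * e" "(\<lambda>n. ip M (y n) z) \<longlonglongrightarrow> 0"
        by blast
      have "\<forall>\<^sub>F n in sequentially. ip M (y n) z < 1" using order_tendstoD(2)[OF z(4)] by simp
      then obtain n0 where n0: "\<And>n. n \<ge> n0 \<Longrightarrow> ip M (y n) z < 1" unfolding eventually_sequentially by blast
      obtain n where n: "n \<ge> n0" "\<sigma> * f (y n) \<ge> e" using inf by blast
      let ?z = "\<lambda>x. z x + y n x"
      have "(nrm M ?z)\<^sup>2 = (nrm M z)\<^sup>2 + 2 * ip M (y n) z + (nrm M (y n))\<^sup>2"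
        using y z(1) by (simp add: nrm_power2 ip_add_left ip_add_right sqint_add ip_commute[of M z "y n"])
      moreover have "(nrm M (y n))\<^sup>2 \<le> C\<^sup>2" by (intro power_mono C nrm_nonneg)
      ultimately have "(nrm M ?z)\<^sup>2 \<le> Suc J * (C\<^sup>2 + 2)"
        using z(2) n0[OF n(1)] by (simp add: algebra_simps)
      moreover have "\<sigma> * f ?z \<ge> Suc J * e"
        using z(3) n(2) by (simp add: add[OF z(1) y] algebra_simps)
      moreover have "(\<lambda>k. ip M (y k) ?z) \<longlonglongrightarrow> 0"
        using tendsto_add[OF z(4) orth[of n]] by (simp add: ip_add_right y z(1))
      ultimately show ?case using sqint_add[OF z(1) y] by blast
    qed
    note ex = this
    have le: "J * e\<^sup>2 \<le> B\<^sup>2 * (C\<^sup>2 + 2)" if "J > 0" for J :: nat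
    proof -
      obtain z where z: "z \<in> sqint M" "(nrm M z)\<^sup>2 \<le> J * (C\<^sup>2 + 2)" "\<sigma> * f z \<ge> J * e" using ex by blast
      have "J * e \<le> \<bar>\<sigma> * f z\<bar>" using z(3) by linarith
      also have "\<dots> \<le> B * nrm M z" using bd[OF z(1)] \<sigma> by (simp add: abs_mult)
      finally have "(J * e)\<^sup>2 \<le> (B * nrm M z)\<^sup>2" using e by (intro power_mono) auto
      also have "\<dots> \<le> B\<^sup>2 * (J * (C\<^sup>2 + 2))" using z(2) by (simp add: power_mult_distrib mult_left_mono)
      finally have "J * (J * e\<^sup>2) \<le> J * (B\<^sup>2 * (C\<^sup>2 + 2))" by (simp add: power2_eq_square mult_ac)
      then show ?thesis using that by simp
    qed
    obtain J :: nat where "J > B\<^sup>2 * (C\<^sup>2 + 2) / e\<^sup>2" using reals_Archimedean2 by blast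
    then have gt: "J * e\<^sup>2 > B\<^sup>2 * (C\<^sup>2 + 2)" using e by (simp add: field_simps)
    have "J > 0"
    proof (rule ccontr)
      assume "\<not> J > 0"
      then have "B\<^sup>2 * (C\<^sup>2 + 2) < 0" using gt by simp
      moreover have "0 \<le> B\<^sup>2 * (C\<^sup>2 + 2)" by (intro mult_nonneg_nonneg) auto
      ultimately show False by linarith
    qed
    then show False using le[of J] gt by linarith
  qed
  show ?thesis
  proof (rule LIMSEQ_I, rule ccontr)
    fix e :: real assume e: "e > 0" and no: "\<not> (\<exists>no. \<forall>n\<ge>no. norm (f (y n) - 0) < e)"
    have *: "\<exists>n\<ge>n0. \<bar>f (y n)\<bar> \<ge> e" for n0
    proof (rule ccontr)
      assume "\<not> (\<exists>n\<ge>n0. \<bar>f (y n)\<bar> \<ge> e)"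
      then have "\<forall>n\<ge>n0. norm (f (y n) - 0) < e" by (metis diff_zero not_le real_norm_def)
      then show False using no by blast
    qed
    show False
    proof (cases "\<forall>n0. \<exists>n\<ge>n0. 1 * f (y n) \<ge> e")
      case True
      then show False using main[where \<sigma>=1 and e=e] e by simp
    next
      case False
      then obtain n1 where n1: "\<And>n. n \<ge> n1 \<Longrightarrow> f (y n) < e" by (metis mult_1 not_le)
      have "\<exists>n\<ge>n0. (-1) * f (y n) \<ge> e" for n0
      proof -
        obtain n where n: "n \<ge> max n0 n1" "\<bar>f (y n)\<bar> \<ge> e" using * by blast
        then have "(-1) * f (y n) \<ge> e" using n1[of n] by (simp add: abs_real_def split: if_splits)
        then show ?thesis using n(1) by auto
      qed
      then show False using main[where \<sigma>="-1" and e=e] e by simp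
    qed
  qed
qed

text \<open>Midpoints suffice in place of all convex combinations, as the parallelogram identity
  uses nothing else, and they give a simple induction principle.\<close>

inductive_set midpoint_hull :: "(nat \<Rightarrow> 'a \<Rightarrow> 'b::euclidean_space) \<Rightarrow> nat \<Rightarrow> ('a \<Rightarrow> 'b) set" for v N where
  base: "n \<ge> N \<Longrightarrow> v n \<in> midpoint_hull v N"
| mid: "z \<in> midpoint_hull v N \<Longrightarrow> z' \<in> midpoint_hull v N \<Longrightarrow> (\<lambda>x. (1/2) *\<^sub>R (z x + z' x)) \<in> midpoint_hull v N"

lemma midpoint_hull_antimono: "z \<in> midpoint_hull v N \<Longrightarrow> M \<le> N \<Longrightarrow> z \<in> midpoint_hull v M"
  by (induction rule: midpoint_hull.induct) (auto intro: midpoint_hull.intros)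

lemma midpoint_hull_sqint:
  "z \<in> midpoint_hull v N \<Longrightarrow> (\<And>n. v n \<in> sqint M) \<Longrightarrow> z \<in> sqint M"
  by (induction rule: midpoint_hull.induct) (auto intro!: sqint_scaleR sqint_add)

lemma midpoint_hull_ip:
  assumes "z \<in> midpoint_hull v N" "\<And>n. v n \<in> sqint M" "u \<in> sqint M"
    and "\<And>n. n \<ge> N \<Longrightarrow> \<bar>ip M (v n) u - a\<bar> \<le> e"
  shows "\<bar>ip M z u - a\<bar> \<le> e"
  using assms(1)
proof (induction rule: midpoint_hull.induct)
  case (mid z z')
  have "z \<in> sqint M" "z' \<in> sqint M" using mid assms(2) midpoint_hull_sqint by blast+
  then have eq: "ip M (\<lambda>x. (1/2) *\<^sub>R (z x + z' x)) u - a = ((ip M z u - a) + (ip M z' u - a)) / 2"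
    using assms(3) by (simp only: ip_scaleR_left ip_add_left) (simp add: field_simps)
  have "\<bar>(ip M z u - a) + (ip M z' u - a)\<bar> \<le> e + e"
    using mid.IH by (intro order_trans[OF abs_triangle_ineq] add_mono)
  then show ?case unfolding eq by simp
qed (use assms in auto)

lemma nrm_parallelogram:
  assumes "u \<in> sqint M" "v \<in> sqint M"
  shows "(nrm M (\<lambda>x. u x - v x))\<^sup>2 = 2 * (nrm M u)\<^sup>2 + 2 * (nrm M v)\<^sup>2 - 4 * (nrm M (\<lambda>x. (1/2) *\<^sub>R (u x + v x)))\<^sup>2"
proof -
  have "(nrm M (\<lambda>x. (1/2) *\<^sub>R (u x + v x)))\<^sup>2 = ip M (\<lambda>x. u x + v x) (\<lambda>x. u x + v x) / 4"
    unfolding nrm_power2 ip_scaleR_left ip_scaleR_right by simp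
  then show ?thesis
    using assms by (simp add: nrm_power2 ip_add_left ip_add_right ip_diff_left ip_diff_right sqint_add sqint_diff ip_commute[of M v u])
qed

text \<open>A diagonal subsequence makes all mutual inner products converge. Nearly shortest
  elements of the midpoint hulls of its tails form a Cauchy sequence, and their limit
  \<open>w\<close> is the weak limit on the span of the sequence. The last conjunct is the near
  orthogonality that \<open>functional_tendsto_0\<close> takes as input, so a Riesz representation
  never enters.\<close>

lemma weakly_convergent_subsequence:
  fixes u :: "nat \<Rightarrow> 'a \<Rightarrow> 'b::euclidean_space"
  assumes fin: "finite_measure M" and u: "\<And>n. u n \<in> sqint M" and C: "\<And>n. nrm M (u n) \<le> C"
  shows "\<exists>r w. strict_mono r \<and> w \<in> sqint M \<and> (\<forall>m. (\<lambda>n. ip M (u (r n)) (u (r m)) - ip M w (u (r m))) \<longlonglongrightarrow> 0)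
     \<and> (\<forall>m. (\<lambda>n. ip M (\<lambda>x. u (r n) x - w x) (\<lambda>x. u (r m) x - w x)) \<longlonglongrightarrow> 0)"
proof -
  have C0: "C \<ge> 0" using C nrm_nonneg order_trans by blast
  \<comment> \<open>Property \<open>m\<close> asks that the inner products with the
    \<open>m\<close>-th member converge; boundedness in the reals provides each refinement.\<close>
  interpret subseqs "\<lambda>m s. convergent (\<lambda>n. ip M (u (s n)) (u m))"
  proof
    fix m and s :: "nat \<Rightarrow> nat" assume "strict_mono s"
    have "\<bar>ip M (u (s n)) (u m)\<bar> \<le> C * C" for n
    proof -
      have "\<bar>ip M (u (s n)) (u m)\<bar> \<le> nrm M (u (s n)) * nrm M (u m)" by (intro ip_Cauchy_Schwarz u)
      also have "\<dots> \<le> C * C" by (intro mult_mono C C0 nrm_nonneg)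
      finally show ?thesis .
    qed
    then have "bounded (range (\<lambda>n. ip M (u (s n)) (u m)))" by (auto simp: bounded_iff)
    from bounded_imp_convergent_subsequence[OF this] obtain l r' where
      "strict_mono r'" "((\<lambda>n. ip M (u (s n)) (u m)) \<circ> r') \<longlonglongrightarrow> l" by blast
    then show "\<exists>r'. strict_mono r' \<and> convergent (\<lambda>n. ip M (u ((s \<circ> r') n)) (u m))"
      by (auto simp: o_def convergent_def)
  qed
  define r where "r = diagseq"
  have r: "strict_mono r" unfolding r_def by (rule subseq_diagseq)
  define v where "v n = u (r n)" for n
  have v: "v n \<in> sqint M" "nrm M (v n) \<le> C" for n by (simp_all add: v_def u C)
  have "convergent (\<lambda>n. ip M (u (r n)) (u m))" for m
  proof -
    \<comment> \<open>The diagonal sequence refines the \<open>m\<close>-th subsequence only from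
      position \<open>Suc m\<close> on; the initial segment does not affect convergence.\<close>
    have "convergent (\<lambda>n. ip M (u ((diagseq \<circ> ((+) (Suc m))) n)) (u m))"
    proof (rule diagseq_holds)
      fix r s :: "nat \<Rightarrow> nat" and n assume "strict_mono r" "convergent (\<lambda>k. ip M (u (s k)) (u n))"
      then show "convergent (\<lambda>k. ip M (u ((s \<circ> r) k)) (u n))"
        using convergent_subseq_convergent[of "\<lambda>k. ip M (u (s k)) (u n)" r] by (simp add: o_def)
    qed
    then have "convergent (\<lambda>n. ip M (u (r (n + Suc m))) (u m))" by (simp add: r_def add.commute)
    then show ?thesis by (subst (asm) convergent_ignore_initial_segment)
  qed
  then have "\<forall>m. \<exists>l. (\<lambda>n. ip M (v n) (v m)) \<longlonglongrightarrow> l" by (auto simp: v_def convergent_def)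
  from choice[OF this] obtain a where a: "\<And>m. (\<lambda>n. ip M (v n) (v m)) \<longlonglongrightarrow> a m" by blast
  define hl where "hl = midpoint_hull v"
  have hull_sq: "z \<in> sqint M" if "z \<in> hl N" for z N
    using midpoint_hull_sqint[of z v N M] that v(1) unfolding hl_def by simp
  \<comment> \<open>The squared distance of the origin from the hull of the tail. It increases with
    \<open>N\<close> as the hulls shrink, and is bounded by \<open>C\<^sup>2\<close>.\<close>
  define d where "d N = (INF z\<in>hl N. (nrm M z)\<^sup>2)" for N
  have ne: "hl N \<noteq> {}" for N unfolding hl_def using midpoint_hull.base[of N N v] by auto
  have bb: "bdd_below ((\<lambda>z. (nrm M z)\<^sup>2) ` hl N)" for N by (rule bdd_belowI2[of _ 0]) simp
  have d_le: "d N \<le> (nrm M z)\<^sup>2" if "z \<in> hl N" for z N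
    unfolding d_def by (rule cINF_lower[OF bb that])
  have vh: "v n \<in> hl N" if "N \<le> n" for n N unfolding hl_def using that by (rule midpoint_hull.base)
  have d_mono: "incseq d"
  proof (rule incseq_SucI)
    fix N
    have sub: "hl (Suc N) \<subseteq> hl N" unfolding hl_def using midpoint_hull_antimono[of _ v "Suc N" N] by auto
    show "d N \<le> d (Suc N)" unfolding d_def by (rule cINF_superset_mono[OF ne bb sub]) simp
  qed
  have "d N \<le> C\<^sup>2" for N
  proof -
    have "d N \<le> (nrm M (v N))\<^sup>2" by (rule d_le[OF vh]) simp
    also have "\<dots> \<le> C\<^sup>2" by (intro power_mono v nrm_nonneg)
    finally show ?thesis .
  qed
  then obtain D where D: "d \<longlonglongrightarrow> D" "\<And>N. d N \<le> D"
    using incseq_convergent[OF d_mono, of "C\<^sup>2"] by blast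
  have "\<exists>z\<in>hl N. (nrm M z)\<^sup>2 < d N + inverse (real (Suc N))" for N
  proof -
    have "Inf ((\<lambda>z. (nrm M z)\<^sup>2) ` hl N) < d N + inverse (real (Suc N))" by (simp add: d_def)
    then show ?thesis using ne by (subst (asm) cInf_less_iff) (auto intro: bb)
  qed
  then have "\<forall>N. \<exists>z. z \<in> hl N \<and> (nrm M z)\<^sup>2 < d N + inverse (real (Suc N))" by blast
  from choice[OF this] obtain W where W: "\<And>N. W N \<in> hl N" "\<And>N. (nrm M (W N))\<^sup>2 < d N + inverse (real (Suc N))"
    by blast
  have Wsq: "W N \<in> sqint M" for N by (rule hull_sq[OF W(1)])
  \<comment> \<open>The midpoint of \<open>W m\<close> and \<open>W n\<close> still lies in the hull
    of the tail from \<open>n\<close>, so its squared norm is at least \<open>d n\<close>; the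
    parallelogram identity turns near minimality into closeness.\<close>
  have est1: "(nrm M (\<lambda>x. W m x - W n x))\<^sup>2 \<le> 4 * (D - d N) + 4 * inverse (real (Suc N))"
    if mn: "m \<ge> n" "n \<ge> N" for m n N
  proof -
    have "W m \<in> hl n" using W(1)[of m] midpoint_hull_antimono[of "W m" v m n] mn(1) unfolding hl_def by simp
    then have mid: "(\<lambda>x. (1/2) *\<^sub>R (W m x + W n x)) \<in> hl n"
      using W(1)[of n] unfolding hl_def by (intro midpoint_hull.mid)
    define I where "I k = inverse (real (Suc k))" for k
    define P where "P = nrm M (\<lambda>x. (1/2) *\<^sub>R (W m x + W n x))"
    define P' where "P' = nrm M (\<lambda>x. W m x - W n x)"
    have "d n \<le> P\<^sup>2" unfolding P_def by (rule d_le[OF mid])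
    moreover have "P'\<^sup>2 = 2 * (nrm M (W m))\<^sup>2 + 2 * (nrm M (W n))\<^sup>2 - 4 * P\<^sup>2"
      unfolding P_def P'_def by (rule nrm_parallelogram[OF Wsq Wsq])
    moreover have "d N \<le> d n" using d_mono mn(2) by (simp add: incseq_def)
    moreover have "I m \<le> I N" "I n \<le> I N"
      unfolding I_def using mn by (auto intro!: le_imp_inverse_le)
    ultimately show ?thesis
      using W(2)[of m] W(2)[of n] D(2)[of m] D(2)[of n] unfolding P'_def[symmetric] I_def[symmetric] by argo
  qed
  have est: "(nrm M (\<lambda>x. W m x - W n x))\<^sup>2 \<le> 4 * (D - d N) + 4 * inverse (real (Suc N))"
    if mn: "m \<ge> N" "n \<ge> N" for m n N
  proof (cases "m \<ge> n")
    case False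
    have "nrm M (\<lambda>x. W m x - W n x) = nrm M (\<lambda>x. W n x - W m x)"
      using nrm_uminus[of M "\<lambda>x. W n x - W m x"] by simp
    then show ?thesis using est1[where m=n and n=m and N=N] False mn by simp
  qed (use est1 mn in auto)
  have "\<exists>w\<in>sqint M. (\<lambda>n. nrm M (\<lambda>x. W n x - w x)) \<longlonglongrightarrow> 0"
  proof (rule sqint_complete[OF fin Wsq])
    fix e :: real assume e: "e > 0"
    have "(\<lambda>N. 4 * (D - d N) + 4 * inverse (real (Suc N))) \<longlonglongrightarrow> 4 * (D - D) + 4 * 0"
      by (intro tendsto_add tendsto_mult tendsto_diff tendsto_const D(1) LIMSEQ_inverse_real_of_nat)
    then have "\<forall>\<^sub>F N in sequentially. 4 * (D - d N) + 4 * inverse (real (Suc N)) < e\<^sup>2"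
      using e by (intro order_tendstoD(2)) auto
    then obtain N where N: "4 * (D - d N) + 4 * inverse (real (Suc N)) < e\<^sup>2"
      unfolding eventually_sequentially by blast
    have "nrm M (\<lambda>x. W m x - W n x) < e" if "m \<ge> N" "n \<ge> N" for m n
      using le_less_trans[OF est[OF that] N] e by (intro power_less_imp_less_base[of _ 2 e]) auto
    then show "\<exists>N. \<forall>m\<ge>N. \<forall>n\<ge>N. nrm M (\<lambda>x. W m x - W n x) < e" by blast
  qed
  then obtain w where w: "w \<in> sqint M" "(\<lambda>n. nrm M (\<lambda>x. W n x - w x)) \<longlonglongrightarrow> 0" by blast
  have ip_lim: "(\<lambda>N. ip M (W N) z) \<longlonglongrightarrow> ip M w z" if z: "z \<in> sqint M" for z
  proof (rule LIM_zero_cancel, rule Lim_null_comparison[of _ "\<lambda>N. nrm M (\<lambda>x. W N x - w x) * nrm M z"])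
    show "\<forall>\<^sub>F N in sequentially. norm (ip M (W N) z - ip M w z) \<le> nrm M (\<lambda>x. W N x - w x) * nrm M z"
      using ip_Cauchy_Schwarz[OF sqint_diff[OF Wsq w(1)] z] by (simp add: ip_diff_left Wsq w(1) z)
    show "(\<lambda>N. nrm M (\<lambda>x. W N x - w x) * nrm M z) \<longlonglongrightarrow> 0"
      by (rule tendsto_mult_left_zero[OF w(2)])
  qed
  \<comment> \<open>The elements \<open>W N\<close> only involve members from \<open>N\<close> on,
    whose inner products with \<open>v m\<close> are already close to \<open>a m\<close>.\<close>
  have wa: "ip M w (v m) = a m" for m
  proof (rule LIMSEQ_unique[OF ip_lim[OF v(1)]])
    show "(\<lambda>N. ip M (W N) (v m)) \<longlonglongrightarrow> a m"
    proof (rule LIMSEQ_I)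
      fix e :: real assume e: "e > 0"
      obtain N where N: "\<And>n. n \<ge> N \<Longrightarrow> \<bar>ip M (v n) (v m) - a m\<bar> \<le> e / 2"
        using LIMSEQ_D[OF a, of "e/2" m] e by (auto intro: less_imp_le)
      have "\<bar>ip M (W k) (v m) - a m\<bar> \<le> e / 2" if k: "k \<ge> N" for k
      proof (rule midpoint_hull_ip[OF _ v(1) v(1)])
        show "W k \<in> midpoint_hull v k" using W(1) by (simp add: hl_def)
        show "\<bar>ip M (v n) (v m) - a m\<bar> \<le> e / 2" if "n \<ge> k" for n using N that k by simp
      qed
      then show "\<exists>no. \<forall>n\<ge>no. norm (ip M (W n) (v m) - a m) < e"
        using e by (intro exI[of _ N]) force
    qed
  qed
  have yv: "(\<lambda>n. ip M (\<lambda>x. v n x - w x) (v m)) \<longlonglongrightarrow> 0" for m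
    using tendsto_diff[OF a[of m] tendsto_const[of "a m"]] by (simp add: ip_diff_left v w(1) wa)
  have y: "(\<lambda>x. v n x - w x) \<in> sqint M" for n by (intro sqint_diff v w)
  have yz: "(\<lambda>n. ip M (\<lambda>x. v n x - w x) z) \<longlonglongrightarrow> 0" if "z \<in> hl 0" for z
    using that unfolding hl_def
  proof (induction rule: midpoint_hull.induct)
    case (mid z z')
    have "z \<in> sqint M" "z' \<in> sqint M"
      using mid v(1) midpoint_hull_sqint[of z v 0 M] midpoint_hull_sqint[of z' v 0 M] by simp_all
    then have eq: "ip M (\<lambda>x. v n x - w x) (\<lambda>x. (1/2) *\<^sub>R (z x + z' x))
        = (1/2) * (ip M (\<lambda>x. v n x - w x) z + ip M (\<lambda>x. v n x - w x) z')" for n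
      by (simp only: ip_scaleR_right ip_add_right[OF _ _ y])
    show ?case
      unfolding eq by (rule tendsto_mult_right_zero[OF tendsto_add[OF mid.IH, simplified]])
  qed (rule yv)
  \<comment> \<open>The limit \<open>w\<close> need not lie in any hull; it is approximated in norm
    by some \<open>W N\<close>, for which the convergence is known, while \<open>K\<close> bounds
    the other factor.\<close>
  have yw: "(\<lambda>n. ip M (\<lambda>x. v n x - w x) w) \<longlonglongrightarrow> 0"
  proof (rule LIMSEQ_I)
    fix e :: real assume e: "e > 0"
    define K where "K = C + nrm M w + 1"
    have K: "K > 0" unfolding K_def using C0 nrm_nonneg[of M w] by linarith
    have yK: "nrm M (\<lambda>x. v n x - w x) \<le> K" for n
      using nrm_triangle_diff[OF v(1) w(1), of n] v(2)[of n] unfolding K_def by linarith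
    have "\<forall>\<^sub>F N in sequentially. nrm M (\<lambda>x. W N x - w x) < e / (2 * K)"
      using order_tendstoD(2)[OF w(2)] e K by simp
    then obtain N where N: "nrm M (\<lambda>x. W N x - w x) < e / (2 * K)" unfolding eventually_sequentially by blast
    have "W N \<in> hl 0" using W(1)[of N] midpoint_hull_antimono[of "W N" v N 0] unfolding hl_def by simp
    from LIMSEQ_D[OF yz[OF this], of "e/2"] e obtain n0 where
      n0: "\<And>n. n \<ge> n0 \<Longrightarrow> \<bar>ip M (\<lambda>x. v n x - w x) (W N)\<bar> < e / 2" by auto
    have "\<bar>ip M (\<lambda>x. v n x - w x) w\<bar> < e" if n: "n \<ge> n0" for n
    proof -
      have "ip M (\<lambda>x. v n x - w x) w = ip M (\<lambda>x. v n x - w x) (W N) - ip M (\<lambda>x. v n x - w x) (\<lambda>x. W N x - w x)"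
        by (simp add: ip_diff_right[OF Wsq w(1) y])
      moreover have "\<bar>ip M (\<lambda>x. v n x - w x) (\<lambda>x. W N x - w x)\<bar> \<le> K * (e / (2 * K))"
        using ip_Cauchy_Schwarz[OF y sqint_diff[OF Wsq w(1)], of n N]
          mult_mono[OF yK less_imp_le[OF N] less_imp_le[OF K] nrm_nonneg, of n] by linarith
      moreover have "K * (e / (2 * K)) = e / 2" using K by simp
      ultimately show ?thesis using n0[OF n] by linarith
    qed
    then show "\<exists>no. \<forall>n\<ge>no. norm (ip M (\<lambda>x. v n x - w x) w - 0) < e" by auto
  qed
  have "(\<lambda>n. ip M (\<lambda>x. v n x - w x) (\<lambda>x. v m x - w x)) \<longlonglongrightarrow> 0" for m
    using tendsto_diff[OF yv[of m] yw] by (simp add: ip_diff_right[OF v(1) w(1) y])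
  moreover have "(\<lambda>n. ip M (v n) (v m) - ip M w (v m)) \<longlonglongrightarrow> 0" for m
    using yv[of m] by (simp add: ip_diff_left v w(1))
  ultimately show ?thesis using r w(1) unfolding v_def by blast
qed

section \<open>Test functions are dense in \<open>L\<^sup>2\<close>\<close>

lemma test_function_borel:
  "f \<in> test_functions UNIV \<Longrightarrow> f \<in> borel_measurable borel"
  by (rule cc_borel[OF test_function_cc])

lemma lebesgue_on_measurable: "f \<in> borel_measurable borel \<Longrightarrow> f \<in> borel_measurable (lebesgue_on \<Omega>)"
  by (rule measurable_restrict_space1) (simp add: measurable_completion)

lemma lebesgue_on_integrable:
  fixes f :: "real^'n \<Rightarrow> 'b::euclidean_space"
  assumes "open \<Omega>" "integrable lborel f"
  shows "integrable (lebesgue_on \<Omega>) f"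
proof -
  have "f \<in> borel_measurable lborel" using assms(2) by simp
  then have "integrable lebesgue f" using integrable_completion assms(2) by blast
  moreover have "\<Omega> \<in> sets lebesgue" using assms(1) by (simp add: sets_completionI_sets)
  ultimately show ?thesis
    by (subst integrable_restrict_space) (auto intro!: integrable_mult_indicator)
qed

lemma lebesgue_on_integral:
  fixes f :: "real^'n \<Rightarrow> 'b::euclidean_space"
  assumes "open \<Omega>" "f \<in> borel_measurable borel" "\<And>x. x \<notin> \<Omega> \<Longrightarrow> f x = 0"
  shows "(LINT x|lebesgue_on \<Omega>. f x) = (LINT x|lborel. f x)"
proof -
  have "\<Omega> \<in> sets lebesgue" using assms(1) by (simp add: sets_completionI_sets)
  then have "(LINT x|lebesgue_on \<Omega>. f x) = (LINT x|lebesgue. indicator \<Omega> x *\<^sub>R f x)"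
    by (subst integral_restrict_space) auto
  also have "(\<lambda>x. indicator \<Omega> x *\<^sub>R f x) = f"
    using assms(3) by (auto simp: indicator_def fun_eq_iff)
  also have "(LINT x|lebesgue. f x) = (LINT x|lborel. f x)"
    by (rule integral_completion) (use assms(2) in simp)
  finally show ?thesis .
qed

lemma test_function_sqint_on:
  fixes f :: "real^'n \<Rightarrow> 'b::euclidean_space"
  assumes "open \<Omega>" "f \<in> test_functions UNIV" shows "f \<in> sqint (lebesgue_on \<Omega>)"
  using lebesgue_on_integrable[OF assms(1), of "\<lambda>x. (norm (f x))\<^sup>2"] test_function_sqint[OF assms(2)]
    lebesgue_on_measurable[OF test_function_borel[OF assms(2)], of \<Omega>]
  by (simp add: sqint_def)

lemma nrm_on_le:
  fixes f :: "real^'n \<Rightarrow> 'b::euclidean_space"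
  assumes "open \<Omega>" "f \<in> test_functions UNIV" shows "nrm (lebesgue_on \<Omega>) f \<le> nrm lborel f"
proof -
  have \<Omega>: "\<Omega> \<in> sets lebesgue" using assms(1) by (simp add: sets_completionI_sets)
  have i: "integrable lborel (\<lambda>x. (norm (f x))\<^sup>2)"
    using test_function_sqint[OF assms(2)] by (simp add: sqint_def)
  then have b: "(\<lambda>x. (norm (f x))\<^sup>2) \<in> borel_measurable lborel" by simp
  have il: "integrable lebesgue (\<lambda>x. (norm (f x))\<^sup>2)" using integrable_completion[OF b] i by blast
  have "(LINT x|lebesgue_on \<Omega>. (norm (f x))\<^sup>2) = (LINT x|lebesgue. indicator \<Omega> x *\<^sub>R (norm (f x))\<^sup>2)"
    using \<Omega> by (subst integral_restrict_space) auto
  also have "\<dots> \<le> (LINT x|lebesgue. (norm (f x))\<^sup>2)"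
    by (intro integral_mono_AE' il) (auto simp: indicator_def)
  also have "\<dots> = (LINT x|lborel. (norm (f x))\<^sup>2)" by (rule integral_completion[OF b])
  finally show ?thesis by (simp add: nrm_eq_integral)
qed

lemma ip_on_eq:
  assumes "open \<Omega>" "u \<in> test_functions \<Omega>" "v \<in> borel_measurable borel"
  shows "ip (lebesgue_on \<Omega>) u v = ip lborel u v"
  unfolding ip_def
  using test_function_borel[OF test_functions_UNIV[OF assms(2)]] assms
  by (intro lebesgue_on_integral) (auto simp: test_functions_outside)

text \<open>Mollify the indicator of a closed neighbourhood of \<open>C\<close>, with mollifier and
  neighbourhood of the same radius: on \<open>C\<close> the kernel sees only the value 1.\<close>

lemma smooth_Urysohn:
  assumes C: "compact C" and U: "open U" "C \<subseteq> (U :: (real^'n) set)"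
  shows "\<exists>h\<in>test_functions U. (\<forall>x. (0::real) \<le> h x \<and> h x \<le> 1) \<and> (\<forall>x\<in>C. h x = 1)"
proof -
  obtain \<epsilon> where \<epsilon>: "\<epsilon> > 0" "(\<Union>x\<in>C. ball x \<epsilon>) \<subseteq> U"
    using compact_subset_open_imp_ball_epsilon_subset[OF C U] by blast
  \<comment> \<open>The neighbourhood and the mollification each enlarge \<open>C\<close> by
    \<open>\<delta>\<close>, and twice \<open>\<delta>\<close> must stay below
    \<open>\<epsilon>\<close>.\<close>
  define \<delta> where "\<delta> = \<epsilon> / 3"
  have \<delta>: "\<delta> > 0" "2 * \<delta> < \<epsilon>" using \<epsilon> by (auto simp: \<delta>_def)
  obtain \<phi> :: "real^'n \<Rightarrow> real" where \<phi>: "\<phi> \<in> tf" "\<And>x. 0 \<le> \<phi> x" "\<And>x. x \<notin> cball 0 \<delta> \<Longrightarrow> \<phi> x = 0" "(LINT x|lborel. \<phi> x) = 1"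
    using normalized_bump_exists[OF \<delta>(1), of 0] by blast
  define K where "K = {a + b |a b. a \<in> C \<and> b \<in> cball 0 \<delta>}"
  have K: "compact K" unfolding K_def by (intro compact_sums C compact_cball)
  define h where "h = conv \<phi> (indicator K)"
  have intK: "integrable lborel (indicator K :: real^'n \<Rightarrow> real)"
    using emeasure_compact_finite[OF K] borel_compact[OF K] by (intro integrable_real_indicator) auto
  have mass: "(LINT y|lborel. \<phi> (x - y)) = 1" for x
    using integral_reflect[OF tf_borel[OF \<phi>(1)], of x] \<phi>(4) by simp
  have hU: "h \<in> test_functions U"
    unfolding h_def
  proof (rule conv_test_function[OF \<phi>(1) intK compact_cball \<phi>(3) K])
    show "(indicator K x :: real) = 0" if "x \<notin> K" for x using that by simp
    show "a + b \<in> U" if ab: "a \<in> cball 0 \<delta>" "b \<in> K" for a b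
    proof -
      obtain c d where cd: "b = c + d" "c \<in> C" "d \<in> cball 0 \<delta>" using ab(2) unfolding K_def by blast
      have "dist c (a + b) = norm (a + d)" using cd(1) norm_minus_cancel[of "a + d"] by (simp add: dist_norm)
      also have "\<dots> \<le> norm a + norm d" by (rule norm_triangle_ineq)
      also have "\<dots> < \<epsilon>" using ab(1) cd(3) \<delta> by simp
      finally have "a + b \<in> ball c \<epsilon>" by simp
      then show ?thesis using \<epsilon>(2) cd(2) by blast
    qed
  qed
  have le: "\<phi> (x - y) * indicator K y \<le> \<phi> (x - y)" for x y using \<phi>(2) by (simp add: indicator_def)
  have i1: "integrable lborel (\<lambda>y. \<phi> (x - y))" for x by (rule test_function_integrable[OF tf_reflect[OF \<phi>(1)]])
  have i2: "integrable lborel (\<lambda>y. \<phi> (x - y) * indicator K y)" for x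
    using integrable_mult_indicator[OF _ i1, of K x] borel_compact[OF K] by (simp add: mult.commute)
  have "0 \<le> h x" for x unfolding h_def conv_def by (rule Bochner_Integration.integral_nonneg) (simp add: \<phi>(2))
  moreover have "h x \<le> 1" for x
    using integral_mono[OF i2 i1 le, of x] mass[of x] by (simp add: h_def conv_def)
  moreover have "h x = 1" if "x \<in> C" for x
  proof -
    have "\<phi> (x - y) * indicator K y = \<phi> (x - y)" for y
    proof (cases "x - y \<in> cball 0 \<delta>")
      case True
      then have "y - x \<in> cball 0 \<delta>" by (simp add: norm_minus_commute)
      then have "x + (y - x) \<in> K" unfolding K_def using that by blast
      then show ?thesis by simp
    qed (simp add: \<phi>(3))
    then have "(\<lambda>y. \<phi> (x - y) * indicator K y) = (\<lambda>y. \<phi> (x - y))" by (rule ext)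
    then show ?thesis using mass[of x] by (simp only: h_def conv_def)
  qed
  ultimately show ?thesis using hU by blast
qed

text \<open>Regularity of Lebesgue measure encloses the set between a compact and an open set; a
  smooth cut-off between them differs from the indicator by at most 1, and only on a set of small
  measure.\<close>

lemma indicator_approximation:
  fixes \<Omega> :: "(real^'n) set"
  assumes \<Omega>: "open \<Omega>" "bounded \<Omega>" and A: "A \<in> sets lebesgue" "A \<subseteq> \<Omega>" and e: "e > 0"
  shows "\<exists>h\<in>test_functions \<Omega>. nrm (lebesgue_on \<Omega>) (\<lambda>x. indicator A x - h x :: real) < e"
proof -
  \<comment> \<open>The squared norm is at most the measure of the exceptional set, which consists
    of two pieces of measure below \<open>d\<close>.\<close>
  define d where "d = e\<^sup>2 / 2"
  have d: "d > 0" using e by (simp add: d_def)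
  obtain C where C: "closed C" "C \<subseteq> A" "A - C \<in> lmeasurable" "emeasure lebesgue (A - C) < ennreal d"
    using sets_lebesgue_inner_closed[OF A(1) d] by blast
  obtain T where T: "open T" "C \<subseteq> T" "T - C \<in> lmeasurable" "emeasure lebesgue (T - C) < ennreal d"
    using sets_lebesgue_outer_open[of C d] C(1) d by auto
  have "bounded C" using bounded_subset[OF \<Omega>(2)] C(2) A(2) by blast
  then have Cc: "compact C" using C(1) by (simp add: compact_eq_bounded_closed)
  have "open (T \<inter> \<Omega>)" "C \<subseteq> T \<inter> \<Omega>" using T \<Omega> C(2) A(2) by (auto simp: open_Int)
  from smooth_Urysohn[OF Cc this] obtain h where h: "h \<in> test_functions (T \<inter> \<Omega>)" "\<And>x. 0 \<le> h x" "\<And>x. h x \<le> 1" "\<And>x. x \<in> C \<Longrightarrow> h x = (1::real)"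
    by blast
  define D where "D = (A - C) \<union> (T - C)"
  have D: "D \<in> lmeasurable" unfolding D_def using C(3) T(3) by (rule fmeasurable.Un)
  have md: "measure lebesgue (A - C) < d" "measure lebesgue (T - C) < d"
    using C(3,4) T(3,4) d by (simp_all add: emeasure_eq_measure2 ennreal_less_iff)
  have "measure lebesgue D \<le> measure lebesgue (A - C) + measure lebesgue (T - C)"
    unfolding D_def using C(3) T(3) by (intro measure_Un_le) (auto simp: fmeasurable_def)
  then have mD: "measure lebesgue D < e\<^sup>2" using md by (simp add: d_def)
  have pw: "(norm (indicator A x - h x))\<^sup>2 \<le> indicator D x" for x
  proof (cases "x \<in> C")
    case True
    then show ?thesis using h(4) C(2) by auto
  next
    case False
    have "\<bar>indicator A x - h x\<bar> \<le> 1" using h(2,3)[of x] by (auto simp: indicator_def)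
    then have "(norm (indicator A x - h x))\<^sup>2 \<le> 1" by (simp add: abs_square_le_1)
    moreover have "(norm (indicator A x - h x))\<^sup>2 = 0" if "x \<notin> D"
      using that False test_functions_outside[OF h(1), of x] unfolding D_def by auto
    ultimately show ?thesis by (cases "x \<in> D") auto
  qed
  have \<Omega>l: "\<Omega> \<in> sets lebesgue" using \<Omega>(1) by (simp add: sets_completionI_sets)
  have "(nrm (lebesgue_on \<Omega>) (\<lambda>x. indicator A x - h x))\<^sup>2 = (LINT x|lebesgue_on \<Omega>. (norm (indicator A x - h x))\<^sup>2)"
    by (simp only: nrm_power2 ip_def power2_norm_eq_inner)
  also have "\<dots> = (LINT x|lebesgue. indicator \<Omega> x *\<^sub>R (norm (indicator A x - h x))\<^sup>2)"
    using \<Omega>l by (subst integral_restrict_space) auto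
  also have "\<dots> \<le> (LINT x|lebesgue. indicator D x)"
  proof (rule integral_mono_AE')
    show "integrable lebesgue (indicator D :: real^'n \<Rightarrow> real)"
      using D by (intro integrable_real_indicator) (auto simp: fmeasurable_def)
    show "AE x in lebesgue. indicator \<Omega> x *\<^sub>R (norm (indicator A x - h x))\<^sup>2 \<le> indicator D x"
      using pw by (auto simp: indicator_def[of \<Omega>])
  qed auto
  also have "\<dots> < e\<^sup>2" using mD by simp
  finally have "nrm (lebesgue_on \<Omega>) (\<lambda>x. indicator A x - h x) < e"
    using e by (intro power_less_imp_less_base[of _ 2 e]) auto
  moreover have "h \<in> test_functions \<Omega>" by (rule test_functions_mono[OF h(1)]) simp
  ultimately show ?thesis by blast
qed

lemma finite_measure_lebesgue_on: "bounded \<Omega> \<Longrightarrow> open \<Omega> \<Longrightarrow> finite_measure (lebesgue_on (\<Omega> :: (real^'n) set))"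
proof
  assume b: "bounded \<Omega>" and o: "open \<Omega>"
  have "emeasure lebesgue \<Omega> < \<infinity>" using emeasure_bounded_finite[OF b] o by simp
  then show "emeasure (lebesgue_on \<Omega>) (space (lebesgue_on \<Omega>)) \<noteq> \<infinity>"
    using o by (simp add: emeasure_restrict_space sets_completionI_sets)
qed

text \<open>Simple functions are dense by dominated convergence, and each of their finitely many
  level sets is handled by \<open>indicator_approximation\<close>.\<close>

lemma test_functions_dense:
  fixes u :: "real^'n \<Rightarrow> 'b::euclidean_space"
  assumes \<Omega>: "open \<Omega>" "bounded \<Omega>" and u: "u \<in> sqint (lebesgue_on \<Omega>)" and e: "e > 0"
  shows "\<exists>\<phi>\<in>test_functions \<Omega>. nrm (lebesgue_on \<Omega>) (\<lambda>x. u x - \<phi> x) < e"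
proof -
  let ?M = "lebesgue_on \<Omega>"
  interpret finite_measure ?M by (rule finite_measure_lebesgue_on[OF \<Omega>(2,1)])
  have \<Omega>l: "\<Omega> \<in> sets lebesgue" using \<Omega>(1) by (simp add: sets_completionI_sets)
  have um: "u \<in> borel_measurable ?M" using u by (simp add: sqint_def)
  obtain F where F': "(\<forall>i. simple_function ?M (F i)) \<and> (\<forall>x\<in>space ?M. (\<lambda>i. F i x) \<longlonglongrightarrow> u x)
      \<and> (\<forall>i. \<forall>x\<in>space ?M. dist (F i x) 0 \<le> 2 * dist (u x) 0)"
    using borel_measurable_implies_sequence_metric[OF um, of 0] by (rule exE)
  then have F: "\<And>i. simple_function ?M (F i)" "\<And>x. x \<in> space ?M \<Longrightarrow> (\<lambda>i. F i x) \<longlonglongrightarrow> u x"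
    "\<And>i x. x \<in> space ?M \<Longrightarrow> norm (F i x) \<le> 2 * norm (u x)"
    by (simp_all add: dist_norm)
  have Fm: "F i \<in> borel_measurable ?M" for i by (rule borel_measurable_simple_function[OF F(1)])
  have "(\<lambda>i. LINT x|?M. (norm (u x - F i x))\<^sup>2) \<longlonglongrightarrow> (LINT x|?M. 0)"
  \<comment> \<open>The approximants are at most twice as large as \<open>u\<close>, so the
    difference is at most three times as large, and 9 is the square.\<close>
  proof (rule integral_dominated_convergence[where w="\<lambda>x. 9 * (norm (u x))\<^sup>2"])
    show "integrable ?M (\<lambda>x. 9 * (norm (u x))\<^sup>2)" using u by (simp add: sqint_def)
    show "(\<lambda>x. (norm (u x - F i x))\<^sup>2) \<in> borel_measurable ?M" for i using um Fm[of i] by simp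
    show "AE x in ?M. (\<lambda>i. (norm (u x - F i x))\<^sup>2) \<longlonglongrightarrow> 0"
    proof (rule AE_I2)
      fix x assume "x \<in> space ?M"
      then have "(\<lambda>i. (norm (u x - F i x))\<^sup>2) \<longlonglongrightarrow> (norm (u x - u x))\<^sup>2" by (intro tendsto_intros F)
      then show "(\<lambda>i. (norm (u x - F i x))\<^sup>2) \<longlonglongrightarrow> 0" by simp
    qed
    show "AE x in ?M. norm ((norm (u x - F i x))\<^sup>2) \<le> 9 * (norm (u x))\<^sup>2" for i
    proof (rule AE_I2)
      fix x assume "x \<in> space ?M"
      then have "norm (u x - F i x) \<le> 3 * norm (u x)"
        using F(3)[of x i] norm_triangle_ineq4[of "u x" "F i x"] by simp
      then have "(norm (u x - F i x))\<^sup>2 \<le> (3 * norm (u x))\<^sup>2" by (intro power_mono) auto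
      then show "norm ((norm (u x - F i x))\<^sup>2) \<le> 9 * (norm (u x))\<^sup>2" by (simp add: power_mult_distrib)
    qed
  qed simp
  then have "(\<lambda>i. nrm ?M (\<lambda>x. u x - F i x)) \<longlonglongrightarrow> 0"
    using tendsto_real_sqrt by (fastforce simp: nrm_eq_integral)
  then have "\<forall>\<^sub>F i in sequentially. nrm ?M (\<lambda>x. u x - F i x) < e / 2"
    using e by (intro order_tendstoD(2)) auto
  then obtain i where i: "nrm ?M (\<lambda>x. u x - F i x) < e / 2" unfolding eventually_sequentially by blast
  define s where "s = F i"
  have s: "simple_function ?M s" unfolding s_def by (rule F)
  have fin: "finite (s ` \<Omega>)" using s by (simp add: simple_function_def)
  define A where "A y = s -` {y} \<inter> \<Omega>" for y
  have A: "A y \<in> sets lebesgue" "A y \<subseteq> \<Omega>" for y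
  proof -
    have "A y \<in> sets ?M" unfolding A_def using simple_functionD(2)[OF s, of "{y}"] by simp
    then show "A y \<in> sets lebesgue" using sets_restrict_space_iff[of \<Omega> lebesgue "A y"] \<Omega>l by simp
    show "A y \<subseteq> \<Omega>" by (simp add: A_def)
  qed
  \<comment> \<open>The tolerance \<open>e / 2\<close> is shared among the values of
    \<open>s\<close>; the further division by \<open>norm y + 1\<close> below compensates for the
    factor \<open>y\<close> of each indicator.\<close>
  define N where "N = real (card (s ` \<Omega>)) + 1"
  have "\<exists>h\<in>test_functions \<Omega>. nrm ?M (\<lambda>x. indicator (A y) x - h x :: real) < e / 2 / N / (norm y + 1)" for y
    using e by (intro indicator_approximation[OF \<Omega> A]) (simp add: N_def add_nonneg_pos)
  then have "\<forall>y. \<exists>h. h \<in> test_functions \<Omega> \<and> nrm ?M (\<lambda>x. indicator (A y) x - h x :: real) < e / 2 / N / (norm y + 1)"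
    by blast
  from choice[OF this] obtain h where h: "\<And>y. h y \<in> test_functions \<Omega>"
    "\<And>y. nrm ?M (\<lambda>x. indicator (A y) x - h y x :: real) < e / 2 / N / (norm y + 1)" by blast
  define \<phi> where "\<phi> x = (\<Sum>y\<in>s ` \<Omega>. h y x *\<^sub>R y)" for x
  have \<phi>: "\<phi> \<in> test_functions \<Omega>"
    unfolding \<phi>_def[abs_def] by (intro test_functions_sum test_functions_scaleR_left h smooth_const)
  define D where "D y x = (indicator (A y) x - h y x) *\<^sub>R y" for y x
  have indA: "(indicator (A y) :: real^'n \<Rightarrow> real) \<in> sqint ?M" for y
  proof -
    have m: "A y \<in> sets ?M" using sets_restrict_space_iff[of \<Omega> lebesgue "A y"] \<Omega>l A[of y] by simp
    have "(\<lambda>x. (norm (indicator (A y) x :: real))\<^sup>2) = indicator (A y)" by (auto simp: indicator_def fun_eq_iff)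
    then show ?thesis using m by (simp add: sqint_def integrable_real_indicator less_top[symmetric])
  qed
  have Dn: "nrm ?M (D y) \<le> e / 2 / N" for y
  proof -
    have "nrm ?M (D y) = nrm ?M (\<lambda>x. indicator (A y) x - h y x) * norm y"
    proof -
      have "(LINT x|?M. (norm (D y x))\<^sup>2) = (LINT x|?M. (norm (indicator (A y) x - h y x))\<^sup>2) * (norm y)\<^sup>2"
        by (simp add: D_def power_mult_distrib)
      then show ?thesis by (simp add: nrm_eq_integral real_sqrt_mult)
    qed
    also have "\<dots> \<le> (e / 2 / N / (norm y + 1)) * (norm y + 1)"
      using h(2)[of y] order_trans[OF nrm_nonneg less_imp_le[OF h(2)[of y]]]
      by (intro mult_mono) (auto simp only: less_imp_le norm_ge_zero le_add_same_cancel1 zero_le_one)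
    also have "\<dots> = e / 2 / N" using norm_ge_zero[of y] by (simp add: add_nonneg_eq_0_iff)
    finally show ?thesis .
  qed
  have Dsq: "D y \<in> sqint ?M" for y
  proof -
    have "(\<lambda>x. indicator (A y) x - h y x) \<in> sqint ?M"
      by (intro sqint_diff indA test_function_sqint_on[OF \<Omega>(1)] test_functions_UNIV[OF h(1)])
    then have "integrable ?M (\<lambda>x. (norm (indicator (A y) x - h y x))\<^sup>2 * (norm y)\<^sup>2)"
      "(\<lambda>x. indicator (A y) x - h y x) \<in> borel_measurable ?M"
      by (simp_all add: sqint_def)
    then show ?thesis by (auto simp: sqint_def D_def[abs_def] power_mult_distrib)
  qed
  have eqs: "s x - \<phi> x = (\<Sum>y\<in>s ` \<Omega>. D y x)" if "x \<in> \<Omega>" for x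
  proof -
    have "(\<Sum>y\<in>s ` \<Omega>. indicator (A y) x *\<^sub>R y) = (\<Sum>y\<in>s ` \<Omega>. if s x = y then y else 0)"
      using that by (intro sum.cong) (auto simp: A_def indicator_def)
    also have "\<dots> = s x" using fin that by simp
    finally show ?thesis by (simp add: \<phi>_def D_def scaleR_diff_left sum_subtractf)
  qed
  have "nrm ?M (\<lambda>x. s x - \<phi> x) = nrm ?M (\<lambda>x. \<Sum>y\<in>s ` \<Omega>. D y x)"
    unfolding nrm_eq_integral
    by (intro arg_cong[where f=sqrt] Bochner_Integration.integral_cong refl) (simp add: eqs)
  also have "\<dots> \<le> (\<Sum>y\<in>s ` \<Omega>. nrm ?M (D y))" by (intro nrm_sum Dsq)
  also have "\<dots> \<le> (\<Sum>y\<in>s ` \<Omega>. e / 2 / N)" by (intro sum_mono Dn)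
  also have "\<dots> \<le> e / 2" using e by (simp add: N_def divide_simps)
  finally have 2: "nrm ?M (\<lambda>x. s x - \<phi> x) \<le> e / 2" .
  have ssq: "s \<in> sqint ?M"
  proof -
    have "integrable ?M (\<lambda>x. (norm (s x))\<^sup>2)"
    proof (rule Bochner_Integration.integrable_bound[of ?M "\<lambda>x. 4 * (norm (u x))\<^sup>2"])
      show "integrable ?M (\<lambda>x. 4 * (norm (u x))\<^sup>2)" using u by (simp add: sqint_def)
      show "AE x in ?M. norm ((norm (s x))\<^sup>2) \<le> norm (4 * (norm (u x))\<^sup>2)"
        using F(3)[of _ i] power_mono[OF F(3)[of _ i] norm_ge_zero, of _ 2] unfolding s_def
        by (intro AE_I2) (simp add: power_mult_distrib)
    qed (use Fm[of i] in \<open>simp add: s_def\<close>)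
    then show ?thesis using Fm[of i] by (simp add: sqint_def s_def)
  qed
  have "nrm ?M (\<lambda>x. (u x - s x) + (s x - \<phi> x)) \<le> nrm ?M (\<lambda>x. u x - s x) + nrm ?M (\<lambda>x. s x - \<phi> x)"
    by (intro nrm_triangle sqint_diff u ssq test_function_sqint_on[OF \<Omega>(1)] test_functions_UNIV[OF \<phi>])
  then have "nrm ?M (\<lambda>x. u x - \<phi> x) < e" using i 2 by (simp add: s_def)
  then show ?thesis using \<phi> by blast
qed

section \<open>Weak derivatives\<close>

lemma L2_eq: "L2 \<Omega> = sqint (lebesgue_on \<Omega>)"
  by (simp add: L2_def sqint_def)

lemma L2_inner_eq: "L2_inner \<Omega> = ip (lebesgue_on \<Omega>)"
  by (simp add: L2_inner_def ip_def fun_eq_iff)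

lemma L2_norm_eq: "L2_norm \<Omega> = nrm (lebesgue_on \<Omega>)"
  by (simp add: L2_norm_def nrm_def L2_inner_eq fun_eq_iff)

lemma integrable_scaleR_sqint:
  fixes \<psi> :: "'a \<Rightarrow> real" and g :: "'a \<Rightarrow> 'b::euclidean_space"
  assumes "\<psi> \<in> sqint M" "g \<in> sqint M"
  shows "integrable M (\<lambda>x. \<psi> x *\<^sub>R g x)"
proof (rule Bochner_Integration.integrable_bound[OF ip_integrable[OF sqint_norm[OF assms(1)] sqint_norm[OF assms(2)]]])
  show "(\<lambda>x. \<psi> x *\<^sub>R g x) \<in> borel_measurable M" using assms by (auto simp: sqint_def)
qed simp

text \<open>The fundamental lemma of the calculus of variations, by density: the vector identities
  give orthogonality to all vector valued test functions, and \<open>g\<close> is close to one of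
  them.\<close>

lemma sqint_null_of_test_functions:
  fixes g :: "real^'n \<Rightarrow> 'b::euclidean_space"
  assumes \<Omega>: "open \<Omega>" "bounded \<Omega>" and g: "g \<in> sqint (lebesgue_on \<Omega>)"
    and null: "\<And>\<psi>. \<psi> \<in> test_functions \<Omega> \<Longrightarrow> (LINT x|lebesgue_on \<Omega>. (\<psi> x :: real) *\<^sub>R g x) = 0"
  shows "nrm (lebesgue_on \<Omega>) g = 0"
proof -
  let ?M = "lebesgue_on \<Omega>"
  have ip0: "ip ?M g \<phi> = 0" if \<phi>: "\<phi> \<in> test_functions \<Omega>" for \<phi>
  proof -
    have t: "(\<lambda>x. \<phi> x \<bullet> b) \<in> test_functions \<Omega>" for b
      by (rule test_functions_bounded_linear[OF bounded_linear_inner_left \<phi>])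
    have i: "integrable ?M (\<lambda>x. (\<phi> x \<bullet> b) *\<^sub>R g x)" for b
      by (rule integrable_scaleR_sqint[OF test_function_sqint_on[OF \<Omega>(1) test_functions_UNIV[OF t]] g])
    have "(LINT x|?M. (\<phi> x \<bullet> b) *\<^sub>R g x) \<bullet> b = (LINT x|?M. (\<phi> x \<bullet> b) * (g x \<bullet> b))" for b
      using integral_inner_left[OF i, of b] by simp
    then have z: "(LINT x|?M. (\<phi> x \<bullet> b) * (g x \<bullet> b)) = 0" for b using null[OF t] by simp
    have "integrable ?M (\<lambda>x. (\<phi> x \<bullet> b) * (g x \<bullet> b))" for b
      using integrable_inner_left[OF i, of b] by simp
    then have "(\<Sum>b\<in>Basis. LINT x|?M. (\<phi> x \<bullet> b) * (g x \<bullet> b)) = (LINT x|?M. (\<Sum>b\<in>Basis. (\<phi> x \<bullet> b) * (g x \<bullet> b)))"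
      by simp
    moreover have "(\<lambda>x. g x \<bullet> \<phi> x) = (\<lambda>x. \<Sum>b\<in>Basis. (\<phi> x \<bullet> b) * (g x \<bullet> b))"
      by (rule ext) (subst euclidean_inner, simp add: mult.commute)
    ultimately show ?thesis by (simp add: z ip_def)
  qed
  have "nrm ?M g * nrm ?M g \<le> e * nrm ?M g" if e: "e > 0" for e
  proof -
    obtain \<phi> where \<phi>: "\<phi> \<in> test_functions \<Omega>" "nrm ?M (\<lambda>x. g x - \<phi> x) < e"
      using test_functions_dense[OF \<Omega> g e] by blast
    have \<phi>s: "\<phi> \<in> sqint ?M" by (rule test_function_sqint_on[OF \<Omega>(1) test_functions_UNIV[OF \<phi>(1)]])
    have "nrm ?M g * nrm ?M g = ip ?M g (\<lambda>x. g x - \<phi> x)"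
      using nrm_power2[of ?M g] by (simp add: ip_diff_right g \<phi>s ip0[OF \<phi>(1)] power2_eq_square)
    also have "\<dots> \<le> nrm ?M g * nrm ?M (\<lambda>x. g x - \<phi> x)"
      using ip_Cauchy_Schwarz[OF g sqint_diff[OF g \<phi>s]] by linarith
    also have "\<dots> \<le> nrm ?M g * e" using \<phi>(2) by (intro mult_left_mono nrm_nonneg) simp
    finally show ?thesis by (simp add: mult.commute)
  qed
  then have "nrm ?M g \<le> 0 + e" if "e > 0" for e
    using that nrm_nonneg[of ?M g] by (cases "nrm ?M g = 0") (auto simp: mult_le_cancel_right)
  then have "nrm ?M g \<le> 0" by (rule field_le_epsilon)
  then show ?thesis using nrm_nonneg[of ?M g] by simp
qed

text \<open>Justifies exchanging representatives, in particular the arbitrary choice made by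
  \<open>weak_partial_deriv\<close> for a classical derivative.\<close>

lemma nrm_eq_of_diff_null:
  assumes "u \<in> sqint M" "v \<in> sqint M" "nrm M (\<lambda>x. u x - v x) = 0"
  shows "nrm M u = nrm M v" and "w \<in> sqint M \<Longrightarrow> ip M u w = ip M v w"
proof -
  show i: "ip M u w = ip M v w" if "w \<in> sqint M" for w
    using ip_Cauchy_Schwarz[OF sqint_diff[OF assms(1,2)] that] assms(3) by (simp add: ip_diff_left assms that)
  have "ip M u u = ip M v v" using i[OF assms(1)] i[OF assms(2)] by (simp add: ip_commute[of M v u])
  then show "nrm M u = nrm M v" by (simp add: nrm_def)
qed

lemma weak_partial_deriv_unique:
  fixes u g h :: "real^'n \<Rightarrow> 'b::euclidean_space"
  assumes \<Omega>: "open \<Omega>" "bounded \<Omega>" and "g \<in> L2 \<Omega>" "h \<in> L2 \<Omega>"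
    and "is_weak_partial_deriv \<Omega> i u g" "is_weak_partial_deriv \<Omega> i u h"
  shows "nrm (lebesgue_on \<Omega>) (\<lambda>x. g x - h x) = 0"
proof (rule sqint_null_of_test_functions[OF \<Omega>])
  show "(\<lambda>x. g x - h x) \<in> sqint (lebesgue_on \<Omega>)" using assms by (simp add: L2_eq sqint_diff)
  fix \<psi> :: "real^'n \<Rightarrow> real" assume \<psi>: "\<psi> \<in> test_functions \<Omega>"
  have s: "\<psi> \<in> sqint (lebesgue_on \<Omega>)" by (rule test_function_sqint_on[OF \<Omega>(1) test_functions_UNIV[OF \<psi>]])
  have "integrable (lebesgue_on \<Omega>) (\<lambda>x. \<psi> x *\<^sub>R g x)" "integrable (lebesgue_on \<Omega>) (\<lambda>x. \<psi> x *\<^sub>R h x)"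
    using assms s by (auto simp: L2_eq intro: integrable_scaleR_sqint)
  then show "(LINT x|lebesgue_on \<Omega>. \<psi> x *\<^sub>R (g x - h x)) = 0"
    using assms(5,6) \<psi> unfolding is_weak_partial_deriv_def by (simp add: scaleR_diff_right)
qed

lemma weak_partial_deriv_spec:
  assumes "u \<in> H1 \<Omega>"
  shows "weak_partial_deriv \<Omega> i u \<in> L2 \<Omega>" "is_weak_partial_deriv \<Omega> i u (weak_partial_deriv \<Omega> i u)"
proof -
  have "\<exists>g. g \<in> L2 \<Omega> \<and> is_weak_partial_deriv \<Omega> i u g" using assms by (auto simp: H1_def)
  from someI_ex[OF this] show "weak_partial_deriv \<Omega> i u \<in> L2 \<Omega>"
    "is_weak_partial_deriv \<Omega> i u (weak_partial_deriv \<Omega> i u)"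
    unfolding weak_partial_deriv_def by auto
qed

lemma weak_partial_deriv_eq:
  assumes "open \<Omega>" "bounded \<Omega>" "u \<in> H1 \<Omega>" "g \<in> L2 \<Omega>" "is_weak_partial_deriv \<Omega> i u g"
  shows "nrm (lebesgue_on \<Omega>) (\<lambda>x. weak_partial_deriv \<Omega> i u x - g x) = 0"
  using weak_partial_deriv_unique[OF assms(1,2) weak_partial_deriv_spec(1)[OF assms(3)] assms(4)
      weak_partial_deriv_spec(2)[OF assms(3)] assms(5)] .

lemma integral_partial_deriv_vector:
  fixes f :: "real^'n \<Rightarrow> 'b::euclidean_space"
  assumes f: "f \<in> test_functions UNIV"
  shows "(LINT x|lborel. partial_deriv i f x) = 0"
proof (rule euclidean_eqI)
  fix b :: 'b
  have t: "(\<lambda>x. f x \<bullet> b) \<in> tf" by (rule test_functions_bounded_linear[OF bounded_linear_inner_left f])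
  have "partial_deriv i (\<lambda>x. f x \<bullet> b) x = partial_deriv i f x \<bullet> b" for x
    by (rule partial_deriv_bounded_linear[OF bounded_linear_inner_left smooth_differentiable[OF test_functions_smooth[OF f]]])
  then show "(LINT x|lborel. partial_deriv i f x) \<bullet> b = 0 \<bullet> b"
    using integral_partial_deriv[OF t, of i]
      integral_inner_left[OF test_function_integrable[OF test_functions_partial[OF f, of i]], of b] by simp
qed

text \<open>There are no boundary terms, since \<open>\<psi>\<close> is compactly supported in
  \<open>\<Omega>\<close>; the function \<open>f\<close> itself may be nonzero on the boundary,
  which matters for testing functionals on \<open>H1\<close>.\<close>

lemma test_function_weak_partial:
  fixes f :: "real^'n \<Rightarrow> 'b::euclidean_space"
  assumes \<Omega>: "open \<Omega>" and f: "f \<in> test_functions UNIV"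
  shows "is_weak_partial_deriv \<Omega> i f (partial_deriv i f)"
  unfolding is_weak_partial_deriv_def
proof
  fix \<psi> :: "real^'n \<Rightarrow> real" assume \<psi>: "\<psi> \<in> test_functions \<Omega>"
  have p: "(\<lambda>x. \<psi> x *\<^sub>R f x) \<in> test_functions UNIV"
    by (rule test_functions_scaleR_left[OF test_functions_UNIV[OF \<psi>] test_functions_smooth[OF f]])
  have a: "(\<lambda>x. partial_deriv i \<psi> x *\<^sub>R f x) \<in> test_functions \<Omega>"
    by (rule test_functions_scaleR_left[OF test_functions_partial[OF \<psi>] test_functions_smooth[OF f]])
  have b: "(\<lambda>x. \<psi> x *\<^sub>R partial_deriv i f x) \<in> test_functions \<Omega>"
    by (rule test_functions_scaleR_left[OF \<psi> smooth_partial[OF test_functions_smooth[OF f]]])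
  have "partial_deriv i (\<lambda>x. \<psi> x *\<^sub>R f x) x = \<psi> x *\<^sub>R partial_deriv i f x + partial_deriv i \<psi> x *\<^sub>R f x" for x
    by (intro partial_deriv_scaleR smooth_differentiable test_functions_smooth[OF \<psi>] test_functions_smooth[OF f])
  then have "(LINT x|lborel. \<psi> x *\<^sub>R partial_deriv i f x) + (LINT x|lborel. partial_deriv i \<psi> x *\<^sub>R f x) = 0"
    using integral_partial_deriv_vector[OF p, of i] test_function_integrable[OF test_functions_UNIV[OF a]]
      test_function_integrable[OF test_functions_UNIV[OF b]] by simp
  moreover have "(LINT x|lebesgue_on \<Omega>. partial_deriv i \<psi> x *\<^sub>R f x) = (LINT x|lborel. partial_deriv i \<psi> x *\<^sub>R f x)"
    by (rule lebesgue_on_integral[OF \<Omega> test_function_borel[OF test_functions_UNIV[OF a]] test_functions_outside[OF a]])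
  moreover have "(LINT x|lebesgue_on \<Omega>. \<psi> x *\<^sub>R partial_deriv i f x) = (LINT x|lborel. \<psi> x *\<^sub>R partial_deriv i f x)"
    by (rule lebesgue_on_integral[OF \<Omega> test_function_borel[OF test_functions_UNIV[OF b]] test_functions_outside[OF b]])
  ultimately show "(LINT x|lebesgue_on \<Omega>. partial_deriv i \<psi> x *\<^sub>R f x) = - (LINT x|lebesgue_on \<Omega>. \<psi> x *\<^sub>R partial_deriv i f x)"
    by (simp add: eq_neg_iff_add_eq_0 add.commute)
qed

lemma test_function_H1:
  fixes f :: "real^'n \<Rightarrow> 'b::euclidean_space"
  assumes "open \<Omega>" "f \<in> test_functions UNIV" shows "f \<in> H1 \<Omega>"
  unfolding H1_def L2_eq
  using test_function_sqint_on[OF assms(1)] test_functions_partial assms test_function_weak_partial by blast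

lemma weak_partial_deriv_test_function:
  fixes f :: "real^'n \<Rightarrow> 'b::euclidean_space"
  assumes "open \<Omega>" "bounded \<Omega>" "f \<in> test_functions UNIV"
  shows "nrm (lebesgue_on \<Omega>) (\<lambda>x. weak_partial_deriv \<Omega> i f x - partial_deriv i f x) = 0"
  using weak_partial_deriv_eq[OF assms(1,2) test_function_H1[OF assms(1,3)] _ test_function_weak_partial[OF assms(1,3)]]
    test_function_sqint_on[OF assms(1) test_functions_partial[OF assms(3)]] by (simp add: L2_eq)

lemma nrm_weak_partial_deriv_test_function:
  fixes f :: "real^'n \<Rightarrow> 'b::euclidean_space"
  assumes "open \<Omega>" "bounded \<Omega>" "f \<in> test_functions UNIV"
  shows "nrm (lebesgue_on \<Omega>) (weak_partial_deriv \<Omega> i f) = nrm (lebesgue_on \<Omega>) (partial_deriv i f)"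
  using nrm_eq_of_diff_null(1)[OF _ _ weak_partial_deriv_test_function[OF assms]]
    weak_partial_deriv_spec(1)[OF test_function_H1[OF assms(1,3)]]
    test_function_sqint_on[OF assms(1) test_functions_partial[OF assms(3)]] by (simp add: L2_eq)

section \<open>Linear structure and seminorm of the Sobolev spaces\<close>

lemma is_weak_partial_deriv_scaleR:
  fixes u g :: "real^'a \<Rightarrow> 'b::euclidean_space"
  shows "is_weak_partial_deriv \<Omega> i u g \<Longrightarrow> is_weak_partial_deriv \<Omega> i (\<lambda>x. c *\<^sub>R u x) (\<lambda>x. c *\<^sub>R g x)"
proof -
  have "(\<lambda>x. a x *\<^sub>R c *\<^sub>R f x) = (\<lambda>x. c *\<^sub>R a x *\<^sub>R f x)" for a :: "real^'a \<Rightarrow> real" and f :: "real^'a \<Rightarrow> 'b"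
    by (simp add: mult.commute)
  then show "is_weak_partial_deriv \<Omega> i u g \<Longrightarrow> is_weak_partial_deriv \<Omega> i (\<lambda>x. c *\<^sub>R u x) (\<lambda>x. c *\<^sub>R g x)"
    unfolding is_weak_partial_deriv_def by (simp only: integral_scaleR_right scaleR_minus_right) simp
qed

lemma is_weak_partial_deriv_diff:
  fixes u v :: "real^'n \<Rightarrow> 'b::euclidean_space"
  assumes "open \<Omega>" "u \<in> L2 \<Omega>" "v \<in> L2 \<Omega>" "g \<in> L2 \<Omega>" "h \<in> L2 \<Omega>"
    "is_weak_partial_deriv \<Omega> i u g" "is_weak_partial_deriv \<Omega> i v h"
  shows "is_weak_partial_deriv \<Omega> i (\<lambda>x. u x - v x) (\<lambda>x. g x - h x)"
  unfolding is_weak_partial_deriv_def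
proof
  fix \<psi> :: "real^'n \<Rightarrow> real" assume \<psi>: "\<psi> \<in> test_functions \<Omega>"
  have s: "\<psi> \<in> sqint (lebesgue_on \<Omega>)" "partial_deriv i \<psi> \<in> sqint (lebesgue_on \<Omega>)"
    using test_functions_partial[OF \<psi>, of i] \<psi> by (auto intro!: test_function_sqint_on assms(1) dest: test_functions_UNIV)
  show "(LINT x|lebesgue_on \<Omega>. partial_deriv i \<psi> x *\<^sub>R (u x - v x)) = - (LINT x|lebesgue_on \<Omega>. \<psi> x *\<^sub>R (g x - h x))"
    using assms(6,7) \<psi> assms(2-5)[unfolded L2_eq, THEN integrable_scaleR_sqint[OF s(1)]]
      assms(2-5)[unfolded L2_eq, THEN integrable_scaleR_sqint[OF s(2)]]
    unfolding is_weak_partial_deriv_def by (simp add: scaleR_diff_right)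
qed

lemma H1_scaleR: "u \<in> H1 \<Omega> \<Longrightarrow> (\<lambda>x. c *\<^sub>R u x) \<in> H1 \<Omega>"
  unfolding H1_def L2_eq using is_weak_partial_deriv_scaleR sqint_scaleR by blast

lemma H1_diff:
  assumes "open \<Omega>" "u \<in> H1 \<Omega>" "v \<in> H1 \<Omega>" shows "(\<lambda>x. u x - v x) \<in> H1 \<Omega>"
proof -
  have L: "u \<in> L2 \<Omega>" "v \<in> L2 \<Omega>" using assms by (auto simp: H1_def)
  have "is_weak_partial_deriv \<Omega> i (\<lambda>x. u x - v x) (\<lambda>x. weak_partial_deriv \<Omega> i u x - weak_partial_deriv \<Omega> i v x)" for i
    using assms L by (intro is_weak_partial_deriv_diff weak_partial_deriv_spec)
  moreover have "(\<lambda>x. weak_partial_deriv \<Omega> i u x - weak_partial_deriv \<Omega> i v x) \<in> L2 \<Omega>" for i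
    using weak_partial_deriv_spec(1)[OF assms(2)] weak_partial_deriv_spec(1)[OF assms(3)] by (simp add: L2_eq sqint_diff)
  ultimately show ?thesis
    using L unfolding H1_def by (auto simp: L2_eq sqint_diff)
qed

lemma H1_norm_scaleR:
  fixes u :: "real^'n \<Rightarrow> 'b::euclidean_space"
  assumes \<Omega>: "open \<Omega>" "bounded \<Omega>" and u: "u \<in> H1 \<Omega>"
  shows "H1_norm \<Omega> (\<lambda>x. c *\<^sub>R u x) = \<bar>c\<bar> * H1_norm \<Omega> u"
proof -
  have "nrm (lebesgue_on \<Omega>) (weak_partial_deriv \<Omega> i (\<lambda>x. c *\<^sub>R u x)) = \<bar>c\<bar> * nrm (lebesgue_on \<Omega>) (weak_partial_deriv \<Omega> i u)" for i
  proof -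
    have g: "(\<lambda>x. c *\<^sub>R weak_partial_deriv \<Omega> i u x) \<in> L2 \<Omega>"
      using weak_partial_deriv_spec(1)[OF u] by (simp add: L2_eq sqint_scaleR)
    have "nrm (lebesgue_on \<Omega>) (weak_partial_deriv \<Omega> i (\<lambda>x. c *\<^sub>R u x)) = nrm (lebesgue_on \<Omega>) (\<lambda>x. c *\<^sub>R weak_partial_deriv \<Omega> i u x)"
      by (rule nrm_eq_of_diff_null(1)[OF _ _ weak_partial_deriv_eq[OF \<Omega> H1_scaleR[OF u] g
            is_weak_partial_deriv_scaleR[OF weak_partial_deriv_spec(2)[OF u]]]])
        (use weak_partial_deriv_spec(1)[OF H1_scaleR[OF u]] g in \<open>simp_all add: L2_eq\<close>)
    then show ?thesis by (simp add: nrm_scaleR)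
  qed
  then have "(L2_norm \<Omega> (\<lambda>x. c *\<^sub>R u x))\<^sup>2 + (\<Sum>i\<in>UNIV. (L2_norm \<Omega> (weak_partial_deriv \<Omega> i (\<lambda>x. c *\<^sub>R u x)))\<^sup>2)
     = c\<^sup>2 * ((L2_norm \<Omega> u)\<^sup>2 + (\<Sum>i\<in>UNIV. (L2_norm \<Omega> (weak_partial_deriv \<Omega> i u))\<^sup>2))"
    by (simp add: L2_norm_eq nrm_scaleR power_mult_distrib sum_distrib_left distrib_left)
  then show ?thesis by (simp add: H1_norm_def real_sqrt_mult)
qed

lemma H1_norm_nonneg: "0 \<le> H1_norm \<Omega> u"
  by (simp add: H1_norm_def sum_nonneg)

lemma H1_norm_test_function_le:
  fixes f :: "real^'n \<Rightarrow> 'b::euclidean_space"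
  assumes \<Omega>: "open \<Omega>" "bounded \<Omega>" and f: "f \<in> test_functions UNIV"
  shows "H1_norm \<Omega> f \<le> nrm lborel f + (\<Sum>i\<in>UNIV. nrm lborel (partial_deriv i f))"
proof -
  have "H1_norm \<Omega> f \<le> sqrt ((nrm (lebesgue_on \<Omega>) f)\<^sup>2) + sqrt (\<Sum>i\<in>UNIV. (nrm (lebesgue_on \<Omega>) (partial_deriv i f))\<^sup>2)"
    unfolding H1_norm_def L2_norm_eq nrm_weak_partial_deriv_test_function[OF \<Omega> f]
    by (intro sqrt_add_le_add_sqrt sum_nonneg) auto
  also have "sqrt (\<Sum>i\<in>UNIV. (nrm (lebesgue_on \<Omega>) (partial_deriv i f))\<^sup>2) \<le> (\<Sum>i\<in>UNIV. nrm (lebesgue_on \<Omega>) (partial_deriv i f))"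
    using L2_set_le_sum[of UNIV "\<lambda>i. nrm (lebesgue_on \<Omega>) (partial_deriv i f)"] by (simp add: L2_set_def nrm_nonneg)
  also have "\<dots> \<le> (\<Sum>i\<in>UNIV. nrm lborel (partial_deriv i f))"
    by (intro sum_mono nrm_on_le[OF \<Omega>(1)] test_functions_partial f)
  also have "sqrt ((nrm (lebesgue_on \<Omega>) f)\<^sup>2) \<le> nrm lborel f"
    using nrm_on_le[OF \<Omega>(1) f] by (simp add: nrm_nonneg)
  finally show ?thesis by simp
qed

lemma test_function_H1_ring:
  fixes f :: "real^'n \<Rightarrow> 'b::euclidean_space"
  assumes \<Omega>: "open \<Omega>" "bounded \<Omega>" and f: "f \<in> test_functions \<Omega>"
  shows "f \<in> H1_ring \<Omega>"
proof -
  have "H1_norm \<Omega> (\<lambda>x. f x - f x) \<le> 0"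
    using H1_norm_test_function_le[OF \<Omega> test_functions_zero, where 'b='b]
    by (simp add: nrm_zero partial_deriv_zero)
  then show ?thesis
    unfolding H1_ring_def using test_function_H1[OF \<Omega>(1) test_functions_UNIV[OF f]] f
    by (auto intro!: bexI[of _ f] elim: le_less_trans)
qed

lemma H1_ring_scaleR:
  fixes u :: "real^'n \<Rightarrow> 'b::euclidean_space"
  assumes \<Omega>: "open \<Omega>" "bounded \<Omega>" and u: "u \<in> H1_ring \<Omega>"
  shows "(\<lambda>x. c *\<^sub>R u x) \<in> H1_ring \<Omega>"
proof -
  have uH: "u \<in> H1 \<Omega>" using u by (simp add: H1_ring_def)
  have "\<exists>\<phi>\<in>test_functions \<Omega>. H1_norm \<Omega> (\<lambda>x. c *\<^sub>R u x - \<phi> x) < \<epsilon>" if \<epsilon>: "\<epsilon> > 0" for \<epsilon>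
  proof -
    have "\<epsilon> / (\<bar>c\<bar> + 1) > 0" using \<epsilon> by (simp add: add_nonneg_pos)
    then obtain \<phi> where \<phi>: "\<phi> \<in> test_functions \<Omega>" "H1_norm \<Omega> (\<lambda>x. u x - \<phi> x) < \<epsilon> / (\<bar>c\<bar> + 1)"
      using u by (auto simp: H1_ring_def)
    have "(\<lambda>x. c *\<^sub>R u x - c *\<^sub>R \<phi> x) = (\<lambda>x. c *\<^sub>R (u x - \<phi> x))" by (simp add: scaleR_diff_right)
    then have "H1_norm \<Omega> (\<lambda>x. c *\<^sub>R u x - c *\<^sub>R \<phi> x) = \<bar>c\<bar> * H1_norm \<Omega> (\<lambda>x. u x - \<phi> x)"
      using H1_norm_scaleR[OF \<Omega> H1_diff[OF \<Omega>(1) uH test_function_H1[OF \<Omega>(1) test_functions_UNIV[OF \<phi>(1)]]], of c] by simp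
    also have "\<dots> \<le> (\<bar>c\<bar> + 1) * H1_norm \<Omega> (\<lambda>x. u x - \<phi> x)"
      by (intro mult_right_mono H1_norm_nonneg) simp
    also have "\<dots> < \<epsilon>" using \<phi>(2) by (simp add: field_simps add_nonneg_pos)
    finally show ?thesis
      using test_functions_bounded_linear[OF bounded_linear_scaleR_right \<phi>(1), of c] by (intro bexI[of _ "\<lambda>x. c *\<^sub>R \<phi> x"])
  qed
  then show ?thesis using H1_scaleR[OF uH, of c] by (simp add: H1_ring_def)
qed

section \<open>Relatively compact sequences of functionals\<close>

lemma dual_dist_bound:
  assumes scale: "\<And>c u. u \<in> V \<Longrightarrow> (\<lambda>x. c *\<^sub>R u x) \<in> V"
    and homogeneous: "\<And>c u. u \<in> V \<Longrightarrow> N (\<lambda>x. c *\<^sub>R u x) = \<bar>c\<bar> * N u"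
    and nonneg: "\<And>u. u \<in> V \<Longrightarrow> 0 \<le> N u"
    and f: "f \<in> dual_space V N" and g: "g \<in> dual_space V N" and u: "u \<in> V"
  shows "\<bar>f u - g u\<bar> \<le> dual_dist V N f g * N u"
proof -
  obtain C where C: "\<And>u. u \<in> V \<Longrightarrow> \<bar>f u\<bar> \<le> C * N u" using f unfolding dual_space_def by blast
  obtain D where D: "\<And>u. u \<in> V \<Longrightarrow> \<bar>g u\<bar> \<le> D * N u" using g unfolding dual_space_def by blast
  have CD: "\<bar>f u - g u\<bar> \<le> (\<bar>C\<bar> + \<bar>D\<bar>) * N u" if "u \<in> V" for u
  proof -
    have "C * N u \<le> \<bar>C\<bar> * N u" "D * N u \<le> \<bar>D\<bar> * N u" using nonneg[OF that] by (auto intro: mult_right_mono)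
    then show ?thesis using C[OF that] D[OF that] unfolding distrib_right by linarith
  qed
  show ?thesis
  \<comment> \<open>\<open>N\<close> is a seminorm, so \<open>u\<close> cannot always be normalised;
    in the degenerate case boundedness makes both functionals vanish at \<open>u\<close>.\<close>
  proof (cases "N u = 0")
    case True
    then show ?thesis using CD[OF u] by simp
  next
    case False
    then have N: "N u > 0" using nonneg[OF u] by simp
    let ?v = "\<lambda>x. (1 / N u) *\<^sub>R u x"
    have v: "?v \<in> {u \<in> V. N u \<le> 1}" using scale[OF u] homogeneous[OF u] N by simp
    have bdd: "bdd_above ((\<lambda>u. \<bar>f u - g u\<bar>) ` {u \<in> V. N u \<le> 1})"
    proof (rule bdd_aboveI2)
      fix w assume "w \<in> {u \<in> V. N u \<le> 1}"
      then have "\<bar>f w - g w\<bar> \<le> (\<bar>C\<bar> + \<bar>D\<bar>) * N w" "N w \<le> 1" using CD by auto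
      moreover have "(\<bar>C\<bar> + \<bar>D\<bar>) * N w \<le> (\<bar>C\<bar> + \<bar>D\<bar>) * 1"
        using \<open>N w \<le> 1\<close> by (intro mult_left_mono) auto
      ultimately show "\<bar>f w - g w\<bar> \<le> \<bar>C\<bar> + \<bar>D\<bar>" by simp
    qed
    have "\<bar>f ?v - g ?v\<bar> \<le> dual_dist V N f g"
      using cSUP_upper[OF v bdd] f g by (simp add: dual_dist_def dual_norm_def)
    moreover have "f ?v = (1 / N u) * f u" "g ?v = (1 / N u) * g u"
      using f g u unfolding dual_space_def by blast+
    ultimately have "\<bar>(1 / N u) * (f u - g u)\<bar> \<le> dual_dist V N f g" by (simp add: right_diff_distrib)
    then show ?thesis using N by (simp add: abs_mult field_simps)
  qed
qed

text \<open>Sequential compactness of the closure gives a limit functional, and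
  \<open>\<delta>\<close> is the dual distance to it along the subsequence: one null sequence for
  all of \<open>V\<close>.\<close>

lemma relatively_compact_dual_subsequence:
  fixes L :: "nat \<Rightarrow> ('a \<Rightarrow> 'b::real_vector) \<Rightarrow> real"
  assumes ne: "V \<noteq> {}" and scale: "\<And>c u. u \<in> V \<Longrightarrow> (\<lambda>x. c *\<^sub>R u x) \<in> V"
    and homogeneous: "\<And>c u. u \<in> V \<Longrightarrow> N (\<lambda>x. c *\<^sub>R u x) = \<bar>c\<bar> * N u"
    and N_nonneg: "\<And>u. u \<in> V \<Longrightarrow> 0 \<le> N u"
    and L: "relatively_compact_in (dual_topology V N) L"
  shows "\<exists>r L0 \<delta>. strict_mono r \<and> \<delta> \<longlonglongrightarrow> 0 \<and> (\<forall>n. \<forall>u\<in>V. \<bar>L (r n) u - L0 u\<bar> \<le> \<delta> n * N u)"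
proof -
  interpret Metric_space "dual_space V N" "dual_dist V N"
    by (rule Metric_space_dual[OF ne scale homogeneous N_nonneg])
  have LV: "L n \<in> dual_space V N" for n
    using L unfolding relatively_compact_in_def dual_topology_def by auto
  have "compactin mtopology (mtopology closure_of range L)"
    using L unfolding relatively_compact_in_def dual_topology_def by simp
  moreover have "range L \<subseteq> mtopology closure_of range L"
    by (rule closure_of_subset) (use LV in auto)
  ultimately obtain l r where l: "l \<in> mtopology closure_of range L" "strict_mono r"
    "limitin mtopology (L \<circ> r) l sequentially"
    unfolding compactin_sequentially by blast
  have lV: "l \<in> dual_space V N" using limitin_mspace[OF l(3)] .
  have "(\<lambda>n. dual_dist V N (L (r n)) l) \<longlonglongrightarrow> 0"
  proof (rule LIMSEQ_I)
    fix e :: real assume "e > 0"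
    then have "\<forall>\<^sub>F n in sequentially. (L \<circ> r) n \<in> dual_space V N \<and> dual_dist V N ((L \<circ> r) n) l < e"
      using l(3) unfolding limitin_metric by blast
    then show "\<exists>no. \<forall>n\<ge>no. norm (dual_dist V N (L (r n)) l - 0) < e"
      unfolding eventually_sequentially by auto
  qed
  moreover have "\<bar>L (r n) u - l u\<bar> \<le> dual_dist V N (L (r n)) l * N u" if "u \<in> V" for n u
    by (rule dual_dist_bound[OF scale homogeneous N_nonneg LV lV that])
  ultimately show ?thesis using l(2) by blast
qed

section \<open>Geometry of the domain and localisation\<close>

text \<open>Moving along the axis of the local chart raises the point linearly, while a Lipschitz
  graph can rise at most \<open>L\<close> times the horizontal drift. In a narrow enough cone the
  point therefore ends strictly above the graph, even when it starts on it.\<close>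

lemma interior_cone:
  assumes dom: "bounded_strong_lipschitz_domain \<Omega>" and p: "p \<in> closure \<Omega>"
  shows "\<exists>r>0. \<exists>v. \<exists>\<rho>>0. \<forall>x\<in>closure \<Omega> \<inter> cball p r. \<forall>z\<in>cone_seg v \<rho> 1. x + z \<in> \<Omega>"
proof (cases "p \<in> \<Omega>")
  case True
  have "open \<Omega>" using dom by (simp add: bounded_strong_lipschitz_domain_def)
  then obtain e where e: "e > 0" "ball p e \<subseteq> \<Omega>" using True open_contains_ball by blast
  \<comment> \<open>At an interior point any short displacement is allowed, hence the direction 0,
    for which the cone is a ball.\<close>
  have "x + z \<in> \<Omega>" if x: "x \<in> cball p (e/4)" and z: "z \<in> cone_seg 0 (e/4) 1" for x z
  proof -
    obtain s f where sf: "z = s *\<^sub>R f" "0 < s" "s \<le> 1" "norm f < e/4" using z unfolding cone_seg_def by auto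
    have "norm z \<le> 1 * norm f" unfolding sf(1) using sf by (simp add: mult_left_le_one_le)
    moreover have "dist p (x + z) \<le> dist p x + norm z"
      using norm_triangle_ineq4[of "p - x" z] by (simp add: dist_norm algebra_simps)
    ultimately have "dist p (x + z) < e" using x sf(4) e(1) by simp
    then show ?thesis using e(2) by auto
  qed
  then show ?thesis using e(1) by (intro exI[of _ "e/4"] conjI exI[of _ 0] exI[of _ "e/4"]) auto
next
  case False
  have op: "open \<Omega>" using dom by (simp add: bounded_strong_lipschitz_domain_def)
  have fr: "frontier \<Omega> = closure \<Omega> - \<Omega>" using op by (simp add: frontier_def interior_open)
  then have "p \<in> frontier \<Omega>" using p False by simp
  then obtain Q :: "real^3 \<Rightarrow> real^3" and U L and g :: "real \<times> real \<Rightarrow> real" where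
    Q: "orthogonal_transformation Q" and U: "open U" "p \<in> U" and lip: "lipschitz_on L UNIV g"
    and in\<Omega>: "\<Omega> \<inter> U = {x\<in>U. g (Q x $ 1, Q x $ 2) < Q x $ 3}"
    and inF: "frontier \<Omega> \<inter> U = {x\<in>U. g (Q x $ 1, Q x $ 2) = Q x $ 3}"
    using dom unfolding bounded_strong_lipschitz_domain_def strong_lipschitz_boundary_def by blast
  have lin: "linear Q" using Q by (simp add: orthogonal_transformation_def)
  have L0: "L \<ge> 0" using lip by (rule lipschitz_on_nonneg)
  obtain e where e: "e > 0" "ball p e \<subseteq> U" using U open_contains_ball by blast
  \<comment> \<open>A point within \<open>t\<close> of \<open>p\<close>, displaced by less than
    \<open>t + \<rho>\<close>, which is at most \<open>3 * t / 2\<close>, remains within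
    \<open>e\<close>.\<close>
  define t where "t = e / 4"
  have t: "t > 0" using e by (simp add: t_def)
  \<comment> \<open>Chosen so that \<open>(L + 1) * \<rho>\<close> is half of \<open>t\<close>:
    horizontal drift times \<open>L\<close> plus vertical loss then stays below the vertical
    gain.\<close>
  define \<rho> where "\<rho> = t / (2 * (L + 1))"
  have \<rho>: "\<rho> > 0" using t L0 by (simp add: \<rho>_def)
  have L\<rho>: "(L + 1) * \<rho> = t / 2"
  proof -
    have "L + 1 \<noteq> 0" using L0 by simp
    then show ?thesis unfolding \<rho>_def by (simp add: divide_simps)
  qed
  have "1 * \<rho> \<le> (L + 1) * \<rho>" using L0 \<rho> by (intro mult_right_mono) auto
  then have \<rho>t: "\<rho> \<le> t / 2" using L\<rho> by simp
  obtain v where v: "Q v = t *\<^sub>R axis 3 1"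
    using orthogonal_transformation_surj[OF Q] by (metis surj_def)
  have nv: "norm v = t" using orthogonal_transformation_norm[OF Q, of v] v t by simp
  have "x + z \<in> \<Omega>" if x: "x \<in> closure \<Omega>" "x \<in> cball p t" and z: "z \<in> cone_seg v \<rho> 1" for x z
  proof -
    obtain s f where sf: "z = s *\<^sub>R f" "0 < s" "s \<le> 1" "dist v f < \<rho>" using z unfolding cone_seg_def by auto
    have xU: "x \<in> U" using x(2) e t unfolding t_def by (intro subsetD[OF e(2)]) auto
    have "norm f \<le> norm v + dist v f" using norm_triangle_sub[of f v] by (simp add: dist_norm norm_minus_commute)
    then have "norm f < t + \<rho>" using nv sf(4) by simp
    moreover have "norm z \<le> 1 * norm f" unfolding sf(1) using sf by (simp add: mult_left_le_one_le)
    moreover have "dist p (x + z) \<le> dist p x + norm z"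
      using norm_triangle_ineq4[of "p - x" z] by (simp add: dist_norm algebra_simps)
    ultimately have "dist p (x + z) < e" using x(2) \<rho>t e(1) by (simp add: t_def)
    then have xzU: "x + z \<in> U" using e(2) by auto
    define w where "w = Q f - Q v"
    have "w = Q (f - v)" using lin by (simp add: w_def linear_diff)
    then have nw: "norm w < \<rho>" using orthogonal_transformation_norm[OF Q, of "f - v"] sf(4) by (simp add: dist_norm norm_minus_commute)
    have Qxz: "Q (x + z) = Q x + s *\<^sub>R (t *\<^sub>R axis 3 1 + w)"
      using lin v by (simp add: sf(1) w_def linear_add linear_scale)
    have q: "Q (x + z) $ 1 = Q x $ 1 + s * w $ 1" "Q (x + z) $ 2 = Q x $ 2 + s * w $ 2"
      "Q (x + z) $ 3 = Q x $ 3 + s * (t + w $ 3)"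
      unfolding Qxz by (simp_all add: axis_def)
    have "x \<in> \<Omega> \<inter> U \<or> x \<in> frontier \<Omega> \<inter> U" using x(1) xU fr by auto
    then have gx: "g (Q x $ 1, Q x $ 2) \<le> Q x $ 3" unfolding in\<Omega> inF by auto
    have "dist (Q (x + z) $ 1, Q (x + z) $ 2) (Q x $ 1, Q x $ 2) = norm (s * w $ 1, s * w $ 2)"
      unfolding q by (simp add: dist_Pair_Pair dist_norm norm_Pair)
    also have "\<dots> = s * norm (w $ 1, w $ 2)"
      using norm_scaleR[of s "(w $ 1, w $ 2)"] sf(2) by simp
    also have "\<dots> \<le> s * norm w"
    proof -
      have "norm (w $ 1, w $ 2) \<le> norm w"
        by (simp add: norm_Pair norm_vec_def L2_set_def sum_3)
      then show ?thesis using sf(2) by simp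
    qed
    also have "\<dots> \<le> s * \<rho>" using nw sf(2) by simp
    finally have d: "dist (Q (x + z) $ 1, Q (x + z) $ 2) (Q x $ 1, Q x $ 2) \<le> s * \<rho>" .
    have "g (Q (x + z) $ 1, Q (x + z) $ 2) - g (Q x $ 1, Q x $ 2) \<le> L * dist (Q (x + z) $ 1, Q (x + z) $ 2) (Q x $ 1, Q x $ 2)"
      using lipschitz_onD[OF lip, of "(Q (x + z) $ 1, Q (x + z) $ 2)" "(Q x $ 1, Q x $ 2)"] by (simp add: dist_real_def)
    also have "\<dots> \<le> L * (s * \<rho>)" by (intro mult_left_mono d L0)
    finally have "g (Q (x + z) $ 1, Q (x + z) $ 2) \<le> Q x $ 3 + s * (L * \<rho>)" using gx by (simp add: mult.left_commute)
    also have "\<dots> < Q x $ 3 + s * (t + w $ 3)"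
    proof -
      have "\<bar>w $ 3\<bar> \<le> norm w" by (rule component_le_norm_cart)
      then have "L * \<rho> < t + w $ 3" using nw L\<rho> t by (simp add: distrib_right)
      then show ?thesis using sf(2) by simp
    qed
    also have "\<dots> = Q (x + z) $ 3" using q by simp
    finally have "x + z \<in> \<Omega> \<inter> U" unfolding in\<Omega> using xzU by simp
    then show ?thesis by simp
  qed
  then show ?thesis using t \<rho> by (intro exI[of _ t] conjI exI[of _ v] exI[of _ \<rho>]) auto
qed

text \<open>The indicators of the balls divided by their sum are a measurable partition of unity on
  the union; mollification makes it smooth and preserves the sum where the kernel sees only this
  union.\<close>

lemma smooth_partition:
  fixes p :: "'i \<Rightarrow> real^'n"
  assumes K: "compact K" and I: "finite I" "I \<noteq> {}" and r: "\<And>i. i \<in> I \<Longrightarrow> r i > 0"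
    and cover: "K \<subseteq> (\<Union>i\<in>I. ball (p i) (r i))"
  shows "\<exists>\<theta>. (\<forall>i\<in>I. \<theta> i \<in> tf \<and> (\<forall>x. x \<notin> cball (p i) (2 * r i) \<longrightarrow> \<theta> i x = 0)) \<and> (\<forall>x\<in>K. (\<Sum>i\<in>I. \<theta> i x) = 1)"
proof -
  define B where "B i = ball (p i) (r i)" for i
  have "open (\<Union>i\<in>I. B i)" by (auto simp: B_def)
  then obtain \<epsilon> where \<epsilon>: "\<epsilon> > 0" "(\<Union>x\<in>K. ball x \<epsilon>) \<subseteq> (\<Union>i\<in>I. B i)"
    using compact_subset_open_imp_ball_epsilon_subset[OF K, of "\<Union>i\<in>I. B i"] cover unfolding B_def by blast
  \<comment> \<open>Being below \<open>\<epsilon>\<close>, it keeps the mollified sum equal to 1 on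
    \<open>K\<close>; being at most each radius, it keeps the mollified weights inside the doubled
    balls.\<close>
  define \<delta> where "\<delta> = min (\<epsilon> / 2) (Min (r ` I))"
  have \<delta>: "\<delta> > 0" "\<delta> < \<epsilon>" "\<And>i. i \<in> I \<Longrightarrow> \<delta> \<le> r i"
    using \<epsilon>(1) I r by (auto simp: \<delta>_def min.coboundedI2)
  obtain \<phi> :: "real^'n \<Rightarrow> real" where \<phi>: "\<phi> \<in> tf" "\<And>x. x \<notin> cball 0 \<delta> \<Longrightarrow> \<phi> x = 0" "(LINT x|lborel. \<phi> x) = 1"
    using normalized_bump_exists[OF \<delta>(1), of 0] by blast
  text \<open>Outside the union of the balls the quotient is \<open>0/0 = 0\<close>.\<close>
  define w where "w i x = indicator (B i) x / (\<Sum>k\<in>I. indicator (B k) x :: real)" for i x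
  have wm: "w i \<in> borel_measurable borel" for i
    unfolding w_def B_def by (intro borel_measurable_divide borel_measurable_sum borel_measurable_indicator) auto
  have wle: "\<bar>w i x\<bar> \<le> indicator (B i) x" if "i \<in> I" for i x
  proof (cases "x \<in> B i")
    case True
    have "(indicator (B i) x :: real) \<le> (\<Sum>k\<in>I. indicator (B k) x)"
      by (rule member_le_sum) (use that I in auto)
    then show ?thesis using True by (simp add: w_def)
  qed (simp add: w_def)
  have iw: "integrable lborel (w i)" if "i \<in> I" for i
  proof (rule Bochner_Integration.integrable_bound[of _ "indicator (B i) :: _ \<Rightarrow> real"])
    show "integrable lborel (indicator (B i) :: real^'n \<Rightarrow> real)"
      unfolding B_def by (intro integrable_real_indicator emeasure_bounded_finite) auto
    show "AE x in lborel. norm (w i x) \<le> norm (indicator (B i) x :: real)"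
      using wle[OF that] by (auto simp: indicator_def)
  qed (use wm in simp)
  have wsum: "(\<Sum>i\<in>I. w i x) = 1" if "x \<in> (\<Union>i\<in>I. B i)" for x
  proof -
    have "(\<Sum>k\<in>I. indicator (B k) x :: real) > 0"
    proof -
      from \<open>x \<in> (\<Union>i\<in>I. B i)\<close> obtain i where "i \<in> I" "x \<in> B i" by blast
      then show ?thesis using I(1) by (intro sum_pos2[of I i]) auto
    qed
    then show ?thesis by (simp add: w_def flip: sum_divide_distrib)
  qed
  define \<theta> where "\<theta> i = conv \<phi> (w i)" for i
  have out: "\<theta> i x = 0" if "i \<in> I" "x \<notin> cball (p i) (2 * r i)" for i x
    unfolding \<theta>_def
  proof (rule conv_outside[OF \<phi>(2)])
    show "w i x = 0" if "x \<notin> B i" for x using that by (simp add: w_def)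
    show "x \<notin> {a + b |a b. a \<in> cball 0 \<delta> \<and> b \<in> B i}"
    proof
      assume "x \<in> {a + b |a b. a \<in> cball 0 \<delta> \<and> b \<in> B i}"
      then obtain a b where ab: "x = a + b" "norm a \<le> \<delta>" "dist (p i) b < r i" by (auto simp: B_def)
      have "dist (p i) x \<le> dist (p i) b + norm a"
        using norm_triangle_ineq4[of "p i - b" a] ab(1) by (simp add: dist_norm algebra_simps)
      then show False using ab \<delta>(3)[OF that(1)] that(2) by simp
    qed
  qed
  have "\<theta> i \<in> tf" if "i \<in> I" for i
    by (rule test_functionsI[of _ "cball (p i) (2 * r i)"])
      (use out[OF that] conv_smooth[OF \<phi>(1) iw[OF that]] in \<open>auto simp: \<theta>_def\<close>)
  moreover have "(\<Sum>i\<in>I. \<theta> i x) = 1" if x: "x \<in> K" for x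
  proof -
    have "integrable lborel (\<lambda>y. \<phi> (x - y) * w i y)" if "i \<in> I" for i
    proof -
      obtain C where C: "\<And>y. norm (\<phi> y) \<le> C" using test_function_bounded[OF \<phi>(1)] by blast
      show ?thesis
      proof (rule Bochner_Integration.integrable_bound[OF integrable_mult_right[OF iw[OF that], of C]])
        show "(\<lambda>y. \<phi> (x - y) * w i y) \<in> borel_measurable lborel"
          using tf_borel[OF tf_reflect[OF \<phi>(1), of x]] wm[of i] by simp
        have "0 \<le> C" using C norm_ge_zero order_trans by blast
        then show "AE y in lborel. norm (\<phi> (x - y) * w i y) \<le> norm (C * w i y)"
          using C by (auto simp: abs_mult intro!: mult_right_mono)
      qed
    qed
    then have "(\<Sum>i\<in>I. \<theta> i x) = (LINT y|lborel. (\<Sum>i\<in>I. \<phi> (x - y) * w i y))"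
      by (simp add: \<theta>_def conv_def)
    also have "(\<lambda>y. \<Sum>i\<in>I. \<phi> (x - y) * w i y) = (\<lambda>y. \<phi> (x - y))"
    proof
      fix y
      show "(\<Sum>i\<in>I. \<phi> (x - y) * w i y) = \<phi> (x - y)"
      proof (cases "x - y \<in> cball 0 \<delta>")
        case True
        then have "y \<in> ball x \<epsilon>" using \<delta>(2) by (simp add: dist_norm norm_minus_commute)
        then have "y \<in> (\<Union>i\<in>I. B i)" using \<epsilon>(2) x by blast
        then show ?thesis using wsum[of y] by (simp flip: sum_distrib_left)
      qed (simp add: \<phi>(2))
    qed
    also have "(LINT y|lborel. \<phi> (x - y)) = 1"
      using integral_reflect[OF tf_borel[OF \<phi>(1)], of x] \<phi>(3) by simp
    finally show ?thesis .
  qed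
  ultimately show ?thesis using out by blast
qed

text \<open>The local cones combine through a partition of unity on the closure, which sums to 1
  wherever the fields live. \<open>X\<close> and \<open>Y\<close> encode which of the two tests is
  restricted to \<open>\<Omega>\<close>, and so which local lemma applies.\<close>

lemma div_curl_test_functions:
  fixes E H :: "nat \<Rightarrow> 3 \<Rightarrow> real^3 \<Rightarrow> real"
  assumes dom: "bounded_strong_lipschitz_domain \<Omega>"
    and supp: "\<And>n j. E n j \<in> test_functions \<Omega>" "\<And>n j. H n j \<in> test_functions \<Omega>"
    and E: "\<And>j. wnull (\<lambda>n. E n j)" and H: "\<And>j. wnull (\<lambda>n. H n j)"
    and \<delta>: "\<delta> \<longlonglongrightarrow> 0"
    and XY: "(X = UNIV \<and> Y = \<Omega>) \<or> (X = \<Omega> \<and> Y = UNIV)"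
    and curlE: "\<And>n \<Phi>. (\<And>j. \<Phi> j \<in> test_functions X) \<Longrightarrow>
        \<bar>\<Sum>j\<in>UNIV. ip lborel (E n j) (ccurl \<Phi> j)\<bar> \<le> \<delta> n * (\<Sum>j\<in>UNIV. N1 (\<Phi> j))"
    and divH: "\<And>n \<phi>. \<phi> \<in> test_functions Y \<Longrightarrow>
        \<bar>\<Sum>j\<in>UNIV. ip lborel (H n j) (partial_deriv j \<phi>)\<bar> \<le> \<delta> n * N1 \<phi>"
  shows "(\<lambda>n. \<Sum>j\<in>UNIV. ip lborel (E n j) (H n j)) \<longlonglongrightarrow> 0"
proof -
  have \<Omega>: "bounded \<Omega>" "\<Omega> \<noteq> {}" using dom by (auto simp: bounded_strong_lipschitz_domain_def)
  have K: "compact (closure \<Omega>)" using \<Omega>(1) by (simp add: compact_closure)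
  \<comment> \<open>Radius, axis and opening of the cone are bundled in one triple so that a single
    choice function delivers them together.\<close>
  have "\<forall>p\<in>closure \<Omega>. \<exists>q::real \<times> (real^3) \<times> real. fst q > 0 \<and> snd (snd q) > 0 \<and>
      (\<forall>x\<in>closure \<Omega> \<inter> cball p (fst q). \<forall>z\<in>cone_seg (fst (snd q)) (snd (snd q)) 1. x + z \<in> \<Omega>)"
    using interior_cone[OF dom] by force
  from bchoice[OF this] obtain q :: "real^3 \<Rightarrow> real \<times> (real^3) \<times> real" where
    q0: "\<forall>p\<in>closure \<Omega>. fst (q p) > 0 \<and> snd (snd (q p)) > 0 \<and>
      (\<forall>x\<in>closure \<Omega> \<inter> cball p (fst (q p)). \<forall>z\<in>cone_seg (fst (snd (q p))) (snd (snd (q p))) 1. x + z \<in> \<Omega>)"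
    by (rule exE)
  have q: "fst (q p) > 0" "snd (snd (q p)) > 0"
    "\<And>x z. x \<in> closure \<Omega> \<inter> cball p (fst (q p)) \<Longrightarrow> z \<in> cone_seg (fst (snd (q p))) (snd (snd (q p))) 1 \<Longrightarrow> x + z \<in> \<Omega>"
    if "p \<in> closure \<Omega>" for p
    using bspec[OF q0 that] by blast+
  \<comment> \<open>Half of the radius of the cone neighbourhood, because the partition functions
    live on doubled balls.\<close>
  define r where "r p = fst (q p) / 2" for p
  have r: "r p > 0" if "p \<in> closure \<Omega>" for p using q(1)[OF that] by (simp add: r_def)
  have "closure \<Omega> \<subseteq> (\<Union>p\<in>closure \<Omega>. ball p (r p))" using r by force
  then obtain I where I: "I \<subseteq> closure \<Omega>" "finite I" "closure \<Omega> \<subseteq> (\<Union>p\<in>I. ball p (r p))"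
    using compactE_image[OF K, of "closure \<Omega>" "\<lambda>p. ball p (r p)"] by auto
  have "I \<noteq> {}" using I(3) \<Omega>(2) by auto
  moreover have "r p > 0" if "p \<in> I" for p using r I(1) that by blast
  ultimately obtain \<theta> where
    th: "(\<forall>p\<in>I. \<theta> p \<in> tf \<and> (\<forall>x. x \<notin> cball p (2 * r p) \<longrightarrow> \<theta> p x = 0)) \<and> (\<forall>x\<in>closure \<Omega>. (\<Sum>p\<in>I. \<theta> p x) = 1)"
    using exE[OF smooth_partition[OF K I(2) _ _ I(3)]] by blast
  have \<theta>: "\<And>p. p \<in> I \<Longrightarrow> \<theta> p \<in> tf" "\<And>p x. p \<in> I \<Longrightarrow> x \<notin> cball p (2 * r p) \<Longrightarrow> \<theta> p x = 0"
    "\<And>x. x \<in> closure \<Omega> \<Longrightarrow> (\<Sum>p\<in>I. \<theta> p x) = 1"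
    using th by blast+
  have part: "(\<lambda>n. \<Sum>j\<in>UNIV. ip lborel (E n j) (\<lambda>x. \<theta> p x * H n j x)) \<longlonglongrightarrow> 0" if p: "p \<in> I" for p
  proof -
    have pc: "p \<in> closure \<Omega>" using p I(1) by blast
    let ?L = "closure \<Omega> \<inter> cball p (fst (q p))"
    have L: "compact ?L" using K by (intro compact_Int_closed) auto
    have z: "\<theta> p x * u x = 0" if "x \<notin> ?L" "u \<in> test_functions \<Omega>" for x u
    proof (cases "x \<in> closure \<Omega>")
      case True
      then show ?thesis using that(1) \<theta>(2)[OF p, of x] by (simp add: r_def)
    next
      case False
      then show ?thesis using test_functions_outside[OF that(2)] closure_subset[of \<Omega>] by auto
    qed
    from XY show ?thesis
    proof
      assume X: "X = UNIV \<and> Y = \<Omega>"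
      have "(\<lambda>n. \<Sum>j\<in>UNIV. ip lborel (H n j) (\<lambda>x. \<theta> p x * E n j x)) \<longlonglongrightarrow> 0"
        by (rule div_curl_core_div[OF \<theta>(1)[OF p] q(2)[OF pc] L z[OF _ supp(1)] q(3)[OF pc] E H \<delta>])
          (use X curlE divH in auto)
      then show ?thesis by (simp add: ip_real mult_ac)
    next
      assume X: "X = \<Omega> \<and> Y = UNIV"
      show ?thesis
        by (rule div_curl_core_curl[OF \<theta>(1)[OF p] q(2)[OF pc] L z[OF _ supp(2)] q(3)[OF pc] E H \<delta>])
          (use X curlE divH in auto)
    qed
  qed
  have "(\<lambda>n. \<Sum>p\<in>I. \<Sum>j\<in>UNIV. ip lborel (E n j) (\<lambda>x. \<theta> p x * H n j x)) \<longlonglongrightarrow> (\<Sum>p\<in>I. 0)"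
    by (intro tendsto_sum part)
  moreover have "(\<Sum>p\<in>I. \<Sum>j\<in>UNIV. ip lborel (E n j) (\<lambda>x. \<theta> p x * H n j x)) = (\<Sum>j\<in>UNIV. ip lborel (E n j) (H n j))" for n
  proof -
    have "(\<Sum>p\<in>I. ip lborel (E n j) (\<lambda>x. \<theta> p x * H n j x)) = ip lborel (E n j) (H n j)" for j
    proof -
      have "(\<Sum>p\<in>I. ip lborel (E n j) (\<lambda>x. \<theta> p x * H n j x)) = ip lborel (E n j) (\<lambda>x. \<Sum>p\<in>I. \<theta> p x * H n j x)"
        by (intro ip_sum_right[symmetric] test_function_sqint tf_mult \<theta>(1) test_functions_UNIV[OF supp(1)] test_functions_UNIV[OF supp(2)])
      also have "(\<lambda>x. \<Sum>p\<in>I. \<theta> p x * H n j x) = H n j"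
      proof
        fix x
        show "(\<Sum>p\<in>I. \<theta> p x * H n j x) = H n j x"
        proof (cases "x \<in> \<Omega>")
          case True
          then have "(\<Sum>p\<in>I. \<theta> p x) = 1" using \<theta>(3) closure_subset by blast
          then show ?thesis by (simp flip: sum_distrib_right)
        qed (simp add: test_functions_outside[OF supp(2)])
      qed
      finally show ?thesis .
    qed
    then show ?thesis by (subst sum.swap) simp
  qed
  ultimately show ?thesis by simp
qed

section \<open>Vector fields and their components\<close>

lemma vec_eq_sum_axis:
  fixes u :: "'a \<Rightarrow> real^'n"
  shows "u = (\<lambda>x. \<Sum>i\<in>UNIV. u x $ i *\<^sub>R axis i 1)"
  by (simp add: fun_eq_iff basis_expansion flip: scalar_mult_eq_scaleR)

lemma sqint_axis: "f \<in> sqint M \<Longrightarrow> (\<lambda>x. f x *\<^sub>R (axis i 1 :: real^'n)) \<in> sqint M"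
  by (auto simp: sqint_def power_mult_distrib)

lemma sqint_component:
  fixes u :: "'a \<Rightarrow> real^'n"
  shows "u \<in> sqint M \<longleftrightarrow> (\<forall>i. (\<lambda>x. u x $ i) \<in> sqint M)"
proof
  assume u: "u \<in> sqint M"
  show "\<forall>i. (\<lambda>x. u x $ i) \<in> sqint M"
  proof
    fix i
    have m: "(\<lambda>x. u x $ i) \<in> borel_measurable M"
      using u borel_measurable_inner[of u M "\<lambda>_. axis i 1"] by (simp add: sqint_def inner_axis)
    moreover have "integrable M (\<lambda>x. (norm (u x $ i))\<^sup>2)"
    proof (rule Bochner_Integration.integrable_bound)
      show "integrable M (\<lambda>x. (norm (u x))\<^sup>2)" using u by (simp add: sqint_def)
      show "AE x in M. norm ((norm (u x $ i))\<^sup>2) \<le> norm ((norm (u x))\<^sup>2)"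
        by (intro AE_I2) (simp add: abs_le_square_iff[symmetric] component_le_norm_cart)
    qed (use m in simp)
    ultimately show "(\<lambda>x. u x $ i) \<in> sqint M" by (simp add: sqint_def)
  qed
next
  assume "\<forall>i. (\<lambda>x. u x $ i) \<in> sqint M"
  then show "u \<in> sqint M"
    by (subst vec_eq_sum_axis) (intro sqint_sum sqint_axis, simp)
qed

lemma ip_component:
  fixes u v :: "'a \<Rightarrow> real^'n"
  assumes "u \<in> sqint M" "v \<in> sqint M"
  shows "ip M u v = (\<Sum>i\<in>UNIV. ip M (\<lambda>x. u x $ i) (\<lambda>x. v x $ i))"
proof -
  have "integrable M (\<lambda>x. u x $ i \<bullet> v x $ i)" for i
    using assms by (intro ip_integrable) (auto simp: sqint_component)
  then show ?thesis by (simp add: ip_def inner_vec_def)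
qed

lemma nrm_component_le:
  fixes u :: "'a \<Rightarrow> real^'n"
  assumes "u \<in> sqint M" shows "nrm M (\<lambda>x. u x $ i) \<le> nrm M u"
  using nrm_mono[OF assms, of "\<lambda>x. u x $ i" 1] by (simp add: component_le_norm_cart)

lemma nrm_le_sum_component:
  fixes u :: "'a \<Rightarrow> real^'n"
  assumes "u \<in> sqint M" shows "nrm M u \<le> (\<Sum>i\<in>UNIV. nrm M (\<lambda>x. u x $ i))"
proof -
  have "nrm M u \<le> (\<Sum>i\<in>UNIV. nrm M (\<lambda>x. u x $ i *\<^sub>R (axis i 1 :: real^'n)))"
    using assms by (subst vec_eq_sum_axis[of u]) (intro nrm_sum sqint_axis, simp add: sqint_component)
  also have "\<dots> = (\<Sum>i\<in>UNIV. nrm M (\<lambda>x. u x $ i))" by (simp add: nrm_eq_integral)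
  finally show ?thesis .
qed

lemma H1_norm_vec_le:
  fixes \<Phi> :: "'m::finite \<Rightarrow> real^'n \<Rightarrow> real"
  assumes \<Omega>: "open \<Omega>" "bounded \<Omega>" and \<Phi>: "\<And>j. \<Phi> j \<in> tf"
  shows "H1_norm \<Omega> (\<lambda>x. (\<chi> j. \<Phi> j x)) \<le> (\<Sum>j\<in>UNIV. N1 (\<Phi> j))"
proof -
  let ?u = "\<lambda>x. (\<chi> j. \<Phi> j x) :: real^'m"
  have u: "?u \<in> test_functions UNIV" by (rule test_functions_vec[OF \<Phi>])
  have p: "(\<lambda>x. partial_deriv i ?u x $ j) = partial_deriv i (\<Phi> j)" for i j
    using partial_deriv_component[OF test_functions_smooth[OF u], of i j] by (simp add: fun_eq_iff)
  have "H1_norm \<Omega> ?u \<le> nrm lborel ?u + (\<Sum>i\<in>UNIV. nrm lborel (partial_deriv i ?u))"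
    by (rule H1_norm_test_function_le[OF \<Omega> u])
  also have "\<dots> \<le> (\<Sum>j\<in>UNIV. n2 (\<Phi> j)) + (\<Sum>i\<in>UNIV. \<Sum>j\<in>UNIV. n2 (partial_deriv i (\<Phi> j)))"
    using nrm_le_sum_component[OF test_function_sqint[OF u]]
      nrm_le_sum_component[OF test_function_sqint[OF test_functions_partial[OF u]]]
    by (intro add_mono sum_mono) (simp_all add: p)
  also have "\<dots> = (\<Sum>j\<in>UNIV. N1 (\<Phi> j))"
    by (subst sum.swap) (simp add: N1_def sum.distrib)
  finally show ?thesis .
qed

lemma H1_norm_le_N1:
  "open \<Omega> \<Longrightarrow> bounded \<Omega> \<Longrightarrow> f \<in> tf \<Longrightarrow> H1_norm \<Omega> f \<le> N1 f"
  using H1_norm_test_function_le[of \<Omega> f] by (simp add: N1_def)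

lemma grad_sqint: "\<phi> \<in> H1 \<Omega> \<Longrightarrow> grad \<Omega> \<phi> \<in> sqint (lebesgue_on \<Omega>)"
  using weak_partial_deriv_spec(1)[of \<phi> \<Omega>] by (simp add: sqint_component grad_def L2_eq)

lemma curl_component:
  "curl \<Omega> \<Phi> x $ j = (if j = 1 then weak_partial_deriv \<Omega> 2 \<Phi> x $ 3 - weak_partial_deriv \<Omega> 3 \<Phi> x $ 2
      else if j = 2 then weak_partial_deriv \<Omega> 3 \<Phi> x $ 1 - weak_partial_deriv \<Omega> 1 \<Phi> x $ 3
      else weak_partial_deriv \<Omega> 1 \<Phi> x $ 2 - weak_partial_deriv \<Omega> 2 \<Phi> x $ 1)"
  using exhaust_3[of j] by (auto simp: curl_def)

lemma curl_sqint: "\<Phi> \<in> H1 \<Omega> \<Longrightarrow> curl \<Omega> \<Phi> \<in> sqint (lebesgue_on \<Omega>)"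
proof -
  assume \<Phi>: "\<Phi> \<in> H1 \<Omega>"
  have w: "(\<lambda>x. weak_partial_deriv \<Omega> i \<Phi> x $ k) \<in> sqint (lebesgue_on \<Omega>)" for i k
    using weak_partial_deriv_spec(1)[OF \<Phi>] by (simp add: sqint_component L2_eq)
  have "(\<lambda>x. curl \<Omega> \<Phi> x $ j) \<in> sqint (lebesgue_on \<Omega>)" for j
    using exhaust_3[of j] by (auto simp: curl_component intro!: sqint_diff w)
  then show ?thesis by (simp add: sqint_component)
qed

lemma nrm_diff_null:
  assumes "a \<in> sqint M" "b \<in> sqint M" "c \<in> sqint M" "d \<in> sqint M"
    and "nrm M (\<lambda>x. a x - b x) = 0" "nrm M (\<lambda>x. c x - d x) = 0"
  shows "nrm M (\<lambda>x. (a x - c x) - (b x - d x)) = 0"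
proof -
  have "nrm M (\<lambda>x. (a x - b x) - (c x - d x)) \<le> 0"
    using nrm_triangle_diff[OF sqint_diff[OF assms(1,2)] sqint_diff[OF assms(3,4)]] assms(5,6) by simp
  then show ?thesis using nrm_nonneg[of M "\<lambda>x. (a x - b x) - (c x - d x)"] by (simp add: algebra_simps)
qed

lemma nrm_null_components:
  fixes u :: "'a \<Rightarrow> real^'n"
  assumes "u \<in> sqint M" "\<And>i. nrm M (\<lambda>x. u x $ i) = 0" shows "nrm M u = 0"
  using nrm_le_sum_component[OF assms(1)] assms(2) nrm_nonneg[of M u] by simp

lemma grad_test_function:
  fixes \<phi> :: "real^'n \<Rightarrow> real"
  assumes \<Omega>: "open \<Omega>" "bounded \<Omega>" and \<phi>: "\<phi> \<in> tf"
  shows "nrm (lebesgue_on \<Omega>) (\<lambda>x. grad \<Omega> \<phi> x - (\<chi> j. partial_deriv j \<phi> x)) = 0"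
proof (rule nrm_null_components)
  show "(\<lambda>x. grad \<Omega> \<phi> x - (\<chi> j. partial_deriv j \<phi> x)) \<in> sqint (lebesgue_on \<Omega>)"
    by (intro sqint_diff grad_sqint test_function_H1 test_function_sqint_on test_functions_vec test_functions_partial \<phi> \<Omega>)
  show "nrm (lebesgue_on \<Omega>) (\<lambda>x. (grad \<Omega> \<phi> x - (\<chi> j. partial_deriv j \<phi> x)) $ i) = 0" for i
    using weak_partial_deriv_test_function[OF \<Omega> \<phi>, of i] by (simp add: grad_def)
qed

text \<open>The chosen weak derivatives agree with the classical ones only up to null sets, so the
  two curls are compared in the seminorm; this is enough for pairings.\<close>

lemma curl_test_function:
  fixes \<Phi> :: "3 \<Rightarrow> real^3 \<Rightarrow> real"
  assumes \<Omega>: "open \<Omega>" "bounded \<Omega>" and \<Phi>: "\<And>j. \<Phi> j \<in> tf"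
  shows "nrm (lebesgue_on \<Omega>) (\<lambda>x. curl \<Omega> (\<lambda>x. \<chi> j. \<Phi> j x) x - (\<chi> j. ccurl \<Phi> j x)) = 0"
proof (rule nrm_null_components)
  let ?M = "lebesgue_on \<Omega>" and ?u = "\<lambda>x. (\<chi> j. \<Phi> j x) :: real^3"
  have u: "?u \<in> test_functions UNIV" by (rule test_functions_vec[OF \<Phi>])
  show "(\<lambda>x. curl \<Omega> ?u x - (\<chi> j. ccurl \<Phi> j x)) \<in> sqint ?M"
    by (intro sqint_diff curl_sqint test_function_H1 test_function_sqint_on test_functions_vec ccurl_tf \<Phi> \<Omega>)
  let ?w = "\<lambda>i k x. weak_partial_deriv \<Omega> i ?u x $ k"
  have w: "?w i k \<in> sqint ?M" for i k
    using weak_partial_deriv_spec(1)[OF test_function_H1[OF \<Omega>(1) u]] by (simp add: sqint_component L2_eq)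
  have d: "partial_deriv i (\<Phi> k) \<in> sqint ?M" for i k
    by (intro test_function_sqint_on test_functions_partial \<Phi> \<Omega>)
  have s: "(\<lambda>x. weak_partial_deriv \<Omega> i ?u x - partial_deriv i ?u x) \<in> sqint ?M" for i
    using weak_partial_deriv_spec(1)[OF test_function_H1[OF \<Omega>(1) u]]
    by (intro sqint_diff[OF _ test_function_sqint_on[OF \<Omega>(1) test_functions_partial[OF u]]]) (simp add: L2_eq)
  have "nrm ?M (\<lambda>x. ?w i k x - partial_deriv i (\<Phi> k) x) = 0" for i k
  proof -
    have "partial_deriv i (\<Phi> k) x = partial_deriv i ?u x $ k" for x
      using partial_deriv_component[OF test_functions_smooth[OF u], of i k x] by simp
    then have "nrm ?M (\<lambda>x. ?w i k x - partial_deriv i (\<Phi> k) x) \<le> 0"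
      using nrm_component_le[OF s, of i k] weak_partial_deriv_test_function[OF \<Omega> u, of i] by simp
    then show ?thesis using nrm_nonneg[of ?M "\<lambda>x. ?w i k x - partial_deriv i (\<Phi> k) x"] by linarith
  qed
  then have z: "nrm ?M (\<lambda>x. (?w i k x - ?w i' k' x) - (partial_deriv i (\<Phi> k) x - partial_deriv i' (\<Phi> k') x)) = 0" for i k i' k'
    by (intro nrm_diff_null w d)
  show "nrm ?M (\<lambda>x. (curl \<Omega> ?u x - (\<chi> j. ccurl \<Phi> j x)) $ j) = 0" for j
    using exhaust_3[of j] z[of 2 3 3 2] z[of 3 1 1 3] z[of 1 2 2 1]
    by (auto simp: curl_component ccurl_def)
qed

lemma nrm_ccurl_le:
  assumes \<Omega>: "open \<Omega>" and \<Phi>: "\<And>j. \<Phi> j \<in> tf"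
  shows "nrm (lebesgue_on \<Omega>) (\<lambda>x. (\<chi> j. ccurl \<Phi> j x)) \<le> (\<Sum>j\<in>UNIV. N1 (\<Phi> j))"
proof -
  have "nrm (lebesgue_on \<Omega>) (\<lambda>x. (\<chi> j. ccurl \<Phi> j x)) \<le> nrm lborel (\<lambda>x. (\<chi> j. ccurl \<Phi> j x))"
    by (intro nrm_on_le test_functions_vec ccurl_tf \<Omega> \<Phi>)
  also have "\<dots> \<le> (\<Sum>j\<in>UNIV. n2 (ccurl \<Phi> j))"
    using nrm_le_sum_component[OF test_function_sqint[OF test_functions_vec[OF ccurl_tf[OF \<Phi>]]]] by simp
  also have "\<dots> \<le> (\<Sum>j\<in>UNIV. N1 (\<Phi> j))"
  proof -
    have "n2 (\<lambda>x. partial_deriv i (\<Phi> k) x - partial_deriv i' (\<Phi> k') x) \<le> n2 (partial_deriv i (\<Phi> k)) + n2 (partial_deriv i' (\<Phi> k'))" for i k i' k'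
      by (intro nrm_triangle_diff test_function_sqint test_functions_partial \<Phi>)
    from this[of 2 3 3 2] this[of 3 1 1 3] this[of 1 2 2 1] show ?thesis
      using nrm_nonneg[of lborel "\<Phi> 1"] nrm_nonneg[of lborel "\<Phi> 2"] nrm_nonneg[of lborel "\<Phi> 3"]
        nrm_nonneg[of lborel "partial_deriv 1 (\<Phi> 1)"] nrm_nonneg[of lborel "partial_deriv 2 (\<Phi> 2)"]
        nrm_nonneg[of lborel "partial_deriv 3 (\<Phi> 3)"]
      by (simp add: sum_3 N1_def ccurl_def[abs_def])
  qed
  finally show ?thesis .
qed

lemma nrm_gradient_le:
  fixes \<phi> :: "real^'n \<Rightarrow> real"
  assumes \<Omega>: "open \<Omega>" and \<phi>: "\<phi> \<in> tf"
  shows "nrm (lebesgue_on \<Omega>) (\<lambda>x. (\<chi> j. partial_deriv j \<phi> x)) \<le> N1 \<phi>"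
proof -
  have "nrm (lebesgue_on \<Omega>) (\<lambda>x. (\<chi> j. partial_deriv j \<phi> x)) \<le> nrm lborel (\<lambda>x. (\<chi> j. partial_deriv j \<phi> x))"
    by (intro nrm_on_le test_functions_vec test_functions_partial \<Omega> \<phi>)
  also have "\<dots> \<le> (\<Sum>j\<in>UNIV. n2 (partial_deriv j \<phi>))"
    using nrm_le_sum_component[OF test_function_sqint[OF test_functions_vec[OF test_functions_partial[OF \<phi>]]]] by simp
  also have "\<dots> \<le> N1 \<phi>" by (simp add: N1_def nrm_nonneg)
  finally show ?thesis .
qed

section \<open>The div-curl lemma for weakly null sequences\<close>

text \<open>Replace the fields by test functions at distance below \<open>1 / (n + 1)\<close>.
  Pairings with curls and gradients change by at most this distance times a first-order norm, so the
  hypotheses survive with a slightly larger null sequence.\<close>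

lemma div_curl_weakly_null:
  fixes Y Z :: "nat \<Rightarrow> real^3 \<Rightarrow> real^3"
  assumes dom: "bounded_strong_lipschitz_domain \<Omega>"
    and Y: "\<And>n. Y n \<in> sqint (lebesgue_on \<Omega>)" "\<And>n. nrm (lebesgue_on \<Omega>) (Y n) \<le> C"
    and Z: "\<And>n. Z n \<in> sqint (lebesgue_on \<Omega>)" "\<And>n. nrm (lebesgue_on \<Omega>) (Z n) \<le> C"
    and weakY: "\<And>g. g \<in> sqint (lebesgue_on \<Omega>) \<Longrightarrow> (\<lambda>n. ip (lebesgue_on \<Omega>) (Y n) g) \<longlonglongrightarrow> 0"
    and weakZ: "\<And>g. g \<in> sqint (lebesgue_on \<Omega>) \<Longrightarrow> (\<lambda>n. ip (lebesgue_on \<Omega>) (Z n) g) \<longlonglongrightarrow> 0"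
    and VW: "(V = H1 \<Omega> \<and> W = H1_ring \<Omega>) \<or> (V = H1_ring \<Omega> \<and> W = H1 \<Omega>)"
    and \<delta>: "\<delta> \<longlonglongrightarrow> 0" "\<delta>' \<longlonglongrightarrow> 0"
    and curlY: "\<And>n \<Phi>. \<Phi> \<in> V \<Longrightarrow> \<bar>ip (lebesgue_on \<Omega>) (Y n) (curl \<Omega> \<Phi>)\<bar> \<le> \<delta> n * H1_norm \<Omega> \<Phi>"
    and divZ: "\<And>n \<phi>. \<phi> \<in> W \<Longrightarrow> \<bar>ip (lebesgue_on \<Omega>) (Z n) (grad \<Omega> \<phi>)\<bar> \<le> \<delta>' n * H1_norm \<Omega> \<phi>"
  shows "(\<lambda>n. ip (lebesgue_on \<Omega>) (Y n) (Z n)) \<longlonglongrightarrow> 0"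
proof -
  let ?M = "lebesgue_on \<Omega>"
  have \<Omega>: "open \<Omega>" "bounded \<Omega>" using dom by (auto simp: bounded_strong_lipschitz_domain_def)
  have K: "compact (closure \<Omega>)" using \<Omega>(2) by (simp add: compact_closure)
  define e where "e n = 1 / (real n + 1)" for n
  have e: "e n > 0" "e n \<le> 1" for n by (auto simp: e_def)
  have e0: "e \<longlonglongrightarrow> 0" unfolding e_def using LIMSEQ_inverse_real_of_nat by (simp add: inverse_eq_divide add.commute)
  have C: "C \<ge> 0" using Y(2) nrm_nonneg order_trans by blast
  have approx: "\<exists>y. \<forall>n. y n \<in> test_functions \<Omega> \<and> nrm ?M (\<lambda>x. X n x - y n x) < e n"
    if X: "\<And>n. X n \<in> sqint ?M" for X :: "nat \<Rightarrow> real^3 \<Rightarrow> real^3"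
    using test_functions_dense[OF \<Omega> X e(1)] by (intro choice) blast
  from approx[of Y, OF Y(1)] obtain y where y: "\<And>n. y n \<in> test_functions \<Omega>" "\<And>n. nrm ?M (\<lambda>x. Y n x - y n x) < e n" by blast
  from approx[of Z, OF Z(1)] obtain z where z: "\<And>n. z n \<in> test_functions \<Omega>" "\<And>n. nrm ?M (\<lambda>x. Z n x - z n x) < e n" by blast
  have close: "\<bar>ip ?M u g\<bar> \<le> \<bar>ip ?M U g\<bar> + e n * nrm ?M g"
    if "U \<in> sqint ?M" "u \<in> sqint ?M" "g \<in> sqint ?M" "nrm ?M (\<lambda>x. U x - u x) < e n" for U u g :: "real^3 \<Rightarrow> real^3" and n
  proof -
    have "\<bar>ip ?M (\<lambda>x. U x - u x) g\<bar> \<le> nrm ?M (\<lambda>x. U x - u x) * nrm ?M g"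
      by (intro ip_Cauchy_Schwarz sqint_diff that)
    also have "\<dots> \<le> e n * nrm ?M g" by (intro mult_right_mono nrm_nonneg) (use that in simp)
    finally show ?thesis using that(1-3) by (simp add: ip_diff_left)
  qed
  have bd: "nrm ?M u \<le> C + 1"
    if "U \<in> sqint ?M" "u \<in> sqint ?M" "nrm ?M (\<lambda>x. U x - u x) < e n" "nrm ?M U \<le> C" for U u :: "real^3 \<Rightarrow> real^3" and n
  proof -
    have "nrm ?M u \<le> nrm ?M U + nrm ?M (\<lambda>x. U x - u x)"
      using nrm_triangle_diff[OF that(1) sqint_diff[OF that(1,2)]] by simp
    then show ?thesis using that(3,4) e(2)[of n] by linarith
  qed
  have ys: "y n \<in> sqint ?M" and zs: "z n \<in> sqint ?M" for n
    by (rule test_function_sqint_on[OF \<Omega>(1) test_functions_UNIV[OF y(1)]])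
      (rule test_function_sqint_on[OF \<Omega>(1) test_functions_UNIV[OF z(1)]])
  have wn: "wnull (\<lambda>n x. u n x $ j)"
    if U: "\<And>n. U n \<in> sqint ?M" "\<And>n. nrm ?M (U n) \<le> C" "\<And>g. g \<in> sqint ?M \<Longrightarrow> (\<lambda>n. ip ?M (U n) g) \<longlonglongrightarrow> 0"
      and u: "\<And>n. u n \<in> test_functions \<Omega>" "\<And>n. nrm ?M (\<lambda>x. U n x - u n x) < e n"
    for U u :: "nat \<Rightarrow> real^3 \<Rightarrow> real^3" and j
    unfolding wnull_def
  proof (intro conjI allI ballI)
    have us: "u n \<in> sqint ?M" for n by (rule test_function_sqint_on[OF \<Omega>(1) test_functions_UNIV[OF u(1)]])
    have uc: "(\<lambda>x. u n x $ j) \<in> test_functions \<Omega>" for n by (rule test_functions_component[OF u(1)])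
    then show "(\<lambda>x. u n x $ j) \<in> tf" for n by (rule test_functions_UNIV)
    have "u n x $ j = 0" if "x \<notin> closure \<Omega>" for n x
      using test_functions_outside[OF u(1), of x n] closure_subset that by force
    then show "\<exists>L. compact L \<and> (\<forall>n x. x \<notin> L \<longrightarrow> u n x $ j = 0)" using K by blast
    have "n2 (\<lambda>x. u n x $ j) \<le> C + 1" for n
    proof -
      have "n2 (\<lambda>x. u n x $ j) = nrm ?M (\<lambda>x. u n x $ j)"
        using ip_on_eq[OF \<Omega>(1) uc[of n] test_function_borel[OF test_functions_UNIV[OF uc[of n]]]] by (simp add: nrm_def)
      also have "\<dots> \<le> nrm ?M (u n)" by (rule nrm_component_le[OF us])
      also have "\<dots> \<le> C + 1" by (rule bd[OF U(1) us u(2) U(2)])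
      finally show ?thesis .
    qed
    then show "\<exists>M. \<forall>n. n2 (\<lambda>x. u n x $ j) \<le> M" by blast
    fix \<psi> :: "real^3 \<Rightarrow> real" assume \<psi>: "\<psi> \<in> tf"
    let ?g = "\<lambda>x. \<psi> x *\<^sub>R axis j (1::real)"
    have g: "?g \<in> sqint ?M" by (rule sqint_axis[OF test_function_sqint_on[OF \<Omega>(1) \<psi>]])
    have "ip lborel (\<lambda>x. u n x $ j) \<psi> = ip ?M (u n) ?g" for n
      using ip_on_eq[OF \<Omega>(1) uc[of n] test_function_borel[OF \<psi>]] by (simp add: ip_def inner_axis mult.commute)
    then have "norm (ip lborel (\<lambda>x. u n x $ j) \<psi>) \<le> \<bar>ip ?M (U n) ?g\<bar> + e n * nrm ?M ?g" for n
      using close[OF U(1) us g u(2)] by simp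
    moreover have "(\<lambda>n. \<bar>ip ?M (U n) ?g\<bar> + e n * nrm ?M ?g) \<longlonglongrightarrow> \<bar>0\<bar> + 0 * nrm ?M ?g"
      by (rule tendsto_add[OF tendsto_rabs[OF U(3)[OF g]] tendsto_mult[OF e0 tendsto_const]])
    ultimately show "(\<lambda>n. ip lborel (\<lambda>x. u n x $ j) \<psi>) \<longlonglongrightarrow> 0"
      by (intro Lim_null_comparison[OF always_eventually[OF allI], of "\<lambda>n. ip lborel (\<lambda>x. u n x $ j) \<psi>" "\<lambda>n. \<bar>ip ?M (U n) ?g\<bar> + e n * nrm ?M ?g"]) simp_all
  qed
  have comp: "(\<Sum>j\<in>UNIV. ip lborel (\<lambda>x. u x $ j) (G j)) = ip ?M u (\<lambda>x. (\<chi> j. G j x))"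
    if u: "u \<in> test_functions \<Omega>" and G: "\<And>j. G j \<in> tf" for u :: "real^3 \<Rightarrow> real^3" and G
  proof -
    have "u \<in> sqint ?M" "(\<lambda>x. (\<chi> j. G j x) :: real^3) \<in> sqint ?M"
      by (intro test_function_sqint_on[OF \<Omega>(1)] test_functions_UNIV[OF u] test_functions_vec G)+
    then have "ip ?M u (\<lambda>x. (\<chi> j. G j x)) = (\<Sum>j\<in>UNIV. ip ?M (\<lambda>x. u x $ j) (G j))" by (simp add: ip_component)
    also have "\<dots> = (\<Sum>j\<in>UNIV. ip lborel (\<lambda>x. u x $ j) (G j))"
      by (intro sum.cong refl ip_on_eq[OF \<Omega>(1) test_functions_component[OF u]] test_function_borel[OF G])
    finally show ?thesis by simp
  qed
  \<comment> \<open>Restrictions of test functions of the whole space lie in \<open>H1\<close>; for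
    \<open>H1_ring\<close> the support must be inside \<open>\<Omega>\<close>.\<close>
  define X where "X = (if V = H1 \<Omega> then UNIV else \<Omega>)"
  have XV: "\<Phi> \<in> V" if "\<Phi> \<in> test_functions X" for \<Phi>
    using that VW test_function_H1[OF \<Omega>(1)] test_function_H1_ring[OF \<Omega>] test_functions_UNIV by (auto simp: X_def split: if_splits)
  define Xd where "Xd = (if V = H1 \<Omega> then \<Omega> else UNIV)"
  have XW: "\<phi> \<in> W" if "\<phi> \<in> test_functions Xd" for \<phi>
    using that VW test_function_H1[OF \<Omega>(1)] test_function_H1_ring[OF \<Omega>] test_functions_UNIV by (auto simp: Xd_def split: if_splits)
  \<comment> \<open>The term \<open>e n\<close> absorbs the approximation error, since the
    \<open>L\<^sup>2\<close> norms of curl and gradient are bounded by \<open>N1\<close>.\<close>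
  define d where "d n = \<bar>\<delta> n\<bar> + \<bar>\<delta>' n\<bar> + e n" for n
  have "d \<longlonglongrightarrow> \<bar>0\<bar> + \<bar>0\<bar> + 0" unfolding d_def by (intro tendsto_intros \<delta> e0)
  then have d0: "d \<longlonglongrightarrow> 0" by simp
  have "(\<lambda>n. \<Sum>j\<in>UNIV. ip lborel (\<lambda>x. y n x $ j) (\<lambda>x. z n x $ j)) \<longlonglongrightarrow> 0"
  proof (rule div_curl_test_functions[OF dom _ _ _ _ d0, where X=X and Y=Xd])
    show "(\<lambda>x. y n x $ j) \<in> test_functions \<Omega>" "(\<lambda>x. z n x $ j) \<in> test_functions \<Omega>" for n j
      by (rule test_functions_component[OF y(1)], rule test_functions_component[OF z(1)])
    show "wnull (\<lambda>n x. y n x $ j)" for j by (rule wn[where U=Y and u=y, OF Y weakY y])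
    show "wnull (\<lambda>n x. z n x $ j)" for j by (rule wn[where U=Z and u=z, OF Z weakZ z])
    show "(X = UNIV \<and> Xd = \<Omega>) \<or> (X = \<Omega> \<and> Xd = UNIV)" by (simp add: X_def Xd_def)
    show "\<bar>\<Sum>j\<in>UNIV. ip lborel (\<lambda>x. y n x $ j) (ccurl \<Phi> j)\<bar> \<le> d n * (\<Sum>j\<in>UNIV. N1 (\<Phi> j))"
      if \<Phi>: "\<And>j. \<Phi> j \<in> test_functions X" for n \<Phi>
    proof -
      let ?u = "\<lambda>x. (\<chi> j. \<Phi> j x) :: real^3" and ?c = "\<lambda>x. (\<chi> j. ccurl \<Phi> j x) :: real^3"
      let ?N = "\<Sum>j\<in>UNIV. N1 (\<Phi> j)"
      have N: "?N \<ge> 0" by (simp add: sum_nonneg N1_nonneg)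
      have \<Phi>': "\<Phi> j \<in> tf" for j by (rule test_functions_UNIV[OF \<Phi>])
      have uV: "?u \<in> V" by (rule XV[OF test_functions_vec[OF \<Phi>]])
      have cs: "?c \<in> sqint ?M" by (intro test_function_sqint_on[OF \<Omega>(1)] test_functions_vec ccurl_tf \<Phi>')
      have curls: "curl \<Omega> ?u \<in> sqint ?M" by (intro curl_sqint test_function_H1[OF \<Omega>(1)] test_functions_vec \<Phi>')
      have "ip ?M (curl \<Omega> ?u) (Y n) = ip ?M ?c (Y n)"
        by (rule nrm_eq_of_diff_null(2)[OF curls cs curl_test_function[OF \<Omega> \<Phi>'] Y(1)])
      then have "\<bar>ip ?M (Y n) ?c\<bar> = \<bar>ip ?M (Y n) (curl \<Omega> ?u)\<bar>" by (simp add: ip_commute[of ?M "Y n"])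
      also have "\<dots> \<le> \<delta> n * H1_norm \<Omega> ?u" by (rule curlY[OF uV])
      also have "\<dots> \<le> \<bar>\<delta> n\<bar> * ?N"
        using H1_norm_vec_le[OF \<Omega> \<Phi>'] by (intro mult_mono H1_norm_nonneg) auto
      finally have "\<bar>ip ?M (y n) ?c\<bar> \<le> \<bar>\<delta> n\<bar> * ?N + e n * nrm ?M ?c"
        using close[OF Y(1) ys cs y(2), of n] by linarith
      also have "\<dots> \<le> \<bar>\<delta> n\<bar> * ?N + e n * ?N"
        using nrm_ccurl_le[OF \<Omega>(1) \<Phi>'] e(1)[of n] by simp
      also have "\<dots> \<le> d n * ?N" using N by (simp add: d_def distrib_right)
      finally show ?thesis using comp[OF y(1) ccurl_tf[OF \<Phi>'], of n] by simp
    qed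
    show "\<bar>\<Sum>j\<in>UNIV. ip lborel (\<lambda>x. z n x $ j) (partial_deriv j \<phi>)\<bar> \<le> d n * N1 \<phi>"
      if \<phi>: "\<phi> \<in> test_functions Xd" for n \<phi>
    proof -
      let ?c = "\<lambda>x. (\<chi> j. partial_deriv j \<phi> x) :: real^3"
      have \<phi>': "\<phi> \<in> tf" by (rule test_functions_UNIV[OF \<phi>])
      have cs: "?c \<in> sqint ?M" by (intro test_function_sqint_on[OF \<Omega>(1)] test_functions_vec test_functions_partial \<phi>')
      have grads: "grad \<Omega> \<phi> \<in> sqint ?M" by (intro grad_sqint test_function_H1[OF \<Omega>(1)] \<phi>')
      have "ip ?M (grad \<Omega> \<phi>) (Z n) = ip ?M ?c (Z n)"
        by (rule nrm_eq_of_diff_null(2)[OF grads cs grad_test_function[OF \<Omega> \<phi>'] Z(1)])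
      then have "\<bar>ip ?M (Z n) ?c\<bar> = \<bar>ip ?M (Z n) (grad \<Omega> \<phi>)\<bar>" by (simp add: ip_commute[of ?M "Z n"])
      also have "\<dots> \<le> \<delta>' n * H1_norm \<Omega> \<phi>" by (rule divZ[OF XW[OF \<phi>]])
      also have "\<dots> \<le> \<bar>\<delta>' n\<bar> * N1 \<phi>"
        using H1_norm_le_N1[OF \<Omega> \<phi>'] by (intro mult_mono H1_norm_nonneg) auto
      finally have "\<bar>ip ?M (z n) ?c\<bar> \<le> \<bar>\<delta>' n\<bar> * N1 \<phi> + e n * nrm ?M ?c"
        using close[OF Z(1) zs cs z(2), of n] by linarith
      also have "\<dots> \<le> \<bar>\<delta>' n\<bar> * N1 \<phi> + e n * N1 \<phi>"
        using nrm_gradient_le[OF \<Omega>(1) \<phi>'] e(1)[of n] by simp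
      also have "\<dots> \<le> d n * N1 \<phi>" using N1_nonneg[of \<phi>] by (simp add: d_def distrib_right)
      finally show ?thesis using comp[where u="z n" and G="\<lambda>j. partial_deriv j \<phi>", OF z(1) test_functions_partial[OF \<phi>']] by simp
    qed
  qed
  moreover have "(\<Sum>j\<in>UNIV. ip lborel (\<lambda>x. y n x $ j) (\<lambda>x. z n x $ j)) = ip ?M (y n) (z n)" for n
    using comp[where u="y n" and G="\<lambda>j x. z n x $ j", OF y(1) test_functions_component[OF test_functions_UNIV[OF z(1)]]] by simp
  ultimately have lim: "(\<lambda>n. ip ?M (y n) (z n)) \<longlonglongrightarrow> 0" by simp
  have diff: "norm (ip ?M (Y n) (Z n)) \<le> \<bar>ip ?M (y n) (z n)\<bar> + e n * (2 * C + 1)" for n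
  proof -
    have "ip ?M (Y n) (Z n) = ip ?M (\<lambda>x. Y n x - y n x) (Z n) + ip ?M (y n) (\<lambda>x. Z n x - z n x) + ip ?M (y n) (z n)"
      by (simp add: ip_diff_left ip_diff_right Y Z ys zs)
    moreover have "\<bar>ip ?M (\<lambda>x. Y n x - y n x) (Z n)\<bar> \<le> e n * C"
      by (rule order_trans[OF ip_Cauchy_Schwarz[OF sqint_diff[OF Y(1) ys] Z(1)]])
        (use y(2) Z(2) e(1) in \<open>intro mult_mono, auto simp: nrm_nonneg less_imp_le\<close>)
    moreover have "\<bar>ip ?M (y n) (\<lambda>x. Z n x - z n x)\<bar> \<le> (C + 1) * e n"
      by (rule order_trans[OF ip_Cauchy_Schwarz[OF ys sqint_diff[OF Z(1) zs]]])
        (use z(2) bd[OF Y(1) ys y(2) Y(2)] C in \<open>intro mult_mono, auto simp: nrm_nonneg less_imp_le\<close>)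
    ultimately show ?thesis by (simp add: algebra_simps)
  qed
  have "(\<lambda>n. \<bar>ip ?M (y n) (z n)\<bar> + e n * (2 * C + 1)) \<longlonglongrightarrow> \<bar>0\<bar> + 0 * (2 * C + 1)"
    by (rule tendsto_add[OF tendsto_rabs[OF lim] tendsto_mult[OF e0 tendsto_const]])
  then show ?thesis
    by (intro Lim_null_comparison[OF always_eventually[OF allI[OF diff]]]) simp
qed

section \<open>Weak limits and the theorem\<close>

lemma inner_functional_dual:
  assumes "g \<in> sqint M"
  shows "(\<lambda>u\<in>sqint M. ip M u g) \<in> dual_space (sqint M) (nrm M)"
  unfolding dual_space_def
  using assms ip_Cauchy_Schwarz[OF _ assms]
  by (auto simp: sqint_add sqint_scaleR ip_add_left ip_scaleR_left mult.commute intro!: exI[of _ "nrm M g"])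

lemma L2_weakly_converges_inner:
  assumes "L2_weakly_converges \<Omega> u w" "\<And>n. u n \<in> L2 \<Omega>" "w \<in> L2 \<Omega>" "g \<in> L2 \<Omega>"
  shows "(\<lambda>n. ip (lebesgue_on \<Omega>) (u n) g) \<longlonglongrightarrow> ip (lebesgue_on \<Omega>) w g"
  using assms(1)[unfolded L2_weakly_converges_def L2_eq L2_norm_eq, rule_format, OF inner_functional_dual, of g] assms(2-4)
  by (simp add: L2_eq)

lemma L2_weakly_converges_subseq:
  "L2_weakly_converges \<Omega> u w \<Longrightarrow> strict_mono r \<Longrightarrow> L2_weakly_converges \<Omega> (u \<circ> r) w"
  unfolding L2_weakly_converges_def using LIMSEQ_subseq_LIMSEQ by (force simp: o_def)

text \<open>Weak convergence is defined by arbitrary bounded functionals. After subtracting the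
  limit, the differences are bounded and asymptotically orthogonal to each of them, and
  \<open>functional_tendsto_0\<close> covers every such functional.\<close>

lemma L2_weakly_convergent_subsequence:
  fixes u :: "nat \<Rightarrow> real^'n \<Rightarrow> 'b::euclidean_space"
  assumes \<Omega>: "open \<Omega>" "bounded \<Omega>" and u: "\<And>n. u n \<in> L2 \<Omega>" and C: "\<And>n. L2_norm \<Omega> (u n) \<le> C"
  shows "\<exists>r w. strict_mono r \<and> w \<in> L2 \<Omega> \<and> L2_weakly_converges \<Omega> (u \<circ> r) w"
proof -
  let ?M = "lebesgue_on \<Omega>"
  have us: "u n \<in> sqint ?M" for n using u by (simp add: L2_eq)
  have uC: "nrm ?M (u n) \<le> C" for n using C by (simp add: L2_norm_eq)
  obtain r w where r: "strict_mono r" and w: "w \<in> sqint ?M"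
    and orth: "\<forall>m. (\<lambda>n. ip ?M (\<lambda>x. u (r n) x - w x) (\<lambda>x. u (r m) x - w x)) \<longlonglongrightarrow> 0"
    using weakly_convergent_subsequence[where u=u, OF finite_measure_lebesgue_on[OF \<Omega>(2,1)] us uC] by blast
  have "(\<lambda>n. f (u (r n))) \<longlonglongrightarrow> f w" if f: "f \<in> dual_space (sqint ?M) (nrm ?M)" for f
  proof -
    have add: "f (\<lambda>x. a x + b x) = f a + f b" if "a \<in> sqint ?M" "b \<in> sqint ?M" for a b
      using f that by (auto simp: dual_space_def)
    from f obtain B where "\<forall>a\<in>sqint ?M. \<bar>f a\<bar> \<le> B * nrm ?M a" by (auto simp: dual_space_def)
    then have B: "\<bar>f a\<bar> \<le> \<bar>B\<bar> * nrm ?M a" if "a \<in> sqint ?M" for a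
      using that by (meson abs_ge_self mult_right_mono nrm_nonneg order_trans)
    have yC: "nrm ?M (\<lambda>x. u (r n) x - w x) \<le> C + nrm ?M w" for n
      using nrm_triangle_diff[OF us w, of "r n"] uC[of "r n"] by linarith
    have "(\<lambda>n. f (\<lambda>x. u (r n) x - w x)) \<longlonglongrightarrow> 0"
      by (rule functional_tendsto_0[where y="\<lambda>n x. u (r n) x - w x", OF sqint_diff[OF us w] yC spec[OF orth] add B]) simp_all
    moreover have "f (u (r n)) = f (\<lambda>x. u (r n) x - w x) + f w" for n
      using add[OF sqint_diff[OF us w] w, of "r n"] by simp
    ultimately show ?thesis using tendsto_add[OF _ tendsto_const] by fastforce
  qed
  then show ?thesis using r w unfolding L2_weakly_converges_def L2_eq L2_norm_eq by auto
qed

lemma relatively_compact_in_subseq: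
  assumes "relatively_compact_in T f" shows "relatively_compact_in T (f \<circ> r)"
proof -
  have "range (f \<circ> r) \<subseteq> range f" by auto
  then have "T closure_of range (f \<circ> r) \<subseteq> T closure_of range f" by (rule closure_of_mono)
  then show ?thesis
    using assms closed_compactin[OF _ _ closedin_closure_of] unfolding relatively_compact_in_def by fastforce
qed

text \<open>The scalar \<open>c\<close> is there for the sign in the definition of the divergence functionals.\<close>

lemma relatively_compact_adjoint_subsequence:
  fixes D :: "('a \<Rightarrow> 'c::real_vector) \<Rightarrow> 'b \<Rightarrow> 'd::euclidean_space"
  assumes ne: "V \<noteq> {}" and scale: "\<And>c u. u \<in> V \<Longrightarrow> (\<lambda>x. c *\<^sub>R u x) \<in> V"
    and homogeneous: "\<And>c u. u \<in> V \<Longrightarrow> N (\<lambda>x. c *\<^sub>R u x) = \<bar>c\<bar> * N u"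
    and N_nonneg: "\<And>u. u \<in> V \<Longrightarrow> 0 \<le> N u"
    and D: "\<And>\<Phi>. \<Phi> \<in> V \<Longrightarrow> D \<Phi> \<in> sqint M"
    and u: "\<And>n. u n \<in> sqint M" and w: "w \<in> sqint M"
    and weak: "\<And>g. g \<in> sqint M \<Longrightarrow> (\<lambda>n. ip M (u n) g) \<longlonglongrightarrow> ip M w g"
    and c: "\<bar>c\<bar> = 1"
    and L: "relatively_compact_in (dual_topology V N) (\<lambda>n. \<lambda>\<Phi>\<in>V. c * ip M (D \<Phi>) (u n))"
  shows "\<exists>r \<delta>. strict_mono r \<and> \<delta> \<longlonglongrightarrow> 0 \<and>
    (\<forall>n. \<forall>\<Phi>\<in>V. \<bar>ip M (\<lambda>x. u (r n) x - w x) (D \<Phi>)\<bar> \<le> \<delta> n * N \<Phi>)"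
proof -
  obtain r l \<delta> where r: "strict_mono r" and \<delta>: "\<delta> \<longlonglongrightarrow> 0"
    and est0: "\<forall>n. \<forall>\<Phi>\<in>V. \<bar>(\<lambda>\<Phi>\<in>V. c * ip M (D \<Phi>) (u (r n))) \<Phi> - l \<Phi>\<bar> \<le> \<delta> n * N \<Phi>"
    using relatively_compact_dual_subsequence[of V N, OF ne scale homogeneous N_nonneg L] by blast
  have est: "\<bar>c * ip M (u (r n)) (D \<Phi>) - l \<Phi>\<bar> \<le> \<delta> n * N \<Phi>" if "\<Phi> \<in> V" for n \<Phi>
    using est0[rule_format, OF that, of n] that by (simp add: ip_commute[of M "D \<Phi>"])
  \<comment> \<open>The limit functional is identified by weak convergence: pointwise on
    \<open>V\<close> it must be the functional generated by \<open>w\<close>.\<close>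
  have l: "l \<Phi> = c * ip M w (D \<Phi>)" if \<Phi>: "\<Phi> \<in> V" for \<Phi>
  proof (rule LIMSEQ_unique)
    show "(\<lambda>n. c * ip M (u (r n)) (D \<Phi>)) \<longlonglongrightarrow> c * ip M w (D \<Phi>)"
      using tendsto_mult_left[OF LIMSEQ_subseq_LIMSEQ[OF weak[OF D[OF \<Phi>]] r], of c] by (simp add: o_def)
    have "norm (c * ip M (u (r n)) (D \<Phi>) - l \<Phi>) \<le> \<delta> n * N \<Phi>" for n
      using est[OF \<Phi>] by simp
    then have "(\<lambda>n. c * ip M (u (r n)) (D \<Phi>) - l \<Phi>) \<longlonglongrightarrow> 0"
      by (rule Lim_null_comparison[OF always_eventually[OF allI] tendsto_mult_left_zero[OF \<delta>]])
    then show "(\<lambda>n. c * ip M (u (r n)) (D \<Phi>)) \<longlonglongrightarrow> l \<Phi>" by (rule LIM_zero_cancel)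
  qed
  have "\<bar>ip M (\<lambda>x. u (r n) x - w x) (D \<Phi>)\<bar> \<le> \<delta> n * N \<Phi>" if \<Phi>: "\<Phi> \<in> V" for n \<Phi>
  proof -
    have "\<bar>ip M (\<lambda>x. u (r n) x - w x) (D \<Phi>)\<bar> = \<bar>c\<bar> * \<bar>ip M (u (r n)) (D \<Phi>) - ip M w (D \<Phi>)\<bar>"
      using u w D[OF \<Phi>] c by (simp add: ip_diff_left)
    also have "\<dots> = \<bar>c * ip M (u (r n)) (D \<Phi>) - l \<Phi>\<bar>"
      by (simp add: l[OF \<Phi>] abs_mult[symmetric] right_diff_distrib)
    finally show ?thesis using est[OF \<Phi>] by simp
  qed
  then show ?thesis using r \<delta> by blast
qed

lemma H1_spaces:
  fixes V :: "(real^'n \<Rightarrow> 'b::euclidean_space) set"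
  assumes "open \<Omega>" "bounded \<Omega>" "V = H1 \<Omega> \<or> V = H1_ring \<Omega>"
  shows "V \<noteq> {}" "V \<subseteq> H1 \<Omega>" "u \<in> V \<Longrightarrow> (\<lambda>x. c *\<^sub>R u x) \<in> V"
proof -
  show "V \<subseteq> H1 \<Omega>" using assms(3) by (auto simp: H1_ring_def)
  have "(\<lambda>x. 0) \<in> V"
    using test_function_H1[OF assms(1) test_functions_zero] test_function_H1_ring[OF assms(1,2) test_functions_zero] assms(3) by blast
  then show "V \<noteq> {}" by blast
  show "u \<in> V \<Longrightarrow> (\<lambda>x. c *\<^sub>R u x) \<in> V"
    using assms(3) H1_scaleR[of u] H1_ring_scaleR[OF assms(1,2), of u] by blast
qed

text \<open>Both alternatives of the theorem at once, with \<open>V\<close> and \<open>W\<close> the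
  spaces on which curl and divergence are tested. Four successive extractions are needed: two for
  the weak limits and two for the functionals.\<close>

lemma div_curl_subsequence:
  fixes E H :: "nat \<Rightarrow> real^3 \<Rightarrow> real^3"
  assumes dom: "bounded_strong_lipschitz_domain \<Omega>"
    and E: "\<And>n. E n \<in> L2 \<Omega>" "\<And>n. L2_norm \<Omega> (E n) \<le> C"
    and H: "\<And>n. H n \<in> L2 \<Omega>" "\<And>n. L2_norm \<Omega> (H n) \<le> C'"
    and VW: "(V = H1 \<Omega> \<and> W = H1_ring \<Omega>) \<or> (V = H1_ring \<Omega> \<and> W = H1 \<Omega>)"
    and curlE: "relatively_compact_in (dual_topology V (H1_norm \<Omega>)) (\<lambda>n. \<lambda>\<Phi>\<in>V. L2_inner \<Omega> (curl \<Omega> \<Phi>) (E n))"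
    and divH: "relatively_compact_in (dual_topology W (H1_norm \<Omega>)) (\<lambda>n. \<lambda>\<phi>\<in>W. - L2_inner \<Omega> (grad \<Omega> \<phi>) (H n))"
  shows "\<exists>E0\<in>L2 \<Omega>. \<exists>H0\<in>L2 \<Omega>. \<exists>r :: nat \<Rightarrow> nat. strict_mono r \<and>
           L2_weakly_converges \<Omega> (E \<circ> r) E0 \<and> L2_weakly_converges \<Omega> (H \<circ> r) H0 \<and>
           (\<lambda>n. L2_inner \<Omega> (E (r n)) (H (r n))) \<longlonglongrightarrow> L2_inner \<Omega> E0 H0"
proof -
  let ?M = "lebesgue_on \<Omega>"
  have \<Omega>: "open \<Omega>" "bounded \<Omega>" using dom by (auto simp: bounded_strong_lipschitz_domain_def)
  have V: "V = H1 \<Omega> \<or> V = H1_ring \<Omega>" and W: "W = H1 \<Omega> \<or> W = H1_ring \<Omega>" using VW by auto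
  obtain r1 E0 where r1: "strict_mono r1" "E0 \<in> L2 \<Omega>" "L2_weakly_converges \<Omega> (E \<circ> r1) E0"
    using L2_weakly_convergent_subsequence[where u=E, OF \<Omega> E] by blast
  obtain r2 H0 where r2: "strict_mono r2" "H0 \<in> L2 \<Omega>" "L2_weakly_converges \<Omega> ((H \<circ> r1) \<circ> r2) H0"
    using L2_weakly_convergent_subsequence[OF \<Omega>, of "H \<circ> r1" C'] H by auto
  define s where "s = r1 \<circ> r2"
  have s: "strict_mono s" using r1 r2 by (simp add: s_def strict_mono_o)
  have Es: "L2_weakly_converges \<Omega> (E \<circ> s) E0"
    using L2_weakly_converges_subseq[OF r1(3) r2(1)] by (simp add: s_def o_assoc)
  have Hs: "L2_weakly_converges \<Omega> (H \<circ> s) H0" using r2(3) by (simp add: s_def o_assoc)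
  have EHs: "E n \<in> sqint ?M" "E0 \<in> sqint ?M" "H n \<in> sqint ?M" "H0 \<in> sqint ?M" for n
    using E H r1 r2 by (auto simp: L2_eq)
  have Ew: "(\<lambda>n. ip ?M (E (s n)) g) \<longlonglongrightarrow> ip ?M E0 g" if "g \<in> sqint ?M" for g
    using L2_weakly_converges_inner[OF Es _ r1(2), of g] E that by (simp add: L2_eq)
  have Hw: "(\<lambda>n. ip ?M (H (s n)) g) \<longlonglongrightarrow> ip ?M H0 g" if "g \<in> sqint ?M" for g
    using L2_weakly_converges_inner[OF Hs _ r2(2), of g] H that by (simp add: L2_eq)
  have "\<exists>r \<delta>. strict_mono r \<and> \<delta> \<longlonglongrightarrow> 0 \<and>
    (\<forall>n. \<forall>\<Phi>\<in>V. \<bar>ip ?M (\<lambda>x. E (s (r n)) x - E0 x) (curl \<Omega> \<Phi>)\<bar> \<le> \<delta> n * H1_norm \<Omega> \<Phi>)"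
  proof (rule relatively_compact_adjoint_subsequence[where c=1 and u="\<lambda>n. E (s n)"])
    show "relatively_compact_in (dual_topology V (H1_norm \<Omega>)) (\<lambda>n. \<lambda>\<Phi>\<in>V. 1 * ip ?M (curl \<Omega> \<Phi>) (E (s n)))"
      using relatively_compact_in_subseq[OF curlE, of s] by (simp add: o_def L2_inner_eq)
  qed (use H1_spaces(1,3)[OF \<Omega> V] H1_norm_scaleR[OF \<Omega> subsetD[OF H1_spaces(2)[OF \<Omega> V]]]
      curl_sqint[OF subsetD[OF H1_spaces(2)[OF \<Omega> V]]] EHs Ew in \<open>simp_all add: H1_norm_nonneg\<close>)
  then obtain r3 \<delta> where r3: "strict_mono r3" "\<delta> \<longlonglongrightarrow> 0"
    "\<And>n \<Phi>. \<Phi> \<in> V \<Longrightarrow> \<bar>ip ?M (\<lambda>x. E (s (r3 n)) x - E0 x) (curl \<Omega> \<Phi>)\<bar> \<le> \<delta> n * H1_norm \<Omega> \<Phi>"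
    by blast
  have "\<exists>r \<delta>. strict_mono r \<and> \<delta> \<longlonglongrightarrow> 0 \<and>
    (\<forall>n. \<forall>\<phi>\<in>W. \<bar>ip ?M (\<lambda>x. H (s (r3 (r n))) x - H0 x) (grad \<Omega> \<phi>)\<bar> \<le> \<delta> n * H1_norm \<Omega> \<phi>)"
  proof (rule relatively_compact_adjoint_subsequence[where c="-1" and u="\<lambda>n. H (s (r3 n))"])
    show "relatively_compact_in (dual_topology W (H1_norm \<Omega>)) (\<lambda>n. \<lambda>\<phi>\<in>W. - 1 * ip ?M (grad \<Omega> \<phi>) (H (s (r3 n))))"
      using relatively_compact_in_subseq[OF divH, of "s \<circ> r3"] by (simp add: o_def L2_inner_eq)
    show "(\<lambda>n. ip ?M (H (s (r3 n))) g) \<longlonglongrightarrow> ip ?M H0 g" if "g \<in> sqint ?M" for g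
      using LIMSEQ_subseq_LIMSEQ[OF Hw[OF that] r3(1)] by (simp add: o_def)
  qed (use H1_spaces(1,3)[OF \<Omega> W] H1_norm_scaleR[OF \<Omega> subsetD[OF H1_spaces(2)[OF \<Omega> W]]]
      grad_sqint[OF subsetD[OF H1_spaces(2)[OF \<Omega> W]]] EHs in \<open>simp_all add: H1_norm_nonneg\<close>)
  then obtain r4 \<delta>' where r4: "strict_mono r4" "\<delta>' \<longlonglongrightarrow> 0"
    "\<And>n \<phi>. \<phi> \<in> W \<Longrightarrow> \<bar>ip ?M (\<lambda>x. H (s (r3 (r4 n))) x - H0 x) (grad \<Omega> \<phi>)\<bar> \<le> \<delta>' n * H1_norm \<Omega> \<phi>"
    by blast
  define t where "t = s \<circ> (r3 \<circ> r4)"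
  have r34: "strict_mono (r3 \<circ> r4)" using r3(1) r4(1) by (rule strict_mono_o)
  have t: "strict_mono t" unfolding t_def using s r34 by (rule strict_mono_o)
  have Et: "(\<lambda>n. ip ?M (E (t n)) g) \<longlonglongrightarrow> ip ?M E0 g" if "g \<in> sqint ?M" for g
    using LIMSEQ_subseq_LIMSEQ[OF Ew[OF that] r34] by (simp add: o_def t_def)
  have Ht: "(\<lambda>n. ip ?M (H (t n)) g) \<longlonglongrightarrow> ip ?M H0 g" if "g \<in> sqint ?M" for g
    using LIMSEQ_subseq_LIMSEQ[OF Hw[OF that] r34] by (simp add: o_def t_def)
  define B where "B = max (C + nrm ?M E0) (C' + nrm ?M H0)"
  have "(\<lambda>n. ip ?M (\<lambda>x. E (t n) x - E0 x) (\<lambda>x. H (t n) x - H0 x)) \<longlonglongrightarrow> 0"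
  proof (rule div_curl_weakly_null[OF dom _ _ _ _ _ _ VW])
    show "nrm ?M (\<lambda>x. E (t n) x - E0 x) \<le> B" for n
      using nrm_triangle_diff[OF EHs(1,2), of "t n"] E(2)[of "t n"] by (simp add: B_def L2_norm_eq)
    show "nrm ?M (\<lambda>x. H (t n) x - H0 x) \<le> B" for n
      using nrm_triangle_diff[OF EHs(3,4), of "t n"] H(2)[of "t n"] by (simp add: B_def L2_norm_eq)
    show "(\<lambda>n. ip ?M (\<lambda>x. E (t n) x - E0 x) g) \<longlonglongrightarrow> 0" if "g \<in> sqint ?M" for g
      using Et[OF that] that EHs by (simp add: ip_diff_left LIM_zero)
    show "(\<lambda>n. ip ?M (\<lambda>x. H (t n) x - H0 x) g) \<longlonglongrightarrow> 0" if "g \<in> sqint ?M" for g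
      using Ht[OF that] that EHs by (simp add: ip_diff_left LIM_zero)
    show "(\<delta> \<circ> r4) \<longlonglongrightarrow> 0" using r3(2) r4(1) by (rule LIMSEQ_subseq_LIMSEQ)
    show "\<bar>ip ?M (\<lambda>x. E (t n) x - E0 x) (curl \<Omega> \<Phi>)\<bar> \<le> (\<delta> \<circ> r4) n * H1_norm \<Omega> \<Phi>" if "\<Phi> \<in> V" for n \<Phi>
      using r3(3)[OF that, of "r4 n"] by (simp add: t_def)
    show "\<bar>ip ?M (\<lambda>x. H (t n) x - H0 x) (grad \<Omega> \<phi>)\<bar> \<le> \<delta>' n * H1_norm \<Omega> \<phi>" if "\<phi> \<in> W" for n \<phi>
      using r4(3)[OF that, of n] by (simp add: t_def)
  qed (use EHs r4(2) in \<open>auto simp: sqint_diff\<close>)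
  \<comment> \<open>Expanding the product of the differences: the mixed terms converge by weak
    convergence against the fixed limits, so only the term just shown to vanish is nonlinear in the
    sequence.\<close>
  then have "(\<lambda>n. ip ?M (\<lambda>x. E (t n) x - E0 x) (\<lambda>x. H (t n) x - H0 x) + ip ?M (E (t n)) H0 + ip ?M (H (t n)) E0 - ip ?M E0 H0)
      \<longlonglongrightarrow> 0 + ip ?M E0 H0 + ip ?M H0 E0 - ip ?M E0 H0"
    by (intro tendsto_intros Et Ht EHs)
  moreover have "ip ?M (\<lambda>x. E (t n) x - E0 x) (\<lambda>x. H (t n) x - H0 x) + ip ?M (E (t n)) H0 + ip ?M (H (t n)) E0 - ip ?M E0 H0
      = ip ?M (E (t n)) (H (t n))" for n
    using EHs by (simp add: ip_diff_left ip_diff_right sqint_diff ip_commute[of ?M "H (t n)" E0])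
  ultimately have "(\<lambda>n. ip ?M (E (t n)) (H (t n))) \<longlonglongrightarrow> ip ?M E0 H0"
    by (simp add: ip_commute[of ?M H0 E0])
  then show ?thesis
    using r1(2) r2(2) t L2_weakly_converges_subseq[OF Es r34] L2_weakly_converges_subseq[OF Hs r34]
    by (intro bexI[of _ E0] bexI[of _ H0] exI[of _ t]) (auto simp: t_def o_assoc L2_inner_eq)
qed

theorem theorem7:
  fixes \<Omega> :: "(real^3) set" and E H :: "nat \<Rightarrow> real^3 \<Rightarrow> real^3"
  assumes "bounded_strong_lipschitz_domain \<Omega>" and "topologically_trivial \<Omega>"
    and "\<forall>n. E n \<in> L2 \<Omega>" and "\<exists>C. \<forall>n. L2_norm \<Omega> (E n) \<le> C"
    and "\<forall>n. H n \<in> L2 \<Omega>" and "\<exists>C. \<forall>n. L2_norm \<Omega> (H n) \<le> C"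
    and "(relatively_compact_in (Hm1_ring \<Omega>) (\<lambda>n. curl_hat \<Omega> (E n)) \<and>
          relatively_compact_in (Hm1 \<Omega>) (\<lambda>n. div_tilde \<Omega> (H n))) \<or>
         (relatively_compact_in (Hm1 \<Omega>) (\<lambda>n. curl_tilde \<Omega> (E n)) \<and>
          relatively_compact_in (Hm1_ring \<Omega>) (\<lambda>n. div_hat \<Omega> (H n)))"
  shows "\<exists>E0\<in>L2 \<Omega>. \<exists>H0\<in>L2 \<Omega>. \<exists>r :: nat \<Rightarrow> nat. strict_mono r \<and>
           L2_weakly_converges \<Omega> (E \<circ> r) E0 \<and> L2_weakly_converges \<Omega> (H \<circ> r) H0 \<and>
           (\<lambda>n. L2_inner \<Omega> (E (r n)) (H (r n))) \<longlonglongrightarrow> L2_inner \<Omega> E0 H0"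
proof -
  obtain C C' where C: "\<And>n. L2_norm \<Omega> (E n) \<le> C" "\<And>n. L2_norm \<Omega> (H n) \<le> C'" using assms(4,6) by blast
  from assms(7) show ?thesis
  proof
    assume "relatively_compact_in (Hm1_ring \<Omega>) (\<lambda>n. curl_hat \<Omega> (E n)) \<and>
      relatively_compact_in (Hm1 \<Omega>) (\<lambda>n. div_tilde \<Omega> (H n))"
    then show ?thesis
      using assms(3,5) C unfolding Hm1_ring_def Hm1_def curl_hat_def div_tilde_def
      by (intro div_curl_subsequence[OF assms(1), of E C H C' "H1 \<Omega>" "H1_ring \<Omega>"]) auto
  next
    assume "relatively_compact_in (Hm1 \<Omega>) (\<lambda>n. curl_tilde \<Omega> (E n)) \<and>
      relatively_compact_in (Hm1_ring \<Omega>) (\<lambda>n. div_hat \<Omega> (H n))"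
    then show ?thesis
      using assms(3,5) C unfolding Hm1_ring_def Hm1_def curl_tilde_def div_hat_def
      by (intro div_curl_subsequence[OF assms(1), of E C H C' "H1_ring \<Omega>" "H1 \<Omega>"]) auto
  qed
qed

end
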